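(* Let $K$ be a field of characteristic zero, let $H$ be a connected algebraic supergroup over $K$, and let $\mathfrak S$ be a supersubalgebra of $\mathfrak H=\mathsf{Lie}(H)$. Then $\mathfrak S$ is algebraic in $\mathfrak H$ (i.e. there is a supersubgroup $S\le H$ with $\mathsf{Lie}(S)=\mathfrak S$) if and only if $\mathfrak S_0$ is an algebraic subalgebra of $\mathfrak H_0=\mathsf{Lie}(H_{ev})$ (i.e. $\mathfrak S_0$ is the Lie algebra of a closed subgroup of $H_{ev}$).
   Context: An algebraic supergroup $G$ is a group-valued functor on supercommutative $K$-superalgebras represented by a finitely generated supercommutative Hopf superalgebra $K[G]$; it is connected if $K[G]_0$ has no nontrivial idempotents. Supersubgroups are closed (given by Hopf superideals). $G_{ev}$ is the largest even supersubgroup, defined by the ideal $K[G]K[G]_1$. $\mathsf{Lie}(G)=(\mathfrak m/\mathfrak m^2)^*$, $\mathfrak m=\ker\epsilon_G$, with bracket the supercommutator of the convolution product. *)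

theory Defs
  imports "HOL-Library.Z2" "HOL-Algebra.Module" "HOL-Algebra.QuotRing" "HOL-Algebra.Ideal_Product" "HOL-Algebra.Subrings"
begin

section \<open>Superspaces\<close>

text \<open>Parities are elements of the two-element field \<^typ>\<open>bit\<close>, so that \<open>i + j\<close> and \<open>i * j\<close> are
  the sum of parities and the exponent of the Koszul sign. As in \<^theory>\<open>HOL-Algebra.Module\<close>,
  spaces without a product are records in which \<open>mult\<close> and \<open>one\<close> are irrelevant.\<close>

record ('k, 'a) super = "('k, 'a) module" +
  gr :: "bit \<Rightarrow> 'a set"

definition koszul :: "('k, 'a, 'm) module_scheme \<Rightarrow> bit \<Rightarrow> 'a \<Rightarrow> 'a"
  where "koszul M n x = (if n = 1 then \<ominus>\<^bsub>M\<^esub> x else x)"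

definition hpart :: "('k, 'a, 'm) super_scheme \<Rightarrow> bit \<Rightarrow> 'a \<Rightarrow> 'a"
  where "hpart V i x = (THE y. y \<in> gr V i \<and> (\<exists>z \<in> gr V (i + 1). x = y \<oplus>\<^bsub>V\<^esub> z))"

definition submod :: "('k, 'l) ring_scheme \<Rightarrow> ('k, 'a, 'm) module_scheme \<Rightarrow> 'a set \<Rightarrow> bool"
  where "submod K M N \<longleftrightarrow>
    subgroup N (add_monoid M) \<and> (\<forall>c \<in> carrier K. \<forall>x \<in> N. c \<odot>\<^bsub>M\<^esub> x \<in> N)"

definition homogeneous_subset :: "('k, 'a, 'm) super_scheme \<Rightarrow> 'a set \<Rightarrow> bool"
  where "homogeneous_subset V N \<longleftrightarrow>
    (\<forall>x \<in> N. \<exists>y \<in> N \<inter> gr V 0. \<exists>z \<in> N \<inter> gr V 1. x = y \<oplus>\<^bsub>V\<^esub> z)"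

definition linear_map ::
  "('k, 'l) ring_scheme \<Rightarrow> ('k, 'a, 'm) module_scheme \<Rightarrow> ('k, 'b, 'n) module_scheme \<Rightarrow>
    ('a \<Rightarrow> 'b) \<Rightarrow> bool"
  where "linear_map K V W f \<longleftrightarrow>
    f \<in> carrier V \<rightarrow> carrier W \<and>
    (\<forall>x \<in> carrier V. \<forall>y \<in> carrier V. f (x \<oplus>\<^bsub>V\<^esub> y) = f x \<oplus>\<^bsub>W\<^esub> f y) \<and>
    (\<forall>c \<in> carrier K. \<forall>x \<in> carrier V. f (c \<odot>\<^bsub>V\<^esub> x) = c \<odot>\<^bsub>W\<^esub> f x)"

definition even_map ::
  "('k, 'a, 'm) super_scheme \<Rightarrow> ('k, 'b, 'n) super_scheme \<Rightarrow> ('a \<Rightarrow> 'b) \<Rightarrow> bool"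
  where "even_map V W f \<longleftrightarrow> (\<forall>i. f ` gr V i \<subseteq> gr W i)"

locale superspace = field K + module K V
  for K :: "('k, 'l) ring_scheme" (structure) and V :: "('k, 'a, 'm) super_scheme" (structure) +
  assumes gr_submod: "submod K V (gr V i)"
    and gr_sum: "x \<in> carrier V \<Longrightarrow> \<exists>y \<in> gr V 0. \<exists>z \<in> gr V 1. x = y \<oplus>\<^bsub>V\<^esub> z"
    and gr_int: "gr V 0 \<inter> gr V 1 = {\<zero>\<^bsub>V\<^esub>}"

definition base :: "('k, 'l) ring_scheme \<Rightarrow> ('k, 'k) super"
  where "base K = \<lparr>carrier = carrier K, mult = mult K, one = \<one>\<^bsub>K\<^esub>, zero = \<zero>\<^bsub>K\<^esub>, add = add K,
    smult = mult K, gr = (\<lambda>i. if i = 0 then carrier K else {\<zero>\<^bsub>K\<^esub>})\<rparr>"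

text \<open>In quotients, a map on cosets is given by \<open>the_elem\<close> of the image of the coset.\<close>

definition quot_module :: "('k, 'a, 'm) module_scheme \<Rightarrow> 'a set \<Rightarrow> ('k, 'a set) module"
  where "quot_module M N = ring.extend (M Quot N)
    (module.fields (\<lambda>c X. the_elem ((\<lambda>x. N +>\<^bsub>M\<^esub> (c \<odot>\<^bsub>M\<^esub> x)) ` X)))"

definition quot_super :: "('k, 'a, 'm) super_scheme \<Rightarrow> 'a set \<Rightarrow> ('k, 'a set) super"
  where "quot_super V N = module.extend (quot_module V N)
    (super.fields (\<lambda>i. (\<lambda>x. N +>\<^bsub>V\<^esub> x) ` gr V i))"

definition dual_space :: "('k, 'l) ring_scheme \<Rightarrow> ('k, 'a, 'm) super_scheme \<Rightarrow> ('k, 'a \<Rightarrow> 'k) super"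
  where "dual_space K V =
    (let D = {f \<in> extensional (carrier V). linear_map K V (base K) f} in
      \<lparr>carrier = D, mult = undefined, one = undefined,
       zero = (\<lambda>x \<in> carrier V. \<zero>\<^bsub>K\<^esub>),
       add = (\<lambda>f g. \<lambda>x \<in> carrier V. f x \<oplus>\<^bsub>K\<^esub> g x),
       smult = (\<lambda>c f. \<lambda>x \<in> carrier V. c \<otimes>\<^bsub>K\<^esub> f x),
       gr = (\<lambda>i. {f \<in> D. \<forall>x \<in> gr V (i + 1). f x = \<zero>\<^bsub>K\<^esub>})\<rparr>)"


section \<open>Superalgebras\<close>

locale superalgebra = superspace K A + ring A
  for K :: "('k, 'l) ring_scheme" (structure) and A :: "('k, 'a, 'm) super_scheme" (structure) +
  assumes smult_mult_left:
      "\<lbrakk>c \<in> carrier K; x \<in> carrier A; y \<in> carrier A\<rbrakk> \<Longrightarrow>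
        (c \<odot>\<^bsub>A\<^esub> x) \<otimes>\<^bsub>A\<^esub> y = c \<odot>\<^bsub>A\<^esub> (x \<otimes>\<^bsub>A\<^esub> y)"
    and smult_mult_right:
      "\<lbrakk>c \<in> carrier K; x \<in> carrier A; y \<in> carrier A\<rbrakk> \<Longrightarrow>
        x \<otimes>\<^bsub>A\<^esub> (c \<odot>\<^bsub>A\<^esub> y) = c \<odot>\<^bsub>A\<^esub> (x \<otimes>\<^bsub>A\<^esub> y)"
    and gr_one: "\<one>\<^bsub>A\<^esub> \<in> gr A 0"
    and gr_mult: "\<lbrakk>x \<in> gr A i; y \<in> gr A j\<rbrakk> \<Longrightarrow> x \<otimes>\<^bsub>A\<^esub> y \<in> gr A (i + j)"

definition supercommutative :: "('k, 'a, 'm) super_scheme \<Rightarrow> bool"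
  where "supercommutative A \<longleftrightarrow>
    (\<forall>i j. \<forall>x \<in> gr A i. \<forall>y \<in> gr A j. x \<otimes>\<^bsub>A\<^esub> y = koszul A (i * j) (y \<otimes>\<^bsub>A\<^esub> x))"

definition finitely_generated :: "('k, 'l) ring_scheme \<Rightarrow> ('k, 'a, 'm) module_scheme \<Rightarrow> bool"
  where "finitely_generated K A \<longleftrightarrow>
    (\<exists>F. finite F \<and> F \<subseteq> carrier A \<and> (\<lambda>B. subring B A \<and> submod K A B) hull F = carrier A)"

definition superalgebra_hom ::
  "('k, 'l) ring_scheme \<Rightarrow> ('k, 'a, 'm) super_scheme \<Rightarrow> ('k, 'b, 'n) super_scheme \<Rightarrow>
    ('a \<Rightarrow> 'b) \<Rightarrow> bool"
  where "superalgebra_hom K A B f \<longleftrightarrow> f \<in> ring_hom A B \<and> linear_map K A B f \<and> even_map A B f"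


section \<open>Tensor products\<close>

text \<open>\<open>A \<otimes> B\<close> is the free \<open>K\<close>-module on \<open>carrier A \<times> carrier B\<close>, realised as the finitely
  supported functions, modulo the bilinearity relations; its elements are cosets.\<close>

definition free_module :: "('k, 'l) ring_scheme \<Rightarrow> 'x set \<Rightarrow> ('k, 'x \<Rightarrow> 'k) module"
  where "free_module K X =
    \<lparr>carrier = {f. f \<in> UNIV \<rightarrow> carrier K \<and> {x. f x \<noteq> \<zero>\<^bsub>K\<^esub>} \<subseteq> X \<and> finite {x. f x \<noteq> \<zero>\<^bsub>K\<^esub>}},
     mult = undefined, one = undefined, zero = (\<lambda>x. \<zero>\<^bsub>K\<^esub>),
     add = (\<lambda>f g x. f x \<oplus>\<^bsub>K\<^esub> g x), smult = (\<lambda>c f x. c \<otimes>\<^bsub>K\<^esub> f x)\<rparr>"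

definition delta :: "('k, 'l) ring_scheme \<Rightarrow> 'x \<Rightarrow> 'x \<Rightarrow> 'k"
  where "delta K x = (\<lambda>y. if y = x then \<one>\<^bsub>K\<^esub> else \<zero>\<^bsub>K\<^esub>)"

definition tensor_rels ::
  "('k, 'l) ring_scheme \<Rightarrow> ('k, 'a, 'm) module_scheme \<Rightarrow> ('k, 'b, 'n) module_scheme \<Rightarrow>
    ('a \<times> 'b \<Rightarrow> 'k) set"
  where "tensor_rels K A B = (let F = free_module K (carrier A \<times> carrier B) in submod K F hull
    ({delta K (a \<oplus>\<^bsub>A\<^esub> a', b) \<ominus>\<^bsub>F\<^esub> (delta K (a, b) \<oplus>\<^bsub>F\<^esub> delta K (a', b)) | a a' b.
        a \<in> carrier A \<and> a' \<in> carrier A \<and> b \<in> carrier B} \<union>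
     {delta K (a, b \<oplus>\<^bsub>B\<^esub> b') \<ominus>\<^bsub>F\<^esub> (delta K (a, b) \<oplus>\<^bsub>F\<^esub> delta K (a, b')) | a b b'.
        a \<in> carrier A \<and> b \<in> carrier B \<and> b' \<in> carrier B} \<union>
     {delta K (c \<odot>\<^bsub>A\<^esub> a, b) \<ominus>\<^bsub>F\<^esub> c \<odot>\<^bsub>F\<^esub> delta K (a, b) | c a b.
        c \<in> carrier K \<and> a \<in> carrier A \<and> b \<in> carrier B} \<union>
     {delta K (a, c \<odot>\<^bsub>B\<^esub> b) \<ominus>\<^bsub>F\<^esub> c \<odot>\<^bsub>F\<^esub> delta K (a, b) | c a b.
        c \<in> carrier K \<and> a \<in> carrier A \<and> b \<in> carrier B}))"

definition tensor_module ::
  "('k, 'l) ring_scheme \<Rightarrow> ('k, 'a, 'm) module_scheme \<Rightarrow> ('k, 'b, 'n) module_scheme \<Rightarrow>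
    ('k, ('a \<times> 'b \<Rightarrow> 'k) set) module"
  where "tensor_module K A B =
    quot_module (free_module K (carrier A \<times> carrier B)) (tensor_rels K A B)"

definition pure_tensor ::
  "('k, 'l) ring_scheme \<Rightarrow> ('k, 'a, 'm) module_scheme \<Rightarrow> ('k, 'b, 'n) module_scheme \<Rightarrow>
    'a \<Rightarrow> 'b \<Rightarrow> ('a \<times> 'b \<Rightarrow> 'k) set"
  where "pure_tensor K A B a b =
    tensor_rels K A B +>\<^bsub>free_module K (carrier A \<times> carrier B)\<^esub> delta K (a, b)"

text \<open>The linear map \<open>A \<otimes> B \<rightarrow> M\<close> with \<open>a \<otimes> b \<mapsto> \<phi> a b\<close>, for bilinear \<open>\<phi>\<close>.\<close>

definition tensor_lift ::
  "('k, 'l) ring_scheme \<Rightarrow> ('k, 'c, 'm) module_scheme \<Rightarrow> ('a \<Rightarrow> 'b \<Rightarrow> 'c) \<Rightarrow>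
    ('a \<times> 'b \<Rightarrow> 'k) set \<Rightarrow> 'c"
  where "tensor_lift K M \<phi> t =
    the_elem ((\<lambda>f. \<Oplus>\<^bsub>M\<^esub> p \<in> {p. f p \<noteq> \<zero>\<^bsub>K\<^esub>}. f p \<odot>\<^bsub>M\<^esub> case_prod \<phi> p) ` t)"

text \<open>The product is \<open>(a \<otimes> b)(c \<otimes> d) = (-1)\<^bsup>|b||c|\<^esup> ac \<otimes> bd\<close>.\<close>

definition tensor ::
  "('k, 'l) ring_scheme \<Rightarrow> ('k, 'a, 'm) super_scheme \<Rightarrow> ('k, 'b, 'n) super_scheme \<Rightarrow>
    ('k, ('a \<times> 'b \<Rightarrow> 'k) set) super"
  where "tensor K A B = (let T = tensor_module K A B in
    module.extend
      (T\<lparr>mult := (\<lambda>t u. tensor_lift K T (\<lambda>a b. tensor_lift K T (\<lambda>c d.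
              \<Oplus>\<^bsub>T\<^esub> i \<in> {0, 1}. \<Oplus>\<^bsub>T\<^esub> j \<in> {0, 1}. koszul T (i * j)
                (pure_tensor K A B (a \<otimes>\<^bsub>A\<^esub> hpart A j c) (hpart B i b \<otimes>\<^bsub>B\<^esub> d))) u) t),
         one := pure_tensor K A B \<one>\<^bsub>A\<^esub> \<one>\<^bsub>B\<^esub>\<rparr>)
      (super.fields (\<lambda>k. submod K T hull
        {pure_tensor K A B a b | a b i j. a \<in> gr A i \<and> b \<in> gr B j \<and> i + j = k})))"

definition tensor_map ::
  "('k, 'l) ring_scheme \<Rightarrow> ('k, 'c, 'm) super_scheme \<Rightarrow> ('k, 'd, 'n) super_scheme \<Rightarrow>
    ('a \<Rightarrow> 'c) \<Rightarrow> ('b \<Rightarrow> 'd) \<Rightarrow> ('a \<times> 'b \<Rightarrow> 'k) set \<Rightarrow> ('c \<times> 'd \<Rightarrow> 'k) set"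
  \<comment> \<open>\<open>f \<otimes> g\<close> for even maps \<open>f\<close>, \<open>g\<close> into \<open>C\<close>, \<open>D\<close>\<close>
  where "tensor_map K C D f g = tensor_lift K (tensor K C D) (\<lambda>a b. pure_tensor K C D (f a) (g b))"

definition tensor_assoc ::
  "('k, 'l) ring_scheme \<Rightarrow> ('k, 'a, 'm) super_scheme \<Rightarrow> ('k, 'b, 'n) super_scheme \<Rightarrow>
    ('k, 'c, 'o) super_scheme \<Rightarrow> (('a \<times> 'b \<Rightarrow> 'k) set \<times> 'c \<Rightarrow> 'k) set \<Rightarrow>
    ('a \<times> ('b \<times> 'c \<Rightarrow> 'k) set \<Rightarrow> 'k) set"
  where "tensor_assoc K A B C = (let T = tensor K A (tensor K B C) in
    tensor_lift K T (\<lambda>t c. tensor_lift K T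
      (\<lambda>a b. pure_tensor K A (tensor K B C) a (pure_tensor K B C b c)) t))"


section \<open>Hopf superalgebras and algebraic supergroups\<close>

record ('k, 'a) hopf = "('k, 'a) super" +
  comult :: "'a \<Rightarrow> ('a \<times> 'a \<Rightarrow> 'k) set"
  counit :: "'a \<Rightarrow> 'k"
  antipode :: "'a \<Rightarrow> 'a"

locale hopf_superalgebra = superalgebra K A
  for K :: "('k, 'l) ring_scheme" (structure) and A :: "('k, 'a, 'm) hopf_scheme" (structure) +
  assumes comult_hom: "superalgebra_hom K A (tensor K A A) (comult A)"
    and counit_hom: "superalgebra_hom K A (base K) (counit A)"
    and antipode_linear: "linear_map K A A (antipode A)"
    and antipode_even: "even_map A A (antipode A)"
    and coassoc: "x \<in> carrier A \<Longrightarrow>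
      tensor_assoc K A A A (tensor_map K (tensor K A A) A (comult A) id (comult A x)) =
      tensor_map K A (tensor K A A) id (comult A) (comult A x)"
    and counit_left: "x \<in> carrier A \<Longrightarrow>
      tensor_lift K A (\<lambda>a b. counit A a \<odot>\<^bsub>A\<^esub> b) (comult A x) = x"
    and counit_right: "x \<in> carrier A \<Longrightarrow>
      tensor_lift K A (\<lambda>a b. counit A b \<odot>\<^bsub>A\<^esub> a) (comult A x) = x"
    and antipode_left: "x \<in> carrier A \<Longrightarrow>
      tensor_lift K A (\<lambda>a b. antipode A a \<otimes>\<^bsub>A\<^esub> b) (comult A x) = counit A x \<odot>\<^bsub>A\<^esub> \<one>\<^bsub>A\<^esub>"
    and antipode_right: "x \<in> carrier A \<Longrightarrow>
      tensor_lift K A (\<lambda>a b. a \<otimes>\<^bsub>A\<^esub> antipode A b) (comult A x) = counit A x \<odot>\<^bsub>A\<^esub> \<one>\<^bsub>A\<^esub>"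

text \<open>By Yoneda's lemma, an algebraic supergroup \<open>G\<close> is the same thing as its coordinate Hopf
  superalgebra \<open>K[G]\<close>; the variables \<open>G\<close> and \<open>H\<close> below stand for coordinate superalgebras, and a
  closed supersubgroup of \<open>G\<close> is given by a Hopf superideal \<open>I\<close>, its coordinate superalgebra being
  \<open>quot_hopf K G I\<close>.\<close>

locale algebraic_supergroup = hopf_superalgebra K G
  for K :: "('k, 'l) ring_scheme" (structure) and G :: "('k, 'a, 'm) hopf_scheme" (structure) +
  assumes supercomm: "supercommutative G"
    and fin_gen: "finitely_generated K G"

definition connected_supergroup :: "('k, 'a, 'm) hopf_scheme \<Rightarrow> bool"
  where "connected_supergroup G \<longleftrightarrow>
    (\<forall>e \<in> gr G 0. e \<otimes>\<^bsub>G\<^esub> e = e \<longrightarrow> e = \<zero>\<^bsub>G\<^esub> \<or> e = \<one>\<^bsub>G\<^esub>)"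

text \<open>The span in the comultiplication condition is \<open>I \<otimes> G + G \<otimes> I\<close>.\<close>

definition hopf_superideal ::
  "('k, 'l) ring_scheme \<Rightarrow> ('k, 'a, 'm) hopf_scheme \<Rightarrow> 'a set \<Rightarrow> bool"
  where "hopf_superideal K G I \<longleftrightarrow>
    ideal I G \<and> homogeneous_subset G I \<and>
    comult G ` I \<subseteq> submod K (tensor K G G) hull
      {pure_tensor K G G a b | a b. a \<in> carrier G \<and> b \<in> carrier G \<and> (a \<in> I \<or> b \<in> I)} \<and>
    counit G ` I \<subseteq> {\<zero>\<^bsub>K\<^esub>} \<and>
    antipode G ` I \<subseteq> I"

definition quot_hopf ::
  "('k, 'l) ring_scheme \<Rightarrow> ('k, 'a, 'm) hopf_scheme \<Rightarrow> 'a set \<Rightarrow> ('k, 'a set) hopf"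
  where "quot_hopf K G I = (let Q = quot_super G I in
    super.extend Q (hopf.fields
      (\<lambda>X. the_elem
        ((\<lambda>x. tensor_map K Q Q (\<lambda>a. I +>\<^bsub>G\<^esub> a) (\<lambda>b. I +>\<^bsub>G\<^esub> b) (comult G x)) ` X))
      (\<lambda>X. the_elem (counit G ` X))
      (\<lambda>X. the_elem ((\<lambda>x. I +>\<^bsub>G\<^esub> antipode G x) ` X))))"

definition ev_ideal :: "('k, 'a, 'm) hopf_scheme \<Rightarrow> 'a set"
  where "ev_ideal G = Idl\<^bsub>G\<^esub> (gr G 1)"

definition ev_supergroup ::
  "('k, 'l) ring_scheme \<Rightarrow> ('k, 'a, 'm) hopf_scheme \<Rightarrow> ('k, 'a set) hopf"
  where "ev_supergroup K G = quot_hopf K G (ev_ideal G)"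


section \<open>The Lie superalgebra of a supergroup\<close>

definition aug_ideal :: "('k, 'l) ring_scheme \<Rightarrow> ('k, 'a, 'm) hopf_scheme \<Rightarrow> 'a set"
  where "aug_ideal K G = a_kernel G K (counit G)"

definition aug_sq :: "('k, 'l) ring_scheme \<Rightarrow> ('k, 'a, 'm) hopf_scheme \<Rightarrow> 'a set"
  where "aug_sq K G = aug_ideal K G \<cdot>\<^bsub>G\<^esub> aug_ideal K G"

definition cotangent ::
  "('k, 'l) ring_scheme \<Rightarrow> ('k, 'a, 'm) hopf_scheme \<Rightarrow> ('k, 'a set) super"
  where "cotangent K G =
    quot_super (G\<lparr>carrier := aug_ideal K G, gr := (\<lambda>i. gr G i \<inter> aug_ideal K G)\<rparr>) (aug_sq K G)"

text \<open>A tangent vector \<open>u \<in> (\<mm>/\<mm>\<^sup>2)\<^sup>*\<close>, viewed as the functional on \<open>K[G]\<close> that vanishes on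
  \<open>1\<close> and on \<open>\<mm>\<^sup>2\<close>.\<close>

definition tangent_functional ::
  "('k, 'l) ring_scheme \<Rightarrow> ('k, 'a, 'm) hopf_scheme \<Rightarrow> ('a set \<Rightarrow> 'k) \<Rightarrow> 'a \<Rightarrow> 'k"
  where "tangent_functional K G u x =
    u (aug_sq K G +>\<^bsub>G\<^esub> (x \<ominus>\<^bsub>G\<^esub> counit G x \<odot>\<^bsub>G\<^esub> \<one>\<^bsub>G\<^esub>))"

text \<open>The convolution product \<open>(\<phi> \<otimes> \<psi>) \<circ> \<Delta>\<close> of functionals, with
  \<open>(\<phi> \<otimes> \<psi>)(a \<otimes> b) = (-1)\<^bsup>|\<psi>||a|\<^esup> \<phi> a \<psi> b\<close>.\<close>

definition convolution ::
  "('k, 'l) ring_scheme \<Rightarrow> ('k, 'a, 'm) hopf_scheme \<Rightarrow> ('a \<Rightarrow> 'k) \<Rightarrow> ('a \<Rightarrow> 'k) \<Rightarrow> 'a \<Rightarrow> 'k"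
  where "convolution K G \<phi> \<psi> x = tensor_lift K (base K)
    (\<lambda>a b. \<Oplus>\<^bsub>K\<^esub> i \<in> {0, 1}. \<Oplus>\<^bsub>K\<^esub> j \<in> {0, 1}.
      koszul (base K) (i * j) (\<phi> (hpart G i a) \<otimes>\<^bsub>K\<^esub> \<psi> (hpart G j b))) (comult G x)"

text \<open>The supercommutator, \<open>u * v - (-1)\<^bsup>|u||v|\<^esup> v * u\<close> on homogeneous elements, as a functional
  on \<open>\<mm>/\<mm>\<^sup>2\<close>.\<close>

definition lie_bracket ::
  "('k, 'l) ring_scheme \<Rightarrow> ('k, 'a, 'm) hopf_scheme \<Rightarrow>
    ('a set \<Rightarrow> 'k) \<Rightarrow> ('a set \<Rightarrow> 'k) \<Rightarrow> 'a set \<Rightarrow> 'k"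
  where "lie_bracket K G u v =
    (let part = (\<lambda>i w. tangent_functional K G (hpart (dual_space K (cotangent K G)) i w)) in
      (\<lambda>X \<in> carrier (cotangent K G). the_elem ((\<lambda>x.
        \<Oplus>\<^bsub>K\<^esub> i \<in> {0, 1}. \<Oplus>\<^bsub>K\<^esub> j \<in> {0, 1}.
          convolution K G (part i u) (part j v) x \<ominus>\<^bsub>K\<^esub>
          koszul (base K) (i * j) (convolution K G (part j v) (part i u) x)) ` X)))"

text \<open>The \<open>mult\<close> component of a Lie superalgebra is its bracket; \<open>one\<close> is irrelevant.\<close>

definition Lie ::
  "('k, 'l) ring_scheme \<Rightarrow> ('k, 'a, 'm) hopf_scheme \<Rightarrow> ('k, 'a set \<Rightarrow> 'k) super"
  where "Lie K G = (dual_space K (cotangent K G))\<lparr>mult := lie_bracket K G\<rparr>"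

definition lie_supersubalgebra ::
  "('k, 'l) ring_scheme \<Rightarrow> ('k, 'v, 'm) super_scheme \<Rightarrow> 'v set \<Rightarrow> bool"
  where "lie_supersubalgebra K L S \<longleftrightarrow>
    submod K L S \<and> homogeneous_subset L S \<and> (\<forall>u \<in> S. \<forall>v \<in> S. u \<otimes>\<^bsub>L\<^esub> v \<in> S)"

text \<open>The map \<open>Lie(S) \<rightarrow> Lie(G)\<close> induced by the inclusion \<open>S \<le> G\<close> of the supersubgroup given by
  \<open>I\<close>, i.e. the dual of \<open>\<mm>\<^sub>G/\<mm>\<^sub>G\<^sup>2 \<rightarrow> \<mm>\<^sub>S/\<mm>\<^sub>S\<^sup>2\<close>.\<close>

definition lie_incl ::
  "('k, 'l) ring_scheme \<Rightarrow> ('k, 'a, 'm) hopf_scheme \<Rightarrow> 'a set \<Rightarrow>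
    ('a set set \<Rightarrow> 'k) \<Rightarrow> 'a set \<Rightarrow> 'k"
  where "lie_incl K G I u = (let S = quot_hopf K G I in
    (\<lambda>X \<in> carrier (cotangent K G).
      the_elem ((\<lambda>x. u (aug_sq K S +>\<^bsub>S\<^esub> (I +>\<^bsub>G\<^esub> x))) ` X)))"

definition algebraic_in ::
  "('k, 'l) ring_scheme \<Rightarrow> ('k, 'a, 'm) hopf_scheme \<Rightarrow> ('a set \<Rightarrow> 'k) set \<Rightarrow> bool"
  where "algebraic_in K G L \<longleftrightarrow>
    (\<exists>I. hopf_superideal K G I \<and> lie_incl K G I ` carrier (Lie K (quot_hopf K G I)) = L)"

text \<open>\<open>Lie(G\<^sub>e\<^sub>v)\<close> is identified with the even part of \<open>Lie(G)\<close> along the inclusion; this is the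
  subset of \<open>Lie(G\<^sub>e\<^sub>v)\<close> that corresponds to the even part of \<open>L \<subseteq> Lie(G)\<close>.\<close>

definition lie_ev_part ::
  "('k, 'l) ring_scheme \<Rightarrow> ('k, 'a, 'm) hopf_scheme \<Rightarrow> ('a set \<Rightarrow> 'k) set \<Rightarrow>
    ('a set set \<Rightarrow> 'k) set"
  where "lie_ev_part K G L =
    {u \<in> carrier (Lie K (ev_supergroup K G)). lie_incl K G (ev_ideal G) u \<in> L \<inter> gr (Lie K G) 0}"

end

theory Submission
  imports Defs
begin

text \<open>A tangent vector \<open>d\<close> of \<open>H\<close> acts on \<open>K[H]\<close> by the operator \<open>x \<mapsto> \<Sum> x\<^sub>1 d(x\<^sub>2)\<close>. Given the Lie
  superalgebra \<open>\<SS>\<close>, let \<open>I\<close> be the annihilator of the convolution algebra generated by \<open>\<SS>\<close>, i.e.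
  the largest subspace of the augmentation ideal that is stable under these operators; it is
  always a Hopf superideal, and \<open>\<SS> \<subseteq> Lie(V(I))\<close>. If \<open>\<SS>\<^sub>0\<close> is the Lie algebra of a subgroup of
  \<open>H\<^sub>e\<^sub>v\<close>, then the tangent vectors that vanish on \<open>I\<close> are those of \<open>\<SS>\<close>: choose a basis \<open>\<xi>\<^sub>j\<close> of
  \<open>\<SS>\<^sub>1\<close> and odd functions \<open>y\<^sub>j\<close> that are dual to it and invariant modulo odd functions. The
  annihilator \<open>I\<^sub>0\<close> of \<open>\<SS>\<^sub>0\<close> is filtered by the order of vanishing under odd operators, and the
  Euler operator \<open>x \<mapsto> \<Sum> (\<xi>\<^sub>j x) y\<^sub>j\<close> acts on the \<open>k\<close>-th graded piece as multiplication by \<open>k\<close>. As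
  products of more than \<open>dim \<SS>\<^sub>1\<close> of the \<open>y\<^sub>j\<close> vanish, this gives \<open>I\<^sub>0 \<subseteq> I + (y\<^sub>j)\<close>, and a tangent
  vector that kills \<open>I\<close> and all \<open>y\<^sub>j\<close> comes from \<open>\<SS>\<^sub>0\<close>. Conversely, the image in \<open>K[H\<^sub>e\<^sub>v]\<close> of the
  Hopf superideal of \<open>S\<close> defines \<open>S\<^sub>e\<^sub>v\<close>.\<close>

section \<open>Linear maps and submodules\<close>

text \<open>The danger is that the Hopf superideal of \<SS> is too small, so that too many tangent
  vectors vanish on it. No splitting of \<open>K[H]\<close> into an even part and exterior
  generators is at hand; the \<open>y_j\<close> are odd coordinates only up to congruence, \<xi>_i
  y_j being the Kronecker symbol modulo \<open>I\<^sub>0\<close>. This suffices because the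
  filtration \<open>G\<close> by vanishing order is multiplicative with
  \<open>G 1 = I\<^sub>0\<close>, so error terms fall one level deeper. Closure under the bracket
  works the same way: \<xi>_i \<xi>_j + \<xi>_j \<xi>_i is an operator of the even part, and such
  operators preserve every \<open>G k\<close>. Hence \<xi>_i lowers the Euler eigenvalue by exactly
  one. Characteristic zero allows division by the eigenvalues k > 0 and gives y_j y_j = 0.
  Algebraicity of the even part serves the even tangent vectors: they vanish on the odd
  \<open>y_j\<close>, hence on \<open>I\<^sub>0\<close>, which contains the pullback of the ideal of
  the even subgroup. An odd tangent vector is corrected by an odd element of \<SS> so as to kill all
  \<open>y_j\<close>; the difference then kills \<open>I\<^sub>0\<close>, which contains every odd
  function, so it is zero.\<close>

lemma linear_mapI:
  assumes "\<And>x. x \<in> carrier V \<Longrightarrow> f x \<in> carrier W"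
    and "\<And>x y. \<lbrakk>x \<in> carrier V; y \<in> carrier V\<rbrakk> \<Longrightarrow> f (x \<oplus>\<^bsub>V\<^esub> y) = f x \<oplus>\<^bsub>W\<^esub> f y"
    and "\<And>c x. \<lbrakk>c \<in> carrier K; x \<in> carrier V\<rbrakk> \<Longrightarrow> f (c \<odot>\<^bsub>V\<^esub> x) = c \<odot>\<^bsub>W\<^esub> f x"
  shows "linear_map K V W f"
  using assms by (auto simp: linear_map_def)

lemma linear_map_closed: "\<lbrakk>linear_map K V W f; x \<in> carrier V\<rbrakk> \<Longrightarrow> f x \<in> carrier W"
  and linear_map_add: "\<lbrakk>linear_map K V W f; x \<in> carrier V; y \<in> carrier V\<rbrakk> \<Longrightarrow>
    f (x \<oplus>\<^bsub>V\<^esub> y) = f x \<oplus>\<^bsub>W\<^esub> f y"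
  and linear_map_smult: "\<lbrakk>linear_map K V W f; c \<in> carrier K; x \<in> carrier V\<rbrakk> \<Longrightarrow>
    f (c \<odot>\<^bsub>V\<^esub> x) = c \<odot>\<^bsub>W\<^esub> f x"
  by (auto simp: linear_map_def)

lemma linear_map_zero:
  assumes "module K V" "module K W" "linear_map K V W f"
  shows "f \<zero>\<^bsub>V\<^esub> = \<zero>\<^bsub>W\<^esub>"
proof -
  interpret V: module K V by fact
  interpret W: module K W by fact
  show ?thesis
    by (metis V.R.zero_closed V.smult_l_null V.zero_closed W.smult_l_null assms(3) linear_map_closed
        linear_map_smult)
qed

lemma (in module) uminus_smult: "x \<in> carrier M \<Longrightarrow> (\<ominus> \<one>) \<odot>\<^bsub>M\<^esub> x = \<ominus>\<^bsub>M\<^esub> x"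
  by (simp add: smult_l_minus)

lemma linear_map_uminus:
  assumes "module K V" "module K W" "linear_map K V W f" "x \<in> carrier V"
  shows "f (\<ominus>\<^bsub>V\<^esub> x) = \<ominus>\<^bsub>W\<^esub> f x"
proof -
  interpret V: module K V by fact
  interpret W: module K W by fact
  show ?thesis
    using linear_map_smult[OF assms(3), of "\<ominus>\<^bsub>K\<^esub> \<one>\<^bsub>K\<^esub>" x] assms linear_map_closed[OF assms(3)]
    by (simp add: V.uminus_smult W.uminus_smult)
qed

lemma linear_map_minus:
  assumes "module K V" "module K W" "linear_map K V W f" "x \<in> carrier V" "y \<in> carrier V"
  shows "f (x \<ominus>\<^bsub>V\<^esub> y) = f x \<ominus>\<^bsub>W\<^esub> f y"
proof -
  interpret V: module K V by fact
  show ?thesis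
    using assms by (simp add: a_minus_def linear_map_add linear_map_uminus)
qed

lemma linear_map_comp:
  "\<lbrakk>linear_map K V W f; linear_map K W X g\<rbrakk> \<Longrightarrow> linear_map K V X (\<lambda>x. g (f x))"
  by (auto simp: linear_map_def Pi_iff)

lemma linear_map_id: "linear_map K V V (\<lambda>x. x)"
  by (simp add: linear_map_def)

lemma linear_map_cong:
  assumes "module K V" "linear_map K V W f" "\<And>x. x \<in> carrier V \<Longrightarrow> f x = g x"
  shows "linear_map K V W g"
proof -
  interpret V: module K V by fact
  show ?thesis using assms(2,3) by (simp add: linear_map_def Pi_iff)
qed

lemma submodI:
  assumes "module K M" "N \<subseteq> carrier M" "\<zero>\<^bsub>M\<^esub> \<in> N"
    and "\<And>x y. \<lbrakk>x \<in> N; y \<in> N\<rbrakk> \<Longrightarrow> x \<oplus>\<^bsub>M\<^esub> y \<in> N"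
    and "\<And>c x. \<lbrakk>c \<in> carrier K; x \<in> N\<rbrakk> \<Longrightarrow> c \<odot>\<^bsub>M\<^esub> x \<in> N"
  shows "submod K M N"
proof -
  interpret module K M by fact
  have "\<ominus>\<^bsub>M\<^esub> x \<in> N" if "x \<in> N" for x
    using that assms(5)[of "\<ominus>\<^bsub>K\<^esub> \<one>\<^bsub>K\<^esub>" x] assms(2) uminus_smult[of x] by auto
  then have "subgroup N (add_monoid M)"
    using assms by (intro M.add.subgroupI) (auto simp: a_inv_def)
  then show ?thesis using assms by (simp add: submod_def)
qed

lemma submod_subset: "submod K M N \<Longrightarrow> N \<subseteq> carrier M"
  and submod_zero: "submod K M N \<Longrightarrow> \<zero>\<^bsub>M\<^esub> \<in> N"
  and submod_add: "\<lbrakk>submod K M N; x \<in> N; y \<in> N\<rbrakk> \<Longrightarrow> x \<oplus>\<^bsub>M\<^esub> y \<in> N"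
  and submod_smult: "\<lbrakk>submod K M N; c \<in> carrier K; x \<in> N\<rbrakk> \<Longrightarrow> c \<odot>\<^bsub>M\<^esub> x \<in> N"
  and submod_uminus: "\<lbrakk>submod K M N; x \<in> N\<rbrakk> \<Longrightarrow> \<ominus>\<^bsub>M\<^esub> x \<in> N"
  using subgroup.subset[of N "add_monoid M"] subgroup.one_closed[of N "add_monoid M"]
    subgroup.m_closed[of N "add_monoid M"] subgroup.m_inv_closed[of N "add_monoid M"]
  by (auto simp: submod_def a_inv_def)

lemma submod_carrier: "\<lbrakk>submod K M N; x \<in> N\<rbrakk> \<Longrightarrow> x \<in> carrier M"
  using submod_subset by blast

lemma submod_minus: "\<lbrakk>submod K M N; x \<in> N; y \<in> N\<rbrakk> \<Longrightarrow> x \<ominus>\<^bsub>M\<^esub> y \<in> N"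
  by (simp add: a_minus_def submod_add submod_uminus)

lemma submod_finsum:
  assumes "module K M" "submod K M N" "\<And>i. i \<in> F \<Longrightarrow> f i \<in> N"
  shows "(\<Oplus>\<^bsub>M\<^esub>i \<in> F. f i) \<in> N"
proof -
  interpret module K M by fact
  show ?thesis
  proof (cases "finite F")
    case True
    then show ?thesis using assms(3)
    proof (induct F)
      case empty
      then show ?case using assms(2) by (simp add: submod_zero)
    next
      case (insert i F)
      then have "f \<in> F \<rightarrow> carrier M" "f i \<in> carrier M"
        using submod_carrier[OF assms(2)] by auto
      then show ?case using insert assms(2) by (simp add: submod_add)
    qed
  next
    case False
    then show ?thesis using submod_zero[OF assms(2)] by (simp add: M.add.finprod_infinite)
  qed
qed

lemma submod_univ: "module K M \<Longrightarrow> submod K M (carrier M)"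
  by (rule submodI) (auto simp: module_def module_axioms_def abelian_group_def
      abelian_monoid.zero_closed abelian_monoid.a_closed)

lemma submod_Int:
  assumes "module K M" "submod K M N" "submod K M N'"
  shows "submod K M (N \<inter> N')"
  using assms by (intro submodI) (auto dest: submod_carrier submod_zero submod_add submod_smult)

lemma submod_vimage:
  assumes "module K V" "module K W" "linear_map K V W f" "submod K W N"
  shows "submod K V {x \<in> carrier V. f x \<in> N}"
proof -
  interpret V: module K V by fact
  show ?thesis
    using assms
    by (intro submodI)
      (auto simp: linear_map_zero linear_map_add linear_map_smult submod_add submod_smult
          submod_zero)
qed

lemma submod_kernel:
  assumes "module K V" "module K W" "linear_map K V W f"
  shows "submod K V {x \<in> carrier V. f x = \<zero>\<^bsub>W\<^esub>}"
proof -
  interpret W: module K W by fact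
  have "submod K W {\<zero>\<^bsub>W\<^esub>}" by (rule submodI) (auto simp: assms)
  from submod_vimage[OF assms this] show ?thesis by simp
qed

lemma submod_image:
  assumes "module K V" "module K W" "linear_map K V W f" "submod K V N"
  shows "submod K W (f ` N)"
proof (rule submodI[OF assms(2)])
  interpret V: module K V by fact
  show "f ` N \<subseteq> carrier W" using assms submod_carrier linear_map_closed by fastforce
  show "\<zero>\<^bsub>W\<^esub> \<in> f ` N" using linear_map_zero[OF assms(1,2,3)] submod_zero[OF assms(4)] by force
next
  fix x y assume "x \<in> f ` N" "y \<in> f ` N"
  then obtain a b where "a \<in> N" "b \<in> N" "x = f a" "y = f b" by blast
  then show "x \<oplus>\<^bsub>W\<^esub> y \<in> f ` N"
    using assms submod_carrier[OF assms(4)] submod_add[OF assms(4)]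
    by (auto simp: linear_map_add[symmetric] intro!: imageI)
next
  fix c x assume "c \<in> carrier K" "x \<in> f ` N"
  then show "c \<odot>\<^bsub>W\<^esub> x \<in> f ` N"
    using assms submod_carrier[OF assms(4)] submod_smult[OF assms(4)]
    by (auto simp: linear_map_smult[OF assms(3), symmetric] intro!: imageI)
qed

lemma hull_submod_subset:
  "\<lbrakk>submod K M N; X \<subseteq> N\<rbrakk> \<Longrightarrow> submod K M hull X \<subseteq> N"
  by (auto simp: hull_def)

lemma submod_hull:
  assumes "module K M" "X \<subseteq> carrier M"
  shows "submod K M (submod K M hull X)"
proof -
  have "carrier M \<in> {N. submod K M N \<and> X \<subseteq> N}" using assms by (simp add: submod_univ)
  then show ?thesis
    unfolding hull_def
    apply (intro submodI[OF assms(1)])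
       apply blast
      apply (auto intro: submod_zero submod_add submod_smult)
    done
qed

text \<open>The graded pieces of a tensor square and the spaces I \<otimes> G + G \<otimes> I are
  given as hulls of pure tensors; with this, only the generators have to be tested.\<close>

lemma linear_map_hull:
  assumes "module K V" "module K W" "linear_map K V W f" "submod K W N"
    and "X \<subseteq> carrier V" "\<And>x. x \<in> X \<Longrightarrow> f x \<in> N" "t \<in> submod K V hull X"
  shows "f t \<in> N"
  using hull_submod_subset[OF submod_vimage[OF assms(1-4)], of X] assms(5-7) by blast

section \<open>Quotient modules\<close>

text \<open>The factor group \<open>M A_Mod N\<close> and the additive monoid of
  \<open>quot_module M N\<close> are different records with the same operations.\<close>

lemma comm_group_cong:
  assumes "comm_group G" "carrier G' = carrier G" "mult G' = mult G" "one G' = one G"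
  shows "comm_group G'"
proof -
  interpret comm_group G by fact
  show ?thesis
    by (rule comm_groupI) (auto simp: assms m_assoc l_inv_ex intro: m_comm)
qed

text \<open>Maps on quotients are encoded as \<open>the_elem\<close> of the image of a coset, so
  well-definedness means that this image is a singleton.\<close>

lemma (in abelian_group) the_elem_coset:
  assumes "additive_subgroup N G" "x \<in> carrier G"
    and "\<And>n. n \<in> N \<Longrightarrow> f (n \<oplus> x) = f x"
  shows "the_elem (f ` (N +> x)) = f x"
proof -
  interpret additive_subgroup N G by fact
  have "f ` (N +> x) = {f x}"
    using assms(2,3) zero_closed by (auto simp: a_r_coset_def' image_iff) 
  then show ?thesis by simp
qed

lemma submod_additive: "submod K M N \<Longrightarrow> additive_subgroup N M"
  by (simp add: submod_def additive_subgroup_def)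

lemma quot_sel [simp]:
  "carrier (quot_module M N) = a_rcosets\<^bsub>M\<^esub> N" "zero (quot_module M N) = N"
  "add (quot_module M N) = set_add M" "mult (quot_module M N) = rcoset_mult M N"
  "one (quot_module M N) = N +>\<^bsub>M\<^esub> \<one>\<^bsub>M\<^esub>"
  by (simp_all add: quot_module_def FactRing_def ring.defs)

lemma smult_quot: "smult (quot_module M N) = (\<lambda>c X. the_elem ((\<lambda>x. N +>\<^bsub>M\<^esub> (c \<odot>\<^bsub>M\<^esub> x)) ` X))"
  by (simp add: quot_module_def module.defs ring.defs)

lemma quot_carrierE:
  assumes "X \<in> a_rcosets\<^bsub>M\<^esub> N"
  obtains x where "x \<in> carrier M" "X = N +>\<^bsub>M\<^esub> x"
  using assms by (auto simp: A_RCOSETS_def')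

lemma quot_carrier_iff: "X \<in> a_rcosets\<^bsub>M\<^esub> N \<longleftrightarrow> (\<exists>x\<in>carrier M. X = N +>\<^bsub>M\<^esub> x)"
  by (auto simp: A_RCOSETS_def')

context
  fixes K :: "('k, 'l) ring_scheme" and M :: "('k, 'a, 'm) module_scheme" and N
  assumes M: "module K M" and N: "submod K M N"
begin

interpretation M: module K M by (rule M)

interpretation N: abelian_subgroup N M
  by (rule abelian_subgroupI3[OF submod_additive[OF N] M.M.abelian_group_axioms])

lemma coset_add: "\<lbrakk>x \<in> carrier M; y \<in> carrier M\<rbrakk> \<Longrightarrow>
    N +>\<^bsub>M\<^esub> (x \<oplus>\<^bsub>M\<^esub> y) = (N +>\<^bsub>M\<^esub> x) <+>\<^bsub>M\<^esub> (N +>\<^bsub>M\<^esub> y)"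
  by (simp add: N.a_rcos_sum)

lemma coset_eq_iff: "\<lbrakk>x \<in> carrier M; y \<in> carrier M\<rbrakk> \<Longrightarrow>
    N +>\<^bsub>M\<^esub> x = N +>\<^bsub>M\<^esub> y \<longleftrightarrow> x \<ominus>\<^bsub>M\<^esub> y \<in> N"
proof -
  assume xy: "x \<in> carrier M" "y \<in> carrier M"
  have "N +>\<^bsub>M\<^esub> x = N +>\<^bsub>M\<^esub> y \<longleftrightarrow> x \<in> N +>\<^bsub>M\<^esub> y"
    using N.a_repr_independence'[of x y] N.a_rcos_self xy by auto
  also have "\<dots> \<longleftrightarrow> x \<ominus>\<^bsub>M\<^esub> y \<in> N"
    using xy by (simp add: N.a_rcos_module a_minus_def)
  finally show ?thesis .
qed

lemma coset_closed: "x \<in> carrier M \<Longrightarrow> N +>\<^bsub>M\<^esub> x \<in> a_rcosets\<^bsub>M\<^esub> N"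
  by (auto simp: quot_carrier_iff)

lemma coset_eq_zero_iff: "x \<in> carrier M \<Longrightarrow> N +>\<^bsub>M\<^esub> x = N \<longleftrightarrow> x \<in> N"
  using N.a_rcos_const N.a_rcos_self by auto

lemma coset_smult: "\<lbrakk>c \<in> carrier K; x \<in> carrier M\<rbrakk> \<Longrightarrow>
    N +>\<^bsub>M\<^esub> (c \<odot>\<^bsub>M\<^esub> x) = c \<odot>\<^bsub>quot_module M N\<^esub> (N +>\<^bsub>M\<^esub> x)"
proof -
  assume c: "c \<in> carrier K" and x: "x \<in> carrier M"
  have "N +>\<^bsub>M\<^esub> (c \<odot>\<^bsub>M\<^esub> (n \<oplus>\<^bsub>M\<^esub> x)) = N +>\<^bsub>M\<^esub> (c \<odot>\<^bsub>M\<^esub> x)" if n: "n \<in> N" for n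
  proof -
    have "c \<odot>\<^bsub>M\<^esub> n \<in> N" "c \<odot>\<^bsub>M\<^esub> n \<in> carrier M" "n \<in> carrier M"
      using n c N submod_smult submod_carrier by metis+
    then show ?thesis
      using c x by (simp add: M.smult_r_distr coset_eq_iff a_minus_def M.M.a_assoc M.M.r_neg)
  qed
  then show ?thesis
    unfolding smult_quot by (subst M.M.the_elem_coset[OF submod_additive[OF N] x]) auto
qed

lemma module_quot: "module K (quot_module M N)"
proof (rule moduleI)
  show "cring K" by (rule M.R.is_cring)
  have "comm_group (M A_Mod N)" by (rule N.a_factorgroup_is_comm_group)
  then have "comm_group (add_monoid (quot_module M N))"
    by (rule comm_group_cong) (simp_all add: A_FactGroup_def')
  then show "abelian_group (quot_module M N)"
    by (intro abelian_group.intro abelian_monoid.intro abelian_group_axioms.intro)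
      (rule comm_group.axioms)
qed (auto simp: quot_carrier_iff coset_smult[symmetric] coset_add[symmetric] 
    M.smult_l_distr M.smult_r_distr M.smult_assoc1)

lemma linear_map_coset: "linear_map K M (quot_module M N) (\<lambda>x. N +>\<^bsub>M\<^esub> x)"
  by (rule linear_mapI) (auto simp: coset_closed coset_add coset_smult)

text \<open>The universal property of the quotient in this encoding: vanishing on \<open>N\<close>
  makes \<open>f\<close> constant on cosets.\<close>

lemma linear_map_quot:
  assumes "module K W" "linear_map K M W f" "\<And>x. x \<in> N \<Longrightarrow> f x = \<zero>\<^bsub>W\<^esub>"
  shows "x \<in> carrier M \<Longrightarrow> the_elem (f ` (N +>\<^bsub>M\<^esub> x)) = f x"
    and "linear_map K (quot_module M N) W (\<lambda>X. the_elem (f ` X))"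
proof -
  interpret W: module K W by fact
  show *: "the_elem (f ` (N +>\<^bsub>M\<^esub> x)) = f x" if "x \<in> carrier M" for x
    using that assms submod_carrier[OF N] linear_map_closed[OF assms(2)]
    by (intro M.M.the_elem_coset[OF submod_additive[OF N]]) (auto simp: linear_map_add)
  show "linear_map K (quot_module M N) W (\<lambda>X. the_elem (f ` X))"
    using assms(2)
    by (intro linear_mapI)
      (auto simp: quot_carrier_iff coset_smult[symmetric] coset_add[symmetric] * linear_map_def)
qed

end

section \<open>Tensor products\<close>

text \<open>\<open>tensor_lift\<close> accepts any function, but the sum in it depends only on the
  coset when the function is bilinear on the carriers. Separate linearity in each variable lets the
  facts on \<open>linear_map\<close> carry over.\<close>

definition bilinear_map ::
  "('k, 'l) ring_scheme \<Rightarrow> ('k, 'a, 'm) module_scheme \<Rightarrow> ('k, 'b, 'n) module_scheme \<Rightarrow>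
    ('k, 'c, 'o) module_scheme \<Rightarrow> ('a \<Rightarrow> 'b \<Rightarrow> 'c) \<Rightarrow> bool"
  where "bilinear_map K A B M \<phi> \<longleftrightarrow>
    (\<forall>a \<in> carrier A. linear_map K B M (\<phi> a)) \<and> (\<forall>b \<in> carrier B. linear_map K A M (\<lambda>a. \<phi> a b))"

lemma bilinear_mapI:
  assumes "\<And>a. a \<in> carrier A \<Longrightarrow> linear_map K B M (\<phi> a)"
    and "\<And>b. b \<in> carrier B \<Longrightarrow> linear_map K A M (\<lambda>a. \<phi> a b)"
  shows "bilinear_map K A B M \<phi>"
  using assms by (simp add: bilinear_map_def)

lemma bilinear_mapD:
  assumes "bilinear_map K A B M \<phi>"
  shows "a \<in> carrier A \<Longrightarrow> linear_map K B M (\<phi> a)"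
    and "b \<in> carrier B \<Longrightarrow> linear_map K A M (\<lambda>a. \<phi> a b)"
  using assms by (simp_all add: bilinear_map_def)

lemma bilinear_map_comp_left:
  "\<lbrakk>linear_map K A' A f; bilinear_map K A B M \<phi>\<rbrakk> \<Longrightarrow> bilinear_map K A' B M (\<lambda>a. \<phi> (f a))"
  using linear_map_comp[of K A' A f M] by (auto simp: bilinear_map_def linear_map_closed)

lemma bilinear_map_comp_right:
  "\<lbrakk>linear_map K B' B f; bilinear_map K A B M \<phi>\<rbrakk> \<Longrightarrow> bilinear_map K A B' M (\<lambda>a b. \<phi> a (f b))"
  using linear_map_comp[of K B' B f M] by (auto simp: bilinear_map_def linear_map_closed)

lemma bilinear_map_comp:
  "\<lbrakk>linear_map K M N g; bilinear_map K A B M \<phi>\<rbrakk> \<Longrightarrow> bilinear_map K A B N (\<lambda>a b. g (\<phi> a b))"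
  by (auto simp: bilinear_map_def intro: linear_map_comp)

lemma bilinear_map_swap: "bilinear_map K A B M \<phi> \<Longrightarrow> bilinear_map K B A M (\<lambda>b a. \<phi> a b)"
  by (auto simp: bilinear_map_def)

lemma linear_map_const_zero:
  assumes "module K W"
  shows "linear_map K V W (\<lambda>_. \<zero>\<^bsub>W\<^esub>)"
proof -
  interpret W: module K W by fact
  show ?thesis by (rule linear_mapI) auto
qed

lemma linear_map_plus:
  assumes "module K W" "linear_map K V W f" "linear_map K V W g"
  shows "linear_map K V W (\<lambda>x. f x \<oplus>\<^bsub>W\<^esub> g x)"
proof -
  interpret W: module K W by fact
  show ?thesis
    using assms(2,3) by (intro linear_mapI) (simp_all add: linear_map_def Pi_iff W.smult_r_distr
        W.M.a_ac)
qed

lemma linear_map_scale: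
  assumes "module K W" "linear_map K V W f" "c \<in> carrier K"
  shows "linear_map K V W (\<lambda>x. c \<odot>\<^bsub>W\<^esub> f x)"
proof -
  interpret W: module K W by fact
  show ?thesis
    using assms(2,3)
    by (intro linear_mapI)
      (simp_all add: linear_map_def Pi_iff W.smult_r_distr W.smult_assoc1[symmetric] W.R.m_comm)
qed

lemma linear_map_neg:
  assumes "module K W" "linear_map K V W f"
  shows "linear_map K V W (\<lambda>x. \<ominus>\<^bsub>W\<^esub> f x)"
proof -
  interpret W: module K W by fact
  show ?thesis
    using assms(2)
    by (intro linear_mapI) (simp_all add: linear_map_def Pi_iff W.M.minus_add W.smult_r_minus)
qed

lemma linear_map_diff:
  assumes "module K W" "linear_map K V W f" "linear_map K V W g"
  shows "linear_map K V W (\<lambda>x. f x \<ominus>\<^bsub>W\<^esub> g x)"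
  unfolding a_minus_def by (intro linear_map_plus linear_map_neg assms)

lemma bilinear_map_plus:
  "\<lbrakk>module K M; bilinear_map K A B M \<phi>; bilinear_map K A B M \<psi>\<rbrakk> \<Longrightarrow>
    bilinear_map K A B M (\<lambda>a b. \<phi> a b \<oplus>\<^bsub>M\<^esub> \<psi> a b)"
  by (auto simp: bilinear_map_def intro: linear_map_plus)

lemma bilinear_map_neg:
  "\<lbrakk>module K M; bilinear_map K A B M \<phi>\<rbrakk> \<Longrightarrow> bilinear_map K A B M (\<lambda>a b. \<ominus>\<^bsub>M\<^esub> \<phi> a b)"
  by (auto simp: bilinear_map_def intro: linear_map_neg)

lemma bilinear_map_closed:
  "\<lbrakk>bilinear_map K A B M \<phi>; a \<in> carrier A; b \<in> carrier B\<rbrakk> \<Longrightarrow> \<phi> a b \<in> carrier M"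
  using bilinear_mapD(1) linear_map_closed by metis

section \<open>Free modules of finitely supported functions\<close>

lemma free_sel [simp]:
  "carrier (free_module K X) =
    {f. f \<in> UNIV \<rightarrow> carrier K \<and> {x. f x \<noteq> \<zero>\<^bsub>K\<^esub>} \<subseteq> X \<and> finite {x. f x \<noteq> \<zero>\<^bsub>K\<^esub>}}"
  "zero (free_module K X) = (\<lambda>x. \<zero>\<^bsub>K\<^esub>)"
  "add (free_module K X) = (\<lambda>f g x. f x \<oplus>\<^bsub>K\<^esub> g x)"
  "smult (free_module K X) = (\<lambda>c f x. c \<otimes>\<^bsub>K\<^esub> f x)"
  by (simp_all add: free_module_def)

lemma (in field) module_free: "module R (free_module R X)"
proof (rule moduleI)
  show "cring R" by (rule is_cring)
  have fin: "finite {x. h x \<noteq> \<zero>}" "{x. h x \<noteq> \<zero>} \<subseteq> X"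
    if "f \<in> carrier (free_module R X)" "g \<in> carrier (free_module R X)"
      "\<And>x. f x = \<zero> \<Longrightarrow> g x = \<zero> \<Longrightarrow> h x = \<zero>" for f g h :: "_ \<Rightarrow> 'a"
  proof -
    have "{x. h x \<noteq> \<zero>} \<subseteq> {x. f x \<noteq> \<zero>} \<union> {x. g x \<noteq> \<zero>}" using that(3) by blast
    then show "finite {x. h x \<noteq> \<zero>}" "{x. h x \<noteq> \<zero>} \<subseteq> X"
      using that(1,2) by (auto intro: finite_subset)
  qed
  show "abelian_group (free_module R X)"
  proof (rule abelian_groupI)
    fix f g assume fg: "f \<in> carrier (free_module R X)" "g \<in> carrier (free_module R X)"
    then show "f \<oplus>\<^bsub>free_module R X\<^esub> g \<in> carrier (free_module R X)"
      using fin[OF fg, of "\<lambda>x. f x \<oplus> g x"] by (auto simp: Pi_iff)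
    show "f \<oplus>\<^bsub>free_module R X\<^esub> g = g \<oplus>\<^bsub>free_module R X\<^esub> f"
      using fg by (auto simp: Pi_iff intro!: ext a_comm)
  next
    fix f g h assume "f \<in> carrier (free_module R X)" "g \<in> carrier (free_module R X)"
      "h \<in> carrier (free_module R X)"
    then show "(f \<oplus>\<^bsub>free_module R X\<^esub> g) \<oplus>\<^bsub>free_module R X\<^esub> h
        = f \<oplus>\<^bsub>free_module R X\<^esub> (g \<oplus>\<^bsub>free_module R X\<^esub> h)"
      by (auto simp: Pi_iff intro!: ext a_assoc)
  next
    fix f assume f: "f \<in> carrier (free_module R X)"
    then show "\<exists>g\<in>carrier (free_module R X). g \<oplus>\<^bsub>free_module R X\<^esub> f = \<zero>\<^bsub>free_module R X\<^esub>"
      using fin[OF f f, of "\<lambda>x. \<ominus> f x"]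
      by (intro bexI[of _ "\<lambda>x. \<ominus> f x"]) (auto simp: Pi_iff l_neg)
  qed (auto simp: Pi_iff)
  show "c \<odot>\<^bsub>free_module R X\<^esub> f \<in> carrier (free_module R X)"
    if c: "c \<in> carrier R" and f: "f \<in> carrier (free_module R X)" for c f
    using c fin[OF f f, of "\<lambda>x. c \<otimes> f x"] f by (auto simp: Pi_iff)
qed (auto simp: Pi_iff l_distr r_distr m_assoc)

lemma (in field) delta_closed: "x \<in> X \<Longrightarrow> delta R x \<in> carrier (free_module R X)"
  by (auto simp: delta_def)

text \<open>Induction on the size of the support: resetting one value of \<open>f\<close> to zero
  splits off a multiple of a basis element.\<close>

lemma (in field) free_module_induct [consumes 1, case_names zero add]:
  assumes f: "f \<in> carrier (free_module R X)"
    and zero: "P (\<lambda>x. \<zero>)"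
    and add: "\<And>c x f. \<lbrakk>c \<in> carrier R; x \<in> X; f \<in> carrier (free_module R X); P f\<rbrakk> \<Longrightarrow>
      P ((c \<odot>\<^bsub>free_module R X\<^esub> delta R x) \<oplus>\<^bsub>free_module R X\<^esub> f)"
  shows "P f"
proof -
  have "finite {x. f x \<noteq> \<zero>}" using f by simp
  then show ?thesis using f
  proof (induct "{x. f x \<noteq> \<zero>}" arbitrary: f rule: finite_induct)
    case empty
    then have "f = (\<lambda>x. \<zero>)" by auto
    then show ?case using zero by simp
  next
    case (insert x F)
    define g where "g = f(x := \<zero>)"
    have F: "F = {y. g y \<noteq> \<zero>}" using insert(2,4) by (auto simp: g_def)
    have g: "g \<in> carrier (free_module R X)"
      using insert(1,4,5) F by (auto simp: g_def Pi_iff)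
    have "f = (f x \<odot>\<^bsub>free_module R X\<^esub> delta R x) \<oplus>\<^bsub>free_module R X\<^esub> g"
      using insert(5) by (auto simp: g_def delta_def Pi_iff)
    moreover have "P ((f x \<odot>\<^bsub>free_module R X\<^esub> delta R x) \<oplus>\<^bsub>free_module R X\<^esub> g)"
      using insert(3)[OF F g] g insert(4,5) by (intro add) (auto simp: Pi_iff)
    ultimately show ?case by simp
  qed
qed

lemma
  assumes "field K" "module K M" and \<phi>: "\<And>x. x \<in> X \<Longrightarrow> \<phi> x \<in> carrier M"
  shows linear_map_free:
      "linear_map K (free_module K X) M (\<lambda>f. \<Oplus>\<^bsub>M\<^esub>p \<in> {p. f p \<noteq> \<zero>\<^bsub>K\<^esub>}. f p \<odot>\<^bsub>M\<^esub> \<phi> p)"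
    and linear_map_free_delta:
      "x \<in> X \<Longrightarrow> (\<Oplus>\<^bsub>M\<^esub>p \<in> {p. delta K x p \<noteq> \<zero>\<^bsub>K\<^esub>}. delta K x p \<odot>\<^bsub>M\<^esub> \<phi> p) = \<phi> x"
proof -
  interpret K: field K by fact
  interpret M: module K M by fact
  define E where "E f = (\<Oplus>\<^bsub>M\<^esub>p \<in> {p. f p \<noteq> \<zero>\<^bsub>K\<^esub>}. f p \<odot>\<^bsub>M\<^esub> \<phi> p)" for f
  \<comment> \<open>The sum may run over any finite subset of \<open>X\<close> containing the
    support, so the sums for \<open>f\<close>, \<open>g\<close> and their sum can share one index
    set.\<close>
  have E: "E f = (\<Oplus>\<^bsub>M\<^esub>p \<in> F. f p \<odot>\<^bsub>M\<^esub> \<phi> p)"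
    if "f \<in> UNIV \<rightarrow> carrier K" "finite F" "F \<subseteq> X" "{p. f p \<noteq> \<zero>\<^bsub>K\<^esub>} \<subseteq> F" for f F
    unfolding E_def using that \<phi>
    by (intro M.M.add.finprod_mono_neutral_cong_left) (auto simp: Pi_iff subset_iff)
  show "x \<in> X \<Longrightarrow> (\<Oplus>\<^bsub>M\<^esub>p \<in> {p. delta K x p \<noteq> \<zero>\<^bsub>K\<^esub>}. delta K x p \<odot>\<^bsub>M\<^esub> \<phi> p) = \<phi> x"
    using E[of "delta K x" "{x}"] \<phi>[of x] by (auto simp: delta_def E_def)
  have "linear_map K (free_module K X) M E"
  proof (rule linear_mapI)
    fix f assume f: "f \<in> carrier (free_module K X)"
    then show "E f \<in> carrier M"
      using \<phi> unfolding E_def by (intro M.M.finsum_closed) (auto simp: Pi_iff subset_iff)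
    fix g assume g: "g \<in> carrier (free_module K X)"
    let ?F = "{p. f p \<noteq> \<zero>\<^bsub>K\<^esub>} \<union> {p. g p \<noteq> \<zero>\<^bsub>K\<^esub>}"
    have "E (\<lambda>x. f x \<oplus>\<^bsub>K\<^esub> g x) = (\<Oplus>\<^bsub>M\<^esub>p \<in> ?F. (f p \<oplus>\<^bsub>K\<^esub> g p) \<odot>\<^bsub>M\<^esub> \<phi> p)"
      using f g by (intro E) (auto simp: Pi_iff)
    also have "\<dots> = (\<Oplus>\<^bsub>M\<^esub>p \<in> ?F. f p \<odot>\<^bsub>M\<^esub> \<phi> p \<oplus>\<^bsub>M\<^esub> g p \<odot>\<^bsub>M\<^esub> \<phi> p)"
      using f g \<phi> by (intro M.M.finsum_cong') (auto simp: Pi_iff M.smult_l_distr subset_iff)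
    also have "\<dots> = (\<Oplus>\<^bsub>M\<^esub>p \<in> ?F. f p \<odot>\<^bsub>M\<^esub> \<phi> p) \<oplus>\<^bsub>M\<^esub> (\<Oplus>\<^bsub>M\<^esub>p \<in> ?F. g p \<odot>\<^bsub>M\<^esub> \<phi> p)"
      using f g \<phi> by (intro M.M.finsum_addf) (auto simp: Pi_iff subset_iff)
    also have "\<dots> = E f \<oplus>\<^bsub>M\<^esub> E g" using f g by (subst (1 2) E[of _ ?F]) auto
    finally show "E (f \<oplus>\<^bsub>free_module K X\<^esub> g) = E f \<oplus>\<^bsub>M\<^esub> E g" by simp
  next
    fix c f assume c: "c \<in> carrier K" and f: "f \<in> carrier (free_module K X)"
    let ?F = "{p. f p \<noteq> \<zero>\<^bsub>K\<^esub>}"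
    have "E (\<lambda>x. c \<otimes>\<^bsub>K\<^esub> f x) = (\<Oplus>\<^bsub>M\<^esub>p \<in> ?F. (c \<otimes>\<^bsub>K\<^esub> f p) \<odot>\<^bsub>M\<^esub> \<phi> p)"
      using f c by (intro E) (auto simp: Pi_iff)
    also have "\<dots> = (\<Oplus>\<^bsub>M\<^esub>p \<in> ?F. c \<odot>\<^bsub>M\<^esub> (f p \<odot>\<^bsub>M\<^esub> \<phi> p))"
      using f c \<phi> by (intro M.M.finsum_cong') (auto simp: Pi_iff M.smult_assoc1 subset_iff)
    also have "\<dots> = c \<odot>\<^bsub>M\<^esub> E f"
      unfolding E_def using f c \<phi>
      by (intro M.finsum_smult_ldistr[symmetric]) (auto simp: Pi_iff subset_iff)
    finally show "E (c \<odot>\<^bsub>free_module K X\<^esub> f) = c \<odot>\<^bsub>M\<^esub> E f" by simp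
  qed
  then show "linear_map K (free_module K X) M (\<lambda>f. \<Oplus>\<^bsub>M\<^esub>p \<in> {p. f p \<noteq> \<zero>\<^bsub>K\<^esub>}. f p \<odot>\<^bsub>M\<^esub> \<phi> p)"
    unfolding E_def .
qed

section \<open>The universal property of the tensor product\<close>

locale tensor_pair = field K + A: module K A + B: module K B
  for K :: "('k, 'l) ring_scheme" and A :: "('k, 'a, 'm) module_scheme"
    and B :: "('k, 'b, 'n) module_scheme"
begin

abbreviation "F \<equiv> free_module K (carrier A \<times> carrier B)"
abbreviation "T \<equiv> tensor_module K A B"
abbreviation pt where "pt \<equiv> pure_tensor K A B"

sublocale F: module K F by (rule module_free)

text \<open>The generators of \<open>tensor_rels\<close> under a name of their own, so that claims
  about the hull reduce to these four families.\<close>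

definition "rels \<equiv> {delta K (a \<oplus>\<^bsub>A\<^esub> a', b) \<ominus>\<^bsub>F\<^esub> (delta K (a, b) \<oplus>\<^bsub>F\<^esub> delta K (a', b)) | a a' b.
        a \<in> carrier A \<and> a' \<in> carrier A \<and> b \<in> carrier B} \<union>
     {delta K (a, b \<oplus>\<^bsub>B\<^esub> b') \<ominus>\<^bsub>F\<^esub> (delta K (a, b) \<oplus>\<^bsub>F\<^esub> delta K (a, b')) | a b b'.
        a \<in> carrier A \<and> b \<in> carrier B \<and> b' \<in> carrier B} \<union>
     {delta K (c \<odot>\<^bsub>A\<^esub> a, b) \<ominus>\<^bsub>F\<^esub> c \<odot>\<^bsub>F\<^esub> delta K (a, b) | c a b.
        c \<in> carrier K \<and> a \<in> carrier A \<and> b \<in> carrier B} \<union>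
     {delta K (a, c \<odot>\<^bsub>B\<^esub> b) \<ominus>\<^bsub>F\<^esub> c \<odot>\<^bsub>F\<^esub> delta K (a, b) | c a b.
        c \<in> carrier K \<and> a \<in> carrier A \<and> b \<in> carrier B}"

lemma tensor_rels_eq: "tensor_rels K A B = submod K F hull rels"
  unfolding tensor_rels_def Let_def rels_def by simp

lemma dc: "\<lbrakk>a \<in> carrier A; b \<in> carrier B\<rbrakk> \<Longrightarrow> delta K (a, b) \<in> carrier F"
  by (rule delta_closed) simp

lemma rels_subset: "rels \<subseteq> carrier F"
  unfolding rels_def
  by (auto simp del: free_sel simp: dc)

lemma submod_rels: "submod K F (tensor_rels K A B)"
  unfolding tensor_rels_eq by (rule submod_hull[OF F.module_axioms rels_subset])

lemma rels_memI: "r \<in> rels \<Longrightarrow> r \<in> tensor_rels K A B"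
  unfolding tensor_rels_eq by (rule hull_inc)

sublocale T: module K T
  unfolding tensor_module_def by (rule module_quot[OF F.module_axioms submod_rels])

lemma pt_alt: "pt a b = tensor_rels K A B +>\<^bsub>F\<^esub> delta K (a, b)"
  by (simp add: pure_tensor_def)

lemmas coset_lin = linear_map_coset[OF F.module_axioms submod_rels, folded tensor_module_def]

lemma pt_closed: "\<lbrakk>a \<in> carrier A; b \<in> carrier B\<rbrakk> \<Longrightarrow> pt a b \<in> carrier T"
  unfolding pt_alt by (rule linear_map_closed[OF coset_lin]) (rule dc)

lemma rel_eq:
  assumes "f \<ominus>\<^bsub>F\<^esub> g \<in> rels" "f \<in> carrier F" "g \<in> carrier F"
  shows "tensor_rels K A B +>\<^bsub>F\<^esub> f = tensor_rels K A B +>\<^bsub>F\<^esub> g"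
  using coset_eq_iff[OF F.module_axioms submod_rels assms(2,3)] rels_memI[OF assms(1)] by simp

lemma pt_bilinear: "bilinear_map K A B T pt"
proof (intro bilinear_mapI linear_mapI)
  fix a a' b assume "a \<in> carrier A" "a' \<in> carrier A" "b \<in> carrier B"
  then show "pt (a \<oplus>\<^bsub>A\<^esub> a') b = pt a b \<oplus>\<^bsub>T\<^esub> pt a' b"
    unfolding pt_alt
    by (subst rel_eq[of _ "delta K (a, b) \<oplus>\<^bsub>F\<^esub> delta K (a', b)"])
      (auto simp del: free_sel simp: dc rels_def linear_map_add[OF coset_lin])
next
  fix a b b' assume "a \<in> carrier A" "b' \<in> carrier B" "b \<in> carrier B"
  then show "pt a (b \<oplus>\<^bsub>B\<^esub> b') = pt a b \<oplus>\<^bsub>T\<^esub> pt a b'"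
    unfolding pt_alt
    by (subst rel_eq[of _ "delta K (a, b) \<oplus>\<^bsub>F\<^esub> delta K (a, b')"])
      (auto simp del: free_sel simp: dc rels_def linear_map_add[OF coset_lin])
next
  fix a b c assume "a \<in> carrier A" "b \<in> carrier B" "c \<in> carrier K"
  then show "pt (c \<odot>\<^bsub>A\<^esub> a) b = c \<odot>\<^bsub>T\<^esub> pt a b"
    unfolding pt_alt
    by (subst rel_eq[of _ "c \<odot>\<^bsub>F\<^esub> delta K (a, b)"])
      (auto simp del: free_sel simp: dc rels_def linear_map_smult[OF coset_lin])
next
  fix a b c assume "a \<in> carrier A" "b \<in> carrier B" "c \<in> carrier K"
  then show "pt a (c \<odot>\<^bsub>B\<^esub> b) = c \<odot>\<^bsub>T\<^esub> pt a b"
    unfolding pt_alt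
    by (subst rel_eq[of _ "c \<odot>\<^bsub>F\<^esub> delta K (a, b)"])
      (auto simp del: free_sel simp: dc rels_def linear_map_smult[OF coset_lin])
qed (simp_all add: pt_closed)

text \<open>A scalar coefficient is absorbed into the left factor, so sums of pure tensors without
  coefficients exhaust the tensor product.\<close>

lemma tensor_induct [consumes 1, case_names zero add]:
  assumes t: "t \<in> carrier T"
    and zero: "P \<zero>\<^bsub>T\<^esub>"
    and add: "\<And>a b t. \<lbrakk>a \<in> carrier A; b \<in> carrier B; t \<in> carrier T; P t\<rbrakk> \<Longrightarrow> P (pt a b \<oplus>\<^bsub>T\<^esub> t)"
  shows "P t"
proof -
  obtain f where f: "f \<in> carrier F" and t: "t = tensor_rels K A B +>\<^bsub>F\<^esub> f"
    using t unfolding tensor_module_def by (auto simp del: free_sel elim: quot_carrierE)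
  from f have "P (tensor_rels K A B +>\<^bsub>F\<^esub> f)"
  proof (induct rule: free_module_induct)
    case zero
    then show ?case
      using assms(2) linear_map_zero[OF F.module_axioms T.module_axioms coset_lin] by simp
  next
    case (add c p f)
    obtain a b where p: "p = (a, b)" "a \<in> carrier A" "b \<in> carrier B" using add(2) by auto
    have "c \<odot>\<^bsub>T\<^esub> pt a b = pt (c \<odot>\<^bsub>A\<^esub> a) b"
      using add(1) p linear_map_smult[OF bilinear_mapD(2)[OF pt_bilinear]] by simp
    then show ?case
      using assms(3)[of "c \<odot>\<^bsub>A\<^esub> a" b "tensor_rels K A B +>\<^bsub>F\<^esub> f"] add p dc[OF p(2,3)]
        linear_map_closed[OF coset_lin add(3)]
      by (simp del: free_sel add: linear_map_add[OF coset_lin] linear_map_smult[OF coset_lin]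
          pt_alt)
  qed
  then show ?thesis using t by simp
qed

text \<open>The linear extension to the free module kills the four families of relations, one for
  each additivity and homogeneity law of \<phi>, and so descends to the quotient.\<close>

lemma
  assumes M: "module K M" and \<phi>: "bilinear_map K A B M \<phi>"
  shows lift_linear: "linear_map K T M (tensor_lift K M \<phi>)"
    and lift_pt: "\<lbrakk>a \<in> carrier A; b \<in> carrier B\<rbrakk> \<Longrightarrow> tensor_lift K M \<phi> (pt a b) = \<phi> a b"
proof -
  interpret M: module K M by fact
  let ?E = "\<lambda>f. \<Oplus>\<^bsub>M\<^esub> p \<in> {p. f p \<noteq> \<zero>\<^bsub>K\<^esub>}. f p \<odot>\<^bsub>M\<^esub> case_prod \<phi> p"
  have \<phi>c: "case_prod \<phi> x \<in> carrier M" if "x \<in> carrier A \<times> carrier B" for x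
    using that bilinear_map_closed[OF \<phi>] by auto
  note E = linear_map_free[OF field_axioms M \<phi>c]
  have Ed: "?E (delta K (a, b)) = \<phi> a b" if "a \<in> carrier A" "b \<in> carrier B" for a b
    using linear_map_free_delta[OF field_axioms M \<phi>c, where x="(a, b)"] that
    by simp
  have "?E r = \<zero>\<^bsub>M\<^esub>" if "r \<in> rels" for r
    using that bilinear_map_closed[OF \<phi>]
      linear_map_add[OF bilinear_mapD(1)[OF \<phi>]] linear_map_add[OF bilinear_mapD(2)[OF \<phi>]]
      linear_map_smult[OF bilinear_mapD(1)[OF \<phi>]] linear_map_smult[OF bilinear_mapD(2)[OF \<phi>]]
    unfolding rels_def
    by (elim UnE; clarsimp simp del: free_sel)
      (simp_all del: free_sel add: linear_map_uminus[OF F.module_axioms M E] linear_map_add[OF E]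
        linear_map_smult[OF E] dc Ed a_minus_def M.M.r_neg)
  then have ker: "?E r = \<zero>\<^bsub>M\<^esub>" if "r \<in> tensor_rels K A B" for r
    using that linear_map_hull[OF F.module_axioms M E submod_kernel[OF M M linear_map_id]
        rels_subset, where t = r]
    unfolding tensor_rels_eq by simp
  show "linear_map K T M (tensor_lift K M \<phi>)"
    using linear_map_quot(2)[OF F.module_axioms submod_rels M E ker]
    unfolding tensor_lift_def tensor_module_def by simp
  show "tensor_lift K M \<phi> (pt a b) = \<phi> a b" if "a \<in> carrier A" "b \<in> carrier B"
    using linear_map_quot(1)[OF F.module_axioms submod_rels M E ker dc[OF that]] Ed[OF that]
    unfolding tensor_lift_def pt_alt by simp
qed

lemma linear_map_eqI:
  assumes M: "module K M" and "linear_map K T M f" "linear_map K T M g"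
    and eq: "\<And>a b. \<lbrakk>a \<in> carrier A; b \<in> carrier B\<rbrakk> \<Longrightarrow> f (pt a b) = g (pt a b)"
    and t: "t \<in> carrier T"
  shows "f t = g t"
  using t
proof (induct rule: tensor_induct)
  case zero
  then show ?case using assms linear_map_zero[OF T.module_axioms M] by metis
next
  case (add a b t)
  then show ?case
    using pt_closed linear_map_add[OF assms(2)] linear_map_add[OF assms(3)] eq by simp
qed

lemma lift_comp:
  assumes "module K M" "module K N" "linear_map K M N g" "bilinear_map K A B M \<phi>" "t \<in> carrier T"
  shows "g (tensor_lift K M \<phi> t) = tensor_lift K N (\<lambda>a b. g (\<phi> a b)) t"
  using lift_pt[OF assms(1,4)] lift_pt[OF assms(2) bilinear_map_comp[OF assms(3,4)]]
  by (intro linear_map_eqI[where f = "\<lambda>t. g (tensor_lift K M \<phi> t)" and t = t, OF assms(2)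
        linear_map_comp[OF lift_linear[OF assms(1,4)] assms(3)]
        lift_linear[OF assms(2) bilinear_map_comp[OF assms(3,4)]] _ assms(5)]) simp

lemma lift_cong:
  assumes "module K M" "bilinear_map K A B M \<phi>" "bilinear_map K A B M \<psi>"
    and "\<And>a b. \<lbrakk>a \<in> carrier A; b \<in> carrier B\<rbrakk> \<Longrightarrow> \<phi> a b = \<psi> a b"
    and "t \<in> carrier T"
  shows "tensor_lift K M \<phi> t = tensor_lift K M \<psi> t"
  using lift_pt[OF assms(1,2)] lift_pt[OF assms(1,3)]
  by (intro linear_map_eqI[OF assms(1) lift_linear[OF assms(1,2)] lift_linear[OF assms(1,3)] _
      assms(5)])
    (simp add: assms(4))

lemma lift_plus:
  assumes "module K M" "bilinear_map K A B M \<phi>" "bilinear_map K A B M \<psi>" "t \<in> carrier T"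
  shows "tensor_lift K M (\<lambda>a b. \<phi> a b \<oplus>\<^bsub>M\<^esub> \<psi> a b) t
    = tensor_lift K M \<phi> t \<oplus>\<^bsub>M\<^esub> tensor_lift K M \<psi> t"
  using lift_pt[OF assms(1,2)] lift_pt[OF assms(1,3)] lift_pt[OF assms(1) bilinear_map_plus[OF
      assms(1-3)]]
  by (intro linear_map_eqI[where t = t, OF assms(1) lift_linear[OF assms(1) bilinear_map_plus[OF
      assms(1-3)]]
       linear_map_plus[OF assms(1) lift_linear[OF assms(1,2)] lift_linear[OF assms(1,3)]] _
           assms(4)]) simp

text \<open>For iterated lifts: an inner lift over a second tensor has to be linear in the variables
  of the outer one before the outer lift is meaningful.\<close>

lemma lift_param:
  assumes "module K M" "module K V" "\<And>c. c \<in> carrier V \<Longrightarrow> bilinear_map K A B M (\<phi> c)"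
    and "\<And>a b. \<lbrakk>a \<in> carrier A; b \<in> carrier B\<rbrakk> \<Longrightarrow> linear_map K V M (\<lambda>c. \<phi> c a b)"
    and t: "t \<in> carrier T"
  shows "linear_map K V M (\<lambda>c. tensor_lift K M (\<phi> c) t)"
  using t
proof (induct rule: tensor_induct)
  case zero
  show ?case
    using assms(1,3) linear_map_zero[OF T.module_axioms assms(1) lift_linear[OF assms(1,3)]]
    by (intro linear_map_cong[OF assms(2) linear_map_const_zero[OF assms(1)]]) auto
next
  case (add a b t)
  show ?case
    by (rule linear_map_cong[OF assms(2) linear_map_plus[OF assms(1) assms(4)[OF add(1,2)] add(4)]])
      (use add assms(1,3) in \<open>simp add: linear_map_add[OF lift_linear] pt_closed lift_pt\<close>)
qed

end

lemma (in abelian_group) diff_eq_zero_iff: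
  assumes "x \<in> carrier G" "y \<in> carrier G"
  shows "x \<ominus> y = \<zero> \<longleftrightarrow> x = y"
proof
  assume "x \<ominus> y = \<zero>"
  then have "(x \<ominus> y) \<oplus> y = y" using assms by simp
  then show "x = y" using assms by (simp add: a_minus_def a_assoc l_neg)
qed (use assms in \<open>simp add: a_minus_def r_neg\<close>)

lemma (in abelian_group) add_diff_cancel:
  "\<lbrakk>x \<in> carrier G; y \<in> carrier G\<rbrakk> \<Longrightarrow> y \<oplus> (x \<ominus> y) = x"
  using r_neg2[of y x] by (simp add: a_minus_def a_comm)

lemma (in abelian_group) diff_add_cancel:
  "\<lbrakk>x \<in> carrier G; y \<in> carrier G\<rbrakk> \<Longrightarrow> (x \<ominus> y) \<oplus> y = x"
  by (simp add: a_minus_def a_assoc l_neg)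

lemma abelian_group_cong:
  assumes "abelian_group G" "carrier G' = carrier G" "add G' = add G" "zero G' = zero G"
  shows "abelian_group G'"
proof -
  interpret abelian_group G by fact
  show ?thesis
    by (rule abelian_groupI) (auto simp: assms a_assoc intro: a_comm l_neg bexI[of _ "\<ominus>\<^bsub>G\<^esub> _"])
qed

lemma module_cong:
  assumes "module K M" "carrier M' = carrier M" "add M' = add M" "zero M' = zero M"
    "smult M' = smult M"
  shows "module K M'"
proof -
  interpret module K M by fact
  show ?thesis
    using abelian_group_cong[OF M.abelian_group_axioms assms(2-4)]
    by (intro moduleI)
      (simp_all add: assms smult_l_distr smult_r_distr smult_assoc1 R.is_cring)
qed

section \<open>Superspaces and superalgebras\<close>

declare add_bit_eq_xor [simp del] mult_bit_eq_and [simp del]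

lemma bit_cases: "i = 0 \<or> i = (1::bit)"
  by (cases i) auto

lemma all_bit: "(\<forall>i::bit. P i) \<longleftrightarrow> P 0 \<and> P 1"
  using bit_cases by metis

lemma bit_double [simp]: "i + i = (0::bit)" "i + (i + j) = (j::bit)"
  by (cases i; cases j; simp)+

lemma (in abelian_monoid) finsum_bit:
  "\<lbrakk>f 0 \<in> carrier G; f 1 \<in> carrier G\<rbrakk> \<Longrightarrow> (\<Oplus>\<^bsub>G\<^esub>i \<in> {0, 1::bit}. f i) = f 0 \<oplus>\<^bsub>G\<^esub> f 1"
  by (simp add: finsum_insert)

lemma koszul_0 [simp]: "koszul M 0 x = x"
  by (simp add: koszul_def)

lemma linear_map_koszul:
  "\<lbrakk>module K W; linear_map K V W f\<rbrakk> \<Longrightarrow> linear_map K V W (\<lambda>x. koszul W n (f x))"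
  by (cases n) (simp_all add: koszul_def linear_map_neg)

lemma koszul_linear:
  "\<lbrakk>module K V; module K W; linear_map K V W f; x \<in> carrier V\<rbrakk> \<Longrightarrow> f (koszul V n x)
      = koszul W n (f x)"
  by (simp add: koszul_def linear_map_uminus)

lemma koszul_mem: "\<lbrakk>submod K M N; x \<in> N\<rbrakk> \<Longrightarrow> koszul M n x \<in> N"
  by (simp add: koszul_def submod_uminus)

lemma base_sel [simp]:
  "carrier (base K) = carrier K" "add (base K) = add K" "zero (base K) = zero K"
  "mult (base K) = mult K" "one (base K) = one K" "smult (base K) = mult K"
  by (simp_all add: base_def)

lemma (in cring) a_inv_base [simp]: "x \<in> carrier R \<Longrightarrow> \<ominus>\<^bsub>base R\<^esub> x = \<ominus> x"
  by (simp add: a_inv_def m_inv_def)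

lemma (in cring) module_base: "module R (base R)"
proof (rule moduleI)
  show "abelian_group (base R)"
    by (rule abelian_groupI) (auto simp: a_ac intro: l_neg bexI[of _ "\<ominus> _"])
qed (auto simp: l_distr r_distr m_assoc intro: is_cring)

text \<open>The structure of \<open>superspace\<close> with qualified parents, which keep the facts
  about the field and about the space apart.\<close>

locale sspace = K: field K + V: abelian_group V + M: module K V
  for K :: "('k, 'l) ring_scheme" and V :: "('k, 'a, 'm) super_scheme" (structure) +
  assumes superspace: "superspace K V"
begin

lemma gr_submod: "submod K V (gr V i)"
  using superspace by (simp add: superspace_def superspace_axioms_def)

lemma gr_closed: "x \<in> gr V i \<Longrightarrow> x \<in> carrier V"
  by (rule submod_carrier[OF gr_submod])

lemma gr_zero [simp]: "\<zero> \<in> gr V i"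
  by (rule submod_zero[OF gr_submod])

lemma gr_int: "\<lbrakk>x \<in> gr V i; x \<in> gr V (i + 1)\<rbrakk> \<Longrightarrow> x = \<zero>"
  using superspace bit_cases[of i] by (auto simp: superspace_def superspace_axioms_def)

lemma gr_sum: "x \<in> carrier V \<Longrightarrow> \<exists>y \<in> gr V i. \<exists>z \<in> gr V (i + 1). x = y \<oplus> z"
proof -
  assume "x \<in> carrier V"
  then obtain y z where yz: "y \<in> gr V 0" "z \<in> gr V 1" "x = y \<oplus> z"
    using superspace by (auto simp: superspace_def superspace_axioms_def)
  then have "x = z \<oplus> y" using gr_closed V.a_comm by metis
  show ?thesis
  proof (cases "i = 0")
    case True
    then show ?thesis using yz by (intro bexI[of _ y] bexI[of _ z]) simp_all
  next
    case False
    then show ?thesis using yz \<open>x = z \<oplus> y\<close> by (intro bexI[of _ z] bexI[of _ y]) simp_all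
  qed
qed

text \<open>Two decompositions differ by y' - y = z - z', an element of both graded pieces, and
  these meet in zero.\<close>

lemma hpart_eqI:
  assumes "y \<in> gr V i" "z \<in> gr V (i + 1)"
  shows "hpart V i (y \<oplus> z) = y"
  unfolding hpart_def
proof (rule the_equality)
  show "y \<in> gr V i \<and> (\<exists>z'\<in>gr V (i + 1). y \<oplus> z = y \<oplus> z')" using assms by blast
next
  fix y' assume "y' \<in> gr V i \<and> (\<exists>z'\<in>gr V (i + 1). y \<oplus> z = y' \<oplus> z')"
  then obtain z' where y': "y' \<in> gr V i" and z': "z' \<in> gr V (i + 1)"
    and eq: "y \<oplus> z = y' \<oplus> z'" by blast
  note c = gr_closed[OF assms(1)] gr_closed[OF assms(2)] gr_closed[OF y'] gr_closed[OF z']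
  have "y' \<ominus> y = ((y' \<oplus> z') \<ominus> z') \<ominus> y"
    using c by (simp add: a_minus_def V.a_assoc V.r_neg)
  also have "\<dots> = \<ominus> y \<oplus> (y \<oplus> (z \<ominus> z'))"
    unfolding eq[symmetric] using c by (simp add: a_minus_def V.a_ac)
  also have "\<dots> = z \<ominus> z'"
    using c by (simp add: V.r_neg1)
  finally have "y' \<ominus> y = z \<ominus> z'" .
  then have "y' \<ominus> y = \<zero>"
    using submod_minus[OF gr_submod y' assms(1)] submod_minus[OF gr_submod assms(2) z']
    by (intro gr_int[of _ i]) simp_all
  then show "y' = y" using c by (simp add: V.diff_eq_zero_iff)
qed

lemma
  assumes "x \<in> carrier V"
  shows hpart_gr: "hpart V i x \<in> gr V i"
    and hpart_decomp: "x = hpart V i x \<oplus> hpart V (i + 1) x"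
proof -
  obtain y z where yz: "y \<in> gr V i" "z \<in> gr V (i + 1)" "x = y \<oplus> z"
    using gr_sum[OF assms] by blast
  then have x': "x = z \<oplus> y" using gr_closed V.a_comm by metis
  have h: "hpart V i x = y" "hpart V (i + 1) x = z"
    using hpart_eqI[OF yz(1,2)] hpart_eqI[of z "i + 1" y] yz x' by (cases i; simp)+
  then show "hpart V i x \<in> gr V i" "x = hpart V i x \<oplus> hpart V (i + 1) x"
    using yz by simp_all
qed

lemma hpart_closed: "x \<in> carrier V \<Longrightarrow> hpart V i x \<in> carrier V"
  using hpart_gr gr_closed by blast

lemma hpart_same: "x \<in> gr V i \<Longrightarrow> hpart V i x = x"
  using hpart_eqI[of x i "\<zero>"] gr_closed by simp

lemma hpart_other: "x \<in> gr V (i + 1) \<Longrightarrow> hpart V i x = \<zero>"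
  using hpart_eqI[of "\<zero>" i x] gr_closed by simp

lemma hpart_linear: "linear_map K V V (hpart V i)"
proof (rule linear_mapI)
  fix x y assume x: "x \<in> carrier V" and y: "y \<in> carrier V"
  let ?h = "hpart V i" and ?k = "hpart V (i + 1)"
  note c = hpart_closed[OF x, of i] hpart_closed[OF y, of i] hpart_closed[OF x, of "i+1"]
      hpart_closed[OF y, of "i+1"]
  have "x \<oplus> y = (?h x \<oplus> ?k x) \<oplus> (?h y \<oplus> ?k y)"
    using hpart_decomp[OF x] hpart_decomp[OF y] by simp
  also have "\<dots> = (?h x \<oplus> ?h y) \<oplus> (?k x \<oplus> ?k y)"
    using c by (simp add: V.a_ac)
  finally show "?h (x \<oplus> y) = ?h x \<oplus> ?h y"
    using x y by (simp add: hpart_eqI hpart_gr submod_add[OF gr_submod])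
next
  fix d x assume d: "d \<in> carrier K" and x: "x \<in> carrier V"
  let ?h = "hpart V i" and ?k = "hpart V (i + 1)"
  have "d \<odot> x = d \<odot> (?h x \<oplus> ?k x)" using hpart_decomp[OF x] by simp
  also have "\<dots> = d \<odot> ?h x \<oplus> d \<odot> ?k x"
    using d x by (simp add: M.smult_r_distr hpart_closed)
  finally show "?h (d \<odot> x) = d \<odot> ?h x"
    using d x by (simp add: hpart_eqI hpart_gr submod_smult[OF gr_submod])
qed (rule hpart_closed)

lemma homogeneousI:
  assumes "N \<subseteq> carrier V" "\<And>x i. x \<in> N \<Longrightarrow> hpart V i x \<in> N"
  shows "homogeneous_subset V N"
  unfolding homogeneous_subset_def
proof
  fix x assume "x \<in> N"
  then show "\<exists>y\<in>N \<inter> gr V 0. \<exists>z\<in>N \<inter> gr V 1. x = y \<oplus> z"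
    using assms hpart_gr[of x 0] hpart_gr[of x 1] hpart_decomp[of x 0]
    by (intro bexI[of _ "hpart V 0 x"] bexI[of _ "hpart V 1 x"]) auto
qed

lemma homogeneousD:
  assumes N: "submod K V N" "homogeneous_subset V N" and x: "x \<in> N"
  shows "hpart V i x \<in> N"
proof -
  obtain y z where yz: "y \<in> N" "y \<in> gr V 0" "z \<in> N" "z \<in> gr V 1" "x = y \<oplus> z"
    using N x unfolding homogeneous_subset_def by blast
  then have x': "x = z \<oplus> y" using gr_closed V.a_comm by metis
  show ?thesis
    using hpart_eqI[of y 0 z] hpart_eqI[of z 1 y] yz x' bit_cases[of i] by auto
qed

end

lemma sspaceI: "superspace K V \<Longrightarrow> sspace K V"
  by (simp add: sspace_def sspace_axioms_def superspace_def module_def)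

text \<open>A \<open>K\<close>-algebra need not be commutative here, unlike in \<^locale>\<open>algebra\<close>.\<close>

locale kalg = K: field K + A: ring A + M: module K A
  for K :: "('k, 'l) ring_scheme" and A :: "('k, 'a, 'm) module_scheme" (structure) +
  assumes smult_mult_left: "\<lbrakk>c \<in> carrier K; x \<in> carrier A; y \<in> carrier A\<rbrakk> \<Longrightarrow>
        (c \<odot> x) \<otimes> y = c \<odot> (x \<otimes> y)"
    and smult_mult_right: "\<lbrakk>c \<in> carrier K; x \<in> carrier A; y \<in> carrier A\<rbrakk> \<Longrightarrow>
        x \<otimes> (c \<odot> y) = c \<odot> (x \<otimes> y)"
begin

lemma mult_bilinear: "bilinear_map K A A A (mult A)"
  by (intro bilinear_mapI linear_mapI)
    (simp_all add: A.r_distr A.l_distr smult_mult_left smult_mult_right)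

lemma mult_linear_left: "\<lbrakk>linear_map K V A f; y \<in> carrier A\<rbrakk> \<Longrightarrow> linear_map K V A (\<lambda>x. f x \<otimes> y)"
  using linear_map_comp[OF _ bilinear_mapD(2)[OF mult_bilinear]] by blast

lemma mult_linear_right: "\<lbrakk>linear_map K V A f; y \<in> carrier A\<rbrakk> \<Longrightarrow> linear_map K V A (\<lambda>x. y \<otimes> f x)"
  using linear_map_comp[OF _ bilinear_mapD(1)[OF mult_bilinear]] by blast

lemma mult_bilinear_comp:
  assumes "linear_map K V A f" "linear_map K W A g"
  shows "bilinear_map K V W A (\<lambda>a b. f a \<otimes> g b)"
  using assms by (intro bilinear_mapI mult_linear_left mult_linear_right) (auto intro:
      linear_map_closed)

lemma smult_linear: "\<lbrakk>linear_map K V (base K) d; x \<in> carrier A\<rbrakk> \<Longrightarrow> linear_map K V A (\<lambda>b. d b \<odot> x)"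
  by (rule linear_mapI)
    (auto simp: linear_map_def Pi_iff M.smult_l_distr M.smult_assoc1)

lemma smult_bilinear:
  assumes "linear_map K V (base K) d" "linear_map K W A f"
  shows "bilinear_map K W V A (\<lambda>a b. d b \<odot> f a)"
  using assms linear_map_closed[OF assms(1)]
  by (intro bilinear_mapI smult_linear linear_map_scale M.module_axioms) (auto intro:
      linear_map_closed)

text \<open>A scalar acts as multiplication by \<open>c \<odot> \<one>\<close>.\<close>

lemma ideal_submod: "ideal I A \<Longrightarrow> submod K A I"
proof -
  assume "ideal I A"
  then interpret I: ideal I A .
  show ?thesis
  proof (rule submodI[OF M.module_axioms])
    fix c x assume "c \<in> carrier K" "x \<in> I"
    then show "c \<odot> x \<in> I"
      using I.I_l_closed[of x "c \<odot> \<one>"] I.a_subset by (simp add: smult_mult_left subset_iff)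
  qed (use I.a_subset in auto)
qed

lemma idealI':
  assumes "submod K A I" "\<And>a x. \<lbrakk>a \<in> I; x \<in> carrier A\<rbrakk> \<Longrightarrow> x \<otimes> a \<in> I"
    and "\<And>a x. \<lbrakk>a \<in> I; x \<in> carrier A\<rbrakk> \<Longrightarrow> a \<otimes> x \<in> I"
  shows "ideal I A"
  using assms by (intro idealI A.ring_axioms) (auto simp: submod_def)

end

lemma superalgebra_kalg: "superalgebra K A \<Longrightarrow> kalg K A"
  by (simp add: kalg_def kalg_axioms_def superspace_def superalgebra_def superalgebra_axioms_def)

locale super_pair = tensor_pair K A B
  for K :: "('k, 'l) ring_scheme" and A :: "('k, 'a, 'm) super_scheme"
    and B :: "('k, 'b, 'n) super_scheme"
begin

abbreviation "TT \<equiv> tensor K A B"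

lemma TT_sel [simp]:
  "carrier TT = carrier T" "add TT = add T" "zero TT = zero T" "smult TT = smult T"
  "one TT = pt \<one>\<^bsub>A\<^esub> \<one>\<^bsub>B\<^esub>"
  "mult TT = (\<lambda>t u. tensor_lift K T (\<lambda>a b. tensor_lift K T (\<lambda>c d.
              \<Oplus>\<^bsub>T\<^esub> i \<in> {0, 1}. \<Oplus>\<^bsub>T\<^esub> j \<in> {0, 1}. koszul T (i * j)
                (pure_tensor K A B (a \<otimes>\<^bsub>A\<^esub> hpart A j c) (hpart B i b \<otimes>\<^bsub>B\<^esub> d))) u) t)"
  "gr TT = (\<lambda>k. submod K T hull
        {pure_tensor K A B a b | a b i j. a \<in> gr A i \<and> b \<in> gr B j \<and> i + j = k})"
  by (simp_all add: tensor_def Let_def module.defs super.defs)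

lemma module_TT: "module K TT"
  by (rule module_cong[OF T.module_axioms]) simp_all

end

section \<open>Hopf superalgebras\<close>

locale hopf = kalg K A + S: sspace K A + TP: super_pair K A A
  for K :: "('k, 'l) ring_scheme" and A :: "('k, 'a, 'm) hopf_scheme" (structure) +
  assumes hopf: "hopf_superalgebra K A"

lemma hopfI: "hopf_superalgebra K A \<Longrightarrow> hopf K A"
  using sspaceI[of K A] superalgebra_kalg[of K A]
  by (simp add: hopf_def hopf_axioms_def hopf_superalgebra_def superalgebra_def
      super_pair_def tensor_pair_def kalg_def)

context hopf begin

abbreviation lf where "lf \<equiv> linear_map K A (base K)"
abbreviation TT where "TT \<equiv> tensor K A A"
abbreviation T where "T \<equiv> tensor_module K A A"
abbreviation \<Delta> where "\<Delta> \<equiv> comult A"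
abbreviation \<epsilon> where "\<epsilon> \<equiv> counit A"

sublocale L: module K "base K"
  by (rule K.module_base)

lemma lf_closed: "\<lbrakk>lf d; x \<in> carrier A\<rbrakk> \<Longrightarrow> d x \<in> carrier K"
  and lf_add: "\<lbrakk>lf d; x \<in> carrier A; y \<in> carrier A\<rbrakk> \<Longrightarrow> d (x \<oplus> y) = d x \<oplus>\<^bsub>K\<^esub> d y"
  and lf_smult: "\<lbrakk>lf d; c \<in> carrier K; x \<in> carrier A\<rbrakk> \<Longrightarrow> d (c \<odot> x) = c \<otimes>\<^bsub>K\<^esub> d x"
  by (auto simp: linear_map_def)

lemma lf_zero: "lf d \<Longrightarrow> d \<zero> = \<zero>\<^bsub>K\<^esub>"
  using linear_map_zero[OF M.module_axioms L.module_axioms] by simp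

lemma lf_minus: "\<lbrakk>lf d; x \<in> carrier A; y \<in> carrier A\<rbrakk> \<Longrightarrow> d (x \<ominus> y) = d x \<ominus>\<^bsub>K\<^esub> d y"
  using linear_map_minus[OF M.module_axioms L.module_axioms, of d x y] lf_closed[of d y]
  by (simp add: a_minus_def)

lemma comult_linear: "linear_map K A T \<Delta>"
  using hopf by (simp add: hopf_superalgebra_def hopf_superalgebra_axioms_def superalgebra_hom_def
      linear_map_def)

lemma comult_closed: "x \<in> carrier A \<Longrightarrow> \<Delta> x \<in> carrier T"
  by (rule linear_map_closed[OF comult_linear])

lemma comult_ring_hom: "\<Delta> \<in> ring_hom A TT" and comult_even: "even_map A TT \<Delta>"
  using hopf by (simp_all add: hopf_superalgebra_def hopf_superalgebra_axioms_def
      superalgebra_hom_def)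

lemma comult_mult: "\<lbrakk>x \<in> carrier A; y \<in> carrier A\<rbrakk> \<Longrightarrow> \<Delta> (x \<otimes> y) = \<Delta> x \<otimes>\<^bsub>TT\<^esub> \<Delta> y"
  by (rule ring_hom_mult[OF comult_ring_hom])

lemma comult_gr: "x \<in> gr A i \<Longrightarrow> \<Delta> x \<in> submod K T hull
    {pure_tensor K A A a b | a b j k. a \<in> gr A j \<and> b \<in> gr A k \<and> j + k = i}"
  using comult_even unfolding even_map_def TP.TT_sel by blast

lemma counit_linear: "lf \<epsilon>"
  using hopf by (simp add: hopf_superalgebra_def hopf_superalgebra_axioms_def superalgebra_hom_def)

lemma counit_mult: "\<lbrakk>x \<in> carrier A; y \<in> carrier A\<rbrakk> \<Longrightarrow> \<epsilon> (x \<otimes> y) = \<epsilon> x \<otimes>\<^bsub>K\<^esub> \<epsilon> y"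
  using hopf unfolding hopf_superalgebra_def hopf_superalgebra_axioms_def superalgebra_hom_def
  by (auto simp: ring_hom_def)

lemma counit_one: "\<epsilon> \<one> = \<one>\<^bsub>K\<^esub>"
  using hopf unfolding hopf_superalgebra_def hopf_superalgebra_axioms_def superalgebra_hom_def
  by (auto simp: ring_hom_def)

lemma counit_odd: "x \<in> gr A 1 \<Longrightarrow> \<epsilon> x = \<zero>\<^bsub>K\<^esub>"
  using hopf unfolding hopf_superalgebra_def hopf_superalgebra_axioms_def superalgebra_hom_def
      even_map_def
  by (auto simp: all_bit base_def)

lemma one_gr: "\<one> \<in> gr A 0"
  and gr_mult: "\<lbrakk>x \<in> gr A i; y \<in> gr A j\<rbrakk> \<Longrightarrow> x \<otimes> y \<in> gr A (i + j)"
  using hopf by (auto simp: hopf_superalgebra_def superalgebra_def superalgebra_axioms_def)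

lemma antipode_linear: "linear_map K A A (antipode A)"
  and antipode_gr: "x \<in> gr A i \<Longrightarrow> antipode A x \<in> gr A i"
  using hopf by (auto simp: hopf_superalgebra_def hopf_superalgebra_axioms_def even_map_def)

lemma antipode_left: "x \<in> carrier A \<Longrightarrow>
    tensor_lift K A (\<lambda>a b. antipode A a \<otimes> b) (\<Delta> x) = \<epsilon> x \<odot> \<one>"
  and antipode_right: "x \<in> carrier A \<Longrightarrow>
    tensor_lift K A (\<lambda>a b. a \<otimes> antipode A b) (\<Delta> x) = \<epsilon> x \<odot> \<one>"
  and counit_left: "x \<in> carrier A \<Longrightarrow> tensor_lift K A (\<lambda>a b. \<epsilon> a \<odot> b) (\<Delta> x) = x"
  and counit_right: "x \<in> carrier A \<Longrightarrow> tensor_lift K A (\<lambda>a b. \<epsilon> b \<odot> a) (\<Delta> x) = x"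
  and coassoc: "x \<in> carrier A \<Longrightarrow>
      tensor_assoc K A A A (tensor_map K TT A \<Delta> id (\<Delta> x)) =
      tensor_map K A TT id \<Delta> (\<Delta> x)"
  using hopf by (simp_all add: hopf_superalgebra_def hopf_superalgebra_axioms_def)

lemma linear_TT_iff: "linear_map K V TT f = linear_map K V T f"
    "linear_map K TT V g = linear_map K T V g"
  by (simp_all add: linear_map_def)

sublocale TP2: super_pair K A TT
  using TP.module_TT M.module_axioms K.field_axioms by (simp add: super_pair_def tensor_pair_def)

sublocale TP3: super_pair K TT A
  using TP.module_TT M.module_axioms K.field_axioms by (simp add: super_pair_def tensor_pair_def)

text \<open>Both sides are \<open>\<Sum> \<Phi>(x\<^sub>1, x\<^sub>2 \<otimes> x\<^sub>3)\<close>.\<close>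

lemma coassoc_lift:
  assumes M: "module K M" and \<Phi>: "bilinear_map K A T M \<Phi>" and x: "x \<in> carrier A"
  shows "tensor_lift K M (\<lambda>x1 c. tensor_lift K M (\<lambda>a b. \<Phi> a (pure_tensor K A A b c)) (\<Delta> x1)) (\<Delta> x)
    = tensor_lift K M (\<lambda>a x2. \<Phi> a (\<Delta> x2)) (\<Delta> x)"
proof -
  let ?M2 = "tensor K A TT" and ?M3 = "tensor K TT A"
  have \<Phi>': "bilinear_map K A TT M \<Phi>"
    using \<Phi> by (simp add: bilinear_map_def linear_map_def)
  \<comment> \<open>\<open>\<Psi>\<close> is \<Phi> as a linear map on A \<otimes> (A \<otimes> A);
    each side of the claim becomes \<open>\<Psi>\<close> of an element of that space.\<close>
  define \<Psi> where "\<Psi> = tensor_lift K M \<Phi>"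
  have \<Psi>: "linear_map K ?M2 M \<Psi>"
    unfolding \<Psi>_def using TP2.lift_linear[OF M \<Phi>'] by (simp add: linear_map_def)
  have \<Psi>pt: "\<Psi> (pure_tensor K A TT a t) = \<Phi> a t" if "a \<in> carrier A" "t \<in> carrier T" for a t
    unfolding \<Psi>_def using TP2.lift_pt[OF M \<Phi>'] that by simp
  have pt2: "bilinear_map K A TT ?M2 (pure_tensor K A TT)"
    using TP2.pt_bilinear by (simp add: bilinear_map_def linear_map_def)
  have pt3: "bilinear_map K TT A ?M3 (pure_tensor K TT A)"
    using TP3.pt_bilinear by (simp add: bilinear_map_def linear_map_def)
  have pt: "bilinear_map K A A TT (pure_tensor K A A)"
    using TP.pt_bilinear by (simp add: bilinear_map_def linear_map_def)
  have \<Delta>: "linear_map K A TT \<Delta>" using comult_linear by (simp add: linear_map_def)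
  have M2: "module K ?M2" by (rule TP2.module_TT)
  have M3: "module K ?M3" by (rule TP3.module_TT)
  have bil_c: "bilinear_map K A A ?M2 (\<lambda>a b. pure_tensor K A TT a (pure_tensor K A A b c))"
    if "c \<in> carrier A" for c
    using bilinear_map_comp_right[OF bilinear_mapD(2)[OF pt that] pt2] .
  \<comment> \<open>\<open>\<alpha> t c\<close> is the reassociated tensor t \<otimes> c, and its
    linear extension \<open>asc\<close> is the map \<open>tensor_assoc\<close> of the
    coassociativity axiom.\<close>
  define \<alpha> where "\<alpha> = (\<lambda>t c. tensor_lift K ?M2
      (\<lambda>a b. pure_tensor K A TT a (pure_tensor K A A b c)) t)"
  have \<alpha>: "bilinear_map K TT A ?M2 \<alpha>"
  proof (rule bilinear_mapI)
    fix t assume "t \<in> carrier TT"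
    then show "linear_map K A ?M2 (\<alpha> t)"
      unfolding \<alpha>_def
      by (intro TP.lift_param[OF M2 M.module_axioms bil_c])
        (auto intro: linear_map_comp[OF bilinear_mapD(1)[OF pt] bilinear_mapD(1)[OF pt2]])
  next
    fix c assume "c \<in> carrier A"
    then show "linear_map K TT ?M2 (\<lambda>t. \<alpha> t c)"
      unfolding \<alpha>_def linear_TT_iff by (intro TP.lift_linear[OF M2 bil_c])
  qed
  define asc where "asc = tensor_lift K ?M2 \<alpha>"
  have asc: "linear_map K ?M3 ?M2 asc"
    unfolding asc_def using TP3.lift_linear[OF M2 \<alpha>] by (simp add: linear_map_def)
  note dx = comult_closed[OF x]
  have L3: "bilinear_map K A A ?M3 (\<lambda>a b. pure_tensor K TT A (\<Delta> a) b)"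
    by (rule bilinear_map_comp_left[OF \<Delta> pt3])
  have R2: "bilinear_map K A A ?M2 (\<lambda>a b. pure_tensor K A TT a (\<Delta> b))"
    by (rule bilinear_map_comp_right[OF \<Delta> pt2])
  have lin: "linear_map K ?M3 M (\<lambda>u. \<Psi> (asc u))" by (rule linear_map_comp[OF asc \<Psi>])
  \<comment> \<open>The nested lift is rewritten as the single linear map \<Psi> after
    \<open>asc\<close>, applied to (\<Delta> \<otimes> id) \<Delta> x, where coassociativity can
    act.\<close>
  have "tensor_lift K M (\<lambda>x1 c. tensor_lift K M (\<lambda>a b. \<Phi> a (pure_tensor K A A b c)) (\<Delta> x1)) (\<Delta> x)
     = tensor_lift K M (\<lambda>a b. \<Psi> (asc (pure_tensor K TT A (\<Delta> a) b))) (\<Delta> x)"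
  proof (rule TP.lift_cong[OF M _ bilinear_map_comp[OF lin L3] _ dx])
    have eq: "tensor_lift K M (\<lambda>a b. \<Phi> a (pure_tensor K A A b c)) t = \<Psi> (\<alpha> t c)"
      if "t \<in> carrier T" "c \<in> carrier A" for t c
    proof -
      have "\<Psi> (\<alpha> t c) = tensor_lift K M (\<lambda>a b. \<Psi> (pure_tensor K A TT a (pure_tensor K A A b c))) t"
        unfolding \<alpha>_def by (rule TP.lift_comp[OF M2 M \<Psi> bil_c that(1)]) (rule that)
      also have "\<dots> = tensor_lift K M (\<lambda>a b. \<Phi> a (pure_tensor K A A b c)) t"
      proof (rule TP.lift_cong[OF M bilinear_map_comp[OF \<Psi> bil_c[OF that(2)]] _ _ that(1)])
        show "bilinear_map K A A M (\<lambda>a b. \<Phi> a (pure_tensor K A A b c))"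
          using bilinear_map_comp_right[OF bilinear_mapD(2)[OF pt that(2)] \<Phi>'] .
      qed (simp add: \<Psi>pt TP.pt_closed that)
      finally show ?thesis by simp
    qed
    have asc_pt: "asc (pure_tensor K TT A t c) = \<alpha> t c" if "t \<in> carrier T" "c \<in> carrier A" for t c
      unfolding asc_def using TP3.lift_pt[OF M2 \<alpha>] that by simp
    show "tensor_lift K M (\<lambda>a b. \<Phi> a (pure_tensor K A A b c)) (\<Delta> x1)
        = \<Psi> (asc (pure_tensor K TT A (\<Delta> x1) c))"
      if "x1 \<in> carrier A" "c \<in> carrier A" for x1 c
      using that by (simp add: eq asc_pt comult_closed)
    have b: "bilinear_map K A A M (\<lambda>x1 c. \<Psi> (\<alpha> (\<Delta> x1) c))"
      by (rule bilinear_map_comp[OF \<Psi> bilinear_map_comp_left[OF \<Delta> \<alpha>]])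
    show "bilinear_map K A A M (\<lambda>x1 c. tensor_lift K M (\<lambda>a b. \<Phi> a (pure_tensor K A A b c)) (\<Delta> x1))"
    proof (rule bilinear_mapI)
      show "linear_map K A M (\<lambda>c. tensor_lift K M (\<lambda>a b. \<Phi> a (pure_tensor K A A b c)) (\<Delta> a))"
        if "a \<in> carrier A" for a
        by (rule linear_map_cong[OF M.module_axioms bilinear_mapD(1)[OF b that]])
          (simp add: eq comult_closed that)
      show "linear_map K A M (\<lambda>a. tensor_lift K M (\<lambda>a b. \<Phi> a (pure_tensor K A A b c)) (\<Delta> a))"
        if "c \<in> carrier A" for c
        by (rule linear_map_cong[OF M.module_axioms bilinear_mapD(2)[OF b that]])
          (simp add: eq comult_closed that)
    qed
  qed
  also have "\<dots> = \<Psi> (asc (tensor_lift K ?M3 (\<lambda>a b. pure_tensor K TT A (\<Delta> a) b) (\<Delta> x)))"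
    by (rule TP.lift_comp[OF M3 M lin L3 dx, symmetric])
  also have "asc (tensor_lift K ?M3 (\<lambda>a b. pure_tensor K TT A (\<Delta> a) b) (\<Delta> x))
      = tensor_lift K ?M2 (\<lambda>a b. pure_tensor K A TT a (\<Delta> b)) (\<Delta> x)"
    using coassoc[OF x] by (simp add: tensor_assoc_def tensor_map_def asc_def \<alpha>_def Let_def)
  also have "\<Psi> \<dots> = tensor_lift K M (\<lambda>a b. \<Psi> (pure_tensor K A TT a (\<Delta> b))) (\<Delta> x)"
    by (rule TP.lift_comp[OF M2 M \<Psi> R2 dx])
  also have "\<dots> = tensor_lift K M (\<lambda>a x2. \<Phi> a (\<Delta> x2)) (\<Delta> x)"
    by (rule TP.lift_cong[OF M bilinear_map_comp[OF \<Psi> R2] bilinear_map_comp_right[OF \<Delta> \<Phi>'] _ dx])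
      (simp add: \<Psi>pt comult_closed)
  finally show ?thesis .
qed

end

context tensor_pair begin

text \<open>The supports of all representatives of \<open>t\<close> lie in the product of the
  carriers, so agreement there makes the defining sums equal term by term. In contrast to
  \<open>lift_cong\<close>, this handles integrands whose bilinearity becomes visible only after
  rewriting, such as nested lifts.\<close>

lemma lift_cong':
  assumes M: "module K M"
    and eq: "\<And>a b. \<lbrakk>a \<in> carrier A; b \<in> carrier B\<rbrakk> \<Longrightarrow> \<phi> a b = \<psi> a b"
    and c: "\<And>a b. \<lbrakk>a \<in> carrier A; b \<in> carrier B\<rbrakk> \<Longrightarrow> \<psi> a b \<in> carrier M"
    and t: "t \<in> carrier T"
  shows "tensor_lift K M \<phi> t = tensor_lift K M \<psi> t"
proof -
  interpret M: module K M by fact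
  obtain g where g: "g \<in> carrier F" and tg: "t = tensor_rels K A B +>\<^bsub>F\<^esub> g"
    using t unfolding tensor_module_def by (auto simp del: free_sel elim: quot_carrierE)
  have "f \<in> carrier F" if "f \<in> t" for f
    using that g submod_carrier[OF submod_rels] unfolding tg a_r_coset_def'
    by (auto simp del: free_sel)
  then have "f p \<in> carrier K \<and> case_prod \<phi> p = case_prod \<psi> p \<and> case_prod \<psi> p \<in> carrier M"
    if "f \<in> t" "f p \<noteq> \<zero>\<^bsub>K\<^esub>" for f p
  proof -
    obtain a b where p: "p = (a, b)" by (cases p)
    have "f \<in> carrier F" by (rule \<open>\<And>f. f \<in> t \<Longrightarrow> f \<in> carrier F\<close>[OF that(1)])
    then have "f p \<in> carrier K" "p \<in> carrier A \<times> carrier B"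
      using that(2) by (auto simp: Pi_iff)
    then show ?thesis using eq[of a b] c[of a b] p by simp
  qed
  then have "(\<Oplus>\<^bsub>M\<^esub> p \<in> {p. f p \<noteq> \<zero>\<^bsub>K\<^esub>}. f p \<odot>\<^bsub>M\<^esub> case_prod \<phi> p)
      = (\<Oplus>\<^bsub>M\<^esub> p \<in> {p. f p \<noteq> \<zero>\<^bsub>K\<^esub>}. f p \<odot>\<^bsub>M\<^esub> case_prod \<psi> p)" if "f \<in> t" for f
    using that by (intro M.M.finsum_cong') (auto simp del: split_paired_All)
  then show ?thesis unfolding tensor_lift_def by (metis (no_types, lifting) image_cong)
qed

lemma lift_bilinear_param:
  assumes "module K M" "\<And>a b. \<lbrakk>a \<in> carrier V; b \<in> carrier W\<rbrakk> \<Longrightarrow> bilinear_map K A B M (\<phi> a b)"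
    and "\<And>c d. \<lbrakk>c \<in> carrier A; d \<in> carrier B\<rbrakk> \<Longrightarrow> bilinear_map K V W M (\<lambda>a b. \<phi> a b c d)"
    and "t \<in> carrier T" "module K V" "module K W"
  shows "bilinear_map K V W M (\<lambda>a b. tensor_lift K M (\<phi> a b) t)"
  using bilinear_mapD[OF assms(3)]
  by (intro bilinear_mapI lift_param[OF assms(1) _ _ _ assms(4)] assms(2,5,6)) auto

end

section \<open>Invariant operators\<close>

context hopf begin

text \<open>The operator \<open>x \<mapsto> \<Sum> x\<^sub>1 d(x\<^sub>2)\<close>, without a Koszul sign.\<close>

definition Lop :: "('a \<Rightarrow> 'k) \<Rightarrow> 'a \<Rightarrow> 'a"
  where "Lop d x = tensor_lift K A (\<lambda>a b. d b \<odot> a) (\<Delta> x)"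

lemma Lop_bilinear: "lf d \<Longrightarrow> bilinear_map K A A A (\<lambda>a b. d b \<odot> a)"
  by (rule smult_bilinear[OF _ linear_map_id])

lemma Lop_linear: "lf d \<Longrightarrow> linear_map K A A (Lop d)"
  unfolding Lop_def
  by (rule linear_map_comp[OF comult_linear TP.lift_linear[OF M.module_axioms Lop_bilinear]])

lemma Lop_closed: "\<lbrakk>lf d; x \<in> carrier A\<rbrakk> \<Longrightarrow> Lop d x \<in> carrier A"
  by (rule linear_map_closed[OF Lop_linear])

lemma Lop_add: "\<lbrakk>lf d; x \<in> carrier A; y \<in> carrier A\<rbrakk> \<Longrightarrow> Lop d (x \<oplus> y) = Lop d x \<oplus> Lop d y"
  by (rule linear_map_add[OF Lop_linear])

lemma Lop_counit: "x \<in> carrier A \<Longrightarrow> Lop \<epsilon> x = x"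
  unfolding Lop_def by (rule counit_right)

lemma Lop_cong:
  assumes "lf d" "x \<in> carrier A" "\<And>y. y \<in> carrier A \<Longrightarrow> d y = d' y"
  shows "Lop d x = Lop d' x"
  unfolding Lop_def
  by (rule TP.lift_cong[OF M.module_axioms Lop_bilinear Lop_bilinear _ comult_closed])
    (use assms linear_map_cong[OF M.module_axioms assms(1,3)] in auto)

text \<open>The right side is the convolution of \<open>f\<close> and \<open>d\<close> without the
  Koszul sign: composing a functional with an operator is multiplying in the convolution
  algebra.\<close>

lemma Lop_functional:
  assumes "lf f" "lf d" "x \<in> carrier A"
  shows "f (Lop d x) = tensor_lift K (base K) (\<lambda>a b. f a \<otimes>\<^bsub>K\<^esub> d b) (\<Delta> x)"
proof -
  have b: "bilinear_map K A A (base K) (\<lambda>a b. f (d b \<odot> a))"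
    by (rule bilinear_map_comp[OF assms(1) Lop_bilinear[OF assms(2)]])
  have eq: "f (d b \<odot> a) = f a \<otimes>\<^bsub>K\<^esub> d b" if "a \<in> carrier A" "b \<in> carrier A" for a b
    using that assms by (simp add: lf_smult lf_closed K.m_comm)
  have b': "bilinear_map K A A (base K) (\<lambda>a b. f a \<otimes>\<^bsub>K\<^esub> d b)"
    using bilinear_mapD[OF b] eq
    by (intro bilinear_mapI; intro linear_mapI)
      (use assms in \<open>auto simp: lf_add lf_closed lf_smult K.r_distr K.l_distr K.m_ac\<close>)
  show ?thesis
    unfolding Lop_def
    by (subst TP.lift_comp[OF M.module_axioms L.module_axioms assms(1) Lop_bilinear[OF assms(2)]
        comult_closed[OF assms(3)]])
      (rule TP.lift_cong[OF L.module_axioms b b' eq comult_closed[OF assms(3)]])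
qed

text \<open>By the left counit law a functional is recovered from its operator, so stability under
  operators yields information on the values of functionals.\<close>

lemma counit_Lop:
  assumes "lf d" "x \<in> carrier A"
  shows "\<epsilon> (Lop d x) = d x"
proof -
  have b: "bilinear_map K A A A (\<lambda>a b. \<epsilon> a \<odot> b)"
    by (rule bilinear_map_swap[OF smult_bilinear[OF counit_linear linear_map_id]])
  have "d x = d (tensor_lift K A (\<lambda>a b. \<epsilon> a \<odot> b) (\<Delta> x))"
    using counit_left[OF assms(2)] by simp
  also have "\<dots> = tensor_lift K (base K) (\<lambda>a b. d (\<epsilon> a \<odot> b)) (\<Delta> x)"
    by (rule TP.lift_comp[OF M.module_axioms L.module_axioms assms(1) b comult_closed[OF assms(2)]])
  also have "\<dots> = tensor_lift K (base K) (\<lambda>a b. \<epsilon> (d b \<odot> a)) (\<Delta> x)"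
    by (rule TP.lift_cong[OF L.module_axioms bilinear_map_comp[OF assms(1) b]
          bilinear_map_comp[OF counit_linear Lop_bilinear[OF assms(1)]] _ comult_closed[OF
              assms(2)]])
      (use assms counit_linear in \<open>simp add: lf_smult lf_closed K.m_comm\<close>)
  also have "\<dots> = \<epsilon> (Lop d x)"
    unfolding Lop_def
    by (rule TP.lift_comp[symmetric, OF M.module_axioms L.module_axioms counit_linear
        Lop_bilinear[OF assms(1)]
          comult_closed[OF assms(2)]])
  finally show ?thesis by simp
qed

text \<open>Coassociativity with \<open>d\<close> applied to the third factor. In group terms, the
  operator commutes with the translations on the other side.\<close>

lemma comult_Lop:
  assumes d: "lf d" and x: "x \<in> carrier A"
  shows "\<Delta> (Lop d x) = tensor_lift K T (\<lambda>a b. pure_tensor K A A a (Lop d b)) (\<Delta> x)"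
proof -
  let ?e = "\<lambda>t. tensor_lift K A (\<lambda>a b. d b \<odot> a) t"
  let ?\<Phi> = "\<lambda>a t. pure_tensor K A A a (?e t)"
  have e: "linear_map K T A ?e" by (rule TP.lift_linear[OF M.module_axioms Lop_bilinear[OF d]])
  have \<Phi>: "bilinear_map K A T T ?\<Phi>" by (rule bilinear_map_comp_right[OF e TP.pt_bilinear])
  have dpt: "bilinear_map K A A T (\<lambda>a c. d c \<odot>\<^bsub>T\<^esub> \<Delta> a)"
    using d linear_map_closed[OF d] comult_linear
    by (intro bilinear_mapI linear_map_scale TP.T.module_axioms)
      (auto intro!: linear_mapI simp: comult_closed linear_map_add[OF d] linear_map_smult[OF d]
        TP.T.smult_l_distr TP.T.smult_assoc1)
  \<comment> \<open>Contracting the last factor by \<open>d\<close> leaves a scalar multiple of the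
    remaining tensor; this identifies the left side of \<open>coassoc_lift\<close> with \<Delta>
    (Lop d x).\<close>
  have inner: "tensor_lift K T (\<lambda>a b. ?\<Phi> a (pure_tensor K A A b c)) t = d c \<odot>\<^bsub>T\<^esub> t"
    if c: "c \<in> carrier A" and t: "t \<in> carrier T" for c t
  proof -
    have eq: "?\<Phi> a (pure_tensor K A A b c) = d c \<odot>\<^bsub>T\<^esub> pure_tensor K A A a b"
      if "a \<in> carrier A" "b \<in> carrier A" for a b
      using that c by (simp add: TP.lift_pt[OF M.module_axioms Lop_bilinear[OF d]] lf_closed[OF d]
          linear_map_smult[OF bilinear_mapD(1)[OF TP.pt_bilinear]])
    have b: "bilinear_map K A A T (\<lambda>a b. ?\<Phi> a (pure_tensor K A A b c))"
      by (rule bilinear_map_comp_right[OF bilinear_mapD(2)[OF TP.pt_bilinear c] \<Phi>])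
    have id: "linear_map K T T (\<lambda>t. d c \<odot>\<^bsub>T\<^esub> t)"
      by (rule linear_map_scale[OF TP.T.module_axioms linear_map_id lf_closed[OF d c]])
    show ?thesis
      by (rule TP.linear_map_eqI[OF TP.T.module_axioms TP.lift_linear[OF TP.T.module_axioms b] id
          _ t])
        (simp add: TP.lift_pt[OF TP.T.module_axioms b] eq)
  qed
  have "\<Delta> (Lop d x) = tensor_lift K T (\<lambda>a b. \<Delta> (d b \<odot> a)) (\<Delta> x)"
    unfolding Lop_def
    by (rule TP.lift_comp[OF M.module_axioms TP.T.module_axioms comult_linear Lop_bilinear[OF d]
        comult_closed[OF x]])
  also have "\<dots> = tensor_lift K T (\<lambda>x1 c. tensor_lift K T (\<lambda>a b. ?\<Phi> a (pure_tensor K A A b c)) (\<Delta>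
      x1)) (\<Delta> x)"
  proof (rule TP.lift_cong[OF TP.T.module_axioms bilinear_map_comp[OF comult_linear
      Lop_bilinear[OF d]] _ _ comult_closed[OF x]])
    show "\<Delta> (d b \<odot> a) = tensor_lift K T (\<lambda>a' b'. ?\<Phi> a' (pure_tensor K A A b' b)) (\<Delta> a)"
      if "a \<in> carrier A" "b \<in> carrier A" for a b
      using that by (simp add: inner comult_closed linear_map_smult[OF comult_linear] lf_closed[OF
          d])
    show "bilinear_map K A A T (\<lambda>x1 c. tensor_lift K T (\<lambda>a b. ?\<Phi> a (pure_tensor K A A b c)) (\<Delta> x1))"
    proof (rule bilinear_mapI)
      fix a assume a: "a \<in> carrier A"
      show "linear_map K A T (\<lambda>c. tensor_lift K T (\<lambda>a b. ?\<Phi> a (pure_tensor K A A b c)) (\<Delta> a))"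
        by (rule linear_map_cong[OF M.module_axioms bilinear_mapD(1)[OF dpt a]])
          (simp add: inner comult_closed a)
    next
      fix c assume c: "c \<in> carrier A"
      show "linear_map K A T (\<lambda>a. tensor_lift K T (\<lambda>a b. ?\<Phi> a (pure_tensor K A A b c)) (\<Delta> a))"
        by (rule linear_map_cong[OF M.module_axioms bilinear_mapD(2)[OF dpt c]])
          (simp add: inner comult_closed c)
    qed
  qed
  also have "\<dots> = tensor_lift K T (\<lambda>a x2. ?\<Phi> a (\<Delta> x2)) (\<Delta> x)"
    by (rule coassoc_lift[OF TP.T.module_axioms \<Phi> x])
  finally show ?thesis unfolding Lop_def .
qed

lemma lift_comult_Lop:
  assumes M: "module K M" and \<phi>: "bilinear_map K A A M \<phi>" and d: "lf d" and x: "x \<in> carrier A"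
  shows "tensor_lift K M \<phi> (\<Delta> (Lop d x)) = tensor_lift K M (\<lambda>a b. \<phi> a (Lop d b)) (\<Delta> x)"
proof -
  have b: "bilinear_map K A A T (\<lambda>a b. pure_tensor K A A a (Lop d b))"
    by (rule bilinear_map_comp_right[OF Lop_linear[OF d] TP.pt_bilinear])
  have "tensor_lift K M \<phi> (\<Delta> (Lop d x))
      = tensor_lift K M (\<lambda>a b. tensor_lift K M \<phi> (pure_tensor K A A a (Lop d b))) (\<Delta> x)"
    unfolding comult_Lop[OF d x]
    by (rule TP.lift_comp[OF TP.T.module_axioms M TP.lift_linear[OF M \<phi>] b comult_closed[OF x]])
  also have "\<dots> = tensor_lift K M (\<lambda>a b. \<phi> a (Lop d b)) (\<Delta> x)"
    by (rule TP.lift_cong[OF M bilinear_map_comp[OF TP.lift_linear[OF M \<phi>] b]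
          bilinear_map_comp_right[OF Lop_linear[OF d] \<phi>] _ comult_closed[OF x]])
      (simp add: TP.lift_pt[OF M \<phi>] Lop_closed[OF d])
  finally show ?thesis .
qed

text \<open>Operators compose as functionals convolve, so brackets of tangent vectors turn into
  brackets of operators.\<close>

lemma Lop_Lop:
  assumes "lf f" "lf d" "x \<in> carrier A"
  shows "Lop f (Lop d x) = Lop (\<lambda>y. f (Lop d y)) x"
  unfolding Lop_def[of f] Lop_def[of "\<lambda>y. f (Lop d y)"]
  by (rule lift_comult_Lop[OF M.module_axioms Lop_bilinear[OF assms(1)] assms(2,3)])

lemma lf_Lop: "\<lbrakk>lf f; lf d\<rbrakk> \<Longrightarrow> lf (\<lambda>x. f (Lop d x))"
  by (rule linear_map_comp[OF Lop_linear])

lemma Lop_plus: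
  assumes "lf f" "lf g" "x \<in> carrier A"
  shows "Lop (\<lambda>y. f y \<oplus>\<^bsub>K\<^esub> g y) x = Lop f x \<oplus> Lop g x"
proof -
  have fg: "lf (\<lambda>y. f y \<oplus>\<^bsub>K\<^esub> g y)"
    using linear_map_plus[OF L.module_axioms assms(1,2)] by simp
  show ?thesis
    unfolding Lop_def
      TP.lift_plus[OF M.module_axioms Lop_bilinear[OF assms(1)] Lop_bilinear[OF assms(2)]
          comult_closed[OF assms(3)], symmetric]
    by (rule TP.lift_cong[OF M.module_axioms Lop_bilinear[OF fg] _ _ comult_closed[OF assms(3)]])
      (use assms in \<open>auto simp: M.smult_l_distr lf_closed
         intro: bilinear_map_plus[OF M.module_axioms Lop_bilinear Lop_bilinear]\<close>)
qed

lemma Lop_scale: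
  assumes "lf f" "c \<in> carrier K" "x \<in> carrier A"
  shows "Lop (\<lambda>y. c \<otimes>\<^bsub>K\<^esub> f y) x = c \<odot> Lop f x"
proof -
  have fg: "lf (\<lambda>y. c \<otimes>\<^bsub>K\<^esub> f y)"
    using linear_map_scale[OF L.module_axioms assms(1,2)] by simp
  have sc: "linear_map K A A (\<lambda>y. c \<odot> y)"
    by (rule linear_map_scale[OF M.module_axioms linear_map_id assms(2)])
  show ?thesis
    unfolding Lop_def
      TP.lift_comp[OF M.module_axioms M.module_axioms sc Lop_bilinear[OF assms(1)]
          comult_closed[OF assms(3)]]
    by (rule TP.lift_cong[OF M.module_axioms Lop_bilinear[OF fg]
        bilinear_map_comp[OF sc Lop_bilinear[OF assms(1)]] _ comult_closed[OF assms(3)]])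
      (use assms in \<open>simp add: M.smult_assoc1 lf_closed\<close>)
qed

lemma Lop_null: "x \<in> carrier A \<Longrightarrow> Lop (\<lambda>y. \<zero>\<^bsub>K\<^esub>) x = \<zero>"
proof -
  assume x: "x \<in> carrier A"
  have z: "lf (\<lambda>y. \<zero>\<^bsub>K\<^esub>)" using linear_map_const_zero[OF L.module_axioms] by simp
  show ?thesis using Lop_scale[OF z K.zero_closed x] x Lop_closed[OF z x] by simp
qed

text \<open>The value of \<open>\<phi>\<close> on a product \<open>(a \<otimes> b)(c \<otimes> d)\<close>.\<close>

definition bprod :: "('k, 'c, 'o) module_scheme \<Rightarrow> ('a \<Rightarrow> 'a \<Rightarrow> 'c) \<Rightarrow> 'a \<Rightarrow> 'a \<Rightarrow> 'a \<Rightarrow> 'a \<Rightarrow> 'c"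
  where "bprod M \<phi> a b c d =
    (\<phi> (a \<otimes> hpart A 0 c) (hpart A 0 b \<otimes> d) \<oplus>\<^bsub>M\<^esub> \<phi> (a \<otimes> hpart A 1 c) (hpart A 0 b \<otimes> d)) \<oplus>\<^bsub>M\<^esub>
    (\<phi> (a \<otimes> hpart A 0 c) (hpart A 1 b \<otimes> d) \<oplus>\<^bsub>M\<^esub> (\<ominus>\<^bsub>M\<^esub> \<phi> (a \<otimes> hpart A 1 c) (hpart A 1 b \<otimes> d)))"

lemma bprod_bilinear:
  assumes M: "module K M" and \<phi>: "bilinear_map K A A M \<phi>"
  shows "\<lbrakk>a \<in> carrier A; b \<in> carrier A\<rbrakk> \<Longrightarrow> bilinear_map K A A M (bprod M \<phi> a b)"
    and "\<lbrakk>c \<in> carrier A; d \<in> carrier A\<rbrakk> \<Longrightarrow> bilinear_map K A A M (\<lambda>a b. bprod M \<phi> a b c d)"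
proof -
  have l: "linear_map K A A (\<lambda>x. hpart A i x \<otimes> y)" "linear_map K A A (\<lambda>x. y \<otimes> hpart A i x)"
     "linear_map K A A (\<lambda>x. x \<otimes> y)" "linear_map K A A (\<lambda>x. y \<otimes> x)"
    if "y \<in> carrier A" for y i
    using that by (auto intro: mult_linear_left mult_linear_right S.hpart_linear linear_map_id)
  have b: "bilinear_map K A A M (\<lambda>c d. \<phi> (f c) (g d))"
      if "linear_map K A A f" "linear_map K A A g" for f g
    by (rule bilinear_map_comp_left[OF that(1) bilinear_map_comp_right[OF that(2) \<phi>]])
  show "bilinear_map K A A M (bprod M \<phi> a b)" if "a \<in> carrier A" "b \<in> carrier A"
    unfolding bprod_def using that
    by (intro bilinear_map_plus bilinear_map_neg M b l) (auto intro: S.hpart_closed)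
  show "bilinear_map K A A M (\<lambda>a b. bprod M \<phi> a b c d)" if "c \<in> carrier A" "d \<in> carrier A"
    unfolding bprod_def using that
    by (intro bilinear_map_plus bilinear_map_neg M b l) (auto intro: S.hpart_closed)
qed

text \<open>Multiplicativity of \<Delta> seen through \<phi>. The product of the tensor square is
  itself a nested lift, so the linear extension of \<phi> is pushed through both layers.\<close>

lemma lift_comult_mult:
  assumes M: "module K M" and \<phi>: "bilinear_map K A A M \<phi>" and x: "x \<in> carrier A"
      and y: "y \<in> carrier A"
  shows "tensor_lift K M \<phi> (\<Delta> (x \<otimes> y))
    = tensor_lift K M (\<lambda>a b. tensor_lift K M (bprod M \<phi> a b) (\<Delta> y)) (\<Delta> x)"
proof -
  let ?pt = "pure_tensor K A A"
  let ?B = "bprod T ?pt"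
  let ?f = "tensor_lift K M \<phi>"
  note Tm = TP.T.module_axioms and Am = M.module_axioms
  note dx = comult_closed[OF x] and dy = comult_closed[OF y]
  have f: "linear_map K T M ?f" by (rule TP.lift_linear[OF M \<phi>])
  \<comment> \<open>The Koszul sign is nontrivial only for i = j = 1, which is the negated summand
    of \<open>bprod\<close>.\<close>
  have B: "(\<Oplus>\<^bsub>T\<^esub> i \<in> {0, 1}. \<Oplus>\<^bsub>T\<^esub> j \<in> {0, 1}. koszul T (i * j)
                (?pt (a \<otimes> hpart A j c) (hpart A i b \<otimes> d))) = ?B a b c d"
    if "a \<in> carrier A" "b \<in> carrier A" "c \<in> carrier A" "d \<in> carrier A" for a b c d
    using that S.hpart_closed
    by (simp add: TP.T.M.finsum_bit bprod_def koszul_def TP.pt_closed TP.T.M.a_ac)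
  have Bb: "bilinear_map K A A T (\<lambda>a b. tensor_lift K T (?B a b) (\<Delta> y))"
    by (rule TP.lift_bilinear_param[OF Tm bprod_bilinear[OF Tm TP.pt_bilinear] dy M.module_axioms
        M.module_axioms])
  have Bc: "?B a b c d \<in> carrier T"
    if "a \<in> carrier A" "b \<in> carrier A" "c \<in> carrier A" "d \<in> carrier A" for a b c d
    by (rule bilinear_map_closed[OF bprod_bilinear(1)[OF Tm TP.pt_bilinear that(1,2)] that(3,4)])
  have fB: "?f (?B a b c d) = bprod M \<phi> a b c d"
    if "a \<in> carrier A" "b \<in> carrier A" "c \<in> carrier A" "d \<in> carrier A" for a b c d
    unfolding bprod_def using that S.hpart_closed
    by (simp add: linear_map_add[OF f] linear_map_uminus[OF Tm M f] TP.pt_closed TP.lift_pt[OF M \<phi>])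
  have "\<Delta> (x \<otimes> y) = tensor_lift K T (\<lambda>a b. tensor_lift K T (?B a b) (\<Delta> y)) (\<Delta> x)"
    unfolding comult_mult[OF x y] TP.TT_sel
    by (intro TP.lift_cong'[OF Tm _ _ dx] TP.lift_cong'[OF Tm _ _ dy])
      (simp_all add: B Bc bilinear_map_closed[OF Bb])
  then have "?f (\<Delta> (x \<otimes> y)) = tensor_lift K M (\<lambda>a b. ?f (tensor_lift K T (?B a b) (\<Delta> y))) (\<Delta> x)"
    using TP.lift_comp[OF Tm M f Bb dx] by simp
  also have "\<dots> = tensor_lift K M (\<lambda>a b. tensor_lift K M (bprod M \<phi> a b) (\<Delta> y)) (\<Delta> x)"
  proof (rule TP.lift_cong[OF M bilinear_map_comp[OF f Bb] TP.lift_bilinear_param[OF M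
      bprod_bilinear[OF M \<phi>] dy Am Am] _ dx])
    fix a b assume ab: "a \<in> carrier A" "b \<in> carrier A"
    have "?f (tensor_lift K T (?B a b) (\<Delta> y)) = tensor_lift K M (\<lambda>c d. ?f (?B a b c d)) (\<Delta> y)"
      by (rule TP.lift_comp[OF Tm M f bprod_bilinear(1)[OF Tm TP.pt_bilinear ab] dy])
    also have "\<dots> = tensor_lift K M (bprod M \<phi> a b) (\<Delta> y)"
      by (rule TP.lift_cong[OF M bilinear_map_comp[OF f bprod_bilinear(1)[OF Tm TP.pt_bilinear ab]]
            bprod_bilinear(1)[OF M \<phi> ab] _ dy]) (simp add: fB ab)
    finally show "?f (tensor_lift K T (?B a b) (\<Delta> y)) = tensor_lift K M (bprod M \<phi> a b) (\<Delta> y)" .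
  qed
  finally show ?thesis .
qed

text \<open>Homogeneous tangent vectors of parity \<open>p\<close>, as functionals on the coordinate superalgebra.\<close>

definition pder :: "bit \<Rightarrow> ('a \<Rightarrow> 'k) \<Rightarrow> bool"
  where "pder p d \<longleftrightarrow> lf d \<and>
    (\<forall>x \<in> carrier A. \<forall>y \<in> carrier A. d (x \<otimes> y) = \<epsilon> x \<otimes>\<^bsub>K\<^esub> d y \<oplus>\<^bsub>K\<^esub> d x \<otimes>\<^bsub>K\<^esub> \<epsilon> y) \<and>
    (\<forall>x \<in> gr A (p + 1). d x = \<zero>\<^bsub>K\<^esub>)"

lemma pder_lf: "pder p d \<Longrightarrow> lf d"
  and pder_mult: "\<lbrakk>pder p d; x \<in> carrier A; y \<in> carrier A\<rbrakk> \<Longrightarrow>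
    d (x \<otimes> y) = \<epsilon> x \<otimes>\<^bsub>K\<^esub> d y \<oplus>\<^bsub>K\<^esub> d x \<otimes>\<^bsub>K\<^esub> \<epsilon> y"
  and pder_other: "\<lbrakk>pder p d; x \<in> gr A (p + 1)\<rbrakk> \<Longrightarrow> d x = \<zero>\<^bsub>K\<^esub>"
  by (auto simp: pder_def)

text \<open>The sign (-1)^(p|x|) for moving an object of parity p past x, extended linearly to
  elements that are not homogeneous.\<close>

definition par :: "bit \<Rightarrow> 'a \<Rightarrow> 'a"
  where "par p x = hpart A 0 x \<oplus> koszul A p (hpart A 1 x)"

lemma par_linear: "linear_map K A A (par p)"
  unfolding par_def
  by (intro linear_map_plus linear_map_koszul S.hpart_linear M.module_axioms)

lemma par_closed: "x \<in> carrier A \<Longrightarrow> par p x \<in> carrier A"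
  by (rule linear_map_closed[OF par_linear])

lemma par_gr: "x \<in> gr A i \<Longrightarrow> par p x = koszul A (p * i) x"
  using S.hpart_same[of x i] S.hpart_other[of x "i + 1"] S.gr_closed[of x i] bit_cases[of i]
      bit_cases[of p]
  by (auto simp: par_def koszul_def)

lemma par_mem:
  assumes "submod K A N" "homogeneous_subset A N" "x \<in> N"
  shows "par p x \<in> N"
  unfolding par_def using assms by (intro submod_add koszul_mem S.homogeneousD) auto

lemma lf_hpart:
  assumes "lf d" "\<And>x. x \<in> gr A (p + 1) \<Longrightarrow> d x = \<zero>\<^bsub>K\<^esub>" "x \<in> carrier A"
  shows "d (hpart A i x) = (if i = p then d x else \<zero>\<^bsub>K\<^esub>)"
proof -
  have "d x = d (hpart A p x) \<oplus>\<^bsub>K\<^esub> d (hpart A (p + 1) x)"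
    using S.hpart_decomp[OF assms(3), of p] lf_add[OF assms(1)] S.hpart_closed[OF assms(3)] by metis
  moreover have "d (hpart A (p + 1) x) = \<zero>\<^bsub>K\<^esub>" by (rule assms(2)[OF S.hpart_gr[OF assms(3)]])
  ultimately show ?thesis
    using lf_closed[OF assms(1) S.hpart_closed[OF assms(3)]] bit_cases[of i] bit_cases[of p] by auto
qed

lemma pder_hpart: "\<lbrakk>pder p d; x \<in> carrier A\<rbrakk> \<Longrightarrow> d (hpart A i x) = (if i = p then d x else \<zero>\<^bsub>K\<^esub>)"
  by (rule lf_hpart) (auto simp: pder_lf pder_other)

lemma counit_hpart: "x \<in> carrier A \<Longrightarrow> \<epsilon> (hpart A i x) = (if i = 0 then \<epsilon> x else \<zero>\<^bsub>K\<^esub>)"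
  by (rule lf_hpart[OF counit_linear]) (auto simp: counit_odd)

lemma counit_par: "x \<in> carrier A \<Longrightarrow> \<epsilon> (par p x) = \<epsilon> x"
  unfolding par_def
  using counit_hpart[of x] S.hpart_closed[of x] counit_linear lf_closed[OF counit_linear, of x]
    linear_map_uminus[OF M.module_axioms L.module_axioms counit_linear, of "hpart A 1 x"]
  by (auto simp: koszul_def lf_add)

text \<open>\<^const>\<open>Lop\<close> of a homogeneous point derivation is a superderivation acting from the right.\<close>

lemma Lop_mult:
  assumes d: "pder p d" and x: "x \<in> carrier A" and y: "y \<in> carrier A"
  shows "Lop d (x \<otimes> y) = Lop d x \<otimes> par p y \<oplus> x \<otimes> Lop d y"
proof -
  note lfd = pder_lf[OF d] and lfe = counit_linear
  note Am = M.module_axioms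
  note dx = comult_closed[OF x] and dy = comult_closed[OF y]
  let ?\<phi> = "\<lambda>a b. d b \<odot> a"
  note b = Lop_bilinear[OF lfd]
  \<comment> \<open>The Leibniz rule splits the value of \<open>d\<close> on the second factor. The
    counit term lives on even b and has no sign; the term with \<open>d b\<close> lives on b of
    parity p, where the Koszul signs on the parts of c add up to \<open>par p c\<close>.\<close>
  have eq: "bprod A ?\<phi> a b c e =
      (d b \<odot> a) \<otimes> (\<epsilon> e \<odot> par p c) \<oplus> (\<epsilon> b \<odot> a) \<otimes> (d e \<odot> c)"
    if abce: "a \<in> carrier A" "b \<in> carrier A" "c \<in> carrier A" "e \<in> carrier A" for a b c e
  proof -
    define c0 c1 \<alpha> \<beta> \<delta> \<eta> where
      defs: "c0 = hpart A 0 c" "c1 = hpart A 1 c" "\<alpha> = d b" "\<beta> = \<epsilon> b" "\<delta> = d e" "\<eta> = \<epsilon> e"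
    have carr: "c0 \<in> carrier A" "c1 \<in> carrier A" "\<alpha> \<in> carrier K" "\<beta> \<in> carrier K"
      "\<delta> \<in> carrier K" "\<eta> \<in> carrier K"
      using abce lfd lfe by (simp_all add: defs S.hpart_closed lf_closed)
    have c: "c = c0 \<oplus> c1" and pc: "par p c = c0 \<oplus> koszul A p c1"
      using S.hpart_decomp[OF abce(3), of 0] by (simp_all add: defs par_def)
    have de: "d (hpart A i b \<otimes> e)
        = (if i = 0 then \<beta> else \<zero>\<^bsub>K\<^esub>) \<otimes>\<^bsub>K\<^esub> \<delta> \<oplus>\<^bsub>K\<^esub> (if i = p then \<alpha> else \<zero>\<^bsub>K\<^esub>) \<otimes>\<^bsub>K\<^esub> \<eta>" for i
      using abce by (simp add: pder_mult[OF d] S.hpart_closed counit_hpart pder_hpart[OF d] defs)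
    show ?thesis
      unfolding bprod_def defs(1-6)[symmetric] pc unfolding de c
      using abce carr bit_cases[of p]
      by (auto simp: koszul_def A.r_distr M.smult_r_distr M.smult_l_distr smult_mult_left
          smult_mult_right
          M.smult_assoc1[symmetric] A.r_minus M.smult_r_minus M.smult_l_minus A.a_ac K.m_ac)
  qed
  have b1: "bilinear_map K A A A (\<lambda>c e. (d b \<odot> a) \<otimes> (\<epsilon> e \<odot> par p c))"
    and b2: "bilinear_map K A A A (\<lambda>c e. (\<epsilon> b \<odot> a) \<otimes> (d e \<odot> c))"
    if "a \<in> carrier A" "b \<in> carrier A" for a b
    using that lfd lfe
    by (auto intro!: bilinear_map_comp[OF mult_linear_right[OF linear_map_id]] smult_bilinear
        par_linear linear_map_id simp: lf_closed)
  have inner: "tensor_lift K A (bprod A ?\<phi> a b) (\<Delta> y)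
      = (d b \<odot> a) \<otimes> par p y \<oplus> (\<epsilon> b \<odot> a) \<otimes> Lop d y"
    if ab: "a \<in> carrier A" "b \<in> carrier A" for a b
  proof -
    have c: "d b \<odot> a \<in> carrier A" "\<epsilon> b \<odot> a \<in> carrier A"
      using ab lfd lfe by (auto simp: lf_closed)
    have "tensor_lift K A (bprod A ?\<phi> a b) (\<Delta> y)
      = tensor_lift K A (\<lambda>c e. (d b \<odot> a) \<otimes> (\<epsilon> e \<odot> par p c) \<oplus> (\<epsilon> b \<odot> a) \<otimes> (d e \<odot> c)) (\<Delta> y)"
      by (rule TP.lift_cong[OF Am bprod_bilinear(1)[OF Am b ab] bilinear_map_plus[OF Am b1[OF ab]
          b2[OF ab]] eq[OF ab] dy])
    also have "\<dots> = tensor_lift K A (\<lambda>c e. (d b \<odot> a) \<otimes> (\<epsilon> e \<odot> par p c)) (\<Delta> y)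
       \<oplus> tensor_lift K A (\<lambda>c e. (\<epsilon> b \<odot> a) \<otimes> (d e \<odot> c)) (\<Delta> y)"
      by (rule TP.lift_plus[OF Am b1[OF ab] b2[OF ab] dy])
    also have "tensor_lift K A (\<lambda>c e. (d b \<odot> a) \<otimes> (\<epsilon> e \<odot> par p c)) (\<Delta> y)
       = (d b \<odot> a) \<otimes> tensor_lift K A (\<lambda>c e. \<epsilon> e \<odot> par p c) (\<Delta> y)"
      by (rule TP.lift_comp[symmetric, OF Am Am mult_linear_right[OF linear_map_id c(1)]
          smult_bilinear[OF lfe par_linear] dy])
    also have "tensor_lift K A (\<lambda>c e. \<epsilon> e \<odot> par p c) (\<Delta> y) = par p y"
    proof -
      have "par p y = par p (tensor_lift K A (\<lambda>c e. \<epsilon> e \<odot> c) (\<Delta> y))"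
        using counit_right[OF y] by simp
      also have "\<dots> = tensor_lift K A (\<lambda>c e. par p (\<epsilon> e \<odot> c)) (\<Delta> y)"
        by (rule TP.lift_comp[OF Am Am par_linear Lop_bilinear[OF lfe] dy])
      also have "\<dots> = tensor_lift K A (\<lambda>c e. \<epsilon> e \<odot> par p c) (\<Delta> y)"
        by (rule TP.lift_cong[OF Am bilinear_map_comp[OF par_linear Lop_bilinear[OF lfe]]
            smult_bilinear[OF lfe par_linear] _ dy])
          (simp add: linear_map_smult[OF par_linear] lf_closed[OF lfe])
      finally show ?thesis by simp
    qed
    also have "tensor_lift K A (\<lambda>c e. (\<epsilon> b \<odot> a) \<otimes> (d e \<odot> c)) (\<Delta> y)
       = (\<epsilon> b \<odot> a) \<otimes> Lop d y"
      unfolding Lop_def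
      by (rule TP.lift_comp[symmetric, OF Am Am mult_linear_right[OF linear_map_id c(2)] b dy])
    finally show ?thesis .
  qed
  note py = par_closed[OF y, of p] and Ly = Lop_closed[OF lfd y]
  have b3: "bilinear_map K A A A (\<lambda>a b. (d b \<odot> a) \<otimes> par p y)"
    by (rule bilinear_map_comp[OF mult_linear_left[OF linear_map_id py] b])
  have b4: "bilinear_map K A A A (\<lambda>a b. (\<epsilon> b \<odot> a) \<otimes> Lop d y)"
    by (rule bilinear_map_comp[OF mult_linear_left[OF linear_map_id Ly] Lop_bilinear[OF lfe]])
  have "Lop d (x \<otimes> y) = tensor_lift K A (\<lambda>a b. tensor_lift K A (bprod A ?\<phi> a b) (\<Delta> y)) (\<Delta> x)"
    unfolding Lop_def[of d "x \<otimes> y"] by (rule lift_comult_mult[OF Am b x y])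
  also have "\<dots> = tensor_lift K A (\<lambda>a b. (d b \<odot> a) \<otimes> par p y \<oplus> (\<epsilon> b \<odot> a) \<otimes> Lop d y) (\<Delta> x)"
    by (rule TP.lift_cong[OF Am TP.lift_bilinear_param[OF Am bprod_bilinear[OF Am b] dy Am Am]
        bilinear_map_plus[OF Am b3 b4] inner dx])
  also have "\<dots> = tensor_lift K A (\<lambda>a b. (d b \<odot> a) \<otimes> par p y) (\<Delta> x) \<oplus>
      tensor_lift K A (\<lambda>a b. (\<epsilon> b \<odot> a) \<otimes> Lop d y) (\<Delta> x)"
    by (rule TP.lift_plus[OF Am b3 b4 dx])
  also have "tensor_lift K A (\<lambda>a b. (d b \<odot> a) \<otimes> par p y) (\<Delta> x) = Lop d x \<otimes> par p y"
    unfolding Lop_def[of d x]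
    by (rule TP.lift_comp[symmetric, OF Am Am mult_linear_left[OF linear_map_id py] b dx])
  also have "tensor_lift K A (\<lambda>a b. (\<epsilon> b \<odot> a) \<otimes> Lop d y) (\<Delta> x) = x \<otimes> Lop d y"
    using TP.lift_comp[symmetric, OF Am Am mult_linear_left[OF linear_map_id Ly] Lop_bilinear[OF
        lfe] dx]
      counit_right[OF x] by simp
  finally show ?thesis .
qed

text \<open>A homogeneous summand a \<otimes> b of \<Delta> x contributes only if b has parity p,
  and a then has parity i - p = i + p.\<close>

lemma Lop_gr:
  assumes d: "lf d" "\<And>x. x \<in> gr A (p + 1) \<Longrightarrow> d x = \<zero>\<^bsub>K\<^esub>" and x: "x \<in> gr A i"
  shows "Lop d x \<in> gr A (i + p)"
  unfolding Lop_def
proof (rule linear_map_hull[OF TP.T.module_axioms M.module_axioms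
      TP.lift_linear[OF M.module_axioms Lop_bilinear[OF d(1)]] S.gr_submod _ _ comult_gr[OF x]])
  show "{TP.pt a b |a b j k. a \<in> gr A j \<and> b \<in> gr A k \<and> j + k = i} \<subseteq> carrier T"
    by (auto intro!: TP.pt_closed S.gr_closed)
  fix t assume "t \<in> {TP.pt a b |a b j k. a \<in> gr A j \<and> b \<in> gr A k \<and> j + k = i}"
  then obtain a b j k where t: "t = TP.pt a b" "a \<in> gr A j" "b \<in> gr A k" "j + k = i" by blast
  show "tensor_lift K A (\<lambda>a b. d b \<odot> a) t \<in> gr A (i + p)"
  proof (cases "k = p")
    case True
    have "i + p = j" using t(4) True bit_double(2) by (metis add.commute)
    then show ?thesis
      using t S.gr_closed d(1)
      by (simp add: TP.lift_pt[OF M.module_axioms Lop_bilinear[OF d(1)]] submod_smult[OF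
          S.gr_submod] lf_closed)
  next
    case False
    then have "k = p + 1" using bit_cases[of k] bit_cases[of p] by auto
    then have "d b = \<zero>\<^bsub>K\<^esub>" using d(2) t(3) by simp
    then show ?thesis
      using t S.gr_closed by (simp add: TP.lift_pt[OF M.module_axioms Lop_bilinear[OF d(1)]])
  qed
qed

lemma Lop_hpart:
  assumes d: "pder p d" and x: "x \<in> carrier A"
  shows "Lop d (hpart A i x) = hpart A (i + p) (Lop d x)"
proof -
  note l = pder_lf[OF d] and h = S.hpart_closed[OF x]
  have L: "Lop d (hpart A j x) \<in> gr A (j + p)" for j
    using Lop_gr[OF l pder_other[OF d] S.hpart_gr[OF x]] .
  have e: "i + 1 + p = i + p + 1" by (simp add: ac_simps)
  have "Lop d x = Lop d (hpart A i x) \<oplus> Lop d (hpart A (i + 1) x)"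
    using S.hpart_decomp[OF x, of i] Lop_add[OF l h h] by metis
  then show ?thesis
    using S.hpart_eqI[OF L[of i], of "Lop d (hpart A (i + 1) x)"] L[of "i + 1"] e by simp
qed

end

section \<open>The Hopf superideal annihilated by a family of point derivations\<close>

lemma (in super_pair) submod_TT: "submod K TT N = submod K T N"
  by (simp add: submod_def subgroup_def m_inv_def)

section \<open>Annihilators in tensor products\<close>

context tensor_pair begin

text \<open>Tensors that are sums of n pure ones. Counting summands takes the place of choosing a
  basis in the proof of \<open>annihilator_tensor\<close>.\<close>

primrec rank_le :: "nat \<Rightarrow> ('a \<times> 'b \<Rightarrow> 'k) set set"
  where "rank_le 0 = {\<zero>\<^bsub>T\<^esub>}"
  | "rank_le (Suc n) = {pt a b \<oplus>\<^bsub>T\<^esub> t | a b t. a \<in> carrier A \<and> b \<in> carrier B \<and> t \<in> rank_le n}"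

lemma rank_le_carrier: "t \<in> rank_le n \<Longrightarrow> t \<in> carrier T"
  by (induct n arbitrary: t) (auto simp: pt_closed)

lemma rank_le_exhaust: "t \<in> carrier T \<Longrightarrow> \<exists>n. t \<in> rank_le n"
proof (induct rule: tensor_induct)
  case zero
  have "\<zero>\<^bsub>T\<^esub> \<in> rank_le 0" by simp
  then show ?case by blast
next
  case (add a b t)
  then obtain n where "t \<in> rank_le n" by blast
  then have "pt a b \<oplus>\<^bsub>T\<^esub> t \<in> rank_le (Suc n)" using add by auto
  then show ?case by blast
qed

lemma rank_le_linear:
  assumes f: "linear_map K T T f"
    and pt: "\<And>a b. \<lbrakk>a \<in> carrier A; b \<in> carrier B\<rbrakk> \<Longrightarrow>
      \<exists>a' \<in> carrier A. \<exists>b' \<in> carrier B. f (pt a b) = pt a' b'"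
  shows "t \<in> rank_le n \<Longrightarrow> f t \<in> rank_le n"
proof (induct n arbitrary: t)
  case 0
  then show ?case using linear_map_zero[OF T.module_axioms T.module_axioms f] by simp
next
  case (Suc n)
  then obtain a b s where t: "t = pt a b \<oplus>\<^bsub>T\<^esub> s" "a \<in> carrier A" "b \<in> carrier B" "s \<in> rank_le n"
    by auto
  then obtain a' b' where "a' \<in> carrier A" "b' \<in> carrier B" "f (pt a b) = pt a' b'"
    using pt by blast
  then show ?case
    using t Suc(1)[OF t(4)] linear_map_add[OF f pt_closed[OF t(2,3)] rank_le_carrier[OF t(4)]]
        by auto
qed

text \<open>Induction on the rank: if a functional \<open>f \<in> W\<close> does not vanish on the second factor \<open>b\<close> of
  a summand, then modulo \<open>I \<otimes> B\<close> the summand can be absorbed into the remaining ones.\<close>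

lemma annihilator_tensor:
  assumes W: "\<And>f. f \<in> W \<Longrightarrow> linear_map K B (base K) f"
    and I: "submod K A I" and J: "J = {x \<in> carrier B. \<forall>f \<in> W. f x = \<zero>\<^bsub>K\<^esub>}"
    and t: "t \<in> carrier T" "\<And>f. f \<in> W \<Longrightarrow> tensor_lift K A (\<lambda>a b. f b \<odot>\<^bsub>A\<^esub> a) t \<in> I"
  shows "t \<in> submod K T hull {pt a b | a b. a \<in> carrier A \<and> b \<in> carrier B \<and> (a \<in> I \<or> b \<in> J)}"
    (is "t \<in> ?N")
proof -
  note Tm = T.module_axioms and Am = A.module_axioms and Bm = B.module_axioms
  have "{pt a b | a b. a \<in> carrier A \<and> b \<in> carrier B \<and> (a \<in> I \<or> b \<in> J)} \<subseteq> carrier T"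
    by (auto simp: pt_closed)
  then have N: "submod K T ?N" by (rule submod_hull[OF Tm])
  have ptN: "pt a b \<in> ?N" if "a \<in> carrier A" "b \<in> carrier B" "a \<in> I \<or> b \<in> J" for a b
    using that by (intro hull_inc) blast
  have Wc: "f x \<in> carrier K" if "f \<in> W" "x \<in> carrier B" for f x
    using linear_map_closed[OF W[OF that(1)] that(2)] by simp
  have bil: "bilinear_map K A B A (\<lambda>a b. f b \<odot>\<^bsub>A\<^esub> a)" if f: "f \<in> W" for f
  proof (intro bilinear_mapI linear_mapI)
    fix a x y assume "a \<in> carrier A" "x \<in> carrier B" "y \<in> carrier B"
    then show "f (x \<oplus>\<^bsub>B\<^esub> y) \<odot>\<^bsub>A\<^esub> a = f x \<odot>\<^bsub>A\<^esub> a \<oplus>\<^bsub>A\<^esub> f y \<odot>\<^bsub>A\<^esub> a"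
      using linear_map_add[OF W[OF f]] Wc[OF f] by (simp add: A.smult_l_distr)
  next
    fix a c x assume "a \<in> carrier A" "c \<in> carrier K" "x \<in> carrier B"
    then show "f (c \<odot>\<^bsub>B\<^esub> x) \<odot>\<^bsub>A\<^esub> a = c \<odot>\<^bsub>A\<^esub> (f x \<odot>\<^bsub>A\<^esub> a)"
      using linear_map_smult[OF W[OF f]] Wc[OF f] by (simp add: A.smult_assoc1)
  next
    fix b c a assume "b \<in> carrier B" "c \<in> carrier K" "a \<in> carrier A"
    then show "f b \<odot>\<^bsub>A\<^esub> (c \<odot>\<^bsub>A\<^esub> a) = c \<odot>\<^bsub>A\<^esub> (f b \<odot>\<^bsub>A\<^esub> a)"
      using Wc[OF f] by (simp add: A.smult_assoc1[symmetric] m_comm)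
  qed (use Wc[OF f] in \<open>auto simp: A.smult_r_distr\<close>)
  let ?L = "\<lambda>f. tensor_lift K A (\<lambda>a b. f b \<odot>\<^bsub>A\<^esub> a)"
  have L: "linear_map K T A (?L f)" if "f \<in> W" for f by (rule lift_linear[OF Am bil[OF that]])
  have Lpt: "?L f (pt a b) = f b \<odot>\<^bsub>A\<^esub> a" if "f \<in> W" "a \<in> carrier A" "b \<in> carrier B" for f a b
    by (rule lift_pt[OF Am bil[OF that(1)] that(2,3)])
  obtain n where "t \<in> rank_le n" using rank_le_exhaust[OF t(1)] by blast
  then show ?thesis using t
  proof (induct n arbitrary: t)
    case 0
    then show ?case using submod_zero[OF N] by simp
  next
    case (Suc n)
    then obtain a b s where teq: "t = pt a b \<oplus>\<^bsub>T\<^esub> s" and ab: "a \<in> carrier A" "b \<in> carrier B"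
      and s: "s \<in> rank_le n" by auto
    note sc = rank_le_carrier[OF s] and pc = pt_closed[OF ab]
    show ?case
    proof (cases "\<forall>f \<in> W. f b = \<zero>\<^bsub>K\<^esub>")
      case True
      then have "b \<in> J" using ab J by simp
      then have p: "pt a b \<in> ?N" using ptN ab by blast
      have "?L f s \<in> I" if f: "f \<in> W" for f
      proof -
        have "?L f t = ?L f (pt a b) \<oplus>\<^bsub>A\<^esub> ?L f s"
          unfolding teq by (rule linear_map_add[OF L[OF f] pc sc])
        moreover have "f b = \<zero>\<^bsub>K\<^esub>" using True f by blast
        ultimately have "?L f t = ?L f s"
          using f ab linear_map_closed[OF L[OF f] sc] by (simp add: Lpt)
        then show ?thesis using Suc(4)[OF f] by simp
      qed
      then have "s \<in> ?N" using Suc(1)[OF s sc] by blast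
      then show ?thesis unfolding teq by (rule submod_add[OF N p])
    next
      case False
      then obtain f where f: "f \<in> W" "f b \<noteq> \<zero>\<^bsub>K\<^esub>" by blast
      define k where "k = inv\<^bsub>K\<^esub> (f b)"
      have k: "k \<in> carrier K" "k \<otimes>\<^bsub>K\<^esub> f b = \<one>\<^bsub>K\<^esub>"
        using f Wc[OF f(1) ab(2)] field_Units unfolding k_def by (auto intro: Units_l_inv)
      \<comment> \<open>This is id \<otimes> \<pi>, where \<pi> is the projection along b onto the
        kernel of \<open>f\<close>. It sends pure tensors to pure tensors and kills the summand
        \<open>pt a b\<close>, so it lowers the number of summands of \<open>t\<close>.\<close>
      define \<Theta> where "\<Theta> = (\<lambda>u. u \<ominus>\<^bsub>T\<^esub> pt (k \<odot>\<^bsub>A\<^esub> ?L f u) b)"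
      have \<Theta>: "linear_map K T T \<Theta>"
        unfolding \<Theta>_def
        by (intro linear_map_diff Tm linear_map_id linear_map_comp[OF _ bilinear_mapD(2)[OF
            pt_bilinear ab(2)]]
            linear_map_scale Am L f k)
      have pc': "pt (k \<odot>\<^bsub>A\<^esub> ?L f u) b \<in> carrier T" if "u \<in> carrier T" for u
        using that k ab linear_map_closed[OF L[OF f(1)]] by (simp add: pt_closed)
      have \<Theta>pt: "\<Theta> (pt a' b') = pt a' (b' \<ominus>\<^bsub>B\<^esub> (k \<otimes>\<^bsub>K\<^esub> f b') \<odot>\<^bsub>B\<^esub> b)"
        if "a' \<in> carrier A" "b' \<in> carrier B" for a' b'
        using that ab k Wc[OF f(1)] unfolding \<Theta>_def
        by (simp add: Lpt[OF f(1)] A.smult_assoc1[symmetric]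
            linear_map_minus[OF Bm Tm bilinear_mapD(1)[OF pt_bilinear]]
            linear_map_smult[OF bilinear_mapD(1)[OF pt_bilinear]]
            linear_map_smult[OF bilinear_mapD(2)[OF pt_bilinear]])
      have "\<Theta> u \<in> rank_le n" if "u \<in> rank_le n" for u
      proof (rule rank_le_linear[OF \<Theta> _ that])
        fix a' b' assume "a' \<in> carrier A" "b' \<in> carrier B"
        then show "\<exists>a\<in>carrier A. \<exists>b\<in>carrier B. \<Theta> (pt a' b') = pt a b"
          using \<Theta>pt[of a' b'] ab k Wc[OF f(1)]
          by (intro bexI[of _ a'] bexI[of _ "b' \<ominus>\<^bsub>B\<^esub> (k \<otimes>\<^bsub>K\<^esub> f b') \<odot>\<^bsub>B\<^esub> b"]) auto
      qed
      moreover have "\<Theta> (pt a b) = \<zero>\<^bsub>T\<^esub>"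
        using \<Theta>pt[OF ab] k ab linear_map_zero[OF Bm Tm bilinear_mapD(1)[OF pt_bilinear ab(1)]]
        by (simp add: B.M.diff_eq_zero_iff[THEN iffD2])
      then have "\<Theta> t = \<Theta> s"
        unfolding teq using linear_map_add[OF \<Theta> pc sc] linear_map_closed[OF \<Theta> sc] by simp
      ultimately have r: "\<Theta> t \<in> rank_le n" using s by simp
      \<comment> \<open>This is the left factor of the pure tensor by which \<open>t\<close> and
        \<open>\<Theta> t\<close> differ, so the difference lies in I \<otimes> B.\<close>
      have I': "k \<odot>\<^bsub>A\<^esub> ?L f t \<in> I" by (rule submod_smult[OF I k(1) Suc(4)[OF f(1)]])
      note I'c = submod_carrier[OF I I']
      have "?L g (\<Theta> t) \<in> I" if g: "g \<in> W" for g
      proof -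
        have "?L g (\<Theta> t) = ?L g t \<ominus>\<^bsub>A\<^esub> g b \<odot>\<^bsub>A\<^esub> (k \<odot>\<^bsub>A\<^esub> ?L f t)"
          unfolding \<Theta>_def using linear_map_minus[OF Tm Am L[OF g] Suc(3) pc'[OF Suc(3)]] Lpt[OF g
              I'c ab(2)]
          by simp
        also have "\<dots> \<in> I"
          by (rule submod_minus[OF I Suc(4)[OF g] submod_smult[OF I Wc[OF g ab(2)] I']])
        finally show ?thesis .
      qed
      then have "\<Theta> t \<in> ?N" using Suc(1)[OF r rank_le_carrier[OF r]] by blast
      moreover have "pt (k \<odot>\<^bsub>A\<^esub> ?L f t) b \<in> ?N" using ptN[OF I'c ab(2)] I' by blast
      ultimately have "\<Theta> t \<oplus>\<^bsub>T\<^esub> pt (k \<odot>\<^bsub>A\<^esub> ?L f t) b \<in> ?N" by (rule submod_add[OF N])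
      then show ?thesis
        unfolding \<Theta>_def using T.M.diff_add_cancel[OF Suc(3) pc'[OF Suc(3)]] by simp
    qed
  qed
qed

end

section \<open>The filtration whose intersection is the annihilator\<close>

context hopf begin

text \<open>The elements on which the counit vanishes after any composite of at most n operators
  from \<open>D\<close>. The finite stages make inductions on n possible, in particular for the
  antipode.\<close>

primrec filt :: "(bit \<Rightarrow> ('a \<Rightarrow> 'k) set) \<Rightarrow> nat \<Rightarrow> 'a set"
  where "filt D 0 = {x \<in> carrier A. \<epsilon> x = \<zero>\<^bsub>K\<^esub>}"
  | "filt D (Suc n) = {x \<in> filt D n. \<forall>p. \<forall>d \<in> D p. Lop d x \<in> filt D n}"

definition annih :: "(bit \<Rightarrow> ('a \<Rightarrow> 'k) set) \<Rightarrow> 'a set"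
  where "annih D = (\<Inter>n. filt D n)"

text \<open>For homogeneous members of \<open>D\<close>, a word is up to sign the convolution
  product of its letters; so the words span the convolution algebra generated by
  \<open>D\<close>.\<close>

inductive_set words :: "(bit \<Rightarrow> ('a \<Rightarrow> 'k) set) \<Rightarrow> ('a \<Rightarrow> 'k) set" for D
  where counit: "\<epsilon> \<in> words D"
  | Lop: "\<lbrakk>f \<in> words D; d \<in> D p\<rbrakk> \<Longrightarrow> (\<lambda>x. f (Lop d x)) \<in> words D"

lemma counit_kernel_submod: "submod K A {x \<in> carrier A. \<epsilon> x = \<zero>\<^bsub>K\<^esub>}"
  using submod_kernel[OF M.module_axioms L.module_axioms counit_linear] by simp

context
  fixes D :: "bit \<Rightarrow> ('a \<Rightarrow> 'k) set"
  assumes D: "\<And>p d. d \<in> D p \<Longrightarrow> pder p d"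
begin

lemma filt_submod: "submod K A (filt D n)"
proof (induct n)
  case 0
  show ?case using counit_kernel_submod by simp
next
  case (Suc n)
  show ?case
    using submod_carrier[OF Suc] submod_zero[OF Suc] submod_add[OF Suc] submod_smult[OF Suc]
    by (intro submodI M.module_axioms)
      (auto simp: linear_map_zero[OF M.module_axioms M.module_axioms Lop_linear[OF pder_lf[OF D]]]
        linear_map_add[OF Lop_linear[OF pder_lf[OF D]]] linear_map_smult[OF Lop_linear[OF
            pder_lf[OF D]]])
qed

lemmas filt_carrier = submod_carrier[OF filt_submod]

lemma filt_hpart: "x \<in> filt D n \<Longrightarrow> hpart A i x \<in> filt D n"
  by (induct n arbitrary: x i)
    (auto simp: counit_hpart S.hpart_closed Lop_hpart[OF D filt_carrier])

lemma filt_homogeneous: "homogeneous_subset A (filt D n)"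
  by (rule S.homogeneousI) (auto intro: filt_carrier filt_hpart)

lemma filt_par: "x \<in> filt D n \<Longrightarrow> par p x \<in> filt D n"
  by (rule par_mem[OF filt_submod filt_homogeneous])

lemma filt_right: "\<lbrakk>x \<in> filt D n; y \<in> carrier A\<rbrakk> \<Longrightarrow> x \<otimes> y \<in> filt D n"
proof (induct n arbitrary: x y)
  case 0
  then show ?case by (simp add: counit_mult lf_closed[OF counit_linear])
next
  case (Suc n)
  have "Lop d (x \<otimes> y) \<in> filt D n" if d: "d \<in> D p" for d p
  proof -
    have x: "x \<in> filt D n" "Lop d x \<in> filt D n" using Suc(2) d by auto
    show ?thesis
      unfolding Lop_mult[OF D[OF d] filt_carrier[OF x(1)] Suc(3)]
      using Suc(1)[OF x(2) par_closed[OF Suc(3)]] Suc(1)[OF x(1) Lop_closed[OF pder_lf[OF D[OF d]]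
          Suc(3)]]
      by (rule submod_add[OF filt_submod])
  qed
  then show ?case using Suc by simp
qed

lemma filt_left: "\<lbrakk>x \<in> filt D n; y \<in> carrier A\<rbrakk> \<Longrightarrow> y \<otimes> x \<in> filt D n"
proof (induct n arbitrary: x y)
  case 0
  then show ?case by (simp add: counit_mult lf_closed[OF counit_linear])
next
  case (Suc n)
  have "Lop d (y \<otimes> x) \<in> filt D n" if d: "d \<in> D p" for d p
  proof -
    have x: "x \<in> filt D n" "Lop d x \<in> filt D n" using Suc(2) d by auto
    show ?thesis
      unfolding Lop_mult[OF D[OF d] Suc(3) filt_carrier[OF x(1)]]
      using Suc(1)[OF filt_par[OF x(1)] Lop_closed[OF pder_lf[OF D[OF d]] Suc(3)]] Suc(1)[OF x(2)
          Suc(3)]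
      by (rule submod_add[OF filt_submod])
  qed
  then show ?case using Suc by simp
qed

text \<open>A derivative falling on y leaves the factor x in \<open>filt D n\<close>. One falling on
  x costs a level, which the factor \<open>par p y\<close> from the kernel of the counit restores by
  induction. This gain of one level drives \<open>annih_antipode\<close>.\<close>

lemma filt_mult: "\<lbrakk>x \<in> filt D n; y \<in> carrier A; \<epsilon> y = \<zero>\<^bsub>K\<^esub>\<rbrakk> \<Longrightarrow> x \<otimes> y \<in> filt D (Suc n)"
proof (induct n arbitrary: x y)
  case 0
  have "Lop d (x \<otimes> y) \<in> filt D 0" if d: "d \<in> D p" for d p
  proof -
    have x: "x \<in> filt D 0" and y: "par p y \<in> filt D 0" using 0
        by (simp_all add: counit_par par_closed)
    show ?thesis
      unfolding Lop_mult[OF D[OF d] filt_carrier[OF x] 0(2)]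
      using filt_left[OF y Lop_closed[OF pder_lf[OF D[OF d]] filt_carrier[OF x]]]
        filt_right[OF x Lop_closed[OF pder_lf[OF D[OF d]] 0(2)]]
      by (rule submod_add[OF filt_submod])
  qed
  then show ?case using filt_right[OF 0(1,2)] by simp
next
  case (Suc n)
  have "Lop d (x \<otimes> y) \<in> filt D (Suc n)" if d: "d \<in> D p" for d p
  proof -
    have x: "x \<in> filt D (Suc n)" "Lop d x \<in> filt D n" using Suc(2) d by auto
    have "\<epsilon> (par p y) = \<zero>\<^bsub>K\<^esub>" using Suc by (simp add: counit_par)
    then show ?thesis
      unfolding Lop_mult[OF D[OF d] filt_carrier[OF x(1)] Suc(3)]
      using Suc(1)[OF x(2) par_closed[OF Suc(3)]] filt_right[OF x(1) Lop_closed[OF pder_lf[OF D[OF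
          d]] Suc(3)]]
      by (intro submod_add[OF filt_submod]) auto
  qed
  then show ?case using filt_right[OF Suc(2,3)] by (subst filt.simps) blast
qed

lemma annih_submod: "submod K A (annih D)"
proof (rule submodI[OF M.module_axioms])
  show "annih D \<subseteq> carrier A" unfolding annih_def using filt_carrier[where n = 0] by blast
qed (simp_all add: annih_def submod_zero[OF filt_submod] submod_add[OF filt_submod]
      submod_smult[OF filt_submod])

lemma annih_ideal: "ideal (annih D) A"
  by (rule idealI'[OF annih_submod]) (auto simp: annih_def filt_left filt_right)

lemma annih_homogeneous: "homogeneous_subset A (annih D)"
  by (rule S.homogeneousI) (auto simp: annih_def intro: filt_carrier filt_hpart)

lemma annih_carrier: "x \<in> annih D \<Longrightarrow> x \<in> carrier A"
  by (rule submod_carrier[OF annih_submod])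

lemma annih_counit: "x \<in> annih D \<Longrightarrow> \<epsilon> x = \<zero>\<^bsub>K\<^esub>"
  unfolding annih_def by (drule INT_D[of _ _ _ 0]) auto

lemma annih_Lop: "\<lbrakk>x \<in> annih D; d \<in> D p\<rbrakk> \<Longrightarrow> Lop d x \<in> annih D"
  unfolding annih_def
proof (rule INT_I)
  fix n assume x: "x \<in> (\<Inter>n. filt D n)" and d: "d \<in> D p"
  have "x \<in> filt D (Suc n)" using x by blast
  then show "Lop d x \<in> filt D n" using d by auto
qed

lemma annih_der: "\<lbrakk>x \<in> annih D; d \<in> D p\<rbrakk> \<Longrightarrow> d x = \<zero>\<^bsub>K\<^esub>"
  using annih_counit[OF annih_Lop] counit_Lop[OF pder_lf[OF D] annih_carrier] by metis

text \<open>Containment in an annihilator is shown below by exhibiting a stable subspace of the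
  kernel of the counit.\<close>

lemma annih_greatest:
  assumes "N \<subseteq> carrier A" "\<And>x. x \<in> N \<Longrightarrow> \<epsilon> x = \<zero>\<^bsub>K\<^esub>"
    and "\<And>p d x. \<lbrakk>d \<in> D p; x \<in> N\<rbrakk> \<Longrightarrow> Lop d x \<in> N"
  shows "N \<subseteq> annih D"
proof -
  have "x \<in> N \<Longrightarrow> x \<in> filt D n" for x n
    using assms by (induct n arbitrary: x) auto
  then show ?thesis unfolding annih_def by blast
qed

lemma words_lf: "f \<in> words D \<Longrightarrow> lf f"
  by (induct rule: words.induct) (auto intro: counit_linear lf_Lop pder_lf D)

text \<open>Brings the annihilator into the form of a common kernel, as
  \<open>annihilator_tensor\<close> demands of its second factor. The common kernel of the words is
  stable because the words are closed under precomposition with operators.\<close>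

lemma annih_eq: "annih D = {x \<in> carrier A. \<forall>f \<in> words D. f x = \<zero>\<^bsub>K\<^esub>}"
proof
  have "f x = \<zero>\<^bsub>K\<^esub>" if "f \<in> words D" "x \<in> annih D" for f x
    using that by (induct arbitrary: x rule: words.induct) (auto intro: annih_counit annih_Lop)
  then show "annih D \<subseteq> {x \<in> carrier A. \<forall>f \<in> words D. f x = \<zero>\<^bsub>K\<^esub>}" using annih_carrier by blast
  show "{x \<in> carrier A. \<forall>f \<in> words D. f x = \<zero>\<^bsub>K\<^esub>} \<subseteq> annih D"
  proof (rule annih_greatest)
    fix p d x assume d: "d \<in> D p" and x: "x \<in> {x \<in> carrier A. \<forall>f \<in> words D. f x = \<zero>\<^bsub>K\<^esub>}"
    have "f (Lop d x) = \<zero>\<^bsub>K\<^esub>" if "f \<in> words D" for f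
      using bspec[of "words D" "\<lambda>f. f x = \<zero>\<^bsub>K\<^esub>", OF _ words.Lop[OF that d]] x by simp
    then show "Lop d x \<in> {x \<in> carrier A. \<forall>f \<in> words D. f x = \<zero>\<^bsub>K\<^esub>}"
      using x Lop_closed[OF pder_lf[OF D[OF d]]] by blast
  qed (use words.counit in auto)
qed

lemma annih_words: "\<lbrakk>f \<in> words D; x \<in> annih D\<rbrakk> \<Longrightarrow> Lop f x \<in> annih D"
proof (induct arbitrary: x rule: words.induct)
  case counit
  then show ?case by (simp add: Lop_counit annih_carrier)
next
  case (Lop f d p)
  then show ?case
    using Lop_Lop[OF words_lf[OF Lop(1)] pder_lf[OF D[OF Lop(3)]] annih_carrier[OF Lop(4)]]
        annih_Lop
    by metis
qed

text \<open>Contracting the second factor of \<Delta> x with a word gives the operator of that word,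
  which preserves the annihilator. So \<open>annihilator_tensor\<close> applies with the annihilator
  in both roles.\<close>

lemma annih_comult:
  assumes "x \<in> annih D"
  shows "\<Delta> x \<in> submod K T hull
    {TP.pt a b | a b. a \<in> carrier A \<and> b \<in> carrier A \<and> (a \<in> annih D \<or> b \<in> annih D)}"
  by (rule TP.annihilator_tensor[OF words_lf annih_submod annih_eq comult_closed[OF
      annih_carrier[OF assms]]])
    (auto simp: Lop_def[symmetric] intro: annih_words assms)

text \<open>Since \<open>S(x) = - \<Sum> S(x\<^sub>1)(x\<^sub>2 - \<epsilon>(x\<^sub>2))\<close> on the kernel of the counit, the antipode maps \<^term>\<open>annih D\<close>
  one step deeper into the filtration than known before.\<close>

lemma annih_antipode:
  assumes "x \<in> annih D"
  shows "antipode A x \<in> annih D"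
proof -
  note Am = M.module_axioms
  let ?S = "antipode A"
  let ?c = "\<lambda>b. b \<ominus> \<epsilon> b \<odot> \<one>"
  let ?\<phi> = "\<lambda>a b. ?S a \<otimes> ?c b"
  have c: "linear_map K A A ?c"
    by (intro linear_map_diff Am linear_map_id smult_linear counit_linear A.one_closed)
  have S: "linear_map K A A ?S" by (rule antipode_linear)
  note Sc = linear_map_closed[OF S] and cc = linear_map_closed[OF c]
  have b: "bilinear_map K A A A ?\<phi>" by (rule mult_bilinear_comp[OF S c])
  have b1: "bilinear_map K A A A (\<lambda>a b. ?S a \<otimes> b)" by (rule mult_bilinear_comp[OF S linear_map_id])
  have b2: "bilinear_map K A A A (\<lambda>a b. \<epsilon> b \<odot> ?S a)" by (rule smult_bilinear[OF counit_linear S])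
  have ce: "\<epsilon> (?c b) = \<zero>\<^bsub>K\<^esub>" if "b \<in> carrier A" for b
    using that counit_one lf_closed[OF counit_linear that]
    by (simp add: lf_minus[OF counit_linear] lf_smult[OF counit_linear] K.diff_eq_zero_iff)
  have Sx: "?S x = \<ominus> tensor_lift K A ?\<phi> (\<Delta> x)" if x: "x \<in> annih D" for x
  proof -
    note xc = annih_carrier[OF x] and dx = comult_closed[OF annih_carrier[OF x]]
    have "tensor_lift K A ?\<phi> (\<Delta> x)
        = tensor_lift K A (\<lambda>a b. ?S a \<otimes> b \<oplus> \<ominus> (\<epsilon> b \<odot> ?S a)) (\<Delta> x)"
      by (rule TP.lift_cong[OF Am b bilinear_map_plus[OF Am b1 bilinear_map_neg[OF Am b2]] _ dx])
        (simp add: a_minus_def A.r_distr A.r_minus smult_mult_right Sc lf_closed[OF counit_linear])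
    also have "\<dots> = tensor_lift K A (\<lambda>a b. ?S a \<otimes> b) (\<Delta> x) \<oplus>
        tensor_lift K A (\<lambda>a b. \<ominus> (\<epsilon> b \<odot> ?S a)) (\<Delta> x)"
      by (rule TP.lift_plus[OF Am b1 bilinear_map_neg[OF Am b2] dx])
    also have "tensor_lift K A (\<lambda>a b. ?S a \<otimes> b) (\<Delta> x) = \<zero>"
      using antipode_left[OF xc] annih_counit[OF x] by simp
    also have "tensor_lift K A (\<lambda>a b. \<ominus> (\<epsilon> b \<odot> ?S a)) (\<Delta> x) =
        \<ominus> tensor_lift K A (\<lambda>a b. \<epsilon> b \<odot> ?S a) (\<Delta> x)"
      by (rule TP.lift_comp[symmetric, OF Am Am linear_map_neg[OF Am linear_map_id] b2 dx])
    also have "tensor_lift K A (\<lambda>a b. \<epsilon> b \<odot> ?S a) (\<Delta> x)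
        = tensor_lift K A (\<lambda>a b. ?S (\<epsilon> b \<odot> a)) (\<Delta> x)"
      by (rule TP.lift_cong[OF Am b2 bilinear_map_comp[OF S Lop_bilinear[OF counit_linear]] _ dx])
        (simp add: linear_map_smult[OF S] lf_closed[OF counit_linear])
    also have "\<dots> = ?S x"
      using TP.lift_comp[symmetric, OF Am Am S Lop_bilinear[OF counit_linear] dx] counit_right[OF
          xc] by simp
    finally show ?thesis using Sc[OF xc] by simp
  qed
  have hull: "{TP.pt a b | a b. a \<in> carrier A \<and> b \<in> carrier A \<and> (a \<in> annih D \<or> b
      \<in> annih D)} \<subseteq> carrier T"
    by (auto intro: TP.pt_closed)
  have cI: "?c b = b" if "b \<in> annih D" for b
    using that annih_counit[OF that] annih_carrier[OF that] by (simp add: a_minus_def)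
  \<comment> \<open>Summands with second factor in the annihilator need only the ideal property,
    because \<open>?c b = b\<close> there; \<open>P\<close> covers the summands whose first factor
    lies in it.\<close>
  have step: "?S x \<in> filt D m"
    if x: "x \<in> annih D" and P: "\<And>a b. \<lbrakk>a \<in> annih D; b \<in> carrier A\<rbrakk> \<Longrightarrow> ?S a \<otimes> ?c b \<in> filt D m" for x m
  proof -
    have "tensor_lift K A ?\<phi> (\<Delta> x) \<in> filt D m"
    proof (rule linear_map_hull[OF TP.T.module_axioms Am TP.lift_linear[OF Am b] filt_submod hull
        _ annih_comult[OF x]])
      fix t assume "t \<in> {TP.pt a b | a b. a \<in> carrier A \<and> b \<in> carrier A \<and> (a \<in> annih D \<or> b
          \<in> annih D)}"
      then obtain a b where t: "t = TP.pt a b" "a \<in> carrier A" "b \<in> carrier A"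
        and ab: "a \<in> annih D \<or> b \<in> annih D" by blast
      from ab have "?S a \<otimes> ?c b \<in> filt D m"
      proof
        assume "b \<in> annih D"
        then show ?thesis
          using cI[of b] filt_left[OF _ Sc[OF t(2)], of b m] by (simp add: annih_def)
      qed (use P t in auto)
      then show "tensor_lift K A ?\<phi> t \<in> filt D m" using t TP.lift_pt[OF Am b] by simp
    qed
    then show ?thesis unfolding Sx[OF x] by (rule submod_uminus[OF filt_submod])
  qed
  have "?S x \<in> filt D n" if "x \<in> annih D" for x n
    using that
  proof (induct n arbitrary: x)
    case 0
    show ?case
      by (rule step[OF 0]) (simp add: counit_mult Sc cc ce annih_carrier lf_closed[OF
          counit_linear])
  next
    case (Suc n)
    show ?case
      by (rule step[OF Suc(2) filt_mult[OF Suc(1) cc ce]])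
  qed
  then show ?thesis using assms unfolding annih_def by blast
qed

theorem annih_hopf_superideal: "hopf_superideal K A (annih D)"
  unfolding hopf_superideal_def
proof (intro conjI)
  show "\<Delta> ` annih D \<subseteq> submod K TT hull
      {TP.pt a b |a b. a \<in> carrier A \<and> b \<in> carrier A \<and> (a \<in> annih D \<or> b \<in> annih D)}"
  proof -
    have "submod K TT = submod K T" by (rule ext) (rule TP.submod_TT)
    then show ?thesis using annih_comult by auto
  qed
qed (use annih_ideal annih_homogeneous annih_counit annih_antipode in auto)

end

end

section \<open>Dual systems of odd derivations\<close>

lemma (in tensor_pair) linear_map_mem:
  assumes M: "module K M" and N: "submod K M N" and f: "linear_map K T M f"
    and pt: "\<And>a b. \<lbrakk>a \<in> carrier A; b \<in> carrier B\<rbrakk> \<Longrightarrow> f (pt a b) \<in> N" and t: "t \<in> carrier T"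
  shows "f t \<in> N"
  using t
proof (induct rule: tensor_induct)
  case zero
  then show ?case using linear_map_zero[OF T.module_axioms M f] submod_zero[OF N] by simp
next
  case (add a b t)
  then show ?case using linear_map_add[OF f pt_closed] pt submod_add[OF N] by simp
qed

lemma (in abelian_group) diff_add_diff:
  "\<lbrakk>x \<in> carrier G; y \<in> carrier G; x' \<in> carrier G; y' \<in> carrier G\<rbrakk> \<Longrightarrow>
    (x \<oplus> x') \<ominus> (y \<oplus> y') = (x \<ominus> y) \<oplus> (x' \<ominus> y')"
  by (simp add: a_minus_def minus_add a_ac)

lemma (in abelian_group) diff_add_diff_cancel:
  "\<lbrakk>x \<in> carrier G; y \<in> carrier G; z \<in> carrier G\<rbrakk> \<Longrightarrow> (x \<ominus> y) \<oplus> (y \<ominus> z) = x \<ominus> z"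
proof -
  assume c: "x \<in> carrier G" "y \<in> carrier G" "z \<in> carrier G"
  have "(x \<ominus> y) \<oplus> (y \<ominus> z) = x \<oplus> (\<ominus> y \<oplus> (y \<oplus> \<ominus> z))" using c by (simp add: a_minus_def a_ac)
  also have "\<dots> = x \<ominus> z" using c by (simp add: r_neg1 a_minus_def)
  finally show ?thesis .
qed

lemma submod_finsum_diff:
  assumes "module K M" and N: "submod K M N" and "finite F"
    and "\<And>j. j \<in> F \<Longrightarrow> f j \<in> carrier M" "\<And>j. j \<in> F \<Longrightarrow> g j \<in> carrier M"
    and "\<And>j. j \<in> F \<Longrightarrow> f j \<ominus>\<^bsub>M\<^esub> g j \<in> N"
  shows "(\<Oplus>\<^bsub>M\<^esub>j \<in> F. f j) \<ominus>\<^bsub>M\<^esub> (\<Oplus>\<^bsub>M\<^esub>j \<in> F. g j) \<in> N"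
proof -
  interpret module K M by fact
  show ?thesis
    using assms(3-6)
  proof (induct F)
    case empty
    then show ?case using submod_zero[OF N] submod_uminus[OF N] by (simp add: a_minus_def)
  next
    case (insert j F)
    have c: "f \<in> F \<rightarrow> carrier M" "g \<in> F \<rightarrow> carrier M" "f j \<in> carrier M" "g j \<in> carrier M"
      using insert by auto
    then show ?case
      using insert submod_add[OF N, of "f j \<ominus>\<^bsub>M\<^esub> g j"]
      by (simp add: M.diff_add_diff)
  qed
qed

section \<open>Spaces of functionals with dual bases\<close>

context hopf begin

text \<open>A linear subspace, saturated under agreement on the carrier, since functionals are total
  functions with arbitrary values elsewhere.\<close>

definition fclosed :: "('a \<Rightarrow> 'k) set \<Rightarrow> bool"
  where "fclosed W \<longleftrightarrow> (\<lambda>x. \<zero>\<^bsub>K\<^esub>) \<in> W \<and> (\<forall>f \<in> W. \<forall>g \<in> W. (\<lambda>x. f x \<oplus>\<^bsub>K\<^esub> g x) \<in> W) \<and>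
    (\<forall>c \<in> carrier K. \<forall>f \<in> W. (\<lambda>x. c \<otimes>\<^bsub>K\<^esub> f x) \<in> W) \<and>
    (\<forall>f \<in> W. \<forall>g. (\<forall>x \<in> carrier A. f x = g x) \<longrightarrow> g \<in> W)"

lemma fclosed_zero: "fclosed W \<Longrightarrow> (\<lambda>x. \<zero>\<^bsub>K\<^esub>) \<in> W"
  and fclosed_add: "\<lbrakk>fclosed W; f \<in> W; g \<in> W\<rbrakk> \<Longrightarrow> (\<lambda>x. f x \<oplus>\<^bsub>K\<^esub> g x) \<in> W"
  and fclosed_scale: "\<lbrakk>fclosed W; c \<in> carrier K; f \<in> W\<rbrakk> \<Longrightarrow> (\<lambda>x. c \<otimes>\<^bsub>K\<^esub> f x) \<in> W"
  and fclosed_ext: "\<lbrakk>fclosed W; f \<in> W; \<And>x. x \<in> carrier A \<Longrightarrow> f x = g x\<rbrakk> \<Longrightarrow> g \<in> W"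
  by (auto simp: fclosed_def)

lemma fclosed_sub:
  assumes "fclosed W" "c \<in> carrier K" "f \<in> W" "g \<in> W" "lf f" "lf g"
  shows "(\<lambda>x. f x \<ominus>\<^bsub>K\<^esub> c \<otimes>\<^bsub>K\<^esub> g x) \<in> W"
proof (rule fclosed_ext[OF assms(1)])
  show "(\<lambda>x. f x \<oplus>\<^bsub>K\<^esub> (\<ominus>\<^bsub>K\<^esub> c) \<otimes>\<^bsub>K\<^esub> g x) \<in> W"
    using assms by (intro fclosed_add fclosed_scale) auto
qed (use assms in \<open>simp add: a_minus_def K.l_minus lf_closed\<close>)

text \<open>The last clause says that the \<xi>_i span \<open>W\<close>, phrased through closed
  subspaces in place of linear combinations of functions. With the duality relations they form a
  basis.\<close>

definition dual_system :: "('a \<Rightarrow> 'k) set \<Rightarrow> nat \<Rightarrow> (nat \<Rightarrow> 'a \<Rightarrow> 'k) \<Rightarrow> (nat \<Rightarrow> 'a) \<Rightarrow> bool"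
  where "dual_system W n \<xi> y \<longleftrightarrow> (\<forall>i<n. \<xi> i \<in> W \<and> y i \<in> carrier A) \<and>
    (\<forall>i<n. \<forall>j<n. \<xi> i (y j) = (if i = j then \<one>\<^bsub>K\<^esub> else \<zero>\<^bsub>K\<^esub>)) \<and>
    (\<forall>C. fclosed C \<longrightarrow> (\<forall>i<n. \<xi> i \<in> C) \<longrightarrow> W \<subseteq> C)"

text \<open>Interpolation by \<Sum> v(y_i) \<xi>_i, built node by node: adding a multiple of \<xi>_m
  changes the value at y_m and at no other node.\<close>

lemma dual_system_match:
  assumes W: "fclosed W" "\<And>w. w \<in> W \<Longrightarrow> lf w" and ds: "dual_system W n \<xi> y" and v: "lf v"
  shows "\<exists>w \<in> W. \<forall>i<n. w (y i) = v (y i)"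
proof -
  have yc: "y i \<in> carrier A" and \<xi>: "\<xi> i \<in> W" if "i < n" for i
    using ds that by (simp_all add: dual_system_def)
  have "m \<le> n \<Longrightarrow> \<exists>w \<in> W. \<forall>i<m. w (y i) = v (y i)" for m
  proof (induct m)
    case 0
    then show ?case using fclosed_zero[OF W(1)] by auto
  next
    case (Suc m)
    then obtain w where w: "w \<in> W" "\<forall>i<m. w (y i) = v (y i)" by auto
    note m = yc[of m] \<xi>[of m] W(2)[OF w(1)]
    let ?c = "v (y m) \<ominus>\<^bsub>K\<^esub> w (y m)"
    have c: "?c \<in> carrier K" using m Suc v by (simp add: lf_closed)
    have "(\<lambda>x. w x \<oplus>\<^bsub>K\<^esub> ?c \<otimes>\<^bsub>K\<^esub> \<xi> m x) \<in> W"
      using Suc m w c by (intro fclosed_add[OF W(1)] fclosed_scale[OF W(1)]) auto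
    moreover have "w (y i) \<oplus>\<^bsub>K\<^esub> ?c \<otimes>\<^bsub>K\<^esub> \<xi> m (y i) = v (y i)" if "i < Suc m" for i
    proof (cases "i = m")
      case True
      then show ?thesis
        using Suc m v ds c by (simp add: dual_system_def K.add_diff_cancel lf_closed)
    next
      case False
      then show ?thesis
        using Suc m v ds c w that yc[of i] by (simp add: dual_system_def lf_closed)
    qed
    ultimately show ?case by (intro bexI[of _ "\<lambda>x. w x \<oplus>\<^bsub>K\<^esub> ?c \<otimes>\<^bsub>K\<^esub> \<xi> m x"]) auto
  qed
  then show ?thesis by blast
qed

text \<open>A finite separating set \<open>F\<close> bounds the dimension of \<open>W\<close>. The
  functionals vanishing at f have codimension at most one in \<open>W\<close> and are separated by
  the rest of \<open>F\<close>, so a system for them needs at most one new pair.\<close>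

lemma dual_system_exists:
  assumes "finite F" "F \<subseteq> carrier A" "fclosed W" "\<And>w. w \<in> W \<Longrightarrow> lf w"
    and "\<And>w x. \<lbrakk>w \<in> W; \<And>f. f \<in> F \<Longrightarrow> w f = \<zero>\<^bsub>K\<^esub>; x \<in> carrier A\<rbrakk> \<Longrightarrow> w x = \<zero>\<^bsub>K\<^esub>"
  shows "\<exists>n \<xi> y. dual_system W n \<xi> y \<and> (\<forall>i<n. y i \<in> F)"
  using assms
proof (induct F arbitrary: W rule: finite_induct)
  case empty
  have "dual_system W 0 (\<lambda>i x. \<zero>\<^bsub>K\<^esub>) (\<lambda>i. \<zero>)"
    unfolding dual_system_def using empty(4) fclosed_ext[OF _ fclosed_zero] by auto
  then show ?case by blast
next
  case (insert f F)
  define W' where "W' = {w \<in> W. w f = \<zero>\<^bsub>K\<^esub>}"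
  have f: "f \<in> carrier A" using insert by simp
  have W': "fclosed W'"
    unfolding fclosed_def W'_def
    using fclosed_zero[OF insert(5)] fclosed_add[OF insert(5)] fclosed_scale[OF insert(5)]
      fclosed_ext[OF insert(5)] f by (auto; metis)
  have lW': "lf w" if "w \<in> W'" for w using that insert(6) by (simp add: W'_def)
  have "\<exists>n \<xi> y. dual_system W' n \<xi> y \<and> (\<forall>i<n. y i \<in> F)"
    using insert(4,6,7) by (intro insert(3)[OF _ W' lW']) (auto simp: W'_def)
  then obtain n \<xi> y where ds: "dual_system W' n \<xi> y" and yF: "\<forall>i<n. y i \<in> F" by blast
  show ?case
  proof (cases "W' = W")
    case True
    then show ?thesis using ds yF by auto
  next
    case False
    then obtain w where w: "w \<in> W" "w f \<noteq> \<zero>\<^bsub>K\<^esub>" unfolding W'_def by blast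
    have wl: "lf w" by (rule insert(6)[OF w(1)])
    let ?k = "inv\<^bsub>K\<^esub> (w f)"
    have k: "?k \<in> carrier K" "?k \<otimes>\<^bsub>K\<^esub> w f = \<one>\<^bsub>K\<^esub>"
      using w lf_closed[OF wl f] K.field_Units by (auto intro: K.Units_l_inv)
    define w1 where "w1 = (\<lambda>x. ?k \<otimes>\<^bsub>K\<^esub> w x)"
    have w1: "w1 \<in> W" "w1 f = \<one>\<^bsub>K\<^esub>"
      using fclosed_scale[OF insert(5) k(1) w(1)] k by (simp_all add: w1_def)
    have w1l: "lf w1" by (rule insert(6)[OF w1(1)])
    obtain v where v: "v \<in> W'" "\<forall>i<n. v (y i) = w1 (y i)"
      using dual_system_match[OF W' lW' ds w1l] by blast
    have vW: "v \<in> W" "v f = \<zero>\<^bsub>K\<^esub>" "lf v" using v lW' by (auto simp: W'_def)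
    \<comment> \<open>\<open>v\<close> has the same values as \<open>w1\<close> at the old nodes and
      vanishes at f, so the difference is dual to f and kills the old nodes.\<close>
    define \<zeta> where "\<zeta> = (\<lambda>x. w1 x \<ominus>\<^bsub>K\<^esub> \<one>\<^bsub>K\<^esub> \<otimes>\<^bsub>K\<^esub> v x)"
    have \<zeta>W: "\<zeta> \<in> W" unfolding \<zeta>_def
        using fclosed_sub[OF insert(5) K.one_closed w1(1) vW(1) w1l vW(3)] .
    have \<zeta>l: "lf \<zeta>" by (rule insert(6)[OF \<zeta>W])
    have yc: "y i \<in> carrier A" "\<xi> i \<in> W'" if "i < n" for i
      using ds that by (simp_all add: dual_system_def)
    have \<zeta>f: "\<zeta> f = \<one>\<^bsub>K\<^esub>" using w1 vW by (simp add: \<zeta>_def a_minus_def)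
    have \<zeta>y: "\<zeta> (y i) = \<zero>\<^bsub>K\<^esub>" if "i < n" for i
      using v(2) that yc[OF that] w1l by (simp add: \<zeta>_def lf_closed K.diff_eq_zero_iff)
    have "dual_system W (Suc n) (\<xi>(n := \<zeta>)) (y(n := f))"
      unfolding dual_system_def
    proof (intro conjI allI impI)
      fix i j assume "i < Suc n" "j < Suc n"
      then show "(\<xi>(n := \<zeta>)) i ((y(n := f)) j) = (if i = j then \<one>\<^bsub>K\<^esub> else \<zero>\<^bsub>K\<^esub>)"
        using ds \<zeta>f \<zeta>y yc(2) by (auto simp: dual_system_def less_Suc_eq W'_def)
    next
      fix C assume C: "fclosed C" and \<xi>C: "\<forall>i<Suc n. (\<xi>(n := \<zeta>)) i \<in> C"
      have "\<xi> i \<in> C" if "i < n" for i using \<xi>C[rule_format, of i] that by simp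
      then have W'C: "W' \<subseteq> C" using ds C by (simp add: dual_system_def)
      have \<zeta>C: "\<zeta> \<in> C" using \<xi>C[rule_format, of n] by simp
      show "W \<subseteq> C"
      proof
        fix u assume u: "u \<in> W"
        note ul = insert(6)[OF u]
        have uf: "u f \<in> carrier K" by (rule lf_closed[OF ul f])
        \<comment> \<open>Removing the component along \<open>\<zeta>\<close> makes the value at f
          zero, so the remainder is spanned by the old functionals.\<close>
        let ?u = "\<lambda>x. u x \<ominus>\<^bsub>K\<^esub> u f \<otimes>\<^bsub>K\<^esub> \<zeta> x"
        have "?u \<in> W" by (rule fclosed_sub[OF insert(5) uf u \<zeta>W ul \<zeta>l])
        then have "?u \<in> W'" using uf \<zeta>f by (simp add: W'_def K.diff_eq_zero_iff)
        then have "(\<lambda>x. ?u x \<oplus>\<^bsub>K\<^esub> u f \<otimes>\<^bsub>K\<^esub> \<zeta> x) \<in> C"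
          using W'C \<zeta>C uf by (intro fclosed_add[OF C] fclosed_scale[OF C]) auto
        then show "u \<in> C"
          using ul \<zeta>l uf by (elim fclosed_ext[OF C]) (simp add: K.diff_add_cancel lf_closed)
      qed
    qed (use yc \<zeta>W f in \<open>auto simp: W'_def less_Suc_eq\<close>)
    moreover have "\<forall>i<Suc n. (y(n := f)) i \<in> insert f F" using yF by (simp add: less_Suc_eq)
    ultimately show ?thesis by blast
  qed
qed

lemma pder_one: "pder p d \<Longrightarrow> d \<one> = \<zero>\<^bsub>K\<^esub>"
proof -
  assume d: "pder p d"
  have c: "d \<one> \<in> carrier K" by (rule lf_closed[OF pder_lf[OF d] A.one_closed])
  then have "d \<one> = d \<one> \<oplus>\<^bsub>K\<^esub> d \<one>"
    using pder_mult[OF d A.one_closed A.one_closed] by (simp add: counit_one)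
  then show ?thesis using c by (metis K.add.l_cancel_one')
qed

text \<open>By the Leibniz rule the kernel of a point derivation is a subalgebra, so finitely many
  generators separate the point derivations. This supplies the finite set for
  \<open>dual_system_exists\<close>.\<close>

lemma pder_generators:
  assumes d: "pder p d" and F: "(\<lambda>B. subring B A \<and> submod K A B) hull F = carrier A"
    and z: "\<And>f. f \<in> F \<Longrightarrow> d f = \<zero>\<^bsub>K\<^esub>" and x: "x \<in> carrier A" "F \<subseteq> carrier A"
  shows "d x = \<zero>\<^bsub>K\<^esub>"
proof -
  let ?B = "{x \<in> carrier A. d x = \<zero>\<^bsub>K\<^esub>}"
  have s: "submod K A ?B"
    using submod_kernel[OF M.module_axioms L.module_axioms pder_lf[OF d]] by simp
  have "subring ?B A"
    by (rule A.subringI)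
      (auto simp: pder_one[OF d] pder_mult[OF d] lf_closed[OF counit_linear] lf_add[OF pder_lf[OF
          d]]
        linear_map_uminus[OF M.module_axioms L.module_axioms pder_lf[OF d], simplified])
  then have "(\<lambda>B. subring B A \<and> submod K A B) hull F \<subseteq> ?B"
    using s z x(2) by (intro hull_minimal) auto
  then show ?thesis using F x by auto
qed

text \<open>Correcting \<open>y\<close> to \<open>\<Sum> S(y\<^sub>1) y\<^sub>2\<close>, restricted to even \<open>y\<^sub>1\<close> and odd \<open>y\<^sub>2\<close>, makes it invariant
  modulo the odd elements, so that odd derivations act on it by constants.\<close>

lemma odd_invariant:
  assumes y: "y \<in> gr A 1"
  obtains y' where "y' \<in> gr A 1"
    and "\<And>d N. \<lbrakk>pder 1 d; ideal N A; gr A 1 \<subseteq> N\<rbrakk> \<Longrightarrow> Lop d y' \<ominus> d y \<odot> \<one> \<in> N"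
proof -
  note Am = M.module_axioms
  let ?S = "antipode A"
  note S = antipode_linear
  note Sc = linear_map_closed[OF S]
  have yc: "y \<in> carrier A" by (rule S.gr_closed[OF y])
  note dy = comult_closed[OF yc]
  let ?\<phi> = "\<lambda>a b. ?S (hpart A 0 a) \<otimes> hpart A 1 b"
  have b: "bilinear_map K A A A ?\<phi>"
    by (rule mult_bilinear_comp[OF linear_map_comp[OF S.hpart_linear S] S.hpart_linear])
  define y' where "y' = tensor_lift K A ?\<phi> (\<Delta> y)"
  show ?thesis
  proof (rule that[of y'])
    show "y' \<in> gr A 1"
      unfolding y'_def
    proof (rule TP.linear_map_mem[OF Am S.gr_submod TP.lift_linear[OF Am b] _ dy])
      fix a b assume "a \<in> carrier A" "b \<in> carrier A"
      moreover from this have "?\<phi> a b \<in> gr A (0 + 1)"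
        by (intro gr_mult antipode_gr S.hpart_gr)
      ultimately show "tensor_lift K A ?\<phi> (TP.pt a b) \<in> gr A 1"
        using TP.lift_pt[OF Am \<open>bilinear_map K A A A ?\<phi>\<close>] by simp
    qed
    fix d N assume d: "pder 1 d" and "ideal N A" and odd: "gr A 1 \<subseteq> N"
    interpret N: ideal N A by fact
    have Ns: "submod K A N" by (rule ideal_submod[OF \<open>ideal N A\<close>])
    note l = pder_lf[OF d] and Ll = Lop_linear[OF pder_lf[OF d]]
        and Lc = Lop_closed[OF pder_lf[OF d]]
    have b1: "bilinear_map K A A A (\<lambda>a b. Lop d (?\<phi> a b))" by (rule bilinear_map_comp[OF Ll b])
    have b2: "bilinear_map K A A A (\<lambda>a b. ?S a \<otimes> Lop d b)" by (rule mult_bilinear_comp[OF S Ll])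
    \<comment> \<open>The second lift is the antipode identity for \<open>Lop d y\<close>, by
      \<open>lift_comult_Lop\<close>, and equals d(y) times the unit. It remains to see that
      dropping the other parity components changes only terms with odd factors.\<close>
    have "tensor_lift K A (\<lambda>a b. Lop d (?\<phi> a b)) (\<Delta> y)
        \<ominus> tensor_lift K A (\<lambda>a b. ?S a \<otimes> Lop d b) (\<Delta> y) \<in> N"
    proof (rule TP.linear_map_mem[OF Am Ns _ _ dy])
      show "linear_map K T A (\<lambda>t. tensor_lift K A (\<lambda>a b. Lop d (?\<phi> a b)) t \<ominus>
          tensor_lift K A (\<lambda>a b. ?S a \<otimes> Lop d b) t)"
        by (intro linear_map_diff Am TP.lift_linear b1 b2)
      fix a b assume ab: "a \<in> carrier A" "b \<in> carrier A"
      define s0 s1 u0 u1 v where "s0 = ?S (hpart A 0 a)" and "s1 = ?S (hpart A 1 a)"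
        and "u0 = hpart A 0 (Lop d b)" and "u1 = hpart A 1 (Lop d b)"
        and "v = Lop d s0 \<otimes> par 1 (hpart A 1 b)"
      have c: "s0 \<in> carrier A" "s1 \<in> carrier A" "u0 \<in> carrier A" "u1 \<in> carrier A" "v \<in> carrier A"
        unfolding s0_def s1_def u0_def u1_def v_def using ab
        by (simp_all add: S.hpart_closed Sc Lc par_closed)
      have "?S a = s0 \<oplus> s1"
        using S.hpart_decomp[OF ab(1), of 0] linear_map_add[OF S S.hpart_closed[OF ab(1)]
            S.hpart_closed[OF ab(1)]]
        unfolding s0_def s1_def by (metis add.left_neutral)
      moreover have "Lop d b = u0 \<oplus> u1"
        using S.hpart_decomp[OF Lc[OF ab(2)], of 0] by (simp add: u0_def u1_def)
      moreover have "Lop d (?\<phi> a b) = v \<oplus> s0 \<otimes> u0"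
        using Lop_mult[OF d c(1) S.hpart_closed[OF ab(2), of 1]] Lop_hpart[OF d ab(2), of 1]
        by (simp add: v_def s0_def u0_def)
      ultimately have "Lop d (?\<phi> a b) \<ominus> ?S a \<otimes> Lop d b
          = (v \<oplus> s0 \<otimes> u0) \<ominus> (s0 \<oplus> s1) \<otimes> (u0 \<oplus> u1)"
        by simp
      also have "\<dots> = (v \<oplus> s0 \<otimes> u0) \<ominus> ((s1 \<otimes> (u0 \<oplus> u1) \<oplus> s0 \<otimes> u1) \<oplus> s0 \<otimes> u0)"
        using c by (simp add: A.l_distr A.r_distr A.a_ac)
      also have "\<dots> = v \<ominus> (s1 \<otimes> (u0 \<oplus> u1) \<oplus> s0 \<otimes> u1)"
        using c by (simp add: A.diff_add_diff A.diff_eq_zero_iff[THEN iffD2])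
      \<comment> \<open>The product of even parts \<open>s0 \<otimes> u0\<close> has cancelled, and
        each remaining summand has an odd factor.\<close>
      also have "\<dots> \<in> N"
      proof -
        have "par 1 (hpart A 1 b) \<in> N"
          using par_gr[OF S.hpart_gr[OF ab(2), of 1], of 1] koszul_mem[OF Ns] S.hpart_gr[OF ab(2),
              of 1] odd by auto
        then have v: "v \<in> N" using N.I_l_closed Lc[OF c(1)] by (simp add: v_def)
        have "s1 \<in> N" using antipode_gr[OF S.hpart_gr[OF ab(1), of 1]] odd by (auto simp: s1_def)
        moreover have "u1 \<in> N" using S.hpart_gr[OF Lc[OF ab(2)], of 1] odd by (auto simp: u1_def)
        ultimately show ?thesis
          using c N.I_r_closed[of s1 "u0 \<oplus> u1"] N.I_l_closed[of u1 s0] v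
          by (intro submod_minus[OF Ns] submod_add[OF Ns]) auto
      qed
      finally show "tensor_lift K A (\<lambda>a b. Lop d (?\<phi> a b)) (TP.pt a b) \<ominus>
          tensor_lift K A (\<lambda>a b. ?S a \<otimes> Lop d b) (TP.pt a b) \<in> N"
        using ab by (simp add: TP.lift_pt[OF Am b1] TP.lift_pt[OF Am b2])
    qed
    moreover have "tensor_lift K A (\<lambda>a b. Lop d (?\<phi> a b)) (\<Delta> y) = Lop d y'"
      unfolding y'_def by (rule TP.lift_comp[OF Am Am Ll b dy, symmetric])
    moreover have "tensor_lift K A (\<lambda>a b. ?S a \<otimes> Lop d b) (\<Delta> y) = d y \<odot> \<one>"
      using lift_comult_Lop[OF Am mult_bilinear_comp[OF S linear_map_id] l yc]
        antipode_left[OF Lc[OF yc]] counit_Lop[OF l yc] by simp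
    ultimately show "Lop d y' \<ominus> d y \<odot> \<one> \<in> N" by simp
  qed
qed

end

section \<open>The point derivations that vanish on the annihilator\<close>

locale sgroup = hopf K A
  for K :: "('k, 'l) ring_scheme" and A :: "('k, 'a, 'm) hopf_scheme" (structure) +
  assumes supercomm: "supercommutative A" and fin_gen: "finitely_generated K A"
    and char_0: "\<And>n::nat. n > 0 \<Longrightarrow> [n] \<cdot>\<^bsub>K\<^esub> \<one>\<^bsub>K\<^esub> \<noteq> \<zero>\<^bsub>K\<^esub>"
begin

lemma supercommD: "\<lbrakk>x \<in> gr A i; y \<in> gr A j\<rbrakk> \<Longrightarrow> x \<otimes> y = koszul A (i * j) (y \<otimes> x)"
  using supercomm unfolding supercommutative_def by blast

lemma odd_anticomm: "\<lbrakk>x \<in> gr A 1; y \<in> gr A 1\<rbrakk> \<Longrightarrow> x \<otimes> y = \<ominus> (y \<otimes> x)"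
  by (subst supercommD[of x 1 y 1]) (simp_all add: koszul_def)

text \<open>Anticommutation of x with itself gives 2 x x = 0, and 2 is invertible in characteristic
  zero.\<close>

lemma odd_square:
  assumes x: "x \<in> gr A 1"
  shows "x \<otimes> x = \<zero>"
proof -
  let ?z = "x \<otimes> x" and ?k = "[(2::nat)] \<cdot>\<^bsub>K\<^esub> \<one>\<^bsub>K\<^esub>"
  have z: "?z \<in> carrier A" using S.gr_closed[OF x] by simp
  have k: "?k \<in> carrier K" "?k = \<one>\<^bsub>K\<^esub> \<oplus>\<^bsub>K\<^esub> \<one>\<^bsub>K\<^esub>" by (simp_all add: numeral_2_eq_2)
  have "?k \<odot> ?z = ?z \<oplus> ?z" unfolding k(2) using z by (simp add: M.smult_l_distr)
  also have "\<dots> = ?z \<oplus> \<ominus> ?z" using odd_anticomm[OF x x] by simp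
  also have "\<dots> = \<zero>" using z by (simp add: A.r_neg)
  finally have kz: "?k \<odot> ?z = \<zero>" .
  have u: "?k \<in> Units K" using k(1) char_0[of 2] K.field_Units by simp
  have "?z = (inv\<^bsub>K\<^esub> ?k \<otimes>\<^bsub>K\<^esub> ?k) \<odot> ?z" using z K.Units_l_inv[OF u] by simp
  also have "\<dots> = inv\<^bsub>K\<^esub> ?k \<odot> (?k \<odot> ?z)"
    by (rule M.smult_assoc1[OF K.Units_inv_closed[OF u] k(1) z])
  also have "\<dots> = \<zero>" unfolding kz using u by simp
  finally show ?thesis .
qed

section \<open>Vanishing order along the odd directions\<close>

context
  fixes D :: "bit \<Rightarrow> ('a \<Rightarrow> 'k) set"
  assumes D: "\<And>p d. d \<in> D p \<Longrightarrow> pder p d"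
    and Dcl: "\<And>p. fclosed (D p)"
    and Dbr: "\<And>p q f g. \<lbrakk>f \<in> D p; g \<in> D q\<rbrakk> \<Longrightarrow>
      (\<lambda>x. f (Lop g x) \<ominus>\<^bsub>K\<^esub> koszul (base K) (p * q) (g (Lop f x))) \<in> D (p + q)"
begin

text \<open>The family with its odd members removed, so that the construction of
  \<open>annih\<close> also yields the annihilator of the even part.\<close>

definition even_part :: "bit \<Rightarrow> ('a \<Rightarrow> 'k) set"
  where "even_part p = (if p = 0 then D 0 else {})"

definition I\<^sub>0 :: "'a set"
  where "I\<^sub>0 = annih even_part"

lemma even_part: "d \<in> even_part p \<Longrightarrow> pder p d"
  by (auto simp: even_part_def D split: if_splits)

lemmas Dl = pder_lf[OF D]

lemma I0_ideal: "ideal I\<^sub>0 A"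
  unfolding I\<^sub>0_def by (rule annih_ideal[OF even_part])

lemmas I0_submod = ideal_submod[OF I0_ideal]

lemmas I0_carrier = submod_carrier[OF I0_submod]

lemma I0_counit: "x \<in> I\<^sub>0 \<Longrightarrow> \<epsilon> x = \<zero>\<^bsub>K\<^esub>"
  unfolding I\<^sub>0_def by (rule annih_counit[OF even_part])

lemma I0_Lop: "\<lbrakk>d \<in> D 0; x \<in> I\<^sub>0\<rbrakk> \<Longrightarrow> Lop d x \<in> I\<^sub>0"
  unfolding I\<^sub>0_def by (rule annih_Lop[OF even_part, where p = 0]) (auto simp: even_part_def)

lemma I0_greatest:
  assumes "N \<subseteq> carrier A" "\<And>x. x \<in> N \<Longrightarrow> \<epsilon> x = \<zero>\<^bsub>K\<^esub>"
    and "\<And>d x. \<lbrakk>d \<in> D 0; x \<in> N\<rbrakk> \<Longrightarrow> Lop d x \<in> N"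
  shows "N \<subseteq> I\<^sub>0"
  unfolding I\<^sub>0_def using assms by (intro annih_greatest[OF even_part]) (auto simp: even_part_def
      split: if_splits)

text \<open>Even operators preserve parity and the counit kills odd elements, so the odd elements
  form a stable subspace.\<close>

lemma odd_I0: "gr A 1 \<subseteq> I\<^sub>0"
proof (rule I0_greatest)
  show "Lop d x \<in> gr A 1" if "d \<in> D 0" "x \<in> gr A 1" for d x
    using Lop_gr[where p = 0, OF Dl[OF that(1)] pder_other[OF D[OF that(1)]] that(2)] by simp
qed (auto simp: counit_odd S.gr_closed)

text \<open>Closure under the bracket read on operators: exchanging the two costs an error term that
  is again an operator from \<open>D p\<close>.\<close>

lemma Lop_commute:
  assumes f: "f \<in> D p" and g: "g \<in> D 0"
  shows "\<exists>h \<in> D p. \<forall>x \<in> carrier A. Lop f (Lop g x) = Lop h x \<oplus> Lop g (Lop f x)"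
proof -
  let ?h = "\<lambda>x. f (Lop g x) \<ominus>\<^bsub>K\<^esub> g (Lop f x)"
  note l = Dl[OF f] Dl[OF g]
  have h: "?h \<in> D p" using Dbr[OF f g] by simp
  have "Lop f (Lop g x) = Lop ?h x \<oplus> Lop g (Lop f x)" if x: "x \<in> carrier A" for x
  proof -
    have "Lop f (Lop g x) = Lop (\<lambda>x. f (Lop g x)) x" by (rule Lop_Lop[OF l x])
    also have "\<dots> = Lop (\<lambda>x. ?h x \<oplus>\<^bsub>K\<^esub> g (Lop f x)) x"
      using l x by (intro Lop_cong lf_Lop) (simp_all add: K.diff_add_cancel lf_closed Lop_closed)
    also have "\<dots> = Lop ?h x \<oplus> Lop (\<lambda>x. g (Lop f x)) x"
      by (rule Lop_plus[OF Dl[OF h] lf_Lop[OF l(2,1)] x])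
    finally show ?thesis using Lop_Lop[OF l(2,1) x] by simp
  qed
  then show ?thesis using h by blast
qed

lemma Lop_anticommute:
  assumes f: "f \<in> D 1" and g: "g \<in> D 1"
  shows "\<exists>h \<in> D 0. \<forall>x \<in> carrier A. Lop f (Lop g x) = Lop h x \<ominus> Lop g (Lop f x)"
proof -
  let ?h = "\<lambda>x. f (Lop g x) \<oplus>\<^bsub>K\<^esub> g (Lop f x)"
  note l = Dl[OF f] Dl[OF g]
  have c: "f (Lop g x) \<in> carrier K" "g (Lop f x) \<in> carrier K" if "x \<in> carrier A" for x
    using l that by (simp_all add: lf_closed Lop_closed)
  have h: "?h \<in> D 0"
  proof (rule fclosed_ext[OF Dcl])
    show "(\<lambda>x. f (Lop g x) \<ominus>\<^bsub>K\<^esub> koszul (base K) (1 * 1) (g (Lop f x))) \<in> D 0"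
      using Dbr[OF f g] by simp
  qed (use c in \<open>simp add: koszul_def a_minus_def\<close>)
  have "Lop f (Lop g x) = Lop ?h x \<ominus> Lop g (Lop f x)" if x: "x \<in> carrier A" for x
  proof -
    have "Lop ?h x = Lop f (Lop g x) \<oplus> Lop g (Lop f x)"
      using Lop_plus[OF lf_Lop[OF l] lf_Lop[OF l(2,1)] x] Lop_Lop[OF l x] Lop_Lop[OF l(2,1) x]
          by simp
    then show ?thesis
      using l x Lop_closed by (simp add: a_minus_def A.a_assoc A.r_neg)
  qed
  then show ?thesis using h by blast
qed

text \<open>The order of vanishing under odd operators, with \<open>G 1 = I\<^sub>0\<close>.
  Requiring membership in \<open>I\<^sub>0\<close> at every positive level is what keeps each level
  stable under the even operators as well.\<close>

primrec G :: "nat \<Rightarrow> 'a set"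
  where "G 0 = carrier A"
  | "G (Suc k) = {x \<in> G k. x \<in> I\<^sub>0 \<and> (\<forall>d \<in> D 1. Lop d x \<in> G k)}"

lemma G_submod: "submod K A (G k)"
proof (induct k)
  case 0
  show ?case by (simp add: submod_univ M.module_axioms)
next
  case (Suc k)
  show ?case
    using submod_carrier[OF Suc] submod_zero[OF Suc] submod_add[OF Suc] submod_smult[OF Suc]
      submod_zero[OF I0_submod] submod_add[OF I0_submod] submod_smult[OF I0_submod]
    by (intro submodI M.module_axioms)
      (auto simp: linear_map_zero[OF M.module_axioms M.module_axioms Lop_linear[OF Dl]]
        linear_map_add[OF Lop_linear[OF Dl]] linear_map_smult[OF Lop_linear[OF Dl]])
qed

lemmas G_carrier = submod_carrier[OF G_submod]

lemma G_pred: "x \<in> G (Suc k) \<Longrightarrow> x \<in> G k"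
  and G_I0: "x \<in> G (Suc k) \<Longrightarrow> x \<in> I\<^sub>0"
  and G_Lop: "\<lbrakk>x \<in> G (Suc k); d \<in> D 1\<rbrakk> \<Longrightarrow> Lop d x \<in> G k"
  by auto

lemma I0_G: "x \<in> I\<^sub>0 \<Longrightarrow> x \<in> G (Suc 0)"
  using I0_carrier Lop_closed[OF Dl] by auto

lemma G_hpart: "x \<in> G k \<Longrightarrow> hpart A i x \<in> G k"
proof (induct k arbitrary: x i)
  case (Suc k)
  have "hpart A i x \<in> I\<^sub>0"
    using S.homogeneousD[OF I0_submod _ G_I0[OF Suc(2)]] annih_homogeneous[OF even_part]
    by (simp add: I\<^sub>0_def)
  moreover have "Lop d (hpart A i x) \<in> G k" if d: "d \<in> D 1" for d
    using Lop_hpart[OF D[OF d] G_carrier[OF Suc(2)]] Suc(1)[OF G_Lop[OF Suc(2) d]] by simp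
  ultimately show ?case using Suc(1)[OF G_pred[OF Suc(2)]] by simp
qed (simp add: S.hpart_closed)

lemma G_par: "x \<in> G k \<Longrightarrow> par p x \<in> G k"
  by (rule par_mem[OF G_submod]) (auto intro: S.homogeneousI G_carrier G_hpart)

text \<open>The superderivation rule puts a derivative on one factor and lowers its level by at most
  one, so the induction runs on the total level i + j. A first factor of level 0 is treated apart,
  since its level cannot drop.\<close>

lemma G_mult: "\<lbrakk>x \<in> G i; y \<in> G j\<rbrakk> \<Longrightarrow> x \<otimes> y \<in> G (i + j)"
proof (induct "i + j" arbitrary: i j x y)
  case 0
  then show ?case by simp
next
  case (Suc m)
  note xc = G_carrier[OF Suc(3)] and yc = G_carrier[OF Suc(4)]
  have gen: "x' \<otimes> y' \<in> G m" if "x' \<in> G i'" "y' \<in> G j'" "m = i' + j'" for x' y' i' j'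
    using Suc(1)[OF that(3,1,2)] that(3) by simp
  have "x \<otimes> y \<in> G m \<and> x \<otimes> y \<in> I\<^sub>0 \<and> (\<forall>d \<in> D 1. Lop d (x \<otimes> y) \<in> G m)"
  proof (cases i)
    case 0
    then obtain j' where j: "j = Suc j'" "m = j'" using Suc(2) by (cases j) auto
    have y: "y \<in> G (Suc m)" using Suc(4) j by simp
    have "Lop d x \<otimes> par p y \<oplus> x \<otimes> Lop d y \<in> G m" if d: "d \<in> D 1" for d p
      using gen[of "Lop d x" 0 "par p y" m] gen[of x 0 "Lop d y" m] G_par[OF G_pred[OF y]]
          G_Lop[OF y d] xc
        Lop_closed[OF Dl[OF d] xc] by (intro submod_add[OF G_submod]) auto
    then show ?thesis
      using gen[of x 0 y m] G_pred[OF y] xc yc ideal.I_l_closed[OF I0_ideal G_I0[OF y] xc]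
      by (simp add: Lop_mult[OF D])
  next
    case (Suc i')
    then have m: "m = i' + j" using Suc.hyps(2) by simp
    have x: "x \<in> G (Suc i')" using Suc.prems Suc by simp
    \<comment> \<open>For j = 0 the derivative of y is just an element of the algebra; the level
      \<open>i' = m\<close> is then supplied by x alone.\<close>
    have xy: "x \<otimes> z \<in> G m" if z: "z \<in> carrier A" "j = 0 \<or> z \<in> G (j - 1)" for z
    proof (cases j)
      case 0
      then show ?thesis using gen[of x i' z j] G_pred[OF x] m z by simp
    next
      case (Suc j')
      then show ?thesis using gen[of x "Suc i'" z j'] x m z by simp
    qed
    have Ly: "j = 0 \<or> Lop d y \<in> G (j - 1)" if "d \<in> D 1" for d
      using G_Lop[of y "j - 1" d] Suc.prems that by (cases j) auto
    have "Lop d x \<otimes> par p y \<oplus> x \<otimes> Lop d y \<in> G m" if d: "d \<in> D 1" for d p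
      using gen[of "Lop d x" i' "par p y" j] G_par[of y j] G_Lop[OF x d] m xy[OF _ Ly[OF d]]
          Suc.prems
        Lop_closed[OF Dl[OF d] yc] by (intro submod_add[OF G_submod]) auto
    then show ?thesis
      using gen[of x i' y j] G_pred[OF x] m xc yc Suc.prems ideal.I_r_closed[OF I0_ideal G_I0[OF
          x] yc]
      by (simp add: Lop_mult[OF D])
  qed
  then show ?case unfolding Suc(2)[symmetric] by simp
qed

text \<open>Moving an odd operator past an even one costs another odd operator, which lowers the
  level by one just like the original.\<close>

lemma G_even: "\<lbrakk>d \<in> D 0; x \<in> G k\<rbrakk> \<Longrightarrow> Lop d x \<in> G k"
proof (induct k arbitrary: x)
  case 0
  then show ?case using Lop_closed[OF Dl] by simp
next
  case (Suc k)
  note xc = G_carrier[OF Suc(3)]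
  have "Lop f (Lop d x) \<in> G k" if f: "f \<in> D 1" for f
  proof -
    obtain h where "h \<in> D 1" "Lop f (Lop d x) = Lop h x \<oplus> Lop d (Lop f x)"
      using Lop_commute[OF f Suc(2)] xc by blast
    then show ?thesis
      using Suc(1)[OF Suc(2) G_Lop[OF Suc(3) f]] G_Lop[OF Suc(3)] submod_add[OF G_submod] by simp
  qed
  then show ?case
    using Suc(1)[OF Suc(2) G_pred[OF Suc(3)]] I0_Lop[OF Suc(2) G_I0[OF Suc(3)]] by simp
qed

section \<open>The Euler operator and the nilpotence of odd coordinates\<close>

context
  fixes n :: nat and \<xi> y
  assumes ds: "dual_system (D 1) n \<xi> y" and odd: "\<And>j. j < n \<Longrightarrow> y j \<in> gr A 1"
    and inv: "\<And>i j. \<lbrakk>i < n; j < n\<rbrakk> \<Longrightarrow>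
      Lop (\<xi> i) (y j) \<ominus> (if i = j then \<one> else \<zero>) \<in> I\<^sub>0"
begin

lemma \<xi>D: "i < n \<Longrightarrow> \<xi> i \<in> D 1"
  and yc: "i < n \<Longrightarrow> y i \<in> carrier A"
  using ds by (simp_all add: dual_system_def)

text \<open>The functionals whose operator sends x into \<open>N\<close> form a closed subspace, so
  by the spanning clause of \<open>dual_system\<close> the basis suffices.\<close>

lemma Lop_span:
  assumes N: "submod K A N" and x: "x \<in> carrier A" and i: "\<And>i. i < n \<Longrightarrow> Lop (\<xi> i) x \<in> N"
    and d: "d \<in> D 1"
  shows "Lop d x \<in> N"
proof -
  let ?C = "{f. lf f \<and> Lop f x \<in> N}"
  have "fclosed ?C"
    unfolding fclosed_def
  proof (intro conjI ballI allI impI)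
    show "(\<lambda>x. \<zero>\<^bsub>K\<^esub>) \<in> ?C"
      using linear_map_const_zero[OF L.module_axioms] submod_zero[OF N] x by (simp add: Lop_null)
  next
    fix f g assume "f \<in> ?C" "g \<in> ?C"
    then show "(\<lambda>x. f x \<oplus>\<^bsub>K\<^esub> g x) \<in> ?C"
      using linear_map_plus[OF L.module_axioms, of A f g] submod_add[OF N] x by (simp add: Lop_plus)
  next
    fix c f assume "f \<in> ?C" "c \<in> carrier K"
    then show "(\<lambda>x. c \<otimes>\<^bsub>K\<^esub> f x) \<in> ?C"
      using linear_map_scale[OF L.module_axioms, of A f c] submod_smult[OF N] x
          by (simp add: Lop_scale)
  next
    fix f g assume f: "f \<in> ?C" and eq: "\<forall>x\<in>carrier A. f x = g x"
    have "lf g" using linear_map_cong[OF M.module_axioms, where f = f and g = g] f eq by blast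
    moreover have "Lop g x = Lop f x" using Lop_cong[of f x g] f eq x by simp
    ultimately show "g \<in> ?C" using f by simp
  qed
  moreover have "\<forall>i<n. \<xi> i \<in> ?C" using i \<xi>D Dl by auto
  ultimately have "D 1 \<subseteq> ?C" using ds by (simp add: dual_system_def)
  then show ?thesis using d by blast
qed

definition euler :: "'a \<Rightarrow> 'a"
  where "euler x = (\<Oplus>j \<in> {..<n}. Lop (\<xi> j) x \<otimes> y j)"

abbreviation \<kappa> :: "nat \<Rightarrow> 'k"
  where "\<kappa> k \<equiv> [k] \<cdot>\<^bsub>K\<^esub> \<one>\<^bsub>K\<^esub>"

lemma Lxc: "\<lbrakk>j < n; x \<in> carrier A\<rbrakk> \<Longrightarrow> Lop (\<xi> j) x \<in> carrier A"
  by (rule Lop_closed[OF Dl[OF \<xi>D]])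

lemma euler_closed: "x \<in> carrier A \<Longrightarrow> euler x \<in> carrier A"
  unfolding euler_def by (intro A.finsum_closed) (auto simp: Lxc yc)

lemma yG: "j < n \<Longrightarrow> y j \<in> G (Suc 0)"
  using odd odd_I0 I0_G by blast

lemma linear_finsum:
  assumes f: "linear_map K A A f" and F: "finite F" and g: "\<And>j. j \<in> F \<Longrightarrow> g j \<in> carrier A"
  shows "f (\<Oplus>j \<in> F. g j) = (\<Oplus>j \<in> F. f (g j))"
  using F g
proof (induct F)
  case empty
  then show ?case using linear_map_zero[OF M.module_axioms M.module_axioms f] by simp
next
  case (insert j F)
  have "g \<in> F \<rightarrow> carrier A" "(\<lambda>j. f (g j)) \<in> F \<rightarrow> carrier A"
    using insert(4) linear_map_closed[OF f] by auto
  then show ?case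
    using insert linear_map_closed[OF f] by (simp add: linear_map_add[OF f])
qed



text \<open>Modulo the filtration, \<xi>_i (euler x) = euler (\<xi>_i x) + \<xi>_i x; as \<xi>_i x
  lies one level lower, its eigenvalue k becomes k + 1 for x. At level 0 it is enough that every
  summand of \<open>euler x\<close> has an odd factor.\<close>

lemma euler_eigen: "x \<in> G k \<Longrightarrow> euler x \<ominus> \<kappa> k \<odot> x \<in> G (Suc k)"
proof (induct k arbitrary: x)
  case 0
  have x: "x \<in> carrier A" using 0 by simp
  have "Lop (\<xi> j) x \<otimes> y j \<in> I\<^sub>0" if "j < n" for j
    using ideal.I_l_closed[OF I0_ideal _ Lxc[OF that x]] odd[OF that] odd_I0 by blast
  then have "euler x \<in> I\<^sub>0" unfolding euler_def
      by (intro submod_finsum[OF M.module_axioms I0_submod]) simp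
  then show ?case using I0_G x euler_closed[OF x] by (simp add: a_minus_def)
next
  case (Suc k)
  note xc = G_carrier[OF Suc(2)] and ec = euler_closed[OF G_carrier[OF Suc(2)]]
  let ?N = "G (Suc k)"
  let ?z = "euler x \<ominus> \<kappa> (Suc k) \<odot> x"
  note Ns = G_submod[of "Suc k"]
  have kc: "\<kappa> m \<in> carrier K" for m by simp
  have "Lop (\<xi> j) x \<otimes> y j \<in> ?N" if j: "j < n" for j
    using G_mult[OF G_Lop[OF Suc(2) \<xi>D[OF j]] yG[OF j]] by simp
  then have "euler x \<in> ?N" unfolding euler_def by (intro submod_finsum[OF M.module_axioms Ns]) simp
  then have z: "?z \<in> ?N" using Suc(2) kc by (intro submod_minus[OF Ns] submod_smult[OF Ns])
  have zc: "?z \<in> carrier A" by (rule submod_carrier[OF Ns z])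
  have "Lop (\<xi> i) ?z \<in> ?N" if i: "i < n" for i
  proof -
    let ?w = "Lop (\<xi> i) x"
    note l = Dl[OF \<xi>D[OF i]] and wc = Lxc[OF i xc]
    have w: "?w \<in> G k" by (rule G_Lop[OF Suc(2) \<xi>D[OF i]])
    let ?f = "\<lambda>j. Lop (\<xi> i) (Lop (\<xi> j) x \<otimes> y j)"
    let ?g = "\<lambda>j. Lop (\<xi> j) ?w \<otimes> y j \<oplus> (if i = j then Lop (\<xi> j) x else \<zero>)"
    \<comment> \<open>The sign from moving \<xi>_i past y_j cancels the sign from anticommuting it
      with \<xi>_j. The errors are the anticommutator term \<open>a \<otimes> c\<close>, harmless by
      \<open>G_even\<close>, and \<open>u \<otimes> (v \<ominus> e)\<close>, a product of levels k
      and 1.\<close>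
    have term_mod: "?f j \<ominus> ?g j \<in> ?N" if j: "j < n" for j
    proof -
      obtain h where h: "h \<in> D 0" and anti: "Lop (\<xi> i) (Lop (\<xi> j) x) = Lop h x \<ominus> Lop (\<xi> j) ?w"
        using Lop_anticommute[OF \<xi>D[OF i] \<xi>D[OF j]] xc by blast
      define a b c u v e where "a = Lop h x" and "b = Lop (\<xi> j) ?w" and "c = y j"
        and "u = Lop (\<xi> j) x" and "v = Lop (\<xi> i) (y j)" and "e = (if i = j then \<one> else \<zero>)"
      have carr: "a \<in> carrier A" "b \<in> carrier A" "c \<in> carrier A" "u \<in> carrier A" "v \<in> carrier A"
          "e \<in> carrier A"
        unfolding a_def b_def c_def u_def v_def e_def using Lop_closed[OF Dl[OF h] xc] wc i j xc
        by (simp_all add: Lxc yc)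
      have "par 1 c = \<ominus> c" unfolding c_def using par_gr[OF odd[OF j], of 1]
          by (simp add: koszul_def)
      then have "?f j = (a \<ominus> b) \<otimes> (\<ominus> c) \<oplus> u \<otimes> v"
        using Lop_mult[OF D[OF \<xi>D[OF i]] Lxc[OF j xc] yc[OF j]] anti
        by (simp add: a_def b_def c_def u_def v_def)
      moreover have "?g j = b \<otimes> c \<oplus> u \<otimes> e"
        using carr by (simp add: b_def c_def u_def e_def)
      moreover have "(a \<ominus> b) \<otimes> (\<ominus> c) = b \<otimes> c \<oplus> \<ominus> (a \<otimes> c)"
        using carr by (simp add: a_minus_def A.l_distr A.r_minus A.l_minus A.minus_add A.a_comm)
      ultimately have "?f j \<ominus> ?g j = (b \<otimes> c \<oplus> (\<ominus> (a \<otimes> c) \<oplus> u \<otimes> v)) \<ominus> (b \<otimes> c \<oplus> u \<otimes> e)"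
        using carr by (simp add: A.a_assoc)
      also have "\<dots> = \<ominus> (a \<otimes> c) \<oplus> u \<otimes> (v \<ominus> e)"
        using carr by (simp add: A.diff_add_diff A.diff_eq_zero_iff[THEN iffD2])
          (simp add: a_minus_def A.r_distr A.r_minus A.a_assoc)
      also have "\<dots> \<in> ?N"
      proof (intro submod_add[OF Ns] submod_uminus[OF Ns])
        show "a \<otimes> c \<in> ?N"
          using G_mult[OF G_even[OF h Suc(2)], of c 0] carr by (simp add: a_def)
        show "u \<otimes> (v \<ominus> e) \<in> ?N"
          using G_mult[OF G_Lop[OF Suc(2) \<xi>D[OF j]] I0_G[OF inv[OF i j]]]
              by (simp add: u_def v_def e_def)
      qed
      finally show ?thesis .
    qed
    have fc: "?f j \<in> carrier A" "?g j \<in> carrier A" "Lop (\<xi> j) ?w \<otimes> y j \<in> carrier A"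
       "Lop (\<xi> j) x \<otimes> y j \<in> carrier A" if "j < n" for j
      using that i xc wc by (simp_all add: Lxc yc)
    have sg: "(\<Oplus>j \<in> {..<n}. ?g j) = euler ?w \<oplus> ?w"
    proof -
      have "(\<Oplus>j \<in> {..<n}. ?g j) = (\<Oplus>j \<in> {..<n}. Lop (\<xi> j) ?w \<otimes> y j) \<oplus>
          (\<Oplus>j \<in> {..<n}. if i = j then Lop (\<xi> j) x else \<zero>)"
        using fc(3) Lxc[OF _ xc] by (intro A.finsum_addf) auto
      moreover have "(\<Oplus>j \<in> {..<n}. if i = j then Lop (\<xi> j) x else \<zero>) = ?w"
        using i Lxc[OF _ xc] by (intro A.add.finprod_singleton) auto
      ultimately show ?thesis by (simp add: euler_def)
    qed
    have "Lop (\<xi> i) (euler x) = (\<Oplus>j \<in> {..<n}. ?f j)"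
      unfolding euler_def by (rule linear_finsum[OF Lop_linear[OF l]]) (use fc in auto)
    then have "Lop (\<xi> i) (euler x) \<ominus> (euler ?w \<oplus> ?w) \<in> ?N"
      using submod_finsum_diff[OF M.module_axioms Ns, of "{..<n}" ?f ?g] fc term_mod sg by simp
    moreover have "(euler ?w \<oplus> ?w) \<ominus> \<kappa> (Suc k) \<odot> ?w \<in> ?N"
    proof -
      have "\<kappa> (Suc k) \<odot> ?w = \<kappa> k \<odot> ?w \<oplus> ?w"
        using wc kc[of k] by (simp add: M.smult_l_distr)
      then have "(euler ?w \<oplus> ?w) \<ominus> \<kappa> (Suc k) \<odot> ?w = euler ?w \<ominus> \<kappa> k \<odot> ?w"
        using wc kc[of k] euler_closed[OF wc]
            by (simp add: A.diff_add_diff A.diff_eq_zero_iff[THEN iffD2])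
      then show ?thesis using Suc(1)[OF w] by simp
    qed
    ultimately have "(Lop (\<xi> i) (euler x) \<ominus> (euler ?w \<oplus> ?w)) \<oplus>
        ((euler ?w \<oplus> ?w) \<ominus> \<kappa> (Suc k) \<odot> ?w) \<in> ?N"
      by (rule submod_add[OF Ns])
    then have "Lop (\<xi> i) (euler x) \<ominus> \<kappa> (Suc k) \<odot> ?w \<in> ?N"
      using wc kc[of "Suc k"] euler_closed[OF wc] Lxc[OF i ec]
          by (subst (asm) A.diff_add_diff_cancel) simp_all
    moreover have "Lop (\<xi> i) ?z = Lop (\<xi> i) (euler x) \<ominus> \<kappa> (Suc k) \<odot> ?w"
      using linear_map_minus[OF M.module_axioms M.module_axioms Lop_linear[OF l] ec
          M.smult_closed[OF kc xc]]
        linear_map_smult[OF Lop_linear[OF l] kc xc] by metis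
    ultimately show ?thesis by simp
  qed
  then have "\<forall>d \<in> D 1. Lop d ?z \<in> ?N" using Lop_span[OF Ns zc] by blast
  then show ?case using z G_I0[OF z] by (subst G.simps) blast
qed

text \<open>Left combinations of k-fold products of the y_j; the recursion splits off the last
  factor, which is the shape in which \<open>euler\<close> produces them.\<close>

primrec Z :: "nat \<Rightarrow> 'a set"
  where "Z 0 = carrier A"
  | "Z (Suc k) = {(\<Oplus>j \<in> {..<n}. a j \<otimes> y j) | a. \<forall>j<n. a j \<in> Z k}"

lemma Z_carrier: "z \<in> Z k \<Longrightarrow> z \<in> carrier A"
  by (induct k arbitrary: z) (auto intro!: A.finsum_closed simp: yc)

lemma Z_smult: "\<lbrakk>c \<in> carrier K; z \<in> Z k\<rbrakk> \<Longrightarrow> c \<odot> z \<in> Z k"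
proof (induct k arbitrary: z)
  case (Suc k)
  then obtain a where a: "z = (\<Oplus>j \<in> {..<n}. a j \<otimes> y j)" "\<forall>j<n. a j \<in> Z k" by auto
  have "c \<odot> z = (\<Oplus>j \<in> {..<n}. c \<odot> (a j \<otimes> y j))"
    unfolding a(1) using Suc(2) a(2) by (intro M.finsum_smult_ldistr) (auto simp: Z_carrier yc)
  also have "\<dots> = (\<Oplus>j \<in> {..<n}. (c \<odot> a j) \<otimes> y j)"
    using Suc(2) a(2) by (intro A.finsum_cong') (auto simp: Z_carrier yc smult_mult_left)
  finally show ?case
    using Suc(1)[OF Suc(2)] a(2) by (auto intro!: exI[of _ "\<lambda>j. c \<odot> a j"])
qed simp

text \<open>At level k + 1, x is congruent to \<open>euler x\<close> divided by k + 1, and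
  \<open>euler x\<close> is a combination of the y_j with coefficients \<xi>_j x one level lower,
  where the induction applies. The division is possible in characteristic zero.\<close>

lemma G_Z: "x \<in> G k \<Longrightarrow> \<exists>z \<in> Z k. x \<ominus> z \<in> G (Suc k)"
proof (induct k arbitrary: x)
  case 0
  then have "x \<ominus> x = \<zero>" by (simp add: A.diff_eq_zero_iff)
  then have "x \<ominus> x \<in> G (Suc 0)" by (simp only: submod_zero[OF G_submod])
  then show ?case using 0 by (intro bexI[of _ x]) simp_all
next
  case (Suc k)
  note xc = G_carrier[OF Suc(2)]
  let ?N = "G (Suc (Suc k))"
  note Ns = G_submod[of "Suc (Suc k)"]
  have "\<exists>z \<in> Z k. Lop (\<xi> j) x \<ominus> z \<in> G (Suc k)" if "j < n" for j
    by (rule Suc(1)[OF G_Lop[OF Suc(2) \<xi>D[OF that]]])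
  then obtain a where a: "\<And>j. j < n \<Longrightarrow> a j \<in> Z k" "\<And>j. j < n \<Longrightarrow> Lop (\<xi> j) x \<ominus> a j \<in> G (Suc k)"
    by metis
  note ac = Z_carrier[OF a(1)]
  let ?z = "\<Oplus>j \<in> {..<n}. a j \<otimes> y j"
  have zZ: "?z \<in> Z (Suc k)" using a(1) by auto
  note zc = Z_carrier[OF zZ]
  have "Lop (\<xi> j) x \<otimes> y j \<ominus> a j \<otimes> y j \<in> ?N" if j: "j < n" for j
  proof -
    have "Lop (\<xi> j) x \<otimes> y j \<ominus> a j \<otimes> y j = (Lop (\<xi> j) x \<ominus> a j) \<otimes> y j"
      using j ac yc Lxc[OF j xc] by (simp add: a_minus_def A.l_distr A.l_minus)
    then show ?thesis using G_mult[OF a(2)[OF j] yG[OF j]] by simp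
  qed
  then have ez: "euler x \<ominus> ?z \<in> ?N"
    unfolding euler_def using ac yc Lxc[OF _ xc]
    by (intro submod_finsum_diff[OF M.module_axioms Ns]) auto
  have kc: "\<kappa> (Suc k) \<in> carrier K" by simp
  have k: "inv\<^bsub>K\<^esub> (\<kappa> (Suc k)) \<in> carrier K" "inv\<^bsub>K\<^esub> (\<kappa> (Suc k)) \<otimes>\<^bsub>K\<^esub> \<kappa> (Suc k) = \<one>\<^bsub>K\<^esub>"
    using char_0[of "Suc k"] kc K.field_Units
        by (auto intro: K.Units_l_inv simp del: K.add.nat_pow_Suc)
  let ?i = "inv\<^bsub>K\<^esub> (\<kappa> (Suc k))"
  note ec = euler_closed[OF xc]
  have "(euler x \<ominus> \<kappa> (Suc k) \<odot> x) \<in> ?N" by (rule euler_eigen[OF Suc(2)])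
  then have "(euler x \<ominus> ?z) \<ominus> (euler x \<ominus> \<kappa> (Suc k) \<odot> x) \<in> ?N"
    by (rule submod_minus[OF Ns ez])
  moreover have "(euler x \<ominus> ?z) \<ominus> (euler x \<ominus> \<kappa> (Suc k) \<odot> x) = \<kappa> (Suc k) \<odot> x \<ominus> ?z"
    using ec zc M.smult_closed[OF kc xc] unfolding a_minus_def
    by (simp add: A.minus_add A.a_ac del: K.add.nat_pow_Suc) (simp add: A.r_neg1 A.r_neg2
        A.a_lcomm[of "euler x"] del: K.add.nat_pow_Suc)
  ultimately have "?i \<odot> (\<kappa> (Suc k) \<odot> x \<ominus> ?z) \<in> ?N"
    using submod_smult[OF Ns k(1)] by simp
  moreover have "?i \<odot> (\<kappa> (Suc k) \<odot> x \<ominus> ?z) = x \<ominus> ?i \<odot> ?z"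
    using k kc xc zc
    by (simp add: a_minus_def M.smult_r_distr M.smult_r_minus M.smult_assoc1[symmetric] del:
        K.add.nat_pow_Suc)
  ultimately show ?case using Z_smult[OF k(1) zZ] by (intro bexI[of _ "?i \<odot> ?z"]) simp_all
qed

definition yprod :: "nat list \<Rightarrow> 'a"
  where "yprod w = foldr (\<lambda>j p. y j \<otimes> p) w \<one>"

lemma yprod_simps [simp]: "yprod [] = \<one>" "yprod (j # w) = y j \<otimes> yprod w"
  by (simp_all add: yprod_def)

lemma yprod_closed: "set w \<subseteq> {..<n} \<Longrightarrow> yprod w \<in> carrier A"
  by (induct w) (simp_all add: yc)

lemma yprod_repeat: "\<lbrakk>set w \<subseteq> {..<n}; j \<in> set w\<rbrakk> \<Longrightarrow> y j \<otimes> yprod w = \<zero>"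
proof (induct w)
  case (Cons i w)
  then have c: "i < n" "j < n" "y i \<in> carrier A" "y j \<in> carrier A" "yprod w \<in> carrier A"
    by (auto intro: yc yprod_closed)
  have "y j \<otimes> yprod (i # w) = (y j \<otimes> y i) \<otimes> yprod w" using c by (simp add: A.m_assoc)
  also have "\<dots> = \<zero>"
  proof (cases "i = j")
    case True
    then show ?thesis using odd_square[OF odd[OF c(2)]] c by simp
  next
    case False
    then have "y j \<otimes> yprod w = \<zero>" using Cons by simp
    then show ?thesis
      unfolding odd_anticomm[OF odd[OF c(2)] odd[OF c(1)]] using c
          by (simp add: A.l_minus A.m_assoc)
  qed
  finally show ?case .
qed simp

lemma yprod_not_distinct: "\<lbrakk>set w \<subseteq> {..<n}; \<not> distinct w\<rbrakk> \<Longrightarrow> yprod w = \<zero>"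
  by (induct w) (auto simp: yprod_repeat yc)

text \<open>The word w collects the factors split off from z, which keeps k + length w constant.
  When k is used up, more than n letters from n indices must repeat.\<close>

lemma Z_yprod: "\<lbrakk>z \<in> Z k; set w \<subseteq> {..<n}; k + length w > n\<rbrakk> \<Longrightarrow> z \<otimes> yprod w = \<zero>"
proof (induct k arbitrary: z w)
  case 0
  have "\<not> distinct w"
  proof
    assume "distinct w"
    then have "length w \<le> n" using card_mono[OF _ 0(2)] by (simp add: distinct_card)
    then show False using 0(3) by simp
  qed
  then show ?case using yprod_not_distinct[OF 0(2)] 0(1) by simp
next
  case (Suc k)
  then obtain a where a: "z = (\<Oplus>j \<in> {..<n}. a j \<otimes> y j)" "\<And>j. j < n \<Longrightarrow> a j \<in> Z k" by auto
  note c = yprod_closed[OF Suc(3)] Z_carrier[OF a(2)]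
  have "z \<otimes> yprod w = (\<Oplus>j \<in> {..<n}. (a j \<otimes> y j) \<otimes> yprod w)"
    unfolding a(1) by (rule linear_finsum[OF mult_linear_left[OF linear_map_id c(1)]]) (use c yc
        in auto)
  also have "\<dots> = (\<Oplus>j \<in> {..<n}. \<zero>)"
    using Suc(1)[OF a(2), of _ "_ # w"] Suc(3,4) c yc
        by (intro A.finsum_cong') (auto simp: A.m_assoc)
  finally show ?case by simp
qed

lemma Z_zero: "\<lbrakk>z \<in> Z k; k > n\<rbrakk> \<Longrightarrow> z = \<zero>"
  using Z_yprod[of z k "[]"] Z_carrier by simp

text \<open>As \<open>Z (Suc n)\<close> is zero, \<open>G (Suc n)\<close> is contained in the next
  level, so odd operators map it to itself; even operators preserve all levels. Stability gives
  containment in the annihilator.\<close>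

lemma G_annih: "G (Suc n) \<subseteq> annih D"
proof (rule annih_greatest[OF D])
  have stable: "x \<in> G (Suc (Suc n))" if xG: "x \<in> G (Suc n)" for x
  proof -
    obtain z where "z \<in> Z (Suc n)" and z: "x \<ominus> z \<in> G (Suc (Suc n))" using G_Z[OF xG] by blast
    then have "z = \<zero>" using Z_zero by blast
    then have "x \<ominus> z = x" using G_carrier[OF xG] by (simp add: a_minus_def)
    then show ?thesis using z by (simp only:)
  qed
  show "Lop d x \<in> G (Suc n)" if "d \<in> D p" "x \<in> G (Suc n)" for p d x
    using that G_even G_Lop[OF stable] bit_cases[of p] by blast
qed (auto dest: G_carrier G_I0 intro: I0_counit)

text \<open>Descent from level n + 1 to level 1: each level is congruent to combinations a y_j
  modulo the next, and d(a y_j) = \<epsilon>(a) d(y_j) + d(a) \<epsilon>(y_j) is zero.\<close>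

lemma vanishing_on_I0:
  assumes d: "pder p d" and ann: "\<And>x. x \<in> annih D \<Longrightarrow> d x = \<zero>\<^bsub>K\<^esub>"
    and dy: "\<And>j. j < n \<Longrightarrow> d (y j) = \<zero>\<^bsub>K\<^esub>" and x: "x \<in> I\<^sub>0"
  shows "d x = \<zero>\<^bsub>K\<^esub>"
proof -
  note l = pder_lf[OF d]
  let ?B = "{x \<in> carrier A. d x = \<zero>\<^bsub>K\<^esub>}"
  have B: "submod K A ?B" using submod_kernel[OF M.module_axioms L.module_axioms l] by simp
  have dZ: "z \<in> ?B" if "z \<in> Z (Suc k)" for z k
  proof -
    obtain a where a: "z = (\<Oplus>j \<in> {..<n}. a j \<otimes> y j)" "\<And>j. j < n \<Longrightarrow> a j \<in> Z k"
      using \<open>z \<in> Z (Suc k)\<close> by auto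
    have "a j \<otimes> y j \<in> ?B" if "j < n" for j
      using that Z_carrier[OF a(2)[OF that]] yc[OF that] dy[OF that] counit_odd[OF odd[OF that]]
      by (simp add: pder_mult[OF d] lf_closed[OF l] lf_closed[OF counit_linear])
    then show ?thesis unfolding a(1) by (intro submod_finsum[OF M.module_axioms B]) simp
  qed
  \<comment> \<open>Positive k is essential: elements of \<open>Z 0\<close> carry no factor y_j, and
    \<open>d\<close> need not vanish on them.\<close>
  have step: "G k \<subseteq> ?B" if "G (Suc k) \<subseteq> ?B" "k > 0" for k
  proof
    fix x assume x: "x \<in> G k"
    obtain z where z: "z \<in> Z k" "x \<ominus> z \<in> G (Suc k)" using G_Z[OF x] by blast
    have "z \<in> ?B" using dZ[of z "k - 1"] z(1) that(2) by simp
    then have "(x \<ominus> z) \<oplus> z \<in> ?B" using that(1) z(2) submod_add[OF B] by blast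
    then show "x \<in> ?B" using G_carrier[OF x] Z_carrier[OF z(1)] by (simp add: A.diff_add_cancel)
  qed
  have "m \<le> n \<Longrightarrow> G (Suc (n - m)) \<subseteq> ?B" for m
  proof (induct m)
    case 0
    have "x \<in> ?B" if "x \<in> G (Suc n)" for x
      using that G_annih ann[of x] annih_carrier[OF D] by blast
    then show ?case by (simp only: diff_zero) blast
  next
    case (Suc m)
    then have "Suc (Suc (n - Suc m)) = Suc (n - m)" by simp
    then show ?case
      using Suc step[of "Suc (n - Suc m)"] by simp
  qed
  from this[of n] have "G (Suc 0) \<subseteq> ?B" by (simp del: G.simps)
  then show ?thesis using I0_G[OF x] by blast
qed

end

end

end

lemma (in hopf) pder_diff:
  assumes d: "pder p d" and w: "pder p w"
  shows "pder p (\<lambda>x. d x \<ominus>\<^bsub>K\<^esub> w x)"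
  unfolding pder_def
proof (intro conjI ballI)
  show "lf (\<lambda>x. d x \<ominus>\<^bsub>K\<^esub> w x)"
    by (rule linear_map_cong[OF M.module_axioms linear_map_diff[OF L.module_axioms pder_lf[OF d]
        pder_lf[OF w]]])
      (simp add: a_minus_def lf_closed[OF pder_lf[OF w]])
  show "d x \<ominus>\<^bsub>K\<^esub> w x = \<zero>\<^bsub>K\<^esub>" if "x \<in> gr A (p + 1)" for x
    using that pder_other[OF d] pder_other[OF w] by (simp add: a_minus_def)
  fix x y assume "x \<in> carrier A" "y \<in> carrier A"
  then show "d (x \<otimes> y) \<ominus>\<^bsub>K\<^esub> w (x \<otimes> y) =
      \<epsilon> x \<otimes>\<^bsub>K\<^esub> (d y \<ominus>\<^bsub>K\<^esub> w y) \<oplus>\<^bsub>K\<^esub> (d x \<ominus>\<^bsub>K\<^esub> w x) \<otimes>\<^bsub>K\<^esub> \<epsilon> y"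
    using lf_closed[OF pder_lf[OF d]] lf_closed[OF pder_lf[OF w]] lf_closed[OF counit_linear]
    by (simp add: pder_mult[OF d] pder_mult[OF w] a_minus_def K.r_distr K.l_distr K.minus_add
        K.r_minus K.l_minus K.a_ac)
qed

text \<open>\<open>J\<close> stands for the pullback of the ideal of the even subgroup. By
  maximality it lies in \<open>I\<^sub>0\<close>, so an even derivation that kills
  \<open>I\<^sub>0\<close> is caught by \<open>alg\<close>; an odd one is compared with the member
  of \<open>D 1\<close> that has the same values on the odd coordinates.\<close>

theorem (in sgroup) annih_derivations:
  assumes D: "\<And>p d. d \<in> D p \<Longrightarrow> pder p d" and Dcl: "\<And>p. fclosed (D p)"
    and Dbr: "\<And>p q f g. \<lbrakk>f \<in> D p; g \<in> D q\<rbrakk> \<Longrightarrow>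
      (\<lambda>x. f (Lop g x) \<ominus>\<^bsub>K\<^esub> koszul (base K) (p * q) (g (Lop f x))) \<in> D (p + q)"
    and J: "J \<subseteq> carrier A" "\<And>x. x \<in> J \<Longrightarrow> \<epsilon> x = \<zero>\<^bsub>K\<^esub>"
      "\<And>d x. \<lbrakk>d \<in> D 0; x \<in> J\<rbrakk> \<Longrightarrow> Lop d x \<in> J"
    and alg: "\<And>d. \<lbrakk>pder 0 d; \<And>x. x \<in> J \<Longrightarrow> d x = \<zero>\<^bsub>K\<^esub>\<rbrakk> \<Longrightarrow> d \<in> D 0"
    and d: "pder p d" "\<And>x. x \<in> annih D \<Longrightarrow> d x = \<zero>\<^bsub>K\<^esub>"
  shows "d \<in> D p"
proof -
  note I0 = I0_ideal[OF D Dcl Dbr] odd_I0[OF D Dcl Dbr] I0_counit[OF D Dcl Dbr]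
  let ?I = "I\<^sub>0 D"
  obtain F where F: "finite F" "F \<subseteq> carrier A" "(\<lambda>B. subring B A \<and> submod K A B) hull F = carrier A"
    using fin_gen unfolding finitely_generated_def by (elim exE conjE)
  \<comment> \<open>Odd functionals see only the odd parts of the generators, so the nodes can be
    taken odd.\<close>
  have "\<exists>n \<xi> y. dual_system (D 1) n \<xi> y \<and> (\<forall>i<n. y i \<in> hpart A 1 ` F)"
  proof (rule dual_system_exists)
    fix w x assume w: "w \<in> D 1" "\<And>f. f \<in> hpart A 1 ` F \<Longrightarrow> w f = \<zero>\<^bsub>K\<^esub>" and x: "x \<in> carrier A"
    have "w f = \<zero>\<^bsub>K\<^esub>" if "f \<in> F" for f
      using w(2)[of "hpart A 1 f"] that F(2) pder_hpart[OF D[OF w(1)], of f 1] by auto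
    then show "w x = \<zero>\<^bsub>K\<^esub>" using pder_generators[OF D[OF w(1)] F(3) _ x F(2)] by blast
  qed (use F S.hpart_closed Dcl pder_lf[OF D] in auto)
  then obtain n \<xi> y where ds: "dual_system (D 1) n \<xi> y" and yF: "\<forall>i<n. y i \<in> hpart A 1 ` F" by blast
  have yo: "y i \<in> gr A 1" if i: "i < n" for i
  proof -
    obtain f where "f \<in> F" "y i = hpart A 1 f" using yF i by auto
    then show ?thesis using F(2) S.hpart_gr[of f 1] by auto
  qed
  have "\<forall>i. \<exists>z. i < n \<longrightarrow> z \<in> gr A 1 \<and>
      (\<forall>d. pder 1 d \<longrightarrow> Lop d z \<ominus> d (y i) \<odot> \<one> \<in> ?I)"
    using odd_invariant[OF yo] I0(1,2) by metis
  then obtain z where z: "\<And>i. i < n \<Longrightarrow> z i \<in> gr A 1"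
    and inv: "\<And>i d. \<lbrakk>i < n; pder 1 d\<rbrakk> \<Longrightarrow> Lop d (z i) \<ominus> d (y i) \<odot> \<one> \<in> ?I"
    by metis
  have zc: "z i \<in> carrier A" "y i \<in> carrier A" if "i < n" for i using z yo S.gr_closed that by auto
  have \<xi>: "\<xi> i \<in> D 1" "pder 1 (\<xi> i)" if "i < n" for i using ds that D
      by (auto simp: dual_system_def)
  \<comment> \<open>Applying the counit to the invariance congruence shows that the corrected nodes
    have the same values as the old ones, so duality survives the correction.\<close>
  have \<xi>z: "\<xi> i (z j) = \<xi> i (y j)" if "i < n" "j < n" for i j
  proof -
    note l = pder_lf[OF \<xi>(2)[OF that(1)]]
    have "\<epsilon> (Lop (\<xi> i) (z j) \<ominus> \<xi> i (y j) \<odot> \<one>) = \<zero>\<^bsub>K\<^esub>"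
      using inv[OF that(2) \<xi>(2)[OF that(1)]] I0(3) by blast
    then have "\<xi> i (z j) \<ominus>\<^bsub>K\<^esub> \<xi> i (y j) = \<zero>\<^bsub>K\<^esub>"
      using zc[OF that(2)] l
      by (simp add: lf_minus[OF counit_linear] Lop_closed lf_closed counit_Lop lf_smult[OF
          counit_linear] counit_one)
    then show ?thesis using zc[OF that(2)] l by (simp add: K.diff_eq_zero_iff lf_closed)
  qed
  have ds': "dual_system (D 1) n \<xi> z"
    using ds zc \<xi>z unfolding dual_system_def by simp
  have inv': "Lop (\<xi> i) (z j) \<ominus> (if i = j then \<one> else \<zero>) \<in> ?I" if "i < n" "j < n" for i j
    using inv[OF that(2) \<xi>(2)[OF that(1)]] ds that
    by (auto simp: dual_system_def split: if_splits)
  have vanish: "f x = \<zero>\<^bsub>K\<^esub>"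
    if "pder q f" "\<And>x. x \<in> annih D \<Longrightarrow> f x = \<zero>\<^bsub>K\<^esub>" "\<And>j. j < n \<Longrightarrow> f (z j) = \<zero>\<^bsub>K\<^esub>" "x \<in> ?I" for f q x
    by (rule vanishing_on_I0[OF D Dcl Dbr ds' z inv']) (assumption | rule that)+
  show ?thesis
  proof (cases "p = 0")
    case True
    have dz: "d (z j) = \<zero>\<^bsub>K\<^esub>" if "j < n" for j using pder_other[OF d(1)] z[OF that] True by simp
    have "d x = \<zero>\<^bsub>K\<^esub>" if x: "x \<in> ?I" for x by (rule vanish[OF d(1)]) (rule d(2) dz x, assumption?)+
    moreover have "J \<subseteq> ?I" by (rule I0_greatest[OF D Dcl Dbr J])
    ultimately have "d \<in> D 0" using d(1) True by (intro alg) auto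
    then show ?thesis using True by simp
  next
    case False
    then have p: "p = 1" by simp
    have "\<exists>w \<in> D 1. \<forall>i<n. w (z i) = d (z i)"
      by (rule dual_system_match[OF Dcl _ ds' pder_lf[OF d(1)]]) (rule pder_lf[OF D])
    then obtain w where w: "w \<in> D 1" "\<forall>i<n. w (z i) = d (z i)" by blast
    let ?d = "\<lambda>x. d x \<ominus>\<^bsub>K\<^esub> w x"
    have d': "pder 1 ?d" using pder_diff[OF _ D[OF w(1)]] d(1) p by simp
    have dw: "d x \<in> carrier K" "w x \<in> carrier K" if "x \<in> carrier A" for x
      using lf_closed[OF pder_lf[OF d(1)] that] lf_closed[OF pder_lf[OF D[OF w(1)]] that]
          by simp_all
    have dann: "?d x = \<zero>\<^bsub>K\<^esub>" if "x \<in> annih D" for x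
      using d(2)[OF that] annih_der[OF D that w(1)] by (simp add: a_minus_def)
    have dz: "?d (z j) = \<zero>\<^bsub>K\<^esub>" if "j < n" for j
      using w(2) that dw zc[OF that] by (simp add: K.diff_eq_zero_iff)
    have v: "?d x = \<zero>\<^bsub>K\<^esub>" if x: "x \<in> ?I" for x by (rule vanish[OF d']) (rule dann dz x, assumption?)+
    \<comment> \<open>Both functionals are odd and thus determined by the odd part of x, which lies
      in \<open>?I\<close>.\<close>
    have "w x = d x" if x: "x \<in> carrier A" for x
    proof -
      have "?d (hpart A 1 x) = \<zero>\<^bsub>K\<^esub>" using v S.hpart_gr[OF x, of 1] I0(2) by blast
      then have "?d x = \<zero>\<^bsub>K\<^esub>" using pder_hpart[OF d' x, of 1] by simp
      then show ?thesis using dw[OF x] by (simp add: K.diff_eq_zero_iff)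
    qed
    then show ?thesis using fclosed_ext[OF Dcl w(1)] p by blast
  qed
qed

section \<open>Tangent vectors as point derivations\<close>

lemma ring_cong:
  assumes "ring R" "carrier R' = carrier R" "mult R' = mult R" "one R' = one R" "add R' = add R"
      "zero R' = zero R"
  shows "ring R'"
proof -
  interpret ring R by fact
  show ?thesis
    by (intro ringI abelian_group_cong[OF abelian_group_axioms] monoidI)
      (simp_all add: assms m_assoc l_distr r_distr)
qed

lemma module_submod: "\<lbrakk>module K M; submod K M N\<rbrakk> \<Longrightarrow> module K (M\<lparr>carrier := N\<rparr>)"
proof -
  assume M: "module K M" and N: "submod K M N"
  interpret module K M by fact
  note c = submod_carrier[OF N]
  have "abelian_group (M\<lparr>carrier := N\<rparr>)"
  proof (rule abelian_groupI)
    show "\<exists>y \<in> carrier (M\<lparr>carrier := N\<rparr>). y \<oplus>\<^bsub>M\<lparr>carrier := N\<rparr>\<^esub> x = \<zero>\<^bsub>M\<lparr>carrier := N\<rparr>\<^esub>"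
      if "x \<in> carrier (M\<lparr>carrier := N\<rparr>)" for x
      using that c submod_uminus[OF N] by (intro bexI[of _ "\<ominus>\<^bsub>M\<^esub> x"]) (auto simp: M.l_neg)
  qed (use c submod_add[OF N] submod_zero[OF N] in \<open>auto simp: M.a_assoc intro: M.a_comm\<close>)
  then show ?thesis
    by (intro moduleI)
      (use c submod_smult[OF N] in \<open>auto simp: smult_l_distr smult_r_distr smult_assoc1 R.is_cring\<close>)
qed

lemma quot_super_sel [simp]:
  "carrier (quot_super V N) = a_rcosets\<^bsub>V\<^esub> N" "zero (quot_super V N) = N"
  "add (quot_super V N) = set_add V" "mult (quot_super V N) = rcoset_mult V N"
  "one (quot_super V N) = N +>\<^bsub>V\<^esub> \<one>\<^bsub>V\<^esub>" "smult (quot_super V N) = smult (quot_module V N)"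
  "gr (quot_super V N) = (\<lambda>i. (\<lambda>x. N +>\<^bsub>V\<^esub> x) ` gr V i)"
  by (simp_all add: quot_super_def module.defs super.defs)

definition point_derivation :: "('k, 'l) ring_scheme \<Rightarrow> ('k, 'a, 'm) hopf_scheme \<Rightarrow> ('a \<Rightarrow> 'k) \<Rightarrow> bool"
  where "point_derivation K G d \<longleftrightarrow> linear_map K G (base K) d \<and>
    (\<forall>x \<in> carrier G. \<forall>y \<in> carrier G.
      d (x \<otimes>\<^bsub>G\<^esub> y) = counit G x \<otimes>\<^bsub>K\<^esub> d y \<oplus>\<^bsub>K\<^esub> d x \<otimes>\<^bsub>K\<^esub> counit G y)"

text \<open>Tangent vectors are determined by the algebra and its augmentation; at this generality
  the description also covers a quotient by an ideal in the kernel of the counit.\<close>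

locale augmented = kalg K G
  for K :: "('k, 'l) ring_scheme" and G :: "('k, 'a, 'm) hopf_scheme" (structure) +
  assumes counit_lin: "linear_map K G (base K) (counit G)"
    and counit_multiplicative: "\<lbrakk>x \<in> carrier G; y \<in> carrier G\<rbrakk> \<Longrightarrow>
      counit G (x \<otimes> y) = counit G x \<otimes>\<^bsub>K\<^esub> counit G y"
    and counit_unit: "counit G \<one> = \<one>\<^bsub>K\<^esub>"
begin

abbreviation "C \<equiv> cotangent K G"
abbreviation tf where "tf \<equiv> tangent_functional K G"
abbreviation \<mm> where "\<mm> \<equiv> aug_ideal K G"
abbreviation cls where "cls x \<equiv> aug_sq K G +> x"
abbreviation e where "e \<equiv> counit G"

lemma base_module: "module K (base K)"
  by (rule K.module_base)

lemma functional_simps: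
  assumes "linear_map K G (base K) d"
  shows "x \<in> carrier G \<Longrightarrow> d x \<in> carrier K"
    and "\<lbrakk>x \<in> carrier G; y \<in> carrier G\<rbrakk> \<Longrightarrow> d (x \<oplus> y) = d x \<oplus>\<^bsub>K\<^esub> d y"
    and "\<lbrakk>c \<in> carrier K; x \<in> carrier G\<rbrakk> \<Longrightarrow> d (c \<odot> x) = c \<otimes>\<^bsub>K\<^esub> d x"
    and "d \<zero> = \<zero>\<^bsub>K\<^esub>"
    and "\<lbrakk>x \<in> carrier G; y \<in> carrier G\<rbrakk> \<Longrightarrow> d (x \<ominus> y) = d x \<ominus>\<^bsub>K\<^esub> d y"
  using assms linear_map_zero[OF M.module_axioms base_module assms]
    linear_map_minus[OF M.module_axioms base_module assms, of x y]
  by (auto simp: linear_map_def a_minus_def Pi_iff)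

lemmas e_simps = functional_simps[OF counit_lin]

lemma \<mm>_eq: "\<mm> = {x \<in> carrier G. e x = \<zero>\<^bsub>K\<^esub>}"
  by (auto simp: aug_ideal_def a_kernel_def')

lemma \<mm>_submod: "submod K G \<mm>"
  unfolding \<mm>_eq using submod_kernel[OF M.module_axioms base_module counit_lin] by simp

lemma \<mm>_ideal: "ideal \<mm> G"
  by (rule idealI'[OF \<mm>_submod]) (auto simp: \<mm>_eq counit_multiplicative e_simps)

lemma sq_ideal: "ideal (aug_sq K G) G"
  unfolding aug_sq_def by (rule A.ideal_prod_is_ideal[OF \<mm>_ideal \<mm>_ideal])

lemmas sq_submod = ideal_submod[OF sq_ideal]

lemma sq_subset: "aug_sq K G \<subseteq> \<mm>"
  unfolding aug_sq_def using A.ideal_prod_inter[OF \<mm>_ideal \<mm>_ideal] by blast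

abbreviation "G' \<equiv> G\<lparr>carrier := \<mm>, gr := (\<lambda>i. gr G i \<inter> \<mm>)\<rparr>"

lemma G'_module: "module K G'"
  by (rule module_cong[OF module_submod[OF M.module_axioms \<mm>_submod]]) simp_all

lemma G'_submod: "submod K G' (aug_sq K G)"
  using submod_carrier[OF sq_submod] sq_subset
  by (intro submodI[OF G'_module]) (auto simp: submod_zero[OF sq_submod] submod_add[OF sq_submod]
      submod_smult[OF sq_submod])

lemma C_sel: "C = quot_super G' (aug_sq K G)"
  by (simp add: cotangent_def)



lemma coset_G': "N +>\<^bsub>G'\<^esub> x = N +> x"
  by (simp add: a_r_coset_def')

lemma C_carrier: "carrier C = cls ` \<mm>"
  by (auto simp: C_sel quot_carrier_iff coset_G')

lemma C_gr: "gr C i = cls ` (gr G i \<inter> \<mm>)"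
  by (simp add: C_sel coset_G')

lemma C_module: "module K C"
  by (rule module_cong[OF module_quot[OF G'_module G'_submod]]) (simp_all add: C_sel)

lemma cls_linear: "linear_map K G' C cls"
  using linear_map_coset[OF G'_module G'_submod] unfolding coset_G'
  by (simp add: linear_map_def C_sel)

lemma cls_add: "\<lbrakk>x \<in> \<mm>; y \<in> \<mm>\<rbrakk> \<Longrightarrow> cls (x \<oplus> y) = cls x \<oplus>\<^bsub>C\<^esub> cls y"
  and cls_smult: "\<lbrakk>c \<in> carrier K; x \<in> \<mm>\<rbrakk> \<Longrightarrow> cls (c \<odot> x) = c \<odot>\<^bsub>C\<^esub> cls x"
  using linear_map_add[OF cls_linear] linear_map_smult[OF cls_linear] by simp_all

lemma cls_closed: "x \<in> \<mm> \<Longrightarrow> cls x \<in> carrier C"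
  by (simp add: C_carrier)

lemma cls_zero: "x \<in> aug_sq K G \<Longrightarrow> cls x = \<zero>\<^bsub>C\<^esub>"
  using coset_eq_zero_iff[OF M.module_axioms sq_submod, of x] submod_carrier[OF sq_submod]
  by (simp add: C_sel)

lemma Lie_carrier: "carrier (Lie K G) = {u \<in> extensional (carrier C). linear_map K C (base K) u}"
  by (simp add: Lie_def dual_space_def Let_def)

lemma Lie_gr: "gr (Lie K G) i = {u \<in> carrier (Lie K G). \<forall>X \<in> gr C (i + 1). u X = \<zero>\<^bsub>K\<^esub>}"
  by (simp add: Lie_def dual_space_def Let_def)

lemma Lie_add: "u \<oplus>\<^bsub>Lie K G\<^esub> v = (\<lambda>X \<in> carrier C. u X \<oplus>\<^bsub>K\<^esub> v X)"
  and Lie_smult: "c \<odot>\<^bsub>Lie K G\<^esub> u = (\<lambda>X \<in> carrier C. c \<otimes>\<^bsub>K\<^esub> u X)"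
  and Lie_zero: "\<zero>\<^bsub>Lie K G\<^esub> = (\<lambda>X \<in> carrier C. \<zero>\<^bsub>K\<^esub>)"
  and Lie_mult: "u \<otimes>\<^bsub>Lie K G\<^esub> v = lie_bracket K G u v"
  by (simp_all add: Lie_def dual_space_def Let_def)

abbreviation c0 where "c0 x \<equiv> x \<ominus> e x \<odot> \<one>"

lemma c0_linear: "linear_map K G G' c0"
proof -
  have *: "c0 x \<in> \<mm>" if "x \<in> carrier G" for x
    using that by (simp add: \<mm>_eq e_simps counit_unit K.diff_eq_zero_iff)
  have "linear_map K G G c0"
    by (intro linear_map_diff M.module_axioms linear_map_id smult_linear counit_lin A.one_closed)
  then show ?thesis using * by (simp add: linear_map_def)
qed

lemma c0_closed: "x \<in> carrier G \<Longrightarrow> c0 x \<in> \<mm>"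
  using linear_map_closed[OF c0_linear] by simp

lemma c0_\<mm>: "x \<in> \<mm> \<Longrightarrow> c0 x = x"
  by (auto simp: \<mm>_eq a_minus_def)

lemma tf_\<mm>: "x \<in> \<mm> \<Longrightarrow> tf u x = u (cls x)"
  by (simp add: tangent_functional_def c0_\<mm>)

text \<open>Write x = \<open>c0 x\<close> + \<epsilon>(x) 1. The functional vanishes on 1, and the
  product of the two \<open>c0\<close> parts lies in the square of the augmentation ideal.\<close>

lemma tf_point_derivation:
  assumes u: "u \<in> carrier (Lie K G)"
  shows "point_derivation K G (tf u)"
  unfolding point_derivation_def
proof (intro conjI ballI)
  have ul: "linear_map K C (base K) u" using u by (simp add: Lie_carrier)
  show lin: "linear_map K G (base K) (tf u)"
    unfolding tangent_functional_def
    using linear_map_comp[OF linear_map_comp[OF c0_linear cls_linear] ul] .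
  fix x y assume x: "x \<in> carrier G" and y: "y \<in> carrier G"
  note xm = c0_closed[OF x] and ym = c0_closed[OF y]
  note xc = submod_carrier[OF \<mm>_submod xm] and yc = submod_carrier[OF \<mm>_submod ym]
  note t = functional_simps[OF lin]
  have one: "tf u \<one> = \<zero>\<^bsub>K\<^esub>"
    using linear_map_zero[OF C_module base_module ul] cls_zero[OF submod_zero[OF sq_submod]]
    by (simp add: tangent_functional_def counit_unit A.diff_eq_zero_iff[THEN iffD2])
  have prod: "tf u (c0 x \<otimes> c0 y) = \<zero>\<^bsub>K\<^esub>"
  proof -
    have "c0 x \<otimes> c0 y \<in> aug_sq K G" unfolding aug_sq_def by (rule ideal_prod.prod[OF xm ym])
    then show ?thesis
      using sq_subset tf_\<mm>[of "c0 x \<otimes> c0 y" u] cls_zero linear_map_zero[OF C_module base_module ul]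
      by auto
  qed
  have dec: "z = c0 z \<oplus> e z \<odot> \<one>" if "z \<in> carrier G" for z
    using that by (simp add: A.diff_add_cancel e_simps)
  have tc0: "tf u (c0 z) = tf u z" if "z \<in> carrier G" for z
    using that one by (simp add: t e_simps) (simp add: t a_minus_def)
  define a b \<alpha> \<beta> where defs: "a = c0 x" "b = c0 y" "\<alpha> = e x" "\<beta> = e y"
  have carr: "a \<in> carrier G" "b \<in> carrier G" "\<alpha> \<in> carrier K" "\<beta> \<in> carrier K"
    using xc yc x y by (simp_all add: defs e_simps)
  have "x \<otimes> y = (a \<oplus> \<alpha> \<odot> \<one>) \<otimes> (b \<oplus> \<beta> \<odot> \<one>)"
    using dec[OF x] dec[OF y] by (simp add: defs)
  also have "\<dots> = a \<otimes> b \<oplus> (\<alpha> \<odot> b \<oplus> (\<beta> \<odot> a \<oplus> (\<alpha> \<otimes>\<^bsub>K\<^esub> \<beta>) \<odot> \<one>))"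
    using carr by (simp add: A.l_distr A.r_distr smult_mult_left smult_mult_right M.smult_r_distr
        M.smult_assoc1[symmetric] A.a_ac K.m_comm)
  finally have xy: "x \<otimes> y = a \<otimes> b \<oplus> (\<alpha> \<odot> b \<oplus> (\<beta> \<odot> a \<oplus> (\<alpha> \<otimes>\<^bsub>K\<^esub> \<beta>) \<odot> \<one>))" .
  have p': "tf u (a \<otimes> b) = \<zero>\<^bsub>K\<^esub>" using prod by (simp add: defs)
  have "tf u (x \<otimes> y) = \<alpha> \<otimes>\<^bsub>K\<^esub> tf u b \<oplus>\<^bsub>K\<^esub> \<beta> \<otimes>\<^bsub>K\<^esub> tf u a"
    unfolding xy using carr by (simp add: t p' one)
  also have "\<dots> = e x \<otimes>\<^bsub>K\<^esub> tf u y \<oplus>\<^bsub>K\<^esub> tf u x \<otimes>\<^bsub>K\<^esub> e y"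
    using x y tc0 carr by (simp add: defs K.m_comm functional_simps(1)[OF lin] e_simps(1))
  finally show "tf u (x \<otimes> y) = e x \<otimes>\<^bsub>K\<^esub> tf u y \<oplus>\<^bsub>K\<^esub> tf u x \<otimes>\<^bsub>K\<^esub> e y" .
qed

lemma point_derivation_one:
  assumes d: "point_derivation K G d"
  shows "d \<one> = \<zero>\<^bsub>K\<^esub>"
proof -
  have c: "d \<one> \<in> carrier K" using d by (auto simp: point_derivation_def functional_simps)
  have "d (\<one> \<otimes> \<one>) = e \<one> \<otimes>\<^bsub>K\<^esub> d \<one> \<oplus>\<^bsub>K\<^esub> d \<one> \<otimes>\<^bsub>K\<^esub> e \<one>"
    using d unfolding point_derivation_def by blast
  then have "d \<one> = d \<one> \<oplus>\<^bsub>K\<^esub> d \<one>" using c by (simp add: counit_unit)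
  then show ?thesis using c by (metis K.add.l_cancel_one')
qed

lemma point_derivation_sq:
  assumes d: "point_derivation K G d" and x: "x \<in> aug_sq K G"
  shows "d x = \<zero>\<^bsub>K\<^esub>"
proof -
  have l: "linear_map K G (base K) d" using d by (simp add: point_derivation_def)
  have "x \<in> carrier G \<and> d x = \<zero>\<^bsub>K\<^esub>"
    using x unfolding aug_sq_def
  proof (induct rule: ideal_prod.induct)
    case (prod i j)
    have "d (i \<otimes> j) = e i \<otimes>\<^bsub>K\<^esub> d j \<oplus>\<^bsub>K\<^esub> d i \<otimes>\<^bsub>K\<^esub> e j"
      using d prod by (auto simp: point_derivation_def \<mm>_eq)
    then show ?case using prod by (auto simp: \<mm>_eq functional_simps[OF l])
  qed (auto simp: functional_simps[OF l])
  then show ?thesis by blast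
qed



lemma point_derivation_cls:
  assumes d: "point_derivation K G d" and x: "x \<in> \<mm>"
  shows "the_elem (d ` cls x) = d x"
proof (rule A.the_elem_coset[OF submod_additive[OF sq_submod] submod_carrier[OF \<mm>_submod x]])
  fix n assume n: "n \<in> aug_sq K G"
  have l: "linear_map K G (base K) d" using d by (simp add: point_derivation_def)
  show "d (n \<oplus> x) = d x"
    using point_derivation_sq[OF d n] submod_carrier[OF sq_submod n] submod_carrier[OF \<mm>_submod x]
    by (simp add: functional_simps[OF l])
qed

text \<open>With \<open>tf_point_derivation\<close> and \<open>tf_inject\<close> this identifies the
  Lie superalgebra, as a space, with the point derivations, whose values are taken on elements and
  not on cosets.\<close>

lemma point_derivation_tf:
  assumes d: "point_derivation K G d"
  defines "u \<equiv> (\<lambda>X \<in> carrier C. the_elem (d ` X))"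
  shows "u \<in> carrier (Lie K G)" and "x \<in> carrier G \<Longrightarrow> tf u x = d x"
proof -
  have l: "linear_map K G (base K) d" using d by (simp add: point_derivation_def)
  note t = functional_simps[OF l]
  have u: "u (cls x) = d x" if "x \<in> \<mm>" for x
    unfolding u_def using that cls_closed point_derivation_cls[OF d] by simp
  note mc = submod_carrier[OF \<mm>_submod]
  have "linear_map K C (base K) u"
  proof (rule linear_mapI)
    fix X Y c assume "X \<in> carrier C"
    then obtain x where x: "x \<in> \<mm>" "X = cls x" by (auto simp: C_carrier)
    show "u X \<in> carrier (base K)" using x mc by (simp add: u t)
    show "u (c \<odot>\<^bsub>C\<^esub> X) = c \<odot>\<^bsub>base K\<^esub> u X" if "c \<in> carrier K"
      using that x mc submod_smult[OF \<mm>_submod that x(1)] by (simp add: cls_smult[symmetric] u t)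
    show "u (X \<oplus>\<^bsub>C\<^esub> Y) = u X \<oplus>\<^bsub>base K\<^esub> u Y" if Y: "Y \<in> carrier C"
    proof -
      obtain y where y: "y \<in> \<mm>" "Y = cls y" using Y by (auto simp: C_carrier)
      show ?thesis using x y mc submod_add[OF \<mm>_submod x(1) y(1)]
          by (simp add: cls_add[symmetric] u t)
    qed
  qed
  then show "u \<in> carrier (Lie K G)" by (simp add: Lie_carrier u_def)
  show "tf u x = d x" if x: "x \<in> carrier G"
    using u[OF c0_closed[OF x]] x point_derivation_one[OF d]
    by (simp add: tangent_functional_def t e_simps) (simp add: t a_minus_def)
qed

lemma tf_inject:
  assumes "u \<in> carrier (Lie K G)" "v \<in> carrier (Lie K G)" "\<And>x. x \<in> carrier G \<Longrightarrow> tf u x = tf v x"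
  shows "u = v"
proof (rule extensionalityI)
  show "u \<in> extensional (carrier C)" "v \<in> extensional (carrier C)" using assms
      by (auto simp: Lie_carrier)
  fix X assume "X \<in> carrier C"
  then obtain x where x: "x \<in> \<mm>" "X = cls x" by (auto simp: C_carrier)
  then show "u X = v X"
    using assms(3)[OF submod_carrier[OF \<mm>_submod x(1)]] by (simp add: tf_\<mm>)
qed

end

lemma quot_hopf_sel [simp]:
  "carrier (quot_hopf K G I) = a_rcosets\<^bsub>G\<^esub> I" "zero (quot_hopf K G I) = I"
  "add (quot_hopf K G I) = set_add G" "mult (quot_hopf K G I) = rcoset_mult G I"
  "one (quot_hopf K G I) = I +>\<^bsub>G\<^esub> \<one>\<^bsub>G\<^esub>" "smult (quot_hopf K G I) = smult (quot_module G I)"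
  "gr (quot_hopf K G I) = (\<lambda>i. (\<lambda>x. I +>\<^bsub>G\<^esub> x) ` gr G i)"
  "comult (quot_hopf K G I) = (\<lambda>X. the_elem ((\<lambda>x. tensor_map K (quot_super G I) (quot_super G I)
      (\<lambda>a. I +>\<^bsub>G\<^esub> a) (\<lambda>b. I +>\<^bsub>G\<^esub> b) (comult G x)) ` X))"
  "counit (quot_hopf K G I) = (\<lambda>X. the_elem (counit G ` X))"
  "antipode (quot_hopf K G I) = (\<lambda>X. the_elem ((\<lambda>x. I +>\<^bsub>G\<^esub> antipode G x) ` X))"
  by (simp_all add: quot_hopf_def Let_def super.defs hopf.defs)

section \<open>Quotients by ideals and the pullback of tangent vectors\<close>

context augmented
begin

context
  fixes I
  assumes I: "ideal I G"
begin

abbreviation "Q \<equiv> quot_hopf K G I"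
abbreviation "\<pi> x \<equiv> I +> x"

lemmas I_submod = ideal_submod[OF I]

lemma module_Q: "module K Q"
  by (rule module_cong[OF module_quot[OF M.module_axioms I_submod]]) simp_all

lemma pi_linear: "linear_map K G Q \<pi>"
  using linear_map_coset[OF M.module_axioms I_submod] by (simp add: linear_map_def)

lemma pi_closed: "x \<in> carrier G \<Longrightarrow> \<pi> x \<in> carrier Q"
  by (rule linear_map_closed[OF pi_linear])

lemma pi_exhaust: "X \<in> carrier Q \<Longrightarrow> \<exists>x \<in> carrier G. X = \<pi> x"
  by (simp add: quot_carrier_iff)

lemma pi_add: "\<lbrakk>x \<in> carrier G; y \<in> carrier G\<rbrakk> \<Longrightarrow> \<pi> (x \<oplus> y) = \<pi> x \<oplus>\<^bsub>Q\<^esub> \<pi> y"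
  and pi_smult: "\<lbrakk>c \<in> carrier K; x \<in> carrier G\<rbrakk> \<Longrightarrow> \<pi> (c \<odot> x) = c \<odot>\<^bsub>Q\<^esub> \<pi> x"
  by (simp_all only: linear_map_add[OF pi_linear] linear_map_smult[OF pi_linear])

lemma pi_mult: "\<lbrakk>x \<in> carrier G; y \<in> carrier G\<rbrakk> \<Longrightarrow> \<pi> (x \<otimes> y) = \<pi> x \<otimes>\<^bsub>Q\<^esub> \<pi> y"
  using ideal.rcoset_mult_add[OF I] by simp

lemma pi_zero_iff: "x \<in> carrier G \<Longrightarrow> \<pi> x = \<zero>\<^bsub>Q\<^esub> \<longleftrightarrow> x \<in> I"
  using coset_eq_zero_iff[OF M.module_axioms I_submod] by simp

lemma kalg_Q: "kalg K Q"
proof (intro kalg.intro kalg_axioms.intro K.field_axioms module_Q)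
  show "ring Q"
    by (rule ring_cong[OF ideal.quotient_is_ring[OF I]]) (simp_all add: FactRing_def)
qed (auto dest!: pi_exhaust simp del: quot_hopf_sel
    simp: pi_mult[symmetric] pi_smult[symmetric] smult_mult_left smult_mult_right)

lemma quot_map:
  assumes "\<And>n. n \<in> I \<Longrightarrow> f (n \<oplus> x) = f x" "x \<in> carrier G"
  shows "the_elem (f ` \<pi> x) = f x"
  by (rule A.the_elem_coset[OF submod_additive[OF I_submod] assms(2,1)])

context
  assumes eI: "\<And>x. x \<in> I \<Longrightarrow> e x = \<zero>\<^bsub>K\<^esub>"
begin

lemma counit_Q: "x \<in> carrier G \<Longrightarrow> counit Q (\<pi> x) = e x"
  using quot_map[of e x] eI submod_carrier[OF I_submod] by (simp add: e_simps)

lemma augmented_Q: "augmented K Q"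
proof (intro augmented.intro augmented_axioms.intro kalg_Q)
  show "linear_map K Q (base K) (counit Q)"
    by (rule linear_mapI)
      (auto dest!: pi_exhaust simp del: quot_hopf_sel
        simp: pi_add[symmetric] pi_smult[symmetric] counit_Q e_simps)
  have "\<one>\<^bsub>Q\<^esub> = \<pi> \<one>" by simp
  then show "counit Q \<one>\<^bsub>Q\<^esub> = \<one>\<^bsub>K\<^esub>" using counit_Q[OF A.one_closed] by (simp only: counit_unit)
qed (auto dest!: pi_exhaust simp del: quot_hopf_sel
    simp: pi_mult[symmetric] counit_Q counit_multiplicative)

interpretation Q: augmented K Q
  by (rule augmented_Q)

lemma pi_\<mm>: "x \<in> \<mm> \<Longrightarrow> \<pi> x \<in> Q.\<mm>"
  using pi_closed counit_Q by (auto simp: \<mm>_eq Q.\<mm>_eq simp del: quot_hopf_sel)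

lemma pi_sq:
  assumes "n \<in> aug_sq K G"
  shows "\<pi> n \<in> aug_sq K Q"
proof -
  have "n \<in> carrier G \<and> \<pi> n \<in> aug_sq K Q"
    using assms unfolding aug_sq_def
  proof (induct rule: ideal_prod.induct)
    case (prod i j)
    have "i \<in> carrier G" "j \<in> carrier G" using prod by (auto simp: \<mm>_eq)
    then show ?case
      using ideal_prod.prod[OF pi_\<mm>[OF prod(1)] pi_\<mm>[OF prod(2)], of Q]
      by (simp del: quot_hopf_sel add: pi_mult)
  next
    case (sum s1 s2)
    then show ?case
      using ideal_prod.sum[of "\<pi> s1" Q Q.\<mm> Q.\<mm> "\<pi> s2"] by (simp del: quot_hopf_sel add: pi_add)
  qed
  then show ?thesis by blast
qed

lemma lie_incl_cls:
  assumes x: "x \<in> \<mm>"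
  shows "lie_incl K G I v (cls x) = v (Q.cls (\<pi> x))"
proof -
  have "the_elem ((\<lambda>x. v (Q.cls (\<pi> x))) ` cls x) = v (Q.cls (\<pi> x))"
  proof (rule A.the_elem_coset[OF submod_additive[OF sq_submod] submod_carrier[OF \<mm>_submod x]])
    fix n assume n: "n \<in> aug_sq K G"
    have nm: "n \<in> \<mm>" using n sq_subset by blast
    have "Q.cls (\<pi> (n \<oplus> x)) = Q.cls (\<pi> n) \<oplus>\<^bsub>Q.C\<^esub> Q.cls (\<pi> x)"
      using Q.cls_add[OF pi_\<mm>[OF nm] pi_\<mm>[OF x]] submod_carrier[OF \<mm>_submod] nm x
          by (simp only: pi_add)
    also have "\<dots> = Q.cls (\<pi> x)"
    proof -
      interpret C: module K Q.C by (rule Q.C_module)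
      show ?thesis using Q.cls_zero[OF pi_sq[OF n]] Q.cls_closed[OF pi_\<mm>[OF x]]
          by (simp only: C.M.l_zero)
    qed
    finally show "v (Q.cls (\<pi> (n \<oplus> x))) = v (Q.cls (\<pi> x))" by (simp only:)
  qed
  then show ?thesis using cls_closed[OF x] by (simp add: lie_incl_def Let_def)
qed

text \<open>Replaces the definition through cosets of cosets by composition with the
  projection.\<close>

lemma tf_lie_incl:
  assumes x: "x \<in> carrier G"
  shows "tf (lie_incl K G I v) x = Q.tf v (\<pi> x)"
proof -
  have "Q.c0 (\<pi> x) = \<pi> (c0 x)"
    using x linear_map_minus[OF M.module_axioms module_Q pi_linear x, of "e x \<odot> \<one>"] counit_Q[OF x]
      pi_smult[of "e x" "\<one>"] quot_hopf_sel(5)[of K G I] e_simps(1)[OF x]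
    by (simp del: quot_hopf_sel)
  then show ?thesis
    unfolding tangent_functional_def using lie_incl_cls[OF c0_closed[OF x], of v] by (simp only:)
qed

lemma point_derivation_pi:
  assumes d: "point_derivation K Q d"
  shows "point_derivation K G (\<lambda>x. d (\<pi> x))"
  unfolding point_derivation_def
proof (intro conjI ballI)
  have l: "linear_map K Q (base K) d" using d by (simp add: point_derivation_def)
  show "linear_map K G (base K) (\<lambda>x. d (\<pi> x))" by (rule linear_map_comp[OF pi_linear l])
  fix x y assume x: "x \<in> carrier G" and y: "y \<in> carrier G"
  have "d (\<pi> x \<otimes>\<^bsub>Q\<^esub> \<pi> y) = counit Q (\<pi> x) \<otimes>\<^bsub>K\<^esub> d (\<pi> y) \<oplus>\<^bsub>K\<^esub> d (\<pi> x) \<otimes>\<^bsub>K\<^esub> counit Q (\<pi> y)"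
    using d pi_closed[OF x] pi_closed[OF y] unfolding point_derivation_def by blast
  then show "d (\<pi> (x \<otimes> y)) = e x \<otimes>\<^bsub>K\<^esub> d (\<pi> y) \<oplus>\<^bsub>K\<^esub> d (\<pi> x) \<otimes>\<^bsub>K\<^esub> e y"
    using x y by (simp only: pi_mult counit_Q)
qed

lemma lie_incl_Lie:
  assumes v: "v \<in> carrier (Lie K Q)"
  shows "lie_incl K G I v \<in> carrier (Lie K G)"
proof -
  have d: "point_derivation K G (\<lambda>x. Q.tf v (\<pi> x))"
    by (rule point_derivation_pi[OF Q.tf_point_derivation[OF v]])
  define u where "u = (\<lambda>X \<in> carrier C. the_elem ((\<lambda>x. Q.tf v (\<pi> x)) ` X))"
  note u = point_derivation_tf[OF d, folded u_def]
  have "lie_incl K G I v = u"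
  proof (rule extensionalityI)
    show "lie_incl K G I v \<in> extensional (carrier C)" by (simp add: lie_incl_def Let_def)
    show "u \<in> extensional (carrier C)" by (simp add: u_def)
    fix X assume "X \<in> carrier C"
    then obtain x where x: "x \<in> \<mm>" "X = cls x" by (auto simp: C_carrier)
    note xc = submod_carrier[OF \<mm>_submod x(1)]
    show "lie_incl K G I v X = u X"
      using tf_lie_incl[OF xc, of v] u(2)[OF xc] tf_\<mm>[OF x(1)] x(2) by (simp only:)
  qed
  then show ?thesis using u(1) by simp
qed

text \<open>A point derivation factors through the quotient exactly when it kills the ideal.
  Algebraicity thereby becomes a statement about which tangent vectors vanish on a Hopf
  superideal.\<close>

theorem lie_incl_image:
  "lie_incl K G I ` carrier (Lie K Q) = {u \<in> carrier (Lie K G). \<forall>x \<in> I. tf u x = \<zero>\<^bsub>K\<^esub>}"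
proof (intro equalityI subsetI)
  fix u assume "u \<in> lie_incl K G I ` carrier (Lie K Q)"
  then obtain v where v: "v \<in> carrier (Lie K Q)" "u = lie_incl K G I v" by blast
  have l: "linear_map K Q (base K) (Q.tf v)"
    using Q.tf_point_derivation[OF v(1)] by (simp add: point_derivation_def)
  have "tf u x = \<zero>\<^bsub>K\<^esub>" if x: "x \<in> I" for x
  proof -
    note xc = submod_carrier[OF I_submod x]
    have "tf u x = Q.tf v (\<pi> x)" unfolding v(2) by (rule tf_lie_incl[OF xc])
    also have "\<pi> x = \<zero>\<^bsub>Q\<^esub>" using pi_zero_iff[OF xc] x by blast
    finally show ?thesis using Q.functional_simps(4)[OF l] by (simp only:)
  qed
  then show "u \<in> {u \<in> carrier (Lie K G). \<forall>x \<in> I. tf u x = \<zero>\<^bsub>K\<^esub>}"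
    using lie_incl_Lie[OF v(1)] v(2) by simp
next
  fix u assume "u \<in> {u \<in> carrier (Lie K G). \<forall>x \<in> I. tf u x = \<zero>\<^bsub>K\<^esub>}"
  then have u: "u \<in> carrier (Lie K G)" and z: "\<And>x. x \<in> I \<Longrightarrow> tf u x = \<zero>\<^bsub>K\<^esub>" by auto
  note pd = tf_point_derivation[OF u]
  have l: "linear_map K G (base K) (tf u)" using pd by (simp add: point_derivation_def)
  note t = functional_simps[OF l]
  define d where "d = (\<lambda>X. the_elem (tf u ` X))"
  have d: "d (\<pi> x) = tf u x" if "x \<in> carrier G" for x
    unfolding d_def using quot_map[of "tf u" x] that z submod_carrier[OF I_submod] by (simp add: t)
  have "point_derivation K Q d"
    unfolding point_derivation_def
  proof (intro conjI ballI linear_mapI)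
    fix X Y assume X: "X \<in> carrier Q" and Y: "Y \<in> carrier Q"
    obtain x where x: "x \<in> carrier G" "X = \<pi> x" using pi_exhaust[OF X] by (elim bexE)
    obtain y where y: "y \<in> carrier G" "Y = \<pi> y" using pi_exhaust[OF Y] by (elim bexE)
    note xy = x(1) y(1) x(2) y(2)
    have "tf u (x \<otimes> y) = e x \<otimes>\<^bsub>K\<^esub> tf u y \<oplus>\<^bsub>K\<^esub> tf u x \<otimes>\<^bsub>K\<^esub> e y"
      using pd xy unfolding point_derivation_def by blast
    then show "d (X \<otimes>\<^bsub>Q\<^esub> Y) = counit Q X \<otimes>\<^bsub>K\<^esub> d Y \<oplus>\<^bsub>K\<^esub> d X \<otimes>\<^bsub>K\<^esub> counit Q Y"
      using xy by (simp del: quot_hopf_sel add: pi_mult[symmetric] d counit_Q)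
    show "d (X \<oplus>\<^bsub>Q\<^esub> Y) = d X \<oplus>\<^bsub>base K\<^esub> d Y"
      using xy by (simp del: quot_hopf_sel add: pi_add[symmetric] d t)
    show "d (c \<odot>\<^bsub>Q\<^esub> X) = c \<odot>\<^bsub>base K\<^esub> d X" if "c \<in> carrier K" for c
      using xy that by (simp del: quot_hopf_sel add: pi_smult[symmetric] d t)
    show "d X \<in> carrier (base K)" using xy by (simp del: quot_hopf_sel add: d t)
  qed
  from Q.point_derivation_tf[OF this] obtain v where v: "v \<in> carrier (Lie K Q)"
    "\<And>X. X \<in> carrier Q \<Longrightarrow> Q.tf v X = d X" by blast
  have "lie_incl K G I v = u"
    by (rule tf_inject[OF lie_incl_Lie[OF v(1)] u]) (simp only: tf_lie_incl v(2) pi_closed d)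
  then show "u \<in> lie_incl K G I ` carrier (Lie K Q)" using v(1) by blast
qed

end

end

end

section \<open>Convolution and the even quotient\<close>

lemma tensor_rels_cong:
  assumes "carrier A' = carrier A" "add A' = add A" "smult A' = smult A"
    "carrier B' = carrier B" "add B' = add B" "smult B' = smult B"
  shows "tensor_rels K A' B' = tensor_rels K A B"
  by (simp add: tensor_rels_def assms)

lemma pure_tensor_cong:
  assumes "carrier A' = carrier A" "add A' = add A" "smult A' = smult A"
    "carrier B' = carrier B" "add B' = add B" "smult B' = smult B"
  shows "pure_tensor K A' B' = pure_tensor K A B" "tensor_module K A' B' = tensor_module K A B"
  using tensor_rels_cong[of A' A B' B K] assms
      by (auto simp: fun_eq_iff pure_tensor_def tensor_module_def)

text \<open>\<open>quot_hopf\<close> forms its comultiplication in the tensor square of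
  \<open>quot_super\<close>, which is a different record from the Hopf quotient with the same
  structure.\<close>

lemma tensor_cong:
  assumes "carrier A' = carrier A" "add A' = add A" "smult A' = smult A" "gr A' = gr A"
      "mult A' = mult A"
    "one A' = one A" "carrier B' = carrier B" "add B' = add B" "smult B' = smult B" "gr B' = gr B"
    "mult B' = mult B" "one B' = one B"
  shows "tensor K A' B' = tensor K A B"
proof -
  have h: "hpart A' = hpart A" "hpart B' = hpart B"
    using assms by (simp_all add: fun_eq_iff hpart_def)
  show ?thesis
    unfolding tensor_def Let_def
      pure_tensor_cong[of A' A B' B, OF assms(1-3) assms(7-9)] h assms ..
qed

section \<open>Convolution of linear maps into an algebra\<close>

context hopf begin

text \<open>Values lie in an algebra and there are no Koszul signs, in contrast to
  \<open>convolution\<close>. It serves the uniqueness of convolution inverses in the even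
  quotient.\<close>

definition conv :: "('k, 'c, 'o) module_scheme \<Rightarrow> ('a \<Rightarrow> 'c) \<Rightarrow> ('a \<Rightarrow> 'c) \<Rightarrow> 'a \<Rightarrow> 'c"
  where "conv B f h x = tensor_lift K B (\<lambda>a b. f a \<otimes>\<^bsub>B\<^esub> h b) (\<Delta> x)"

context
  fixes B :: "('k, 'c, 'o) module_scheme"
  assumes B: "kalg K B"
begin

interpretation B: kalg K B by (rule B)

lemma conv_linear:
  assumes "linear_map K A B f" "linear_map K A B h"
  shows "linear_map K A B (conv B f h)"
  unfolding conv_def
  by (rule linear_map_comp[OF comult_linear TP.lift_linear[OF B.M.module_axioms
      B.mult_bilinear_comp[OF assms]]])

lemma conv_assoc:
  assumes f: "linear_map K A B f" and g: "linear_map K A B g" and h: "linear_map K A B h"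
      and x: "x \<in> carrier A"
  shows "conv B (conv B f g) h x = conv B f (conv B g h) x"
proof -
  note Bm = B.M.module_axioms and dx = comult_closed[OF x]
  let ?gh = "tensor_lift K B (\<lambda>b c. g b \<otimes>\<^bsub>B\<^esub> h c)"
  have gh: "linear_map K T B ?gh" by (rule TP.lift_linear[OF Bm B.mult_bilinear_comp[OF g h]])
  let ?\<Phi> = "\<lambda>a t. f a \<otimes>\<^bsub>B\<^esub> ?gh t"
  have \<Phi>: "bilinear_map K A T B ?\<Phi>" by (rule B.mult_bilinear_comp[OF f gh])
  note fc = linear_map_closed[OF f] and gc = linear_map_closed[OF g]
      and hc = linear_map_closed[OF h]
  have inner: "tensor_lift K B (\<lambda>a b. ?\<Phi> a (pure_tensor K A A b c)) (\<Delta> x1) = conv B f g x1 \<otimes>\<^bsub>B\<^esub> h c"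
    if x1: "x1 \<in> carrier A" and c: "c \<in> carrier A" for x1 c
  proof -
    have b: "bilinear_map K A A B (\<lambda>a b. ?\<Phi> a (pure_tensor K A A b c))"
      by (rule bilinear_map_comp_right[OF bilinear_mapD(2)[OF TP.pt_bilinear c] \<Phi>])
    have b': "bilinear_map K A A B (\<lambda>a b. (f a \<otimes>\<^bsub>B\<^esub> g b) \<otimes>\<^bsub>B\<^esub> h c)"
      by (rule bilinear_map_comp[OF B.mult_linear_left[OF linear_map_id hc[OF c]]
          B.mult_bilinear_comp[OF f g]])
    have "tensor_lift K B (\<lambda>a b. ?\<Phi> a (pure_tensor K A A b c)) (\<Delta> x1)
      = tensor_lift K B (\<lambda>a b. (f a \<otimes>\<^bsub>B\<^esub> g b) \<otimes>\<^bsub>B\<^esub> h c) (\<Delta> x1)"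
      by (rule TP.lift_cong[OF Bm b b' _ comult_closed[OF x1]])
        (simp add: TP.lift_pt[OF Bm B.mult_bilinear_comp[OF g h]] c fc gc hc B.A.m_assoc)
    also have "\<dots> = conv B f g x1 \<otimes>\<^bsub>B\<^esub> h c"
      unfolding conv_def
      by (rule TP.lift_comp[symmetric, OF Bm Bm B.mult_linear_left[OF linear_map_id hc[OF c]]
            B.mult_bilinear_comp[OF f g] comult_closed[OF x1]])
    finally show ?thesis .
  qed
  have "conv B (conv B f g) h x
      = tensor_lift K B (\<lambda>x1 c. tensor_lift K B (\<lambda>a b. ?\<Phi> a (pure_tensor K A A b c)) (\<Delta> x1)) (\<Delta> x)"
    unfolding conv_def[of B "conv B f g"]
    by (rule TP.lift_cong'[OF Bm _ _ dx, symmetric])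
      (simp_all add: inner linear_map_closed[OF conv_linear[OF f g]] hc)
  also have "\<dots> = tensor_lift K B (\<lambda>a x2. ?\<Phi> a (\<Delta> x2)) (\<Delta> x)" by (rule coassoc_lift[OF Bm \<Phi> x])
  finally show ?thesis unfolding conv_def .
qed

lemma conv_unit_right:
  assumes f: "linear_map K A B f" and x: "x \<in> carrier A"
  shows "conv B f (\<lambda>b. \<epsilon> b \<odot>\<^bsub>B\<^esub> \<one>\<^bsub>B\<^esub>) x = f x"
proof -
  note Bm = B.M.module_axioms and dx = comult_closed[OF x] and fc = linear_map_closed[OF f]
  have "conv B f (\<lambda>b. \<epsilon> b \<odot>\<^bsub>B\<^esub> \<one>\<^bsub>B\<^esub>) x = tensor_lift K B (\<lambda>a b. f (\<epsilon> b \<odot> a)) (\<Delta> x)"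
    unfolding conv_def
    by (rule TP.lift_cong'[OF Bm _ _ dx])
      (simp_all add: fc lf_closed[OF counit_linear] B.smult_mult_right linear_map_smult[OF f])
  also have "\<dots> = f x"
    using TP.lift_comp[symmetric, OF M.module_axioms Bm f Lop_bilinear[OF counit_linear] dx]
        counit_right[OF x]
    by simp
  finally show ?thesis .
qed

lemma conv_unit_left:
  assumes f: "linear_map K A B f" and z: "z \<in> carrier B" and x: "x \<in> carrier A"
  shows "conv B (\<lambda>b. \<epsilon> b \<odot>\<^bsub>B\<^esub> z) f x = z \<otimes>\<^bsub>B\<^esub> f x"
proof -
  note Bm = B.M.module_axioms and dx = comult_closed[OF x] and fc = linear_map_closed[OF f]
  note zf = B.mult_linear_right[OF f z]
  have b: "bilinear_map K A A A (\<lambda>a b. \<epsilon> a \<odot> b)"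
    by (rule bilinear_map_swap[OF smult_bilinear[OF counit_linear linear_map_id]])
  have "conv B (\<lambda>b. \<epsilon> b \<odot>\<^bsub>B\<^esub> z) f x = tensor_lift K B (\<lambda>a b. z \<otimes>\<^bsub>B\<^esub> f (\<epsilon> a \<odot> b)) (\<Delta> x)"
    unfolding conv_def
    by (rule TP.lift_cong'[OF Bm _ _ dx])
      (simp_all add: fc z lf_closed[OF counit_linear] B.smult_mult_right B.smult_mult_left
          linear_map_smult[OF f])
  also have "\<dots> = z \<otimes>\<^bsub>B\<^esub> f x"
    using TP.lift_comp[symmetric, OF M.module_axioms Bm zf b dx] counit_left[OF x] by simp
  finally show ?thesis .
qed



text \<open>f = f * (q * s) = (f * q) * s: a factor with a convolution inverse can be
  cancelled.\<close>

lemma conv_cancel: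
  assumes f: "linear_map K A B f" and q: "linear_map K A B q" and s: "linear_map K A B s"
    and qs: "\<And>x. x \<in> carrier A \<Longrightarrow> conv B q s x = \<epsilon> x \<odot>\<^bsub>B\<^esub> \<one>\<^bsub>B\<^esub>"
    and z: "z \<in> carrier B" and fq: "\<And>x. x \<in> carrier A \<Longrightarrow> conv B f q x = \<epsilon> x \<odot>\<^bsub>B\<^esub> z"
        and x: "x \<in> carrier A"
  shows "f x = z \<otimes>\<^bsub>B\<^esub> s x"
proof -
  note Bm = B.M.module_axioms and dx = comult_closed[OF x]
  note fc = linear_map_closed[OF f] and sc = linear_map_closed[OF s]
      and qc = linear_map_closed[OF q]
  have "f x = conv B f (\<lambda>b. \<epsilon> b \<odot>\<^bsub>B\<^esub> \<one>\<^bsub>B\<^esub>) x" by (rule conv_unit_right[OF f x, symmetric])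
  also have "\<dots> = conv B f (conv B q s) x"
    unfolding conv_def[of B f]
    by (rule TP.lift_cong'[OF Bm _ _ dx])
      (simp_all add: qs fc linear_map_closed[OF conv_linear[OF q s]] lf_closed[OF counit_linear])
  also have "\<dots> = conv B (conv B f q) s x" by (rule conv_assoc[OF f q s x, symmetric])
  also have "\<dots> = conv B (\<lambda>b. \<epsilon> b \<odot>\<^bsub>B\<^esub> z) s x"
    unfolding conv_def[of B _ s]
    by (rule TP.lift_cong'[OF Bm _ _ dx]) (simp_all add: fq z sc lf_closed[OF counit_linear])
  also have "\<dots> = z \<otimes>\<^bsub>B\<^esub> s x" by (rule conv_unit_left[OF s z x])
  finally show ?thesis .
qed

end

section \<open>The even quotient of the coordinate superalgebra\<close>

sublocale Aug: augmented K A
  by unfold_locales (simp_all add: counit_linear counit_mult counit_one)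

abbreviation "\<aa> \<equiv> ev_ideal A"
abbreviation "\<B> \<equiv> ev_supergroup K A"
abbreviation "q x \<equiv> \<aa> +> x"

lemma odd_carrier: "gr A i \<subseteq> carrier A"
  using S.gr_closed by blast

lemma ev_ideal: "ideal \<aa> A"
  unfolding ev_ideal_def by (rule A.genideal_ideal[OF odd_carrier])

lemma odd_ev: "gr A 1 \<subseteq> \<aa>"
  unfolding ev_ideal_def by (rule A.genideal_self[OF odd_carrier])

lemma ev_least: "\<lbrakk>ideal N A; gr A 1 \<subseteq> N\<rbrakk> \<Longrightarrow> \<aa> \<subseteq> N"
  unfolding ev_ideal_def by (rule A.genideal_minimal)

lemma ev_carrier: "x \<in> \<aa> \<Longrightarrow> x \<in> carrier A"
  using submod_carrier[OF ideal_submod[OF ev_ideal]] .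

lemma ev_counit: "x \<in> \<aa> \<Longrightarrow> \<epsilon> x = \<zero>\<^bsub>K\<^esub>"
proof -
  have "gr A 1 \<subseteq> Aug.\<mm>" using counit_odd S.gr_closed by (auto simp: Aug.\<mm>_eq)
  from ev_least[OF Aug.\<mm>_ideal this] show "x \<in> \<aa> \<Longrightarrow> \<epsilon> x = \<zero>\<^bsub>K\<^esub>" by (auto simp: Aug.\<mm>_eq)
qed

lemma ev_sel: "\<B> = quot_hopf K A \<aa>"
  by (simp add: ev_supergroup_def)

sublocale B: augmented K \<B>
  unfolding ev_sel by (rule Aug.augmented_Q[OF ev_ideal ev_counit])

lemmas q_linear = Aug.pi_linear[OF ev_ideal, folded ev_sel]
  and q_closed = Aug.pi_closed[OF ev_ideal, folded ev_sel]
  and q_exhaust = Aug.pi_exhaust[OF ev_ideal, folded ev_sel]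
  and q_add = Aug.pi_add[OF ev_ideal, folded ev_sel]
  and q_smult = Aug.pi_smult[OF ev_ideal, folded ev_sel]
  and q_mult = Aug.pi_mult[OF ev_ideal, folded ev_sel]
  and q_zero_iff = Aug.pi_zero_iff[OF ev_ideal, folded ev_sel]
lemma q_counit: "x \<in> carrier A \<Longrightarrow> counit \<B> (q x) = \<epsilon> x"
  by (rule Aug.counit_Q[OF ev_ideal ev_counit, folded ev_sel])

lemma q_lie_incl: "x \<in> carrier A \<Longrightarrow> Aug.tf (lie_incl K A \<aa> w) x = B.tf w (q x)"
  by (rule Aug.tf_lie_incl[OF ev_ideal ev_counit, folded ev_sel])

lemma q_lie_incl_Lie: "w \<in> carrier (Lie K \<B>) \<Longrightarrow> lie_incl K A \<aa> w \<in> carrier (Lie K A)"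
  by (rule Aug.lie_incl_Lie[OF ev_ideal ev_counit, folded ev_sel])

lemma q_lie_incl_image: "lie_incl K A \<aa> ` carrier (Lie K \<B>) =
    {u \<in> carrier (Lie K A). \<forall>x \<in> \<aa>. Aug.tf u x = \<zero>\<^bsub>K\<^esub>}"
  by (rule Aug.lie_incl_image[OF ev_ideal ev_counit, folded ev_sel])

lemma q_one: "q \<one> = \<one>\<^bsub>\<B>\<^esub>"
  by (simp add: ev_sel)

lemma q_odd: "x \<in> gr A 1 \<Longrightarrow> q x = \<zero>\<^bsub>\<B>\<^esub>"
  using q_zero_iff[OF S.gr_closed] odd_ev by blast

lemma q_hpart: "x \<in> carrier A \<Longrightarrow> q (hpart A i x) = (if i = 0 then q x else \<zero>\<^bsub>\<B>\<^esub>)"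
proof -
  assume x: "x \<in> carrier A"
  have "q x = q (hpart A 0 x) \<oplus>\<^bsub>\<B>\<^esub> q (hpart A 1 x)"
    using S.hpart_decomp[OF x, of 0] q_add[OF S.hpart_closed[OF x] S.hpart_closed[OF x]]
        by (metis add.left_neutral)
  then show ?thesis
    using q_odd[OF S.hpart_gr[OF x, of 1]] q_closed[OF S.hpart_closed[OF x, of 0]] bit_cases[of i]
        by auto
qed

sublocale TB: super_pair K \<B> \<B>
  by (simp add: super_pair_def tensor_pair_def K.field_axioms B.M.module_axioms)

abbreviation "qq t \<equiv> tensor_lift K TB.TT (\<lambda>a b. TB.pt (q a) (q b)) t"

lemma ptB_bilinear: "bilinear_map K \<B> \<B> TB.TT TB.pt"
  using TB.pt_bilinear by (simp add: bilinear_map_def linear_map_def)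

lemma qq_bilinear: "bilinear_map K A A TB.TT (\<lambda>a b. TB.pt (q a) (q b))"
  by (rule bilinear_map_comp_left[OF q_linear bilinear_map_comp_right[OF q_linear ptB_bilinear]])

lemma qq_linear: "linear_map K T TB.TT (\<lambda>t. qq t)"
  by (rule TP.lift_linear[OF TB.module_TT qq_bilinear])

lemma qq_pt: "\<lbrakk>a \<in> carrier A; b \<in> carrier A\<rbrakk> \<Longrightarrow> qq (TP.pt a b) = TB.pt (q a) (q b)"
  by (rule TP.lift_pt[OF TB.module_TT qq_bilinear])

text \<open>Each homogeneous summand of \<Delta> x has an odd factor, which dies in the even
  quotient.\<close>

lemma qq_odd:
  assumes x: "x \<in> gr A 1"
  shows "qq (\<Delta> x) = \<zero>\<^bsub>TB.TT\<^esub>"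
proof -
  interpret TTm: module K TB.TT by (rule TB.module_TT)
  have z: "submod K TB.TT {\<zero>\<^bsub>TB.TT\<^esub>}" by (rule submodI[OF TB.module_TT]) auto
  have "qq (\<Delta> x) \<in> {\<zero>\<^bsub>TB.TT\<^esub>}"
  proof (rule linear_map_hull[OF TP.T.module_axioms TB.module_TT qq_linear z _ _ comult_gr[OF x]])
    show "{TP.pt a b |a b j k. a \<in> gr A j \<and> b \<in> gr A k \<and> j + k = 1} \<subseteq> carrier T"
      by (auto intro!: TP.pt_closed S.gr_closed)
    fix t assume "t \<in> {TP.pt a b |a b j k. a \<in> gr A j \<and> b \<in> gr A k \<and> j + k = 1}"
    then obtain a b j k where t: "t = TP.pt a b" "a \<in> gr A j" "b \<in> gr A k" "j + k = 1" by blast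
    note c = S.gr_closed[OF t(2)] S.gr_closed[OF t(3)]
    have "j = 1 \<or> k = 1" using t(4) bit_cases[of j] bit_cases[of k] by auto
    then show "qq t \<in> {\<zero>\<^bsub>TB.TT\<^esub>}"
    proof
      assume "j = 1"
      then show ?thesis
        using t c q_odd[of a] q_closed linear_map_zero[OF B.M.module_axioms TB.module_TT
            bilinear_mapD(2)[OF ptB_bilinear]]
        by (simp add: qq_pt del: TB.TT_sel)
    next
      assume "k = 1"
      then show ?thesis
        using t c q_odd[of b] q_closed linear_map_zero[OF B.M.module_axioms TB.module_TT
            bilinear_mapD(1)[OF ptB_bilinear]]
        by (simp add: qq_pt del: TB.TT_sel)
    qed
  qed
  then show ?thesis by simp
qed

text \<open>No Koszul signs occur, since odd factors vanish in the even quotient.\<close>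

lemma qq_mult:
  assumes x: "x \<in> carrier A" and y: "y \<in> carrier A"
  shows "qq (\<Delta> (x \<otimes> y)) = tensor_lift K TB.TT (\<lambda>a b. tensor_lift K TB.TT
      (\<lambda>c d. TB.pt (q a \<otimes>\<^bsub>\<B>\<^esub> q c) (q b \<otimes>\<^bsub>\<B>\<^esub> q d)) (\<Delta> y)) (\<Delta> x)"
proof -
  interpret TTm: module K TB.TT by (rule TB.module_TT)
  note Tm = TB.module_TT
  let ?\<phi> = "\<lambda>a b. TB.pt (q a) (q b)"
  have ptc: "TB.pt a b \<in> carrier TB.TT" if "a \<in> carrier \<B>" "b \<in> carrier \<B>" for a b
    using bilinear_map_closed[OF ptB_bilinear that] .
  have z1: "TB.pt a \<zero>\<^bsub>\<B>\<^esub> = \<zero>\<^bsub>TB.TT\<^esub>" and z2: "TB.pt \<zero>\<^bsub>\<B>\<^esub> a = \<zero>\<^bsub>TB.TT\<^esub>" if "a \<in> carrier \<B>" for a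
    using linear_map_zero[OF B.M.module_axioms Tm bilinear_mapD(1)[OF ptB_bilinear that]]
      linear_map_zero[OF B.M.module_axioms Tm bilinear_mapD(2)[OF ptB_bilinear that]] by simp_all
  have eq: "bprod TB.TT ?\<phi> a b c d = TB.pt (q a \<otimes>\<^bsub>\<B>\<^esub> q c) (q b \<otimes>\<^bsub>\<B>\<^esub> q d)"
    if "a \<in> carrier A" "b \<in> carrier A" "c \<in> carrier A" "d \<in> carrier A" for a b c d
    using that unfolding bprod_def
    by (simp add: q_mult S.hpart_closed q_hpart q_closed z1 z2 ptc del: TB.TT_sel)
  show ?thesis
    unfolding lift_comult_mult[OF Tm qq_bilinear x y]
  proof (rule TP.lift_cong'[OF Tm _ _ comult_closed[OF x]])
    fix a b assume ab: "a \<in> carrier A" "b \<in> carrier A"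
    show e: "tensor_lift K TB.TT (bprod TB.TT ?\<phi> a b) (\<Delta> y) =
        tensor_lift K TB.TT (\<lambda>c d. TB.pt (q a \<otimes>\<^bsub>\<B>\<^esub> q c) (q b \<otimes>\<^bsub>\<B>\<^esub> q d)) (\<Delta> y)"
      by (rule TP.lift_cong'[OF Tm _ _ comult_closed[OF y]]) (simp_all add: eq ab ptc q_closed
          del: TB.TT_sel)
    show "tensor_lift K TB.TT (\<lambda>c d. TB.pt (q a \<otimes>\<^bsub>\<B>\<^esub> q c) (q b \<otimes>\<^bsub>\<B>\<^esub> q d)) (\<Delta> y) \<in> carrier TB.TT"
      unfolding e[symmetric]
      by (rule linear_map_closed[OF TP.lift_linear[OF Tm bprod_bilinear(1)[OF Tm qq_bilinear ab]]
          comult_closed[OF y]])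
  qed
qed

end

lemma (in tensor_pair) lift_zero:
  assumes M: "module K M" and z: "\<And>a b. \<lbrakk>a \<in> carrier A; b \<in> carrier B\<rbrakk> \<Longrightarrow> \<phi> a b = \<zero>\<^bsub>M\<^esub>"
      and t: "t \<in> carrier T"
  shows "tensor_lift K M \<phi> t = \<zero>\<^bsub>M\<^esub>"
proof -
  interpret M: module K M by fact
  have b: "bilinear_map K A B M (\<lambda>a b. \<zero>\<^bsub>M\<^esub>)"
    by (intro bilinear_mapI linear_map_const_zero M)
  have "tensor_lift K M \<phi> t = tensor_lift K M (\<lambda>a b. \<zero>\<^bsub>M\<^esub>) t"
    by (rule lift_cong'[OF M z _ t]) auto
  also have "\<dots> = \<zero>\<^bsub>M\<^esub>"
    by (rule linear_map_eqI[OF M lift_linear[OF M b] linear_map_const_zero[OF M] _ t]) (rule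
        lift_pt[OF M b])
  finally show ?thesis .
qed

text \<open>The shape of the difference of two second-order Leibniz expansions; a and b are the
  cross terms, which occur in both.\<close>

lemma (in abelian_group) cross_cancel:
  assumes "a \<in> carrier G" "b \<in> carrier G" "s \<in> carrier G" "s' \<in> carrier G" "r \<in> carrier G"
      "r' \<in> carrier G"
  shows "((a \<oplus> s) \<oplus> (s' \<oplus> b)) \<ominus> ((b \<oplus> r) \<oplus> (r' \<oplus> a)) = (s' \<ominus> r') \<oplus> (s \<ominus> r)"
proof -
  have "((a \<oplus> s) \<oplus> (s' \<oplus> b)) \<ominus> ((b \<oplus> r) \<oplus> (r' \<oplus> a)) = ((a \<oplus> b) \<oplus> (s' \<oplus> s)) \<ominus> ((a \<oplus> b) \<oplus> (r' \<oplus> r))"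
    using assms by (simp add: a_ac)
  also have "\<dots> = (s' \<ominus> r') \<oplus> (s \<ominus> r)"
    using assms by (simp add: diff_add_diff diff_eq_zero_iff[THEN iffD2])
  finally show ?thesis .
qed

section \<open>Comultiplication and antipode of the even quotient\<close>

context sgroup begin

lemma q_comm: "\<lbrakk>x \<in> carrier A; y \<in> carrier A\<rbrakk> \<Longrightarrow> q x \<otimes>\<^bsub>\<B>\<^esub> q y = q y \<otimes>\<^bsub>\<B>\<^esub> q x"
proof -
  assume x: "x \<in> carrier A" and y: "y \<in> carrier A"
  have "hpart A 0 x \<otimes> hpart A 0 y = hpart A 0 y \<otimes> hpart A 0 x"
    using supercommD[OF S.hpart_gr[OF x, of 0] S.hpart_gr[OF y, of 0]] by simp
  then have "q (hpart A 0 x) \<otimes>\<^bsub>\<B>\<^esub> q (hpart A 0 y) = q (hpart A 0 y) \<otimes>\<^bsub>\<B>\<^esub> q (hpart A 0 x)"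
    using x y S.hpart_closed q_mult by metis
  then show ?thesis using x y by (simp add: q_hpart)
qed

text \<open>Odd elements supercommute with homogeneous ones, so the left ideal they generate is
  two-sided. Left stability is what \<open>qq_mult\<close> and \<open>q_antipode_mult\<close>
  provide for the kernels in question.\<close>

lemma ev_least_left:
  assumes N: "submod K A N" and left: "\<And>x y. \<lbrakk>x \<in> carrier A; y \<in> N\<rbrakk> \<Longrightarrow> x \<otimes> y \<in> N"
    and odd: "gr A 1 \<subseteq> N"
  shows "\<aa> \<subseteq> N"
proof -
  \<comment> \<open>The largest two-sided ideal inside \<open>N\<close>.\<close>
  let ?N = "{n \<in> carrier A. \<forall>y \<in> carrier A. n \<otimes> y \<in> N}"
  note Nc = submod_carrier[OF N]
  have "submod K A ?N"
    by (rule submodI[OF M.module_axioms])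
      (auto simp: A.l_distr smult_mult_left submod_zero[OF N] submod_add[OF N] submod_smult[OF N])
  then have "ideal ?N A"
    by (rule idealI') (auto simp: A.m_assoc left)
  moreover have "gr A 1 \<subseteq> ?N"
  proof
    fix n assume n: "n \<in> gr A 1"
    have nN: "n \<in> N" using n odd by blast
    have "n \<otimes> y \<in> N" if y: "y \<in> carrier A" for y
    proof -
      have h: "n \<otimes> hpart A i y \<in> N" for i
        unfolding supercommD[OF n S.hpart_gr[OF y, of i]]
        by (rule koszul_mem[OF N left[OF S.hpart_closed[OF y] nN]])
      have "n \<otimes> y = n \<otimes> hpart A 0 y \<oplus> n \<otimes> hpart A (0 + 1) y"
        using A.r_distr[OF S.hpart_closed[OF y] S.hpart_closed[OF y] S.gr_closed[OF n]]
            S.hpart_decomp[OF y]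
        by metis
      then show ?thesis using submod_add[OF N h h] by metis
    qed
    then show "n \<in> ?N" using S.gr_closed[OF n] by blast
  qed
  ultimately have "\<aa> \<subseteq> ?N" by (rule ev_least)
  moreover have "?N \<subseteq> N"
  proof
    fix n assume n: "n \<in> ?N"
    then have "n \<otimes> \<one> \<in> N" using A.one_closed by blast
    then show "n \<in> N" using n by simp
  qed
  ultimately show ?thesis by blast
qed

text \<open>Makes the comultiplication of the quotient constant on cosets. By
  \<open>qq_mult\<close>, the image of \<Delta> (x y) is obtained by linear maps from the image of
  \<Delta> y, so the kernel is stable under left multiplication.\<close>

lemma qq_ev:
  assumes n: "n \<in> \<aa>"
  shows "qq (\<Delta> n) = \<zero>\<^bsub>TB.TT\<^esub>"
proof -
  note Tm = TB.module_TT
  let ?N = "{x \<in> carrier A. qq (\<Delta> x) = \<zero>\<^bsub>TB.TT\<^esub>}"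
  have l: "linear_map K A TB.TT (\<lambda>x. qq (\<Delta> x))"
      by (rule linear_map_comp[OF comult_linear qq_linear])
  have "\<aa> \<subseteq> ?N"
  proof (rule ev_least_left[OF submod_kernel[OF M.module_axioms Tm l]])
    show "gr A 1 \<subseteq> ?N" using S.gr_closed qq_odd by blast
    fix x y assume x: "x \<in> carrier A" and "y \<in> ?N"
    then have y: "y \<in> carrier A" and yz: "qq (\<Delta> y) = \<zero>\<^bsub>TB.TT\<^esub>" by blast+
    note dy = comult_closed[OF y]
    have "tensor_lift K TB.TT (\<lambda>c d. TB.pt (q a \<otimes>\<^bsub>\<B>\<^esub> q c) (q b \<otimes>\<^bsub>\<B>\<^esub> q d)) (\<Delta> y) = \<zero>\<^bsub>TB.TT\<^esub>"
      if ab: "a \<in> carrier A" "b \<in> carrier A" for a b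
    proof -
      let ?\<psi> = "\<lambda>c d. TB.pt (q a \<otimes>\<^bsub>\<B>\<^esub> c) (q b \<otimes>\<^bsub>\<B>\<^esub> d)"
      have \<psi>: "bilinear_map K \<B> \<B> TB.TT ?\<psi>"
        by (rule bilinear_map_comp_left[OF B.mult_linear_right[OF linear_map_id q_closed[OF ab(1)]]
              bilinear_map_comp_right[OF B.mult_linear_right[OF linear_map_id q_closed[OF ab(2)]]
                  ptB_bilinear]])
      have \<Psi>: "linear_map K TB.TT TB.TT (tensor_lift K TB.TT ?\<psi>)"
        using TB.lift_linear[OF Tm \<psi>] by (simp add: linear_map_def)
      have "tensor_lift K TB.TT (\<lambda>c d. TB.pt (q a \<otimes>\<^bsub>\<B>\<^esub> q c) (q b \<otimes>\<^bsub>\<B>\<^esub> q d)) (\<Delta> y)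
        = tensor_lift K TB.TT (\<lambda>c d. tensor_lift K TB.TT ?\<psi> (TB.pt (q c) (q d))) (\<Delta> y)"
        by (rule TP.lift_cong'[OF Tm _ _ dy])
          (simp_all add: TB.lift_pt[OF Tm \<psi>] q_closed bilinear_map_closed[OF \<psi>] del: TB.TT_sel)
      also have "\<dots> = tensor_lift K TB.TT ?\<psi> (qq (\<Delta> y))"
        by (rule TP.lift_comp[OF Tm Tm \<Psi> qq_bilinear dy, symmetric])
      also have "\<dots> = \<zero>\<^bsub>TB.TT\<^esub>" unfolding yz by (rule linear_map_zero[OF Tm Tm \<Psi>])
      finally show ?thesis .
    qed
    then have "qq (\<Delta> (x \<otimes> y)) = \<zero>\<^bsub>TB.TT\<^esub>"
      unfolding qq_mult[OF x y] by (rule TP.lift_zero[OF Tm _ comult_closed[OF x]])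
    then show "x \<otimes> y \<in> ?N" using x y by blast
  qed
  then show ?thesis using n by blast
qed

lemma antipode_closed: "x \<in> carrier A \<Longrightarrow> antipode A x \<in> carrier A"
  by (rule linear_map_closed[OF antipode_linear])

text \<open>Both sides are convolution inverses, in each variable separately, of the projection to the
  even quotient.\<close>

lemma q_antipode_mult:
  assumes x: "x \<in> carrier A" and y: "y \<in> carrier A"
  shows "q (antipode A (x \<otimes> y)) = q (antipode A x) \<otimes>\<^bsub>\<B>\<^esub> q (antipode A y)"
proof -
  let ?s = "\<lambda>x. q (antipode A x)"
  note kB = B.kalg_axioms and Bm = B.M.module_axioms and ql = q_linear
  have s: "linear_map K A \<B> ?s" by (rule linear_map_comp[OF antipode_linear ql])
  note sc = linear_map_closed[OF s]
  have qs: "conv \<B> q ?s x = \<epsilon> x \<odot>\<^bsub>\<B>\<^esub> \<one>\<^bsub>\<B>\<^esub>" if x: "x \<in> carrier A" for x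
  proof -
    note b = mult_bilinear_comp[OF linear_map_id antipode_linear]
    have "conv \<B> q ?s x = tensor_lift K \<B> (\<lambda>a b. q (a \<otimes> antipode A b)) (\<Delta> x)"
      unfolding conv_def
      by (rule TP.lift_cong'[OF Bm _ _ comult_closed[OF x]]) (simp_all add: q_mult antipode_closed
          q_closed)
    also have "\<dots> = q (\<epsilon> x \<odot> \<one>)"
      using TP.lift_comp[symmetric, OF M.module_axioms Bm ql b comult_closed[OF x]]
          antipode_right[OF x] by simp
    finally show ?thesis using x by (simp add: q_smult lf_closed[OF counit_linear] q_one)
  qed
  let ?F = "\<lambda>a c. ?s (a \<otimes> c)"
  have F1: "linear_map K A \<B> (?F a)" if "a \<in> carrier A" for a
    by (rule linear_map_comp[OF mult_linear_right[OF linear_map_id that] s])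
  have F2: "linear_map K A \<B> (\<lambda>a. ?F a c)" if "c \<in> carrier A" for c
    by (rule linear_map_comp[OF mult_linear_left[OF linear_map_id that] s])
  \<comment> \<open>Convolution with the projection in the second variable, with the first variable
    \<open>a\<close> kept as a parameter.\<close>
  let ?G = "\<lambda>y a. conv \<B> (?F a) q y"
  have G: "linear_map K A \<B> (?G y)" if y: "y \<in> carrier A" for y
    unfolding conv_def
    by (rule TP.lift_param[OF Bm M.module_axioms _ _ comult_closed[OF y]])
      (auto intro: B.mult_bilinear_comp F1 ql B.mult_linear_left F2 q_closed)
  \<comment> \<open>Convolving the antipode of a product with the projection in both variables gives
    the projected antipode identity at the product of x and y.\<close>
  have Gq: "conv \<B> (?G y) q x = \<epsilon> x \<odot>\<^bsub>\<B>\<^esub> (\<epsilon> y \<odot>\<^bsub>\<B>\<^esub> \<one>\<^bsub>\<B>\<^esub>)" if x: "x \<in> carrier A" and y: "y \<in> carrier A"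
      for x y
  proof -
    note dx = comult_closed[OF x] and dy = comult_closed[OF y]
    let ?\<phi> = "\<lambda>a b. ?s a \<otimes>\<^bsub>\<B>\<^esub> q b"
    note \<phi> = B.mult_bilinear_comp[OF s ql]
    note b = mult_bilinear_comp[OF antipode_linear linear_map_id]
    \<comment> \<open>The projection kills odd parts, hence all signs, and commutativity of the even
      quotient moves \<open>q b\<close> to the outside, where the outer convolution expects
      it.\<close>
    have eq: "bprod \<B> ?\<phi> a b c d = (?F a c \<otimes>\<^bsub>\<B>\<^esub> q d) \<otimes>\<^bsub>\<B>\<^esub> q b"
      if abcd: "a \<in> carrier A" "b \<in> carrier A" "c \<in> carrier A" "d \<in> carrier A" for a b c d
    proof -
      note h = S.hpart_closed[OF abcd(3)] and Fc = linear_map_closed[OF F1[OF abcd(1)]]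
      note qc = q_closed[OF abcd(2)] q_closed[OF abcd(4)]
      have "?F a c = ?F a (hpart A 0 c) \<oplus>\<^bsub>\<B>\<^esub> ?F a (hpart A (0 + 1) c)"
        using linear_map_add[OF F1[OF abcd(1)] h h] S.hpart_decomp[OF abcd(3)] by metis
      then have "?F a c \<otimes>\<^bsub>\<B>\<^esub> (q b \<otimes>\<^bsub>\<B>\<^esub> q d)
          = ?F a (hpart A 0 c) \<otimes>\<^bsub>\<B>\<^esub> (q b \<otimes>\<^bsub>\<B>\<^esub> q d) \<oplus>\<^bsub>\<B>\<^esub> ?F a (hpart A 1 c) \<otimes>\<^bsub>\<B>\<^esub> (q b \<otimes>\<^bsub>\<B>\<^esub> q d)"
        using Fc h qc by (simp add: B.A.l_distr)
      moreover have "(?F a c \<otimes>\<^bsub>\<B>\<^esub> q d) \<otimes>\<^bsub>\<B>\<^esub> q b = ?F a c \<otimes>\<^bsub>\<B>\<^esub> (q b \<otimes>\<^bsub>\<B>\<^esub> q d)"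
        using Fc[OF abcd(3)] qc q_comm[OF abcd(4) abcd(2)] by (simp add: B.A.m_assoc)
      ultimately show ?thesis
        using abcd Fc h qc unfolding bprod_def by (simp add: q_mult q_hpart S.hpart_closed)
    qed
    have "q (tensor_lift K A (\<lambda>a b. antipode A a \<otimes> b) (\<Delta> (x \<otimes> y)))
        = tensor_lift K \<B> (\<lambda>a b. q (antipode A a \<otimes> b)) (\<Delta> (x \<otimes> y))"
      using x y by (intro TP.lift_comp[OF M.module_axioms Bm ql b comult_closed]) simp
    also have "\<dots> = tensor_lift K \<B> ?\<phi> (\<Delta> (x \<otimes> y))"
      using x y by (intro TP.lift_cong'[OF Bm _ _ comult_closed]) (simp_all add: q_mult
          antipode_closed q_closed)
    also have "\<dots> = tensor_lift K \<B> (\<lambda>a b. tensor_lift K \<B> (bprod \<B> ?\<phi> a b) (\<Delta> y)) (\<Delta> x)"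
      by (rule lift_comult_mult[OF Bm \<phi> x y])
    also have "\<dots> = conv \<B> (?G y) q x"
      unfolding conv_def[of \<B> "?G y"]
    proof (rule TP.lift_cong'[OF Bm _ _ dx])
      fix a b assume ab: "a \<in> carrier A" "b \<in> carrier A"
      note Gc = linear_map_closed[OF G[OF y] ab(1)]
      show "?G y a \<otimes>\<^bsub>\<B>\<^esub> q b \<in> carrier \<B>" using Gc q_closed[OF ab(2)] by simp
      have "tensor_lift K \<B> (bprod \<B> ?\<phi> a b) (\<Delta> y) = tensor_lift K \<B> (\<lambda>c d. (?F a c \<otimes>\<^bsub>\<B>\<^esub> q d) \<otimes>\<^bsub>\<B>\<^esub> q
          b) (\<Delta> y)"
        by (rule TP.lift_cong'[OF Bm _ _ dy])
          (use ab eq linear_map_closed[OF F1[OF ab(1)]] in \<open>simp_all add: q_closed\<close>)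
      also have "\<dots> = ?G y a \<otimes>\<^bsub>\<B>\<^esub> q b"
        unfolding conv_def
        by (rule TP.lift_comp[symmetric, OF Bm Bm B.mult_linear_left[OF linear_map_id q_closed[OF
            ab(2)]]
              B.mult_bilinear_comp[OF F1[OF ab(1)] ql] dy])
      finally show "tensor_lift K \<B> (bprod \<B> ?\<phi> a b) (\<Delta> y) = ?G y a \<otimes>\<^bsub>\<B>\<^esub> q b" .
    qed
    finally have "conv \<B> (?G y) q x = q (\<epsilon> (x \<otimes> y) \<odot> \<one>)"
      using antipode_left[of "x \<otimes> y"] x y by simp
    then show ?thesis
      using x y by (simp add: q_smult q_one counit_mult lf_closed[OF counit_linear]
          B.M.smult_assoc1)
  qed
  have c1: "\<epsilon> y \<odot>\<^bsub>\<B>\<^esub> \<one>\<^bsub>\<B>\<^esub> \<in> carrier \<B>" if "y \<in> carrier A" for y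
    using that lf_closed[OF counit_linear] by simp
  have Gx: "?G y x = \<epsilon> y \<odot>\<^bsub>\<B>\<^esub> ?s x" if y: "y \<in> carrier A" for y
  proof -
    have "?G y x = (\<epsilon> y \<odot>\<^bsub>\<B>\<^esub> \<one>\<^bsub>\<B>\<^esub>) \<otimes>\<^bsub>\<B>\<^esub> ?s x"
      by (rule conv_cancel[OF kB G[OF y] ql s qs c1[OF y] Gq[OF _ y] x])
    then show ?thesis using sc[OF x] lf_closed[OF counit_linear y] by (simp add: B.smult_mult_left)
  qed
  \<comment> \<open>\<open>Gx\<close> has already cancelled the projection in the first variable;
    this cancels it in the second.\<close>
  show ?thesis by (rule conv_cancel[OF kB F1[OF x] ql s qs sc[OF x] Gx y])
qed

lemma antipode_ev:
  assumes n: "n \<in> \<aa>"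
  shows "antipode A n \<in> \<aa>"
proof -
  let ?N = "{x \<in> carrier A. q (antipode A x) = \<zero>\<^bsub>\<B>\<^esub>}"
  have "\<aa> \<subseteq> ?N"
  proof (rule ev_least_left[OF submod_kernel[OF M.module_axioms B.M.module_axioms
      linear_map_comp[OF antipode_linear q_linear]]])
    show "gr A 1 \<subseteq> ?N" using S.gr_closed q_odd[OF antipode_gr] by blast
    show "x \<otimes> y \<in> ?N" if "x \<in> carrier A" "y \<in> ?N" for x y
      using that q_closed[OF antipode_closed] by (simp add: q_antipode_mult)
  qed
  then show ?thesis using n q_zero_iff[OF antipode_closed[OF ev_carrier[OF n]]] by blast
qed

lemma comult_B:
  assumes x: "x \<in> carrier A"
  shows "comult \<B> (q x) = qq (\<Delta> x)"
proof -
  let ?Q = "quot_super A \<aa>"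
  interpret TTm: module K TB.TT by (rule TB.module_TT)
  have T: "tensor K ?Q ?Q = TB.TT" by (rule tensor_cong) (simp_all add: ev_sel)
  have p: "pure_tensor K ?Q ?Q = TB.pt" by (rule pure_tensor_cong) (simp_all add: ev_sel)
  have tm: "tensor_map K ?Q ?Q q q t = qq t" for t
    by (simp only: tensor_map_def T p)
  have "the_elem ((\<lambda>x. qq (\<Delta> x)) ` q x) = qq (\<Delta> x)"
  proof (rule Aug.quot_map[OF ev_ideal _ x])
    fix n assume n: "n \<in> \<aa>"
    show "qq (\<Delta> (n \<oplus> x)) = qq (\<Delta> x)"
      using linear_map_add[OF linear_map_comp[OF comult_linear qq_linear] ev_carrier[OF n] x]
          qq_ev[OF n]
        linear_map_closed[OF qq_linear comult_closed[OF x]] by (simp del: TB.TT_sel)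
  qed
  then show ?thesis by (simp add: ev_sel tm[unfolded ev_sel])
qed

lemma antipode_B:
  assumes x: "x \<in> carrier A"
  shows "antipode \<B> (q x) = q (antipode A x)"
proof -
  have "the_elem ((\<lambda>x. q (antipode A x)) ` q x) = q (antipode A x)"
  proof (rule Aug.quot_map[OF ev_ideal _ x])
    fix n assume n: "n \<in> \<aa>"
    have "q (antipode A n) = \<zero>\<^bsub>\<B>\<^esub>" using q_zero_iff antipode_ev[OF n] ev_carrier by blast
    then show "q (antipode A (n \<oplus> x)) = q (antipode A x)"
      using linear_map_add[OF antipode_linear ev_carrier[OF n] x]
        q_add[OF antipode_closed[OF ev_carrier[OF n]] antipode_closed[OF x]] q_closed[OF
            antipode_closed[OF x]]
      by (simp only: B.A.l_zero)
  qed
  then show ?thesis by (simp add: ev_sel)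
qed

section \<open>The bracket\<close>

text \<open>The correction \<epsilon>(x) 1 in \<open>tangent_functional\<close> respects parity: it
  is even, and zero for odd x.\<close>

lemma Lie_gr_iff: "u \<in> gr (Lie K A) i \<longleftrightarrow> u \<in> carrier (Lie K A) \<and> (\<forall>x \<in> gr A (i + 1). Aug.tf u x
    = \<zero>\<^bsub>K\<^esub>)"
proof (cases "u \<in> carrier (Lie K A)")
  case True
  have l: "lf (Aug.tf u)" using Aug.tf_point_derivation[OF True] by (simp add: point_derivation_def)
  have "(\<forall>X \<in> gr Aug.C (i + 1). u X = \<zero>\<^bsub>K\<^esub>) \<longleftrightarrow> (\<forall>x \<in> gr A (i + 1). Aug.tf u x = \<zero>\<^bsub>K\<^esub>)" (is "?L = ?R")
  proof
    assume L: ?L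
    show ?R
    proof
      fix x assume x: "x \<in> gr A (i + 1)"
      note xc = S.gr_closed[OF x]
      have "Aug.c0 x \<in> gr A (i + 1)"
      proof (cases "i = 0")
        case True
        then show ?thesis using x counit_odd[of x] xc by (simp add: a_minus_def)
      next
        case False
        then show ?thesis
          using x one_gr lf_closed[OF counit_linear xc]
          by (auto intro!: submod_minus[OF S.gr_submod] submod_smult[OF S.gr_submod])
      qed
      then have "Aug.cls (Aug.c0 x) \<in> gr Aug.C (i + 1)" using Aug.c0_closed[OF xc]
          by (auto simp: Aug.C_gr)
      then show "Aug.tf u x = \<zero>\<^bsub>K\<^esub>" using L by (simp add: tangent_functional_def)
    qed
  qed (auto simp: Aug.C_gr Aug.tf_\<mm>[symmetric])
  then show ?thesis using True by (simp add: Aug.Lie_gr)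
qed (simp add: Aug.Lie_gr)

lemma pder_iff: "pder p d \<longleftrightarrow> point_derivation K A d \<and> (\<forall>x \<in> gr A (p + 1). d x = \<zero>\<^bsub>K\<^esub>)"
  by (simp add: pder_def point_derivation_def)

lemma Lie_gr_pder: "u \<in> gr (Lie K A) p \<longleftrightarrow> u \<in> carrier (Lie K A) \<and> pder p (Aug.tf u)"
  using Lie_gr_iff pder_iff Aug.tf_point_derivation by blast

lemma tf_add: "x \<in> carrier A \<Longrightarrow> Aug.tf (u \<oplus>\<^bsub>Lie K A\<^esub> v) x = Aug.tf u x \<oplus>\<^bsub>K\<^esub> Aug.tf v x"
  and tf_smult: "x \<in> carrier A \<Longrightarrow> Aug.tf (c \<odot>\<^bsub>Lie K A\<^esub> u) x = c \<otimes>\<^bsub>K\<^esub> Aug.tf u x"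
  and tf_zero: "x \<in> carrier A \<Longrightarrow> Aug.tf \<zero>\<^bsub>Lie K A\<^esub> x = \<zero>\<^bsub>K\<^esub>"
  using Aug.cls_closed[OF Aug.c0_closed]
  by (simp_all add: Aug.Lie_add Aug.Lie_smult Aug.Lie_zero tangent_functional_def)

lemma pder_null: "pder p (\<lambda>x. \<zero>\<^bsub>K\<^esub>)"
  using linear_map_const_zero[OF L.module_axioms] lf_closed[OF counit_linear]
      by (simp add: pder_def)

lemma pder_cong: "\<lbrakk>pder p d; \<And>x. x \<in> carrier A \<Longrightarrow> d x = d' x\<rbrakk> \<Longrightarrow> pder p d'"
  unfolding pder_def using linear_map_cong[OF M.module_axioms, of "base K" d d'] S.gr_closed by auto

lemma Lie_zero_gr: "\<zero>\<^bsub>Lie K A\<^esub> \<in> gr (Lie K A) p"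
proof -
  have "\<zero>\<^bsub>Lie K A\<^esub> \<in> carrier (Lie K A)"
    unfolding Aug.Lie_zero Aug.Lie_carrier
    using linear_map_cong[OF Aug.C_module linear_map_const_zero[OF L.module_axioms]] by auto
  then show ?thesis
    using pder_cong[OF pder_null, of "Aug.tf \<zero>\<^bsub>Lie K A\<^esub>"] by (simp add: Lie_gr_pder tf_zero)
qed

text \<open>\<open>lie_bracket\<close> splits its arguments with \<open>hpart\<close> in the dual
  space; on homogeneous arguments this leaves a single nonzero component.\<close>

lemma hpart_Lie:
  assumes u: "u \<in> gr (Lie K A) p"
  shows "hpart (dual_space K Aug.C) i u = (if i = p then u else \<zero>\<^bsub>Lie K A\<^esub>)"
proof -
  let ?L = "Lie K A"
  have sel: "gr (dual_space K Aug.C) = gr ?L" "add (dual_space K Aug.C) = add ?L"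
    by (simp_all add: Lie_def)
  have cl: "w \<oplus>\<^bsub>?L\<^esub> \<zero>\<^bsub>?L\<^esub> = w" "\<zero>\<^bsub>?L\<^esub> \<oplus>\<^bsub>?L\<^esub> w = w" if "w \<in> carrier ?L" for w
  proof -
    have l: "linear_map K Aug.C (base K) w" "w \<in> extensional (carrier Aug.C)" using that
        by (auto simp: Aug.Lie_carrier)
    have "w X \<in> carrier K" if "X \<in> carrier Aug.C" for X using linear_map_closed[OF l(1) that]
        by simp
    then have "(w \<oplus>\<^bsub>?L\<^esub> \<zero>\<^bsub>?L\<^esub>) X = w X \<and> (\<zero>\<^bsub>?L\<^esub> \<oplus>\<^bsub>?L\<^esub> w) X = w X" for X
      using extensional_arb[OF l(2), of X]
      by (cases "X \<in> carrier Aug.C") (simp_all add: Aug.Lie_add Aug.Lie_zero)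
    then show "w \<oplus>\<^bsub>?L\<^esub> \<zero>\<^bsub>?L\<^esub> = w" "\<zero>\<^bsub>?L\<^esub> \<oplus>\<^bsub>?L\<^esub> w = w"
      by (simp_all add: fun_eq_iff)
  qed
  have uc: "u \<in> carrier ?L" and up: "pder p (Aug.tf u)" using u by (simp_all add: Lie_gr_pder)
  let ?w = "if i = p then u else \<zero>\<^bsub>?L\<^esub>"
  show ?thesis
    unfolding hpart_def sel
  proof (rule the_equality)
    show "?w \<in> gr ?L i \<and> (\<exists>z \<in> gr ?L (i + 1). u = ?w \<oplus>\<^bsub>?L\<^esub> z)"
    proof (cases "i = p")
      case True
      then show ?thesis
        using u cl(1)[OF uc] Lie_zero_gr[of "i + 1"] by (auto intro!: bexI[of _ "\<zero>\<^bsub>?L\<^esub>"])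
    next
      case False
      then have "i + 1 = p" using bit_cases[of i] bit_cases[of p] by auto
      then show ?thesis
        using False u cl(2)[OF uc] Lie_zero_gr[of i] by (auto intro!: bexI[of _ u])
    qed
    fix y assume "y \<in> gr ?L i \<and> (\<exists>z \<in> gr ?L (i + 1). u = y \<oplus>\<^bsub>?L\<^esub> z)"
    then obtain z where y: "y \<in> gr ?L i" and z: "z \<in> gr ?L (i + 1)" and uyz: "u = y \<oplus>\<^bsub>?L\<^esub> z" by blast
    have yp: "pder i (Aug.tf y)" and zp: "pder (i + 1) (Aug.tf z)" using y z
        by (simp_all add: Lie_gr_pder)
    show "y = ?w"
    proof (rule Aug.tf_inject)
      show "y \<in> carrier ?L" using y by (simp add: Lie_gr_pder)
      show "?w \<in> carrier ?L" using uc Lie_zero_gr[of 0] by (auto simp: Lie_gr_pder)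
      fix x assume x: "x \<in> carrier A"
      note h = S.hpart_closed[OF x, of i]
      have "Aug.tf y x = Aug.tf y (hpart A i x) \<oplus>\<^bsub>K\<^esub> Aug.tf z (hpart A i x)"
        using pder_hpart[OF yp x, of i] pder_hpart[OF zp x, of i] lf_closed[OF pder_lf[OF yp] x]
            bit_cases[of i]
        by auto
      also have "\<dots> = Aug.tf u (hpart A i x)" unfolding uyz by (rule tf_add[OF h, symmetric])
      also have "\<dots> = Aug.tf ?w x" using pder_hpart[OF up x, of i] x by (simp add: tf_zero)
      finally show "Aug.tf y x = Aug.tf ?w x" .
    qed
  qed
qed

text \<open>On homogeneous functionals the Koszul sign of \<open>convolution\<close> is the constant
  (-1)^(pr); this links it to the operators, which carry no such sign.\<close>

lemma convolution_part:
  assumes \<phi>: "pder p \<phi>" and \<psi>: "pder r \<psi>" and x: "x \<in> carrier A"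
    and \<phi>': "\<And>x. x \<in> carrier A \<Longrightarrow> \<phi>' x = (if i = p then \<phi> x else \<zero>\<^bsub>K\<^esub>)"
    and \<psi>': "\<And>x. x \<in> carrier A \<Longrightarrow> \<psi>' x = (if j = r then \<psi> x else \<zero>\<^bsub>K\<^esub>)"
  shows "convolution K A \<phi>' \<psi>' x = (if i = p \<and> j = r then koszul (base K) (p * r) (\<phi> (Lop \<psi> x))
      else \<zero>\<^bsub>K\<^esub>)"
proof -
  note lp = pder_lf[OF \<phi>] and lr = pder_lf[OF \<psi>] and Lm = L.module_axioms
      and dx = comult_closed[OF x]
  have val: "(\<Oplus>\<^bsub>K\<^esub> k \<in> {0, 1}. \<Oplus>\<^bsub>K\<^esub> l \<in> {0, 1}. koszul (base K) (k * l) (\<phi>' (hpart A k a) \<otimes>\<^bsub>K\<^esub> \<psi>' (hpart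
      A l b)))
     = (if i = p \<and> j = r then koszul (base K) (p * r) (\<phi> a \<otimes>\<^bsub>K\<^esub> \<psi> b) else \<zero>\<^bsub>K\<^esub>)"
    if a: "a \<in> carrier A" and b: "b \<in> carrier A" for a b
  proof -
    have "\<phi>' (hpart A k a) = (if k = p \<and> i = p then \<phi> a else \<zero>\<^bsub>K\<^esub>)" for k
      using \<phi>'[OF S.hpart_closed[OF a]] pder_hpart[OF \<phi> a] by simp
    moreover have "\<psi>' (hpart A l b) = (if l = r \<and> j = r then \<psi> b else \<zero>\<^bsub>K\<^esub>)" for l
      using \<psi>'[OF S.hpart_closed[OF b]] pder_hpart[OF \<psi> b] by simp
    ultimately show ?thesis
      using lf_closed[OF lp a] lf_closed[OF lr b] bit_cases[of p] bit_cases[of r]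
      by (auto simp: K.finsum_bit koszul_def K.l_minus)
  qed
  have kl: "linear_map K (base K) (base K) (\<lambda>z. koszul (base K) (p * r) z)"
    by (rule linear_map_koszul[OF Lm linear_map_id])
  have b: "bilinear_map K A A (base K) (\<lambda>a b. \<phi> a \<otimes>\<^bsub>K\<^esub> \<psi> b)"
    using lp lr
    by (intro bilinear_mapI linear_mapI)
      (auto simp: lf_add lf_smult lf_closed K.r_distr K.l_distr K.m_ac)
  show ?thesis
  proof (cases "i = p \<and> j = r")
    case True
    have "convolution K A \<phi>' \<psi>' x = tensor_lift K (base K) (\<lambda>a b. koszul (base K) (p * r) (\<phi> a \<otimes>\<^bsub>K\<^esub>
        \<psi> b)) (\<Delta> x)"
      unfolding convolution_def
      by (rule TP.lift_cong'[OF Lm _ _ dx])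
        (use val True lf_closed[OF lp] lf_closed[OF lr] in \<open>auto simp: koszul_def\<close>)
    also have "\<dots> = koszul (base K) (p * r) (tensor_lift K (base K) (\<lambda>a b. \<phi> a \<otimes>\<^bsub>K\<^esub> \<psi> b) (\<Delta> x))"
      by (rule TP.lift_comp[OF Lm Lm kl b dx, symmetric])
    finally show ?thesis using True Lop_functional[OF lp lr x] by simp
  next
    case False
    have "convolution K A \<phi>' \<psi>' x = \<zero>\<^bsub>base K\<^esub>"
      unfolding convolution_def
      by (rule TP.lift_zero[OF Lm _ dx]) (use val False in auto)
    then show ?thesis using False by auto
  qed
qed

text \<open>The supercommutator for the convolution product without Koszul signs;
  \<open>tf_bracket\<close> compares it with the Lie bracket.\<close>

definition commutator :: "bit \<Rightarrow> ('a \<Rightarrow> 'k) \<Rightarrow> ('a \<Rightarrow> 'k) \<Rightarrow> 'a \<Rightarrow> 'k"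
  where "commutator s f g x = f (Lop g x) \<ominus>\<^bsub>K\<^esub> koszul (base K) s (g (Lop f x))"

lemma Lop_pder_mult:
  assumes f: "pder p f" and g: "pder r g" and x: "x \<in> carrier A" and y: "y \<in> carrier A"
  shows "f (Lop g (x \<otimes> y)) =
    (g x \<otimes>\<^bsub>K\<^esub> koszul (base K) (p * r) (f y) \<oplus>\<^bsub>K\<^esub> f (Lop g x) \<otimes>\<^bsub>K\<^esub> \<epsilon> y) \<oplus>\<^bsub>K\<^esub>
    (\<epsilon> x \<otimes>\<^bsub>K\<^esub> f (Lop g y) \<oplus>\<^bsub>K\<^esub> f x \<otimes>\<^bsub>K\<^esub> g y)"
proof -
  note lf = pder_lf[OF f] and lg = pder_lf[OF g]
  have "f (par r y) = f (hpart A 0 y) \<oplus>\<^bsub>K\<^esub> koszul (base K) r (f (hpart A 1 y))"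
    unfolding par_def using y lf koszul_linear[OF M.module_axioms L.module_axioms lf
        S.hpart_closed[OF y], of r 1]
    by (simp add: lf_add S.hpart_closed koszul_def)
  then have fp: "f (par r y) = koszul (base K) (p * r) (f y)"
    using pder_hpart[OF f y] lf_closed[OF lf y] bit_cases[of p] bit_cases[of r]
        by (auto simp: koszul_def)
  show ?thesis
    using x y lf lg
    by (simp add: Lop_mult[OF g] lf_add pder_mult[OF f] par_closed Lop_closed counit_Lop
        counit_par fp[symmetric])
qed

text \<open>The terms pairing a value of f with a value of g occur in both second-order expansions,
  and the sign in the commutator makes them cancel.\<close>

lemma commutator_pder:
  assumes f: "pder p f" and g: "pder r g"
  shows "pder (p + r) (commutator (p * r) f g)"
  unfolding pder_def
proof (intro conjI ballI)
  note lf = pder_lf[OF f] and lg = pder_lf[OF g]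
  let ?k = "koszul (base K) (p * r)"
  note fg = lf_Lop[OF lf lg] and gf = lf_Lop[OF lg lf]
  have kc: "?k z \<in> carrier K" if "z \<in> carrier K" for z using that by (simp add: koszul_def)
  show "linear_map K A (base K) (commutator (p * r) f g)"
    by (rule linear_map_cong[OF M.module_axioms
          linear_map_diff[OF L.module_axioms fg linear_map_koszul[OF L.module_axioms gf,
              where n = "p * r"]]])
      (simp add: commutator_def a_minus_def kc lf_closed[OF gf])
  fix x assume x: "x \<in> gr A (p + r + 1)"
  have "Lop g x \<in> gr A (p + r + 1 + r)" by (rule Lop_gr[OF lg _ x]) (rule pder_other[OF g])
  moreover have "Lop f x \<in> gr A (p + r + 1 + p)" by (rule Lop_gr[OF lf _ x]) (rule pder_other[OF f])
  moreover have "p + r + 1 + r = p + 1" "p + r + 1 + p = r + 1"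
    using bit_cases[of p] bit_cases[of r] by auto
  ultimately show "commutator (p * r) f g x = \<zero>\<^bsub>K\<^esub>"
    using pder_other[OF f] pder_other[OF g] by (simp add: commutator_def koszul_def a_minus_def)
next
  note lf = pder_lf[OF f] and lg = pder_lf[OF g]
  let ?k = "koszul (base K) (p * r)"
  fix x y assume x: "x \<in> carrier A" and y: "y \<in> carrier A"
  note c = lf_closed[OF lf x] lf_closed[OF lf y] lf_closed[OF lg x] lf_closed[OF lg y]
    lf_closed[OF lf Lop_closed[OF lg x]] lf_closed[OF lf Lop_closed[OF lg y]]
    lf_closed[OF lg Lop_closed[OF lf x]] lf_closed[OF lg Lop_closed[OF lf y]]
    lf_closed[OF counit_linear x] lf_closed[OF counit_linear y]
  have k: "?k (a \<oplus>\<^bsub>K\<^esub> b) = ?k a \<oplus>\<^bsub>K\<^esub> ?k b" "?k (a \<otimes>\<^bsub>K\<^esub> b) = a \<otimes>\<^bsub>K\<^esub> ?k b" "?k (a \<otimes>\<^bsub>K\<^esub> b) = ?k a \<otimes>\<^bsub>K\<^esub> b"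
    "?k (?k a) = a" "?k a \<in> carrier K" if "a \<in> carrier K" "b \<in> carrier K" for a b
    using that by (simp_all add: koszul_def K.minus_add K.r_minus K.l_minus)
  have "?k (g (Lop f (x \<otimes> y))) =
    (f x \<otimes>\<^bsub>K\<^esub> g y \<oplus>\<^bsub>K\<^esub> ?k (g (Lop f x)) \<otimes>\<^bsub>K\<^esub> \<epsilon> y) \<oplus>\<^bsub>K\<^esub> (\<epsilon> x \<otimes>\<^bsub>K\<^esub> ?k (g (Lop f y)) \<oplus>\<^bsub>K\<^esub> g x \<otimes>\<^bsub>K\<^esub> ?k (f y))"
    unfolding Lop_pder_mult[OF g f x y] mult.commute[of r p]
    using c k(4)[of "g y" "g y"] k(5)[of "g y" "g y"]
    by (simp add: k(1) k(2)[of "f x"] k(2)[of "\<epsilon> x"] k(2)[of "g x"] k(3)[of "g (Lop f x)"])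
  then have "commutator (p * r) f g (x \<otimes> y) =
      (\<epsilon> x \<otimes>\<^bsub>K\<^esub> f (Lop g y) \<ominus>\<^bsub>K\<^esub> \<epsilon> x \<otimes>\<^bsub>K\<^esub> ?k (g (Lop f y))) \<oplus>\<^bsub>K\<^esub>
      (f (Lop g x) \<otimes>\<^bsub>K\<^esub> \<epsilon> y \<ominus>\<^bsub>K\<^esub> ?k (g (Lop f x)) \<otimes>\<^bsub>K\<^esub> \<epsilon> y)"
    unfolding commutator_def Lop_pder_mult[OF f g x y]
    using c k(5) by (simp add: K.cross_cancel)
  also have "\<dots> = \<epsilon> x \<otimes>\<^bsub>K\<^esub> commutator (p * r) f g y \<oplus>\<^bsub>K\<^esub> commutator (p * r) f g x \<otimes>\<^bsub>K\<^esub> \<epsilon> y"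
    unfolding commutator_def using c k(5)
        by (simp add: a_minus_def K.r_distr K.l_distr K.r_minus K.l_minus)
  finally show "commutator (p * r) f g (x \<otimes> y) =
      \<epsilon> x \<otimes>\<^bsub>K\<^esub> commutator (p * r) f g y \<oplus>\<^bsub>K\<^esub> commutator (p * r) f g x \<otimes>\<^bsub>K\<^esub> \<epsilon> y" .
qed

text \<open>Both convolutions in the bracket carry the same sign (-1)^(pr), so bracket and
  commutator differ by a global sign, to which a subspace is blind.\<close>

lemma tf_bracket:
  assumes u: "u \<in> gr (Lie K A) p" and v: "v \<in> gr (Lie K A) r" and x: "x \<in> carrier A"
  shows "Aug.tf (u \<otimes>\<^bsub>Lie K A\<^esub> v) x = koszul (base K) (p * r) (commutator (p * r) (Aug.tf u) (Aug.tf
      v) x)"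
proof -
  let ?f = "Aug.tf u" and ?g = "Aug.tf v" and ?k = "koszul (base K) (p * r)"
  have f: "pder p ?f" and g: "pder r ?g" using u v by (simp_all add: Lie_gr_pder)
  let ?E = "commutator (p * r) ?f ?g"
  define d where "d x = ?k (?E x)" for x
  have E: "pder (p + r) ?E" by (rule commutator_pder[OF f g])
  have kc: "?k z \<in> carrier K" if "z \<in> carrier K" for z using that by (simp add: koszul_def)
  have Ec: "?E x \<in> carrier K" if "x \<in> carrier A" for x by (rule lf_closed[OF pder_lf[OF E] that])
  have d: "point_derivation K A d"
    unfolding point_derivation_def d_def
  proof (intro conjI ballI)
    show "lf (\<lambda>x. ?k (?E x))" by (rule linear_map_koszul[OF L.module_axioms pder_lf[OF E]])
    show "?k (?E (x \<otimes> y)) = \<epsilon> x \<otimes>\<^bsub>K\<^esub> ?k (?E y) \<oplus>\<^bsub>K\<^esub> ?k (?E x) \<otimes>\<^bsub>K\<^esub> \<epsilon> y"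
      if "x \<in> carrier A" "y \<in> carrier A" for x y
    proof -
      have "?k (a \<otimes>\<^bsub>K\<^esub> b \<oplus>\<^bsub>K\<^esub> c \<otimes>\<^bsub>K\<^esub> z) = a \<otimes>\<^bsub>K\<^esub> ?k b \<oplus>\<^bsub>K\<^esub> ?k c \<otimes>\<^bsub>K\<^esub> z"
        if "a \<in> carrier K" "b \<in> carrier K" "c \<in> carrier K" "z \<in> carrier K" for a b c z
        using that by (simp add: koszul_def K.minus_add K.r_minus K.l_minus)
      then show ?thesis
        unfolding pder_mult[OF E that]
        by (simp add: Ec[OF that(1)] Ec[OF that(2)] lf_closed[OF counit_linear] that)
    qed
  qed
  let ?part = "\<lambda>i w. Aug.tf (hpart (dual_space K Aug.C) i w)"
  have pu: "?part i u x = (if i = p then ?f x else \<zero>\<^bsub>K\<^esub>)"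
      and pv: "?part i v x = (if i = r then ?g x else \<zero>\<^bsub>K\<^esub>)"
    if "x \<in> carrier A" for x i
    using that by (simp_all add: hpart_Lie[OF u] hpart_Lie[OF v] tf_zero)
  let ?S = "\<lambda>x. \<Oplus>\<^bsub>K\<^esub> i \<in> {0, 1}. \<Oplus>\<^bsub>K\<^esub> j \<in> {0, 1}.
          convolution K A (?part i u) (?part j v) x \<ominus>\<^bsub>K\<^esub>
          koszul (base K) (i * j) (convolution K A (?part j v) (?part i u) x)"
  have S: "?S x = d x" if x: "x \<in> carrier A" for x
  proof -
    define F G where "F = ?f (Lop ?g x)" and "G = ?g (Lop ?f x)"
    have c: "F \<in> carrier K" "G \<in> carrier K"
      unfolding F_def G_def using x pder_lf[OF f] pder_lf[OF g]
          by (simp_all add: lf_closed Lop_closed)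
    have c1: "convolution K A (?part i u) (?part j v) x = (if i = p \<and> j = r then ?k F else \<zero>\<^bsub>K\<^esub>)"
        for i j
      unfolding F_def by (rule convolution_part[OF f g x pu pv])
    have c2: "convolution K A (?part j v) (?part i u) x = (if i = p \<and> j = r then ?k G else \<zero>\<^bsub>K\<^esub>)"
        for i j
      using convolution_part[OF g f x pv pu] unfolding G_def by (auto simp: mult.commute)
    have t: "(if i = p \<and> j = r then ?k F else \<zero>\<^bsub>K\<^esub>) \<ominus>\<^bsub>K\<^esub> koszul (base K) (i * j) (if i = p \<and> j
        = r then ?k G else \<zero>\<^bsub>K\<^esub>)
        = (if i = p \<and> j = r then d x else \<zero>\<^bsub>K\<^esub>)" for i j
      using c unfolding d_def commutator_def F_def[symmetric] G_def[symmetric]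
      by (auto simp: koszul_def a_minus_def K.minus_add)
    have dc: "d x \<in> carrier K" using Ec[OF x] kc by (simp add: d_def)
    show ?thesis
      unfolding c1 c2 t using dc bit_cases[of p] bit_cases[of r] by (auto simp: K.finsum_bit)
  qed
  have lb: "lie_bracket K A u v (Aug.cls z) = d z" if z: "z \<in> Aug.\<mm>" for z
  proof -
    have zc: "z \<in> carrier A" using z by (simp add: Aug.\<mm>_eq)
    have sub: "Aug.cls z \<subseteq> carrier A"
      using zc submod_carrier[OF Aug.sq_submod] by (auto simp: a_r_coset_def')
    have "lie_bracket K A u v (Aug.cls z) = the_elem (?S ` Aug.cls z)"
      using Aug.cls_closed[OF z] by (simp add: lie_bracket_def Let_def)
    also have "?S ` Aug.cls z = d ` Aug.cls z" using sub S by (intro image_cong) auto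
    also have "the_elem (d ` Aug.cls z) = d z" by (rule Aug.point_derivation_cls[OF d z])
    finally show ?thesis .
  qed
  have l: "lf d" using d by (simp add: point_derivation_def)
  have "Aug.tf (u \<otimes>\<^bsub>Lie K A\<^esub> v) x = d (Aug.c0 x)"
    using lb[OF Aug.c0_closed[OF x]] by (simp add: tangent_functional_def Aug.Lie_mult)
  also have "\<dots> = d x"
    using x Aug.point_derivation_one[OF d] lf_closed[OF counit_linear x] lf_closed[OF l x]
    by (simp add: lf_minus[OF l] lf_smult[OF l]) (simp add: a_minus_def)
  finally show ?thesis by (simp add: d_def)
qed

end

section \<open>Algebraic supersubalgebras\<close>

context sgroup begin

lemma lie_incl_image_iff:
  assumes I: "ideal I A" "\<And>x. x \<in> I \<Longrightarrow> \<epsilon> x = \<zero>\<^bsub>K\<^esub>"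
  shows "lie_incl K A I ` carrier (Lie K (quot_hopf K A I)) = S \<longleftrightarrow>
    {u \<in> carrier (Lie K A). \<forall>x \<in> I. Aug.tf u x = \<zero>\<^bsub>K\<^esub>} = S"
  using Aug.lie_incl_image[OF I] by simp

lemma hpart_mult:
  assumes x: "x \<in> carrier A" and y: "y \<in> carrier A"
  shows "hpart A p (x \<otimes> y) =
    hpart A p x \<otimes> hpart A 0 y \<oplus> hpart A (p + 1) x \<otimes> hpart A 1 y" (is "_ = ?e")
proof -
  let ?o = "hpart A p x \<otimes> hpart A 1 y \<oplus> hpart A (p + 1) x \<otimes> hpart A 0 y"
  note hx = S.hpart_closed[OF x] and hy = S.hpart_closed[OF y]
  note gx = S.hpart_gr[OF x] and gy = S.hpart_gr[OF y]
  have "x \<otimes> y = (hpart A p x \<oplus> hpart A (p + 1) x) \<otimes> (hpart A 0 y \<oplus> hpart A (0 + 1) y)"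
    using S.hpart_decomp[OF x, of p] S.hpart_decomp[OF y, of 0] by metis
  also have "\<dots> = ?e \<oplus> ?o" using hx hy by (simp add: A.l_distr A.r_distr A.a_ac)
  finally have xy: "x \<otimes> y = ?e \<oplus> ?o" .
  have p: "p + 0 = p" "(p + 1) + 1 = p" "(p + 1) + 0 = p + 1" using bit_cases[of p] by auto
  have "?e \<in> gr A p"
    using gr_mult[OF gx gy, of p 0] gr_mult[OF gx gy, of "p + 1" 1] unfolding p
    by (rule submod_add[OF S.gr_submod])
  moreover have "?o \<in> gr A (p + 1)"
    using gr_mult[OF gx gy, of p 1] gr_mult[OF gx gy, of "p + 1" 0] unfolding p
    by (rule submod_add[OF S.gr_submod])
  ultimately show ?thesis unfolding xy by (rule S.hpart_eqI)
qed

text \<open>Of the products in \<open>hpart_mult\<close>, those of two odd parts contribute nothing,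
  since the counit vanishes on both factors.\<close>

lemma point_derivation_hpart:
  assumes d: "point_derivation K A d"
  shows "pder p (\<lambda>x. d (hpart A p x))"
  unfolding pder_def
proof (intro conjI ballI)
  have l: "lf d" using d by (simp add: point_derivation_def)
  show "lf (\<lambda>x. d (hpart A p x))" by (rule linear_map_comp[OF S.hpart_linear l])
  show "d (hpart A p x) = \<zero>\<^bsub>K\<^esub>" if "x \<in> gr A (p + 1)" for x
    using S.hpart_other[OF that] lf_zero[OF l] by simp
  fix x y assume x: "x \<in> carrier A" and y: "y \<in> carrier A"
  have m: "d (a \<otimes> b) = \<epsilon> a \<otimes>\<^bsub>K\<^esub> d b \<oplus>\<^bsub>K\<^esub> d a \<otimes>\<^bsub>K\<^esub> \<epsilon> b" if "a \<in> carrier A" "b \<in> carrier A" for a b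
    using d that by (simp add: point_derivation_def)
  show "d (hpart A p (x \<otimes> y)) = \<epsilon> x \<otimes>\<^bsub>K\<^esub> d (hpart A p y) \<oplus>\<^bsub>K\<^esub> d (hpart A p x) \<otimes>\<^bsub>K\<^esub> \<epsilon> y"
    using x y bit_cases[of p] lf_closed[OF l] lf_closed[OF counit_linear]
    by (auto simp: hpart_mult lf_add[OF l] m S.hpart_closed counit_hpart K.a_comm)
qed

text \<open>The common kernel of \<open>d\<close> and the counit is an ideal containing the odd
  elements, so \<open>d\<close> factors through the even quotient. This is the identification of the
  even tangent vectors with those of the even subgroup.\<close>

lemma even_derivation_lift:
  assumes d: "pder 0 d"
  obtains w where "w \<in> carrier (Lie K \<B>)" "\<And>x. x \<in> carrier A \<Longrightarrow> B.tf w (q x) = d x"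
proof -
  have pd: "point_derivation K A d" using d by (simp add: pder_iff)
  note l = pder_lf[OF d]
  let ?N = "{x \<in> carrier A. d x = \<zero>\<^bsub>K\<^esub>} \<inter> {x \<in> carrier A. \<epsilon> x = \<zero>\<^bsub>K\<^esub>}"
  have "submod K A ?N"
    using submod_kernel[OF M.module_axioms L.module_axioms l]
    by (intro submod_Int[OF M.module_axioms _ counit_kernel_submod]) simp
  then have N: "ideal ?N A"
    using l counit_linear
    by (intro idealI') (auto simp: pder_mult[OF d] counit_mult lf_closed)
  have "gr A 1 \<subseteq> ?N" using pder_other[OF d] counit_odd S.gr_closed by auto
  then have ev: "d x = \<zero>\<^bsub>K\<^esub>" if "x \<in> \<aa>" for x using ev_least[OF N] that by blast
  obtain u where u: "u \<in> carrier (Lie K A)" "\<And>x. x \<in> carrier A \<Longrightarrow> Aug.tf u x = d x"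
    using Aug.point_derivation_tf[OF pd] by blast
  have "u \<in> lie_incl K A \<aa> ` carrier (Lie K \<B>)"
  proof -
    have "u \<in> {u \<in> carrier (Lie K A). \<forall>x \<in> \<aa>. Aug.tf u x = \<zero>\<^bsub>K\<^esub>}" using u ev ev_carrier by simp
    then show ?thesis by (simp only: q_lie_incl_image)
  qed
  then obtain w where w: "w \<in> carrier (Lie K \<B>)" "u = lie_incl K A \<aa> w" by blast
  show ?thesis
    by (rule that[OF w(1)]) (use u(2) q_lie_incl w(2) in simp)
qed

section \<open>From the even part to the supersubalgebra\<close>

context
  fixes S
  assumes S: "lie_supersubalgebra K (Lie K A) S"
begin

text \<open>\<SS> as a family of functionals, split by parity and saturated under agreement on the
  carrier as \<open>fclosed\<close> requires.\<close>

definition ders :: "bit \<Rightarrow> ('a \<Rightarrow> 'k) set"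
  where "ders p = {d. pder p d \<and> (\<exists>u \<in> S. \<forall>x \<in> carrier A. d x = Aug.tf u x)}"

lemma S_submod: "submod K (Lie K A) S"
  and S_homogeneous: "homogeneous_subset (Lie K A) S"
  and S_bracket: "\<lbrakk>u \<in> S; v \<in> S\<rbrakk> \<Longrightarrow> u \<otimes>\<^bsub>Lie K A\<^esub> v \<in> S"
  using S by (auto simp: lie_supersubalgebra_def)

lemma S_Lie: "u \<in> S \<Longrightarrow> u \<in> carrier (Lie K A)"
  using submod_carrier[OF S_submod] .

lemma ders_pder: "d \<in> ders p \<Longrightarrow> pder p d"
  by (simp add: ders_def)

lemma ders_fclosed: "fclosed (ders p)"
  unfolding fclosed_def
proof (intro conjI ballI allI impI)
  show "(\<lambda>x. \<zero>\<^bsub>K\<^esub>) \<in> ders p"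
    using pder_null submod_zero[OF S_submod]
        by (auto simp: ders_def tf_zero intro!: bexI[of _ "\<zero>\<^bsub>Lie K A\<^esub>"])
next
  fix f g assume f: "f \<in> ders p" and g: "g \<in> ders p"
  then obtain u v where uv: "u \<in> S" "v \<in> S" "\<And>x. x \<in> carrier A \<Longrightarrow> f x = Aug.tf u x"
      "\<And>x. x \<in> carrier A \<Longrightarrow> g x = Aug.tf v x"
    by (auto simp: ders_def)
  note pf = ders_pder[OF f] and pg = ders_pder[OF g]
  note c = lf_closed[OF pder_lf[OF pf]] lf_closed[OF pder_lf[OF pg]] lf_closed[OF counit_linear]
  have "pder p (\<lambda>x. f x \<oplus>\<^bsub>K\<^esub> g x)"
    unfolding pder_def
    using linear_map_plus[OF L.module_axioms pder_lf[OF pf] pder_lf[OF pg]] c pder_other[OF pf]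
        pder_other[OF pg]
    by (simp add: pder_mult[OF pf] pder_mult[OF pg] K.r_distr K.l_distr K.a_ac)
  then show "(\<lambda>x. f x \<oplus>\<^bsub>K\<^esub> g x) \<in> ders p"
    using uv submod_add[OF S_submod uv(1,2)]
    by (auto simp: ders_def tf_add intro!: bexI[of _ "u \<oplus>\<^bsub>Lie K A\<^esub> v"])
next
  fix k f assume k: "k \<in> carrier K" and f: "f \<in> ders p"
  then obtain u where u: "u \<in> S" "\<And>x. x \<in> carrier A \<Longrightarrow> f x = Aug.tf u x" by (auto simp: ders_def)
  note pf = ders_pder[OF f]
  note c = lf_closed[OF pder_lf[OF pf]] lf_closed[OF counit_linear]
  have "pder p (\<lambda>x. k \<otimes>\<^bsub>K\<^esub> f x)"
    unfolding pder_def
    using linear_map_scale[OF L.module_axioms pder_lf[OF pf] k] c pder_other[OF pf] k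
    by (simp add: pder_mult[OF pf] K.r_distr K.m_ac)
  then show "(\<lambda>x. k \<otimes>\<^bsub>K\<^esub> f x) \<in> ders p"
    using u submod_smult[OF S_submod k u(1)]
    by (auto simp: ders_def tf_smult intro!: bexI[of _ "k \<odot>\<^bsub>Lie K A\<^esub> u"])
next
  fix f g assume f: "f \<in> ders p" and eq: "\<forall>x \<in> carrier A. f x = g x"
  have "pder p g" using pder_cong[OF ders_pder[OF f]] eq by blast
  then show "g \<in> ders p" using f eq by (auto simp: ders_def)
qed

lemma ders_bracket:
  assumes f: "f \<in> ders p" and g: "g \<in> ders r"
  shows "(\<lambda>x. f (Lop g x) \<ominus>\<^bsub>K\<^esub> koszul (base K) (p * r) (g (Lop f x))) \<in> ders (p + r)"
proof -
  obtain u v where uv: "u \<in> S" "v \<in> S" and fu: "\<And>x. x \<in> carrier A \<Longrightarrow> f x = Aug.tf u x"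
    and gv: "\<And>x. x \<in> carrier A \<Longrightarrow> g x = Aug.tf v x"
    using f g by (auto simp: ders_def)
  note pf = ders_pder[OF f] and pg = ders_pder[OF g]
  have ug: "u \<in> gr (Lie K A) p" and vg: "v \<in> gr (Lie K A) r"
    using pder_cong[OF pf fu] pder_cong[OF pg gv] uv S_Lie by (simp_all add: Lie_gr_pder)
  let ?k = "koszul (base K) (p * r)"
  let ?E = "commutator (p * r) f g"
  have E: "pder (p + r) ?E" by (rule commutator_pder[OF pf pg])
  \<comment> \<open>The global sign from \<open>tf_bracket\<close>; it is its own inverse.\<close>
  define s where "s = (if p * r = 1 then \<ominus>\<^bsub>K\<^esub> \<one>\<^bsub>K\<^esub> else \<one>\<^bsub>K\<^esub>)"
  have s: "s \<in> carrier K" by (simp add: s_def)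
  have "?E x = Aug.tf (s \<odot>\<^bsub>Lie K A\<^esub> (u \<otimes>\<^bsub>Lie K A\<^esub> v)) x" if x: "x \<in> carrier A" for x
  proof -
    have "?E x = commutator (p * r) (Aug.tf u) (Aug.tf v) x"
      using x Lop_cong[OF pder_lf[OF pg] x gv] Lop_cong[OF pder_lf[OF pf] x fu]
        fu[OF Lop_closed[OF pder_lf[OF pg] x]] gv[OF Lop_closed[OF pder_lf[OF pf] x]]
      by (simp add: commutator_def)
    moreover have "z = s \<otimes>\<^bsub>K\<^esub> ?k z" if "z \<in> carrier K" for z
      using that by (simp add: s_def koszul_def K.l_minus K.r_minus)
    ultimately show ?thesis
      using lf_closed[OF pder_lf[OF E] x] by (simp add: tf_smult[OF x] tf_bracket[OF ug vg x])
  qed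
  then have "?E \<in> ders (p + r)"
    using E submod_smult[OF S_submod s S_bracket[OF uv]] by (auto simp: ders_def)
  then show ?thesis by (simp add: commutator_def[abs_def])
qed

theorem algebraic_if_even_part_algebraic:
  assumes "algebraic_in K \<B> (lie_ev_part K A S)"
  shows "algebraic_in K A S"
proof -
  obtain J where J: "hopf_superideal K \<B> J"
    and JL: "lie_incl K \<B> J ` carrier (Lie K (quot_hopf K \<B> J)) = lie_ev_part K A S"
    using assms by (auto simp: algebraic_in_def)
  have Ji: "ideal J \<B>" and Je: "\<And>X. X \<in> J \<Longrightarrow> counit \<B> X = \<zero>\<^bsub>K\<^esub>"
    and Jc: "comult \<B> ` J \<subseteq> submod K TB.TT hull
      {TB.pt a b | a b. a \<in> carrier \<B> \<and> b \<in> carrier \<B> \<and> (a \<in> J \<or> b \<in> J)}"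
    using J by (auto simp: hopf_superideal_def simp del: TB.TT_sel)
  have Js: "submod K \<B> J" by (rule B.ideal_submod[OF Ji])
  have JL': "{w \<in> carrier (Lie K \<B>). \<forall>X \<in> J. B.tf w X = \<zero>\<^bsub>K\<^esub>} = lie_ev_part K A S"
    using B.lie_incl_image[OF Ji Je] JL by simp
  have kills: "(\<forall>X \<in> J. B.tf w X = \<zero>\<^bsub>K\<^esub>) \<longleftrightarrow> lie_incl K A \<aa> w \<in> S \<inter> gr (Lie K A) 0"
    if "w \<in> carrier (Lie K \<B>)" for w
    using JL' that unfolding lie_ev_part_def by blast
  \<comment> \<open>The ideal of the even subgroup pulled back to \<open>K[H]\<close>; it plays the
    part of \<open>J\<close> in \<open>annih_derivations\<close>.\<close>
  let ?J = "{x \<in> carrier A. q x \<in> J}"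
  have alg: "d \<in> ders 0" if d: "pder 0 d" and z: "\<And>x. x \<in> ?J \<Longrightarrow> d x = \<zero>\<^bsub>K\<^esub>" for d
  proof -
    obtain w where w: "w \<in> carrier (Lie K \<B>)" "\<And>x. x \<in> carrier A \<Longrightarrow> B.tf w (q x) = d x"
      by (rule even_derivation_lift[OF d]) (rule that)
    have "B.tf w X = \<zero>\<^bsub>K\<^esub>" if X: "X \<in> J" for X
    proof -
      obtain x where x: "x \<in> carrier A" "X = q x" using q_exhaust[OF submod_carrier[OF Js X]]
          by (elim bexE)
      then show ?thesis using w(2)[OF x(1)] z[of x] X by simp
    qed
    then have "lie_incl K A \<aa> w \<in> S" using kills[OF w(1)] by blast
    moreover have "\<forall>x \<in> carrier A. d x = Aug.tf (lie_incl K A \<aa> w) x" using w(2) q_lie_incl by simp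
    ultimately show ?thesis using d by (auto simp: ders_def)
  qed
  \<comment> \<open>Modulo odd factors, \<open>Lop d x\<close> is the contraction of the
    comultiplication of \<open>q x\<close> with the tangent vector \<open>w\<close> of the even
    subgroup. The coideal property of \<open>J\<close> leaves J \<otimes> B + B \<otimes> J, and
    \<open>w\<close> kills \<open>J\<close>.\<close>
  have stable: "Lop d x \<in> ?J" if d: "d \<in> ders 0" and x: "x \<in> ?J" for d x
  proof -
    note pd = ders_pder[OF d] and l = pder_lf[OF ders_pder[OF d]]
    have xc: "x \<in> carrier A" and xJ: "q x \<in> J" using x by auto
    note dx = comult_closed[OF xc] and Bm = B.M.module_axioms
    obtain u where u: "u \<in> S" "\<And>x. x \<in> carrier A \<Longrightarrow> d x = Aug.tf u x" using d
        by (auto simp: ders_def)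
    obtain w where w: "w \<in> carrier (Lie K \<B>)" "\<And>x. x \<in> carrier A \<Longrightarrow> B.tf w (q x) = d x"
      by (rule even_derivation_lift[OF pd]) (rule that)
    have "lie_incl K A \<aa> w = u"
      by (rule Aug.tf_inject[OF q_lie_incl_Lie[OF w(1)] S_Lie[OF u(1)]]) (simp add: q_lie_incl
          w(2) u(2)[symmetric])
    moreover have "u \<in> gr (Lie K A) 0" using pder_cong[OF pd u(2)] S_Lie[OF u(1)]
        by (simp add: Lie_gr_pder)
    ultimately have wJ: "B.tf w X = \<zero>\<^bsub>K\<^esub>" if "X \<in> J" for X using kills[OF w(1)] u(1) that by blast
    have wl: "linear_map K \<B> (base K) (B.tf w)"
      using B.tf_point_derivation[OF w(1)] by (simp add: point_derivation_def)
    have b: "bilinear_map K \<B> \<B> \<B> (\<lambda>a b. B.tf w b \<odot>\<^bsub>\<B>\<^esub> a)"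
        by (rule B.smult_bilinear[OF wl linear_map_id])
    let ?\<Psi> = "tensor_lift K \<B> (\<lambda>a b. B.tf w b \<odot>\<^bsub>\<B>\<^esub> a)"
    have \<Psi>: "linear_map K TB.TT \<B> ?\<Psi>" using TB.lift_linear[OF Bm b] by (simp add: linear_map_def)
    have hull: "qq (\<Delta> x) \<in> submod K TB.TT hull
      {TB.pt a b | a b. a \<in> carrier \<B> \<and> b \<in> carrier \<B> \<and> (a \<in> J \<or> b \<in> J)}"
      using Jc xJ comult_B[OF xc] by (metis (no_types, lifting) image_subset_iff)
    have "?\<Psi> (qq (\<Delta> x)) \<in> J"
    proof (rule linear_map_hull[OF TB.module_TT Bm \<Psi> Js _ _ hull])
      show "{TB.pt a b |a b. a \<in> carrier \<B> \<and> b \<in> carrier \<B> \<and> (a \<in> J \<or> b \<in> J)} \<subseteq> carrier TB.TT"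
        using bilinear_map_closed[OF ptB_bilinear] by blast
      fix t assume "t \<in> {TB.pt a b |a b. a \<in> carrier \<B> \<and> b \<in> carrier \<B> \<and> (a \<in> J \<or> b \<in> J)}"
      then obtain a b where t: "t = TB.pt a b" "a \<in> carrier \<B>" "b \<in> carrier \<B>" "a \<in> J \<or> b \<in> J"
          by blast
      have "B.tf w b \<odot>\<^bsub>\<B>\<^esub> a \<in> J"
        using t(4)
      proof
        assume "a \<in> J"
        then show ?thesis using submod_smult[OF Js B.functional_simps(1)[OF wl t(3)]] by blast
      next
        assume "b \<in> J"
        then show ?thesis using wJ t(2) submod_zero[OF Js] by simp
      qed
      then show "?\<Psi> t \<in> J" using TB.lift_pt[OF Bm b t(2,3)] t(1) by simp
    qed
    moreover have "?\<Psi> (qq (\<Delta> x)) = q (Lop d x)"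
    proof -
      have "?\<Psi> (qq (\<Delta> x)) = tensor_lift K \<B> (\<lambda>a b. ?\<Psi> (TB.pt (q a) (q b))) (\<Delta> x)"
        by (rule TP.lift_comp[OF TB.module_TT Bm \<Psi> qq_bilinear dx])
      also have "\<dots> = tensor_lift K \<B> (\<lambda>a b. q (d b \<odot> a)) (\<Delta> x)"
        by (rule TP.lift_cong'[OF Bm _ _ dx])
          (simp_all add: TB.lift_pt[OF Bm b] q_closed w(2) q_smult lf_closed[OF l])
      also have "\<dots> = q (Lop d x)"
        unfolding Lop_def by (rule TP.lift_comp[symmetric, OF M.module_axioms Bm q_linear
            Lop_bilinear[OF l] dx])
      finally show ?thesis .
    qed
    ultimately show ?thesis using Lop_closed[OF l xc] by simp
  qed
  let ?I = "annih ders"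
  have I: "hopf_superideal K A ?I" by (rule annih_hopf_superideal[OF ders_pder])
  have Ii: "ideal ?I A" and Ie: "\<And>x. x \<in> ?I \<Longrightarrow> \<epsilon> x = \<zero>\<^bsub>K\<^esub>"
    using annih_ideal[OF ders_pder] annih_counit[OF ders_pder] by auto
  have key: "d \<in> ders p" if d: "pder p d" "\<And>x. x \<in> ?I \<Longrightarrow> d x = \<zero>\<^bsub>K\<^esub>" for p d
  proof (rule annih_derivations[of ders, OF ders_pder ders_fclosed ders_bracket _ _ stable alg])
    show "\<epsilon> x = \<zero>\<^bsub>K\<^esub>" if "x \<in> ?J" for x using q_counit[of x] Je[of "q x"] that by auto
  qed (use d in auto)
  have "{u \<in> carrier (Lie K A). \<forall>x \<in> ?I. Aug.tf u x = \<zero>\<^bsub>K\<^esub>} = S"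
  proof (intro equalityI subsetI)
    fix u assume "u \<in> S"
    then obtain y z where yz: "y \<in> S" "y \<in> gr (Lie K A) 0" "z \<in> S" "z \<in> gr (Lie K A) 1"
        "u = y \<oplus>\<^bsub>Lie K A\<^esub> z"
      using S_homogeneous unfolding homogeneous_subset_def by blast
    have yd: "Aug.tf y \<in> ders 0" and zd: "Aug.tf z \<in> ders 1" using yz
        by (auto simp: ders_def Lie_gr_pder)
    have "Aug.tf u x = \<zero>\<^bsub>K\<^esub>" if x: "x \<in> ?I" for x
    proof -
      have "Aug.tf y x = \<zero>\<^bsub>K\<^esub>" by (rule annih_der[OF ders_pder x yd])
      moreover have "Aug.tf z x = \<zero>\<^bsub>K\<^esub>" by (rule annih_der[OF ders_pder x zd])
      ultimately show ?thesis using submod_carrier[OF ideal_submod[OF Ii] x]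
          by (simp add: yz(5) tf_add)
    qed
    then show "u \<in> {u \<in> carrier (Lie K A). \<forall>x \<in> ?I. Aug.tf u x = \<zero>\<^bsub>K\<^esub>}" using S_Lie[OF \<open>u \<in> S\<close>]
        by blast
  next
    fix u assume "u \<in> {u \<in> carrier (Lie K A). \<forall>x \<in> ?I. Aug.tf u x = \<zero>\<^bsub>K\<^esub>}"
    then have u: "u \<in> carrier (Lie K A)" and uI: "\<And>x. x \<in> ?I \<Longrightarrow> Aug.tf u x = \<zero>\<^bsub>K\<^esub>" by auto
    note pd = Aug.tf_point_derivation[OF u]
    have l: "lf (Aug.tf u)" using pd by (simp add: point_derivation_def)
    \<comment> \<open>The annihilator is homogeneous, so it is killed by both parity components of
      u, and \<open>key\<close> applies to each of them.\<close>
    have "\<exists>v \<in> S. \<forall>x \<in> carrier A. Aug.tf u (hpart A p x) = Aug.tf v x" for p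
    proof -
      have "pder p (\<lambda>x. Aug.tf u (hpart A p x))" by (rule point_derivation_hpart[OF pd])
      moreover have "Aug.tf u (hpart A p x) = \<zero>\<^bsub>K\<^esub>" if "x \<in> ?I" for x
        using uI S.homogeneousD[OF ideal_submod[OF Ii] annih_homogeneous[OF ders_pder] that]
            by blast
      ultimately have "(\<lambda>x. Aug.tf u (hpart A p x)) \<in> ders p" by (rule key)
      then show ?thesis by (auto simp: ders_def)
    qed
    then obtain v where v: "\<And>p. v p \<in> S" "\<And>p x. x \<in> carrier A \<Longrightarrow> Aug.tf u (hpart A p x)
        = Aug.tf (v p) x"
      by metis
    have "u = v 0 \<oplus>\<^bsub>Lie K A\<^esub> v 1"
    proof (rule Aug.tf_inject[OF u S_Lie[OF submod_add[OF S_submod v(1) v(1)]]])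
      fix x assume x: "x \<in> carrier A"
      have "Aug.tf u x = Aug.tf u (hpart A 0 x) \<oplus>\<^bsub>K\<^esub> Aug.tf u (hpart A (0 + 1) x)"
        using S.hpart_decomp[OF x, of 0] lf_add[OF l S.hpart_closed[OF x] S.hpart_closed[OF x]]
            by metis
      then show "Aug.tf u x = Aug.tf (v 0 \<oplus>\<^bsub>Lie K A\<^esub> v 1) x" using x by (simp add: v(2) tf_add)
    qed
    then show "u \<in> S" using submod_add[OF S_submod v(1) v(1)] by metis
  qed
  then show ?thesis
    unfolding algebraic_in_def using I lie_incl_image_iff[OF Ii Ie] by blast
qed

end

section \<open>From the supersubalgebra to its even part\<close>

theorem even_part_algebraic:
  assumes "algebraic_in K A S"
  shows "algebraic_in K \<B> (lie_ev_part K A S)"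
proof -
  obtain I where I: "hopf_superideal K A I"
    and IL: "lie_incl K A I ` carrier (Lie K (quot_hopf K A I)) = S"
    using assms by (auto simp: algebraic_in_def)
  have Ii: "ideal I A" and Ih: "homogeneous_subset A I" and Ie: "\<And>x. x \<in> I \<Longrightarrow> \<epsilon> x = \<zero>\<^bsub>K\<^esub>"
    and Ia: "\<And>x. x \<in> I \<Longrightarrow> antipode A x \<in> I"
    and Ic: "\<Delta> ` I \<subseteq> submod K TT hull {TP.pt a b | a b. a \<in> carrier A \<and> b \<in> carrier A \<and> (a \<in> I \<or> b
        \<in> I)}"
    using I by (auto simp: hopf_superideal_def simp del: TP.TT_sel)
  note Is = ideal_submod[OF Ii]
  note Ica = submod_carrier[OF Is] and Bm = B.M.module_axioms
  have SI: "{u \<in> carrier (Lie K A). \<forall>x \<in> I. Aug.tf u x = \<zero>\<^bsub>K\<^esub>} = S"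
    using IL lie_incl_image_iff[OF Ii Ie] by blast
  \<comment> \<open>The image of \<open>I\<close> in the even quotient cuts out the intersection of
    the supersubgroup with the even subgroup.\<close>
  let ?J = "q ` I"
  have Js: "submod K \<B> ?J" by (rule submod_image[OF M.module_axioms Bm q_linear Is])
  have Ji: "ideal ?J \<B>"
  proof (rule B.idealI'[OF Js])
    fix a X assume a: "a \<in> ?J" and X: "X \<in> carrier \<B>"
    obtain i where i: "i \<in> I" "a = q i" using a by blast
    obtain x where x: "x \<in> carrier A" "X = q x" using q_exhaust[OF X] by (elim bexE)
    show "X \<otimes>\<^bsub>\<B>\<^esub> a \<in> ?J" "a \<otimes>\<^bsub>\<B>\<^esub> X \<in> ?J"
      using i x Ica ideal.I_l_closed[OF Ii i(1) x(1)] ideal.I_r_closed[OF Ii i(1) x(1)]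
      by (auto simp: q_mult[symmetric])
  qed
  have Je: "counit \<B> X = \<zero>\<^bsub>K\<^esub>" if "X \<in> ?J" for X using that Ie Ica by (auto simp: q_counit)
  have "hopf_superideal K \<B> ?J"
    unfolding hopf_superideal_def
  proof (intro conjI)
    show "homogeneous_subset \<B> ?J"
      unfolding homogeneous_subset_def
    proof
      fix X assume "X \<in> ?J"
      then obtain x where x: "x \<in> I" "X = q x" by blast
      obtain y z where yz: "y \<in> I" "y \<in> gr A 0" "z \<in> I" "z \<in> gr A 1" "x = y \<oplus> z"
        using Ih x(1) unfolding homogeneous_subset_def by blast
      have "X = q y \<oplus>\<^bsub>\<B>\<^esub> q z" using x yz Ica by (simp add: q_add)
      moreover have "q y \<in> ?J \<inter> gr \<B> 0" "q z \<in> ?J \<inter> gr \<B> 1" using yz by (auto simp: ev_sel)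
      ultimately show "\<exists>y \<in> ?J \<inter> gr \<B> 0. \<exists>z \<in> ?J \<inter> gr \<B> 1. X = y \<oplus>\<^bsub>\<B>\<^esub> z" by blast
    qed
    have "submod K TB.TT hull {TB.pt a b | a b. a \<in> carrier \<B> \<and> b \<in> carrier \<B> \<and> (a \<in> ?J \<or> b \<in> ?J)}
        = submod K TB.T hull {TB.pt a b | a b. a \<in> carrier \<B> \<and> b \<in> carrier \<B> \<and> (a \<in> ?J \<or> b \<in>
            ?J)}" (is "?H = _")
      using TB.submod_TT[abs_def] by (simp only: fun_eq_iff)
    have gens: "{TB.pt a b | a b. a \<in> carrier \<B> \<and> b \<in> carrier \<B> \<and> (a \<in> ?J \<or> b
        \<in> ?J)} \<subseteq> carrier TB.TT"
      using bilinear_map_closed[OF ptB_bilinear] by blast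
    show "comult \<B> ` ?J \<subseteq> ?H"
    proof (intro subsetI, elim imageE)
      fix Y X x assume Y: "Y = comult \<B> X" "X = q x" and x: "x \<in> I"
      have TTs: "submod K TT = submod K T" by (rule ext) (rule TP.submod_TT)
      have hx: "\<Delta> x \<in> submod K T hull {TP.pt a b | a b. a \<in> carrier A \<and> b \<in> carrier A \<and> (a \<in> I \<or> b
          \<in> I)}"
        using Ic x TTs by auto
      have "qq (\<Delta> x) \<in> ?H"
      proof (rule linear_map_hull[OF TP.T.module_axioms TB.module_TT qq_linear submod_hull[OF
          TB.module_TT gens] _ _ hx])
        show "{TP.pt a b | a b. a \<in> carrier A \<and> b \<in> carrier A \<and> (a \<in> I \<or> b \<in> I)} \<subseteq> carrier T"
          by (auto intro: TP.pt_closed)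
        fix t assume "t \<in> {TP.pt a b | a b. a \<in> carrier A \<and> b \<in> carrier A \<and> (a \<in> I \<or> b \<in> I)}"
        then obtain a b where t: "t = TP.pt a b" "a \<in> carrier A" "b \<in> carrier A" "a \<in> I \<or> b \<in> I"
            by blast
        have "TB.pt (q a) (q b) \<in> ?H" using t q_closed by (intro hull_inc) blast
        then show "qq t \<in> ?H" using qq_pt[OF t(2,3)] t(1) by simp
      qed
      then show "Y \<in> ?H" using Y comult_B[OF Ica[OF x]] by (simp only:)
    qed
    show "counit \<B> ` ?J \<subseteq> {\<zero>\<^bsub>K\<^esub>}" using Je by blast
    show "antipode \<B> ` ?J \<subseteq> ?J"
    proof (intro subsetI, elim imageE)
      fix Y X x assume "Y = antipode \<B> X" "X = q x" "x \<in> I"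
      then show "Y \<in> ?J" using antipode_B[OF Ica] Ia by simp
    qed
  qed (rule Ji)
  moreover have "lie_incl K \<B> ?J ` carrier (Lie K (quot_hopf K \<B> ?J)) = lie_ev_part K A S"
  proof -
    \<comment> \<open>Tangent vectors from the even quotient vanish on odd elements, so they are
      even in \<open>Lie K A\<close>, and only membership in \<open>S\<close> is a
      condition.\<close>
    have ev: "(\<forall>X \<in> ?J. B.tf w X = \<zero>\<^bsub>K\<^esub>) \<longleftrightarrow> lie_incl K A \<aa> w \<in> S \<inter> gr (Lie K A) 0"
      if w: "w \<in> carrier (Lie K \<B>)" for w
    proof -
      have wl: "linear_map K \<B> (base K) (B.tf w)"
        using B.tf_point_derivation[OF w] by (simp add: point_derivation_def)
      have u: "lie_incl K A \<aa> w \<in> carrier (Lie K A)" by (rule q_lie_incl_Lie[OF w])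
      have "Aug.tf (lie_incl K A \<aa> w) x = \<zero>\<^bsub>K\<^esub>" if "x \<in> gr A 1" for x
        using q_lie_incl[OF S.gr_closed[OF that], of w] q_odd[OF that] B.functional_simps(4)[OF
            wl] by simp
      then have "lie_incl K A \<aa> w \<in> gr (Lie K A) 0" using u by (simp add: Lie_gr_iff)
      moreover have "(\<forall>X \<in> ?J. B.tf w X = \<zero>\<^bsub>K\<^esub>) \<longleftrightarrow> lie_incl K A \<aa> w \<in> S"
        using u Ica unfolding SI[symmetric] by (auto simp: q_lie_incl)
      ultimately show ?thesis by blast
    qed
    have "lie_incl K \<B> ?J ` carrier (Lie K (quot_hopf K \<B> ?J)) =
        {w \<in> carrier (Lie K \<B>). \<forall>X \<in> ?J. B.tf w X = \<zero>\<^bsub>K\<^esub>}"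
      by (rule B.lie_incl_image[OF Ji Je])
    also have "\<dots> = lie_ev_part K A S"
      unfolding lie_ev_part_def by (rule Collect_cong) (rule conj_cong[OF refl ev])
    finally show ?thesis .
  qed
  ultimately show ?thesis unfolding algebraic_in_def by blast
qed

end

theorem proposition9p1:
  fixes K :: "('k, 'l) ring_scheme"
    and H :: "('k, 'a, 'm) hopf_scheme"
    and S :: "('a set \<Rightarrow> 'k) set"
  assumes "field K"
    and "\<forall>n::nat. n > 0 \<longrightarrow> [n] \<cdot>\<^bsub>K\<^esub> \<one>\<^bsub>K\<^esub> \<noteq> \<zero>\<^bsub>K\<^esub>"
    and "algebraic_supergroup K H"
    and "connected_supergroup H"
    and "lie_supersubalgebra K (Lie K H) S"
  shows "algebraic_in K H S \<longleftrightarrow> algebraic_in K (ev_supergroup K H) (lie_ev_part K H S)"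
proof -
  interpret sgroup K H
    using assms(2,3) hopfI[of K H]
    by (simp add: sgroup_def sgroup_axioms_def algebraic_supergroup_def
        algebraic_supergroup_axioms_def)
  show ?thesis
    using even_part_algebraic algebraic_if_even_part_algebraic[OF assms(5)] by blast
qed

end
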